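(* For every rigid measure $\mu\in\mathcal{M}_{r}$ ($r>0$, $\mu\neq 0$, so that the dual $\mu^{*}$ is defined), we have \[ {\rm ext}(\mu)+{\rm ext}(\mu^{*})={\rm att}(\mu)+1 . \]
   Context: Fix unit vectors $w_1,w_2,w_3\in\mathbb{R}^2$ with $w_1+w_2+w_3=0$. \emph{The cone $\mathcal{M}$.} $\mathcal{M}$ is the convex cone of measures $\mu$ on $\mathbb{R}^2$ satisfying the following. The support of $\mu$ is contained in a finite union of lines, each parallel to one of the $w_j$. On each segment of the support that does not meet other segments of the support, $\mu$ is a constant multiple of length measure; this constant is the density of $\mu$ on the segment, and the density is $0$ off the support. For every point $A$, \[ \delta_1^+-\delta_1^-=\delta_2^+-\delta_2^-=\delta_3^+-\delta_3^-, \] where $\delta_j^{\pm}=\delta_j^\pm(\mu,A)$ is the density of $\mu$ on $\{A\pm tw_j:0<t<\varepsilon\}$ for small $\varepsilon>0$. Branch points of $\mu$ are the points $A$ at which at least three of the numbers $\delta_j^\pm(\mu,A)$ are nonzero. \emph{The triangle $\triangle_r$.} For $r>0$, $\triangle_r$ is the closed triangle with vertices $X_3=0$, $X_1=rw_1$, $X_2=r(w_1+w_2)$. \emph{The cones $\mathcal{M}_r$ and $\mathcal{M}_r^*$.} $\mathcal{M}_r$ is the set of $\mu\in\mathcal{M}$ whose branch points lie in $\triangle_r$ and whose support outside $\triangle_r$ is a finite union of half-lines $\{A+tw_j:t>0\}$ with $A\in\partial\triangle_r$. $\mathcal{M}_r^*$ is defined in the same way, with half-lines $\{A-tw_j:t>0\}$.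 \emph{Exit and attachment points.} An exit point of $\mu$ is a point $A\in\partial\triangle_r$ such that such a half-line starting at $A$ lies in $\operatorname{supp}\mu\setminus\triangle_r$; its density is the corresponding exit density. An exit point is an attachment point if either it is not a corner of $\triangle_r$, or it is a corner and the half-line through it parallel to the opposite side of $\triangle_r$ lies in the support of $\mu$. ${\rm att}(\mu)$ denotes the number of attachment points. \emph{Weight.} For each $j$, the sum of the exit densities in direction $w_j$ is independent of $j$; this common value is the weight $\omega(\mu)$. The weight of a measure in $\mathcal{M}^*_r$ is defined analogously. \emph{Rigidity and extremality.} $\mu\in\mathcal{M}_r$ is rigid if no other $\nu\in\mathcal{M}_r$ has the same exit points and the same exit densities; rigidity in $\mathcal{M}_r^*$ is defined likewise. A nonzero $\mu\in\mathcal{M}$ is extremal if every $\nu\in\mathcal{M}$ with $\nu\le\mu$ equals $c\mu$ for some constant $c$. Two extremal measures are inequivalent if neither is a multiple of the other. A rigid measure (in $\mathcal{M}_r$ or $\mathcal{M}_r^*$) can be written uniquely as a sum of mutually inequivalent extremal measures; ${\rm ext}(\mu)$ denotes the number of summands. \emph{Dual.} Let $\mu\in\mathcal{M}_r$ be nonzero. - Inflation: translate the connected components of $\triangle_r\setminus\operatorname{supp}\mu$ (the white pieces) apart. This is done so that, for each segment $AB$ of the support between consecutive vertices, the two translates of $AB$ form a parallelogram whose other two sides make a $60^\circ$ clockwise angle with $AB$ and have length equal to the density of $\mu$ on $AB$. - The resulting puzzle consists of the white pieces, these parallelograms, and one polygon at each branch point, with sides equal to the densities of the segments meeting there. It tiles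 $\triangle_{r+\omega(\mu)}$. - Deflation: replace each parallelogram $ABA'B'$ (where $AB$ and $A'B'$ are the translates of a support edge) by a segment congruent to $AA'$, carrying density equal to the length of $AB$, and discard the white pieces. - The result is the restriction to $\triangle_{\omega(\mu)}$ of a measure $\mu^*\in\mathcal{M}^*_{\omega(\mu)}$, the dual of $\mu$. If $\mu$ is rigid, so is $\mu^*$. *)

theory Defs
  imports "HOL-Analysis.Analysis"
begin

text \<open>
  The three unit vectors are a family \<open>w :: 3 \<Rightarrow> real^2\<close>. Arithmetic in the index type \<open>3\<close> is
  modulo 3, so \<open>w 3\<close> is \<open>w 0\<close> and \<open>w (j + 1)\<close> is the cyclic successor of \<open>w j\<close>.
\<close>

section \<open>Measures and densities\<close>

definition supp :: "'a::topological_space measure \<Rightarrow> 'a set" where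
  "supp \<mu> = {x. \<forall>U. open U \<and> x \<in> U \<longrightarrow> emeasure \<mu> U \<noteq> 0}"

definition halfline :: "real^2 \<Rightarrow> real^2 \<Rightarrow> (real^2) set" where
  "halfline A v = {A + t *\<^sub>R v | t. t > 0}"

definition seg_length :: "real^2 \<Rightarrow> real^2 \<Rightarrow> (real^2) set \<Rightarrow> ennreal" where
  \<comment> \<open>length of the part of the segment \<open>AB\<close> that lies in \<open>E\<close>\<close>
  "seg_length A B E =
     ennreal (dist A B) * emeasure lborel {t \<in> {0..1}. A + t *\<^sub>R (B - A) \<in> E}"

definition has_density :: "(real^2) measure \<Rightarrow> real^2 \<Rightarrow> real^2 \<Rightarrow> real \<Rightarrow> bool" where
  "has_density \<mu> A v c \<longleftrightarrow> c \<ge> 0 \<and>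
     (\<exists>\<epsilon>>0. \<forall>E\<in>sets borel.
        emeasure \<mu> (E \<inter> open_segment A (A + \<epsilon> *\<^sub>R v)) = ennreal c * seg_length A (A + \<epsilon> *\<^sub>R v) E)"

text \<open>\<open>\<delta>\<^sub>j\<^sup>+(\<mu>,A)\<close> is \<open>dens \<mu> A (w j)\<close> and \<open>\<delta>\<^sub>j\<^sup>-(\<mu>,A)\<close> is \<open>dens \<mu> A (- w j)\<close>.\<close>

definition dens :: "(real^2) measure \<Rightarrow> real^2 \<Rightarrow> real^2 \<Rightarrow> real" where
  "dens \<mu> A v = (THE c. has_density \<mu> A v c)"

text \<open>
  A measure in the cone is determined by its densities, so it has no point masses. Near every
  point it is, in each of the six directions, a constant multiple (possibly 0) of length measure;
  along a segment that meets no other segment of the support, the balance condition makes this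
  constant the same at all points.
\<close>

definition cone_M :: "(3 \<Rightarrow> real^2) \<Rightarrow> (real^2) measure set" where
  "cone_M w = {\<mu>. sets \<mu> = sets borel \<and>
     (\<exists>L. finite L \<and> supp \<mu> \<subseteq> (\<Union>(P, j)\<in>L. {P + t *\<^sub>R w j | t. True})) \<and>
     (\<forall>x. emeasure \<mu> {x} = 0) \<and>
     (\<forall>A j. (\<exists>c. has_density \<mu> A (w j) c) \<and> (\<exists>c. has_density \<mu> A (- w j) c)) \<and>
     (\<forall>A j k. dens \<mu> A (w j) - dens \<mu> A (- w j) = dens \<mu> A (w k) - dens \<mu> A (- w k))}"

definition branch_points :: "(3 \<Rightarrow> real^2) \<Rightarrow> (real^2) measure \<Rightarrow> (real^2) set" where
  "branch_points w \<mu> =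
     {A. card {v \<in> range w \<union> range (\<lambda>j. - w j). dens \<mu> A v \<noteq> 0} \<ge> 3}"

section \<open>Measures attached to a triangle\<close>

definition corner :: "(3 \<Rightarrow> real^2) \<Rightarrow> real \<Rightarrow> 3 \<Rightarrow> real^2" where
  "corner w r j = (if j = 1 then r *\<^sub>R w 1 else if j = 2 then r *\<^sub>R (w 1 + w 2) else 0)"

definition tri :: "(3 \<Rightarrow> real^2) \<Rightarrow> real \<Rightarrow> (real^2) set" where
  "tri w r = convex hull {corner w r 1, corner w r 2, corner w r 3}"

text \<open>
  The parameter \<open>e\<close> is the family of exit directions: \<open>e = w\<close> gives \<open>\<M>\<^sub>r\<close>, and
  \<open>e = (\<lambda>j. - w j)\<close> gives \<open>\<M>\<^sub>r\<^sup>*\<close>; the triangle is the same in both cases.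
\<close>

definition cone_tri :: "(3 \<Rightarrow> real^2) \<Rightarrow> (3 \<Rightarrow> real^2) \<Rightarrow> real \<Rightarrow> (real^2) measure set" where
  "cone_tri w e r = {\<mu> \<in> cone_M w.
     branch_points w \<mu> \<subseteq> tri w r \<and>
     (\<exists>F. finite F \<and> F \<subseteq> frontier (tri w r) \<times> UNIV \<and>
        supp \<mu> - tri w r = (\<Union>(A, j)\<in>F. halfline A (e j)))}"

abbreviation cone_Mr :: "(3 \<Rightarrow> real^2) \<Rightarrow> real \<Rightarrow> (real^2) measure set" where
  "cone_Mr w r \<equiv> cone_tri w w r"

abbreviation cone_Mr_star :: "(3 \<Rightarrow> real^2) \<Rightarrow> real \<Rightarrow> (real^2) measure set" where
  "cone_Mr_star w r \<equiv> cone_tri w (\<lambda>j. - w j) r"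

text \<open>Two exit half-lines may start at a corner, so exits are recorded as pairs of a point and an
  index.\<close>

definition exits ::
  "(3 \<Rightarrow> real^2) \<Rightarrow> (3 \<Rightarrow> real^2) \<Rightarrow> real \<Rightarrow> (real^2) measure \<Rightarrow> ((real^2) \<times> 3) set" where
  "exits w e r \<mu> =
     {(A, j). A \<in> frontier (tri w r) \<and> halfline A (e j) \<subseteq> supp \<mu> - tri w r}"

definition exit_points ::
  "(3 \<Rightarrow> real^2) \<Rightarrow> (3 \<Rightarrow> real^2) \<Rightarrow> real \<Rightarrow> (real^2) measure \<Rightarrow> (real^2) set" where
  "exit_points w e r \<mu> = fst ` exits w e r \<mu>"

text \<open>The side opposite to \<open>corner w r k\<close> is parallel to \<open>w (k - 1)\<close>.\<close>

definition attachment_points ::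
  "(3 \<Rightarrow> real^2) \<Rightarrow> real \<Rightarrow> (real^2) measure \<Rightarrow> (real^2) set" where
  "attachment_points w r \<mu> = {A \<in> exit_points w w r \<mu>.
     \<forall>k. A = corner w r k \<longrightarrow> halfline A (w (k - 1)) \<subseteq> supp \<mu>}"

definition att :: "(3 \<Rightarrow> real^2) \<Rightarrow> real \<Rightarrow> (real^2) measure \<Rightarrow> nat" where
  "att w r \<mu> = card (attachment_points w r \<mu>)"

definition weight ::
  "(3 \<Rightarrow> real^2) \<Rightarrow> (3 \<Rightarrow> real^2) \<Rightarrow> real \<Rightarrow> (real^2) measure \<Rightarrow> real" where
  "weight w e r \<mu> = (THE c. \<forall>j. (\<Sum>A | (A, j) \<in> exits w e r \<mu>. dens \<mu> A (e j)) = c)"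

section \<open>Rigidity and extremality\<close>

definition rigid ::
  "(3 \<Rightarrow> real^2) \<Rightarrow> (3 \<Rightarrow> real^2) \<Rightarrow> real \<Rightarrow> (real^2) measure \<Rightarrow> bool" where
  "rigid w e r \<mu> \<longleftrightarrow> \<mu> \<in> cone_tri w e r \<and>
     (\<forall>\<nu>\<in>cone_tri w e r.
        exits w e r \<nu> = exits w e r \<mu> \<and>
        (\<forall>(A, j)\<in>exits w e r \<mu>. dens \<nu> A (e j) = dens \<mu> A (e j)) \<longrightarrow> \<nu> = \<mu>)"

definition multiple_of :: "'a measure \<Rightarrow> 'a measure \<Rightarrow> bool" where
  "multiple_of \<nu> \<mu> \<longleftrightarrow> (\<exists>c\<ge>0. \<nu> = scale_measure (ennreal c) \<mu>)"

definition extremal :: "(3 \<Rightarrow> real^2) \<Rightarrow> (real^2) measure \<Rightarrow> bool" where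
  "extremal w \<mu> \<longleftrightarrow> \<mu> \<in> cone_M w \<and> \<mu> \<noteq> null_measure borel \<and>
     (\<forall>\<nu>\<in>cone_M w. (\<forall>E\<in>sets borel. emeasure \<nu> E \<le> emeasure \<mu> E) \<longrightarrow> multiple_of \<nu> \<mu>)"

definition extremal_decomposition ::
  "(3 \<Rightarrow> real^2) \<Rightarrow> (real^2) measure \<Rightarrow> (real^2) measure set \<Rightarrow> bool" where
  "extremal_decomposition w \<mu> S \<longleftrightarrow> finite S \<and> (\<forall>\<nu>\<in>S. extremal w \<nu>) \<and>
     (\<forall>\<nu>\<in>S. \<forall>\<nu>'\<in>S. \<nu> \<noteq> \<nu>' \<longrightarrow> \<not> multiple_of \<nu> \<nu>') \<and>
     (\<forall>E\<in>sets borel. emeasure \<mu> E = (\<Sum>\<nu>\<in>S. emeasure \<nu> E))"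

definition ext :: "(3 \<Rightarrow> real^2) \<Rightarrow> (real^2) measure \<Rightarrow> nat" where
  "ext w \<mu> = card (THE S. extremal_decomposition w \<mu> S)"

section \<open>The dual of a measure\<close>

text \<open>An edge \<open>(A, B, j)\<close> joins consecutive vertices of the support in the triangle; it is listed
  once, oriented so that \<open>B - A\<close> is a positive multiple of \<open>w j\<close>.\<close>

definition vertices :: "(3 \<Rightarrow> real^2) \<Rightarrow> real \<Rightarrow> (real^2) measure \<Rightarrow> (real^2) set" where
  "vertices w r \<mu> = branch_points w \<mu> \<union> exit_points w w r \<mu>"

definition edges :: "(3 \<Rightarrow> real^2) \<Rightarrow> real \<Rightarrow> (real^2) measure \<Rightarrow> ((real^2) \<times> (real^2) \<times> 3) set" where
  "edges w r \<mu> = {(A, B, j). A \<in> vertices w r \<mu> \<and> B \<in> vertices w r \<mu> \<and>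
     (\<exists>l>0. B = A + l *\<^sub>R w j) \<and>
     open_segment A B \<subseteq> supp \<mu> \<inter> tri w r \<and>
     open_segment A B \<inter> vertices w r \<mu> = {}}"

text \<open>
  Pieces are components of the complement of the support in the whole plane. Such a component
  \<open>C\<close> is convex, and if it meets the triangle then its intersection with the triangle is a single
  white piece. The remaining components are needed for edges contained in the boundary of the
  triangle: they provide the outer one of the two translates of such an edge.
\<close>

definition pieces :: "(real^2) measure \<Rightarrow> (real^2) set set" where
  "pieces \<mu> = components (- supp \<mu>)"

text \<open>The piece adjacent to the edge \<open>AB\<close> on the side to which the vector \<open>n\<close> points.\<close>

definition side_piece :: "(real^2) measure \<Rightarrow> real^2 \<Rightarrow> real^2 \<Rightarrow> real^2 \<Rightarrow> (real^2) set" where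
  "side_piece \<mu> A B n =
     (THE C. C \<in> pieces \<mu> \<and> (\<forall>\<^sub>F \<epsilon> in at_right 0. midpoint A B + \<epsilon> *\<^sub>R n \<in> C))"

text \<open>
  \<open>\<tau> C\<close> is the vector by which the piece \<open>C\<close> is translated. When \<open>w 1, w 2, w 3\<close> is in
  counterclockwise order, the line spanned by \<open>w (j + 1)\<close> is obtained from the line spanned by
  \<open>w j\<close> by a clockwise rotation through 60 degrees, and \<open>w (j + 1)\<close> points to the left of
  \<open>w j\<close>; in the opposite order the picture is reflected. The two translates of an edge with
  direction \<open>w j\<close> and density \<open>d\<close> thus differ by \<open>d *\<^sub>R w (j + 1)\<close>, and the two pieces move away
  from each other. The differences determine the translations of the pieces adjacent to edges up
  to a common vector, which is fixed by requiring the translated pieces to lie in the triangle of size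
  \<open>r + \<omega>(\<mu>)\<close> that the puzzle tiles.
\<close>

definition inflation ::
  "(3 \<Rightarrow> real^2) \<Rightarrow> real \<Rightarrow> (real^2) measure \<Rightarrow> ((real^2) set \<Rightarrow> real^2) \<Rightarrow> bool" where
  "inflation w r \<mu> \<tau> \<longleftrightarrow>
     (\<forall>(A, B, j)\<in>edges w r \<mu>.
        \<tau> (side_piece \<mu> A B (w (j + 1))) - \<tau> (side_piece \<mu> A B (- w (j + 1))) =
        dens \<mu> A (w j) *\<^sub>R w (j + 1)) \<and>
     (\<forall>C\<in>pieces \<mu>. (\<lambda>x. x + \<tau> C) ` (closure C \<inter> tri w r) \<subseteq> tri w (r + weight w w r \<mu>))"

text \<open>
  Discarding the white pieces shrinks each translate \<open>C + \<tau> C\<close> to the point \<open>\<tau> C\<close>. The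
  parallelogram of an edge \<open>AB\<close> between the pieces \<open>C\<close> and \<open>C'\<close> becomes the segment from
  \<open>\<tau> C\<close> to \<open>\<tau> C'\<close> with density equal to the length of \<open>AB\<close>.
\<close>

definition deflation ::
  "(3 \<Rightarrow> real^2) \<Rightarrow> real \<Rightarrow> (real^2) measure \<Rightarrow> ((real^2) set \<Rightarrow> real^2) \<Rightarrow> (real^2) set \<Rightarrow> ennreal"
  where
  "deflation w r \<mu> \<tau> E =
     (\<Sum>(A, B, j)\<in>edges w r \<mu>. ennreal (dist A B) *
        seg_length (\<tau> (side_piece \<mu> A B (- w (j + 1)))) (\<tau> (side_piece \<mu> A B (w (j + 1)))) E)"

text \<open>The part of a measure in \<open>\<M>\<^sub>\<omega>\<^sup>*\<close> outside the triangle is determined, through the balance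
  condition on the boundary, by its restriction to the triangle.\<close>

definition is_dual :: "(3 \<Rightarrow> real^2) \<Rightarrow> real \<Rightarrow> (real^2) measure \<Rightarrow> (real^2) measure \<Rightarrow> bool" where
  "is_dual w r \<mu> \<nu> \<longleftrightarrow> \<nu> \<in> cone_Mr_star w (weight w w r \<mu>) \<and>
     (\<exists>\<tau>. inflation w r \<mu> \<tau> \<and>
        (\<forall>E\<in>sets borel. E \<subseteq> tri w (weight w w r \<mu>) \<longrightarrow> emeasure \<nu> E = deflation w r \<mu> \<tau> E))"

definition dual :: "(3 \<Rightarrow> real^2) \<Rightarrow> real \<Rightarrow> (real^2) measure \<Rightarrow> (real^2) measure" where
  "dual w r \<mu> = (THE \<nu>. is_dual w r \<mu> \<nu>)"

end

theory Submission imports Defs begin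

text \<open>
  A measure in \<open>\<M>\<^sub>r\<close> is a finite signed sum of tripods \<open>{A + t w\<^sub>j | t \<ge> 0, j = 1, 2, 3}\<close> with vertices
  \<open>A\<close> in the triangle, given by the function \<open>s\<close> of their weights; the exit densities are the sums of
  \<open>s\<close> over the lines parallel to the \<open>w\<^sub>j\<close>. A closed walk around white pieces can be shifted to its
  left without changing these sums, so a rigid measure admits no closed walk. Acyclicity makes the
  equations between the densities at the two ends of the edges triangular. Hence the measures
  dominated by a multiple of a rigid measure form an orthant, and its dimension satisfies
  \<open>2 ext = exit rays + (sum over the branch points of degree - 4)\<close>.

  Adding a unit tripod at each corner puts the sides of the triangle into the support and changes
  \<open>ext\<close> by the number of corners which carry no tripod of the measure. Inflation followed by deflation
  turns the edges of this framed measure into edges of the dual and exchanges angles of 60 and 120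
  degrees. The dual is acyclic because its walks are walks of the framed measure, and the two
  dimension formulas add up to the claim. The displacement of the white pieces is the gradient of a
  convex function; its monotonicity shows that dual edges do not cross.
\<close>

section \<open>Six directions\<close>

text \<open>A white piece that meets a side of the triangle is not bounded by the support alone. The
  frame supplies its missing edges, so that each piece has a closed boundary walk, while
  displacements are still taken from the unframed measure: lengths and incidences come from
  \<open>u\<close>, densities and translations from \<open>s\<close>. A framed edge along a side
  yields one exit ray of the dual. Each edge equates the densities at its two ends, and a density at
  a branch point is a sum of at most two coefficients, of a tripod and of a line. Seen from the end
  whose outgoing walker has at least as many predecessors, the other end carries a single
  coefficient, and the equation is solved for it. Dependencies between solved coefficients follow
  walks, so a circular dependency would be a closed walk. The numbers of branch points are
  eliminated by angles: six sectors surround each branch point, grouped into angles of 60 and 120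
  degrees. Since duality exchanges these, the two sector counts combine into a count of flags and of
  points on the sides. Directions are integers modulo 6, so both orientations of an edge and the
  dual, with index \<open>1 - k\<close>, obey the same formulas.\<close>

lemma six_numerals [simp]: "(6::6) = 0" "(7::6) = 1" "(8::6) = 2" "(9::6) = 3" "(10::6) = 4"
  "(11::6) = 5" "(12::6) = 0" "(-1::6) = 5" "(-2::6) = 4" "(-3::6) = 3" "(-4::6) = 2" "(-5::6) = 1"
  by auto

lemma six_normalize [simp]:
  "(k::6) + numeral a + numeral b = k + numeral (a + b)" "k + 1 + numeral b = k + numeral (Num.One + b)"
  "k + numeral a + 1 = k + numeral (a + Num.One)" "k + 1 + 1 = k + 2"
  "k - 1 = k + 5" "k - 2 = k + 4" "k - 3 = k + 3" "k - 4 = k + 2" "k - 5 = k + 1"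
proof -
  have *: "x - y = x + - y" for x y :: 6 by simp
  show "k - 1 = k + 5" "k - 2 = k + 4" "k - 3 = k + 3" "k - 4 = k + 2" "k - 5 = k + 1"
    by (simp_all only: * six_numerals)
qed (simp_all only: add.assoc numeral_add numeral_One one_add_one)

lemma six_minus_normalize [simp]:
  "numeral c - (k::6) + numeral b = numeral (c + b) - k" "numeral c - k + 1 = numeral (c + Num.One) - k"
  "1 - k + numeral b = numeral (Num.One + b) - k" "1 - k + 1 = 2 - k"
  "numeral c - (k + numeral b) = (numeral c - numeral b) - k" "numeral c - (k + 1) = (numeral c - 1) - k"
  "1 - (k + numeral b) = (1 - numeral b) - k" "1 - (k + 1) = - k" "- k + numeral b = numeral b - k" "- k + 1 = 1 - k"
  "- (k + numeral b) = - numeral b - k" "- (k + 1) = 5 - k"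
proof -
  show "numeral c - k + numeral b = numeral (c + b) - k" "numeral c - k + 1 = numeral (c + Num.One) - k"
    "1 - k + numeral b = numeral (Num.One + b) - k" "1 - k + 1 = 2 - k" "- k + numeral b = numeral b - k" "- k + 1 = 1 - k"
    by (simp_all only: numeral_add numeral_One one_add_one[symmetric] diff_conv_add_uminus add_ac)
  show "- (k + 1) = 5 - k" by (simp only: six_numerals(8)[symmetric] minus_add_distrib diff_conv_add_uminus add_ac)
  show "1 - (k + 1) = - k" by (simp only: diff_add_eq_diff_diff_swap) simp
qed (simp_all only: diff_conv_add_uminus minus_add_distrib add_ac)

lemma six_cases: "(k::6) = 0 \<or> k = 1 \<or> k = 2 \<or> k = 3 \<or> k = 4 \<or> k = 5"
proof (cases k rule: bit0.cases)
  case (1 z)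
  then have "z = 0 \<or> z = 1 \<or> z = 2 \<or> z = 3 \<or> z = 4 \<or> z = 5" by auto
  with 1 show ?thesis by auto
qed

lemma six_rel: "(l::6) = k \<or> l = k + 1 \<or> l = k + 2 \<or> l = k + 3 \<or> l = k + 4 \<or> l = k + 5"
proof -
  have l: "l = k + (l - k)" by simp
  show ?thesis using six_cases[of "l - k"] by (metis add.right_neutral l)
qed

text \<open>Even indices will be the exit directions, odd indices their opposites.\<close>

definition ev :: "6 \<Rightarrow> bool" where "ev k \<longleftrightarrow> k \<in> {0, 2, 4}"

lemma ev_add [simp]: "ev (k + 1) \<longleftrightarrow> \<not> ev k" "ev (k + 2) \<longleftrightarrow> ev k" "ev (k + 3) \<longleftrightarrow> \<not> ev k"
  "ev (k + 4) \<longleftrightarrow> ev k" "ev (k + 5) \<longleftrightarrow> \<not> ev k" "ev (2 - k) \<longleftrightarrow> ev k" "ev 0" "\<not> ev 1" "ev 2" "\<not> ev 3" "ev 4" "\<not> ev 5"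
  using six_cases[of k] by (auto simp: ev_def)

lemma Collect_ev: "{k. ev k} = {0, 2, 4}"
  by (auto simp: ev_def)

definition sg :: "6 \<Rightarrow> real" where "sg k = (if ev k then 1 else - 1)"

lemma sg_add [simp]: "sg (k + 1) = - sg k" "sg (k + 2) = sg k" "sg (k + 3) = - sg k" "sg (k + 4) = sg k"
  "sg (k + 5) = - sg k" "sg k * sg k = 1" "sg k \<noteq> 0"
  by (auto simp: sg_def)

definition fs :: "('a \<Rightarrow> real) \<Rightarrow> bool" where "fs s \<longleftrightarrow> finite {A. s A \<noteq> 0}"

lemma fs_add [intro]: "fs s \<Longrightarrow> fs s' \<Longrightarrow> fs (\<lambda>A. s A + s' A)"
  unfolding fs_def by (rule finite_subset[of _ "{A. s A \<noteq> 0} \<union> {A. s' A \<noteq> 0}"]) auto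

lemma fs_scale [intro]: "fs s \<Longrightarrow> fs (\<lambda>A. c * s A)"
  unfolding fs_def by (rule finite_subset[of _ "{A. s A \<noteq> 0}"]) auto

lemma fs_sum [intro]: "(\<And>i. i \<in> I \<Longrightarrow> fs (f i)) \<Longrightarrow> fs (\<lambda>A. \<Sum>i\<in>I. f i A)"
proof (induction I rule: infinite_finite_induct)
  case (insert i I) then show ?case using fs_add[of "f i" "\<lambda>A. \<Sum>i\<in>I. f i A"] by simp
qed (auto simp: fs_def)

lemma fs_diff [intro]: "fs s \<Longrightarrow> fs s' \<Longrightarrow> fs (\<lambda>A. s A - s' A)"
  using fs_add[OF _ fs_scale[of s' "-1"], of s] by simp

lemma fs_point [intro]: "fs (\<lambda>A. of_bool (A = P))"
  unfolding fs_def by (rule finite_subset[of _ "{P}"]) auto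

locale hex =
  fixes dir :: "6 \<Rightarrow> real^2"
  assumes norm_dir [simp]: "norm (dir k) = 1"
    and dir_sum: "dir (k + 1) = dir k + dir (k + 2)"
begin

lemma dir_add [simp]: "dir (k + 2) = dir (k + 1) - dir k" "dir (k + 3) = - dir k" "dir (k + 4) = - dir (k + 1)"
  "dir (k + 5) = dir k - dir (k + 1)"
proof -
  show 2: "dir (k + 2) = dir (k + 1) - dir k" for k using dir_sum[of k] by simp
  show 3: "dir (k + 3) = - dir k" for k using 2[of "k + 1"] 2[of k] by simp
  show "dir (k + 4) = - dir (k + 1)" using 3[of "k + 1"] by simp
  show "dir (k + 5) = dir k - dir (k + 1)" using 3[of "k + 2"] 2[of k] by simp
qed

lemma inner_dir: "dir k \<bullet> dir k = 1" "dir k \<bullet> dir (k + 1) = 1 / 2"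
proof -
  show 1: "dir k \<bullet> dir k = 1" for k using norm_dir[of k] by (simp add: dot_square_norm)
  have "dir (k + 2) \<bullet> dir (k + 2) = 1" by (rule 1)
  then have "dir (k + 1) \<bullet> dir (k + 1) - 2 * (dir k \<bullet> dir (k + 1)) + dir k \<bullet> dir k = 1"
    by (simp add: inner_diff inner_commute)
  then show "dir k \<bullet> dir (k + 1) = 1 / 2" using 1[of k] 1[of "k + 1"] by simp
qed

text \<open>An oblique coordinate: zero on the line spanned by \<open>dir k\<close>, positive to its
  left. The factor \<open>2 / 3\<close> makes it 1 at \<open>dir (k + 1)\<close>, because
  \<open>dir (k + 1) \<bullet> (dir (k + 1) + dir (k + 2)) = 3 / 2\<close>.\<close>

definition off :: "6 \<Rightarrow> real^2 \<Rightarrow> real" where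
  "off k x = 2 / 3 * (x \<bullet> (dir (k + 1) + dir (k + 2)))"

lemma off_lin [simp]: "off k (x + y) = off k x + off k y" "off k (x - y) = off k x - off k y"
  "off k (c *\<^sub>R x) = c * off k x" "off k (- x) = - off k x" "off k 0 = 0"
  unfolding off_def by (simp_all add: inner_left_distrib inner_diff_left distrib_left right_diff_distrib)

lemma off_sum: "off k (\<Sum>i\<in>I. f i) = (\<Sum>i\<in>I. off k (f i))"
  by (induction I rule: infinite_finite_induct) auto

lemma off_alt: "off k x = 4 / 3 * (x \<bullet> dir (k + 1)) - 2 / 3 * (x \<bullet> dir k)"
  unfolding off_def dir_add(1) inner_add_right inner_diff_right by (simp add: field_simps)

lemma off_add [simp]: "off (k + 2) x = off (k + 1) x - off k x" "off (k + 3) x = - off k x"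
  "off (k + 4) x = - off (k + 1) x" "off (k + 5) x = off k x - off (k + 1) x"
  unfolding off_alt by (simp_all add: inner_diff_right field_simps)

lemma off_dir [simp]: "off k (dir k) = 0" "off k (dir (k + 1)) = 1" "off (k + 1) (dir k) = - 1"
  "off (k + 1) (dir (k + 1)) = 0"
proof -
  have i: "dir (k + 1) \<bullet> dir k = 1 / 2" for k using inner_dir[of k] by (simp add: inner_commute)
  show 1: "off k (dir k) = 0" for k unfolding off_def dir_add(1) by (simp only: inner_add_right inner_diff_right inner_dir) simp
  show "off k (dir (k + 1)) = 1" unfolding off_def dir_add(1) by (simp only: inner_add_right inner_diff_right inner_dir i) simp
  show "off (k + 1) (dir k) = - 1" unfolding off_alt by (simp add: inner_diff_right inner_dir)
  show "off (k + 1) (dir (k + 1)) = 0" by (rule 1)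
qed

lemma off_rep: "x = off k x *\<^sub>R dir (k + 1) - off (k + 1) x *\<^sub>R dir k"
proof -
  have ind: "independent {dir k, dir (k + 1)}" "dir k \<noteq> dir (k + 1)"
  proof -
    show ne: "dir k \<noteq> dir (k + 1)"
    proof
      assume "dir k = dir (k + 1)"
      then have "off k (dir k) = off k (dir (k + 1))" by (rule arg_cong)
      then show False by simp
    qed
    show "independent {dir k, dir (k + 1)}"
    proof (rule independent_if_scalars_zero)
      fix f x assume z: "(\<Sum>x\<in>{dir k, dir (k + 1)}. f x *\<^sub>R x) = 0" and x: "x \<in> {dir k, dir (k + 1)}"
      have z: "f (dir k) *\<^sub>R dir k + f (dir (k + 1)) *\<^sub>R dir (k + 1) = 0" using z ne by simp
      have "f (dir (k + 1)) = 0" using arg_cong[OF z, of "off k"] by simp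
      moreover have "f (dir k) = 0" using arg_cong[OF z, of "off (k + 1)"] by simp
      ultimately show "f x = 0" using x by auto
    qed simp
  qed
  have "span {dir k, dir (k + 1)} = UNIV"
    using ind card_eq_dim[of "{dir k, dir (k + 1)}" UNIV] by auto
  then have "x \<in> span {dir k, dir (k + 1)}" by simp
  then obtain a b where "x - a *\<^sub>R dir k - b *\<^sub>R dir (k + 1) = 0"
    unfolding span_breakdown_eq span_empty by blast
  then have "x = a *\<^sub>R dir k + b *\<^sub>R dir (k + 1)" by (simp add: algebra_simps)
  then show ?thesis by simp
qed

lemma off_eqI: "off k x = off k y \<Longrightarrow> off (k + 1) x = off (k + 1) y \<Longrightarrow> x = y"
  by (metis off_rep)

lemma dir_nonzero [simp]: "dir k \<noteq> 0"
  using norm_dir[of k] by (metis norm_zero zero_neq_one)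

lemma on_lineD: "off k y = 0 \<Longrightarrow> y = (- off (k + 1) y) *\<^sub>R dir k"
  using off_rep[of y k] by simp

section \<open>Balanced densities generated by tripods\<close>

text \<open>The germ at \<open>y\<close> in direction \<open>dir k\<close> lies on the tripod \<open>{t *\<^sub>R dir j | t \<ge> 0, ev j}\<close>.\<close>

definition hit :: "6 \<Rightarrow> real^2 \<Rightarrow> bool" where
  "hit k y \<longleftrightarrow> off k y = 0 \<and> (if ev k then off (k + 1) y \<le> 0 else off (k + 1) y > 0)"

text \<open>Density of the signed sum of tripods on the germ at \<open>x\<close>. At a vertex it may
  differ from the density on the opposite germ, which is why it depends on a point and a direction
  rather than on a line.\<close>

definition D :: "(real^2 \<Rightarrow> real) \<Rightarrow> real^2 \<Rightarrow> 6 \<Rightarrow> real" where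
  "D s x k = (\<Sum>A | s A \<noteq> 0. s A * of_bool (hit k (x - A)))"

lemma D_superset: "finite S \<Longrightarrow> {A. s A \<noteq> 0} \<subseteq> S \<Longrightarrow> D s x k = (\<Sum>A\<in>S. s A * of_bool (hit k (x - A)))"
  unfolding D_def by (rule sum.mono_neutral_left) auto

lemma D_add: assumes "fs s" "fs s'" shows "D (\<lambda>A. s A + s' A) x k = D s x k + D s' x k"
proof -
  let ?S = "{A. s A \<noteq> 0} \<union> {A. s' A \<noteq> 0}"
  have "finite ?S" using assms by (auto simp: fs_def)
  then show ?thesis
    by (subst (1 2 3) D_superset[of ?S]) (auto simp: distrib_right sum.distrib)
qed

lemma D_scale: assumes "fs s" shows "D (\<lambda>A. c * s A) x k = c * D s x k"
proof -
  have "finite {A. s A \<noteq> 0}" using assms by (auto simp: fs_def)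
  then have "D (\<lambda>A. c * s A) x k = (\<Sum>A | s A \<noteq> 0. c * s A * of_bool (hit k (x - A)))"
    by (rule D_superset) auto
  then show ?thesis by (simp add: D_def sum_distrib_left mult.assoc)
qed

lemma D_diff: assumes "fs s" "fs s'" shows "D (\<lambda>A. s A - s' A) x k = D s x k - D s' x k"
  using D_add[OF assms(1) fs_scale[OF assms(2), of "-1"]] D_scale[OF assms(2), of "-1"] by simp

lemma D_zero [simp]: "D (\<lambda>A. 0) x k = 0"
  by (simp add: D_def)

lemma D_sum: "(\<And>i. i \<in> I \<Longrightarrow> fs (f i)) \<Longrightarrow> D (\<lambda>A. \<Sum>i\<in>I. f i A) x k = (\<Sum>i\<in>I. D (f i) x k)"
proof (induction I rule: infinite_finite_induct)
  case (insert i I)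
  then have "fs (f i)" "fs (\<lambda>A. \<Sum>i\<in>I. f i A)" by (auto intro!: fs_sum)
  then show ?case using insert D_add[of "f i" "\<lambda>A. \<Sum>i\<in>I. f i A"] by simp
qed auto

lemma D_point: "D (\<lambda>A. of_bool (A = P)) x k = of_bool (hit k (x - P))"
  by (subst D_superset[of "{P}"]) auto

lemma hit_jump: "of_bool (hit k y) - of_bool (hit (k + 3) y) = sg k * of_bool (y = 0)"
proof -
  have "y = 0 \<longleftrightarrow> off k y = 0 \<and> off (k + 1) y = 0" using off_eqI[of k y 0] by auto
  then show ?thesis by (auto simp: hit_def sg_def)
qed

text \<open>Along a line through \<open>x\<close> only the tripod with vertex \<open>x\<close>
  distinguishes the two opposite germs. Up to the sign \<open>sg k\<close> the jump is the same on
  all three lines: this is the balance condition, and it recovers \<open>s\<close> from the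
  densities.\<close>

lemma D_jump: assumes "fs s" shows "D s x k - D s x (k + 3) = sg k * s x"
proof -
  let ?S = "insert x {A. s A \<noteq> 0}"
  have f: "finite ?S" using assms by (auto simp: fs_def)
  have "D s x k - D s x (k + 3) = (\<Sum>A\<in>?S. s A * (of_bool (hit k (x - A)) - of_bool (hit (k + 3) (x - A))))"
    by (subst (1 2) D_superset[OF f]) (auto simp: sum_subtractf right_diff_distrib)
  also have "\<dots> = (\<Sum>A\<in>?S. if A = x then sg k * s x else 0)"
    unfolding hit_jump by (rule sum.cong) auto
  also have "\<dots> = sg k * s x" using f by simp
  finally show ?thesis .
qed

lemma hit_between:
  assumes "t > 0" "\<And>\<tau>. 0 < \<tau> \<Longrightarrow> \<tau> < t \<Longrightarrow> y + \<tau> *\<^sub>R dir k \<noteq> 0"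
  shows "hit (k + 3) (y + t *\<^sub>R dir k) \<longleftrightarrow> hit k y"
proof (cases "off k y = 0")
  case True
  have "\<not> (0 < off (k + 1) y \<and> off (k + 1) y < t)"
    using assms(2)[of "off (k + 1) y"] on_lineD[OF True] by (metis add.commute add.right_inverse scaleR_minus_left)
  then show ?thesis using True assms(1) by (auto simp: hit_def)
qed (simp add: hit_def)

lemma D_const:
  assumes "t > 0" "\<And>\<tau>. 0 < \<tau> \<Longrightarrow> \<tau> < t \<Longrightarrow> s (x + \<tau> *\<^sub>R dir k) = 0"
  shows "D s (x + t *\<^sub>R dir k) (k + 3) = D s x k"
  unfolding D_def
proof (rule sum.cong, simp, goal_cases)
  case (1 A)
  have "hit (k + 3) (x - A + t *\<^sub>R dir k) \<longleftrightarrow> hit k (x - A)"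
  proof (rule hit_between[OF assms(1)])
    fix \<tau> assume "0 < \<tau>" "\<tau> < t"
    then show "x - A + \<tau> *\<^sub>R dir k \<noteq> 0" using assms(2)[of \<tau>] 1 by (auto simp: algebra_simps)
  qed
  then show ?case by (simp add: algebra_simps)
qed

lemma D_const':
  assumes "fs s" "t \<ge> 0" "\<And>\<tau>. 0 < \<tau> \<Longrightarrow> \<tau> \<le> t \<Longrightarrow> s (x + \<tau> *\<^sub>R dir k) = 0"
  shows "D s (x + t *\<^sub>R dir k) k = D s x k"
proof (cases "t = 0")
  case False
  have "D s (x + t *\<^sub>R dir k) (k + 3) = D s x k" using assms False by (intro D_const) auto
  then show ?thesis using D_jump[OF assms(1), of "x + t *\<^sub>R dir k" k] assms False by simp
qed simp

lemma D_nz_line: "D s x k \<noteq> 0 \<Longrightarrow> \<exists>A. s A \<noteq> 0 \<and> off k A = off k x"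
proof (rule ccontr)
  assume "D s x k \<noteq> 0" "\<not> (\<exists>A. s A \<noteq> 0 \<and> off k A = off k x)"
  moreover from this(2) have "D s x k = 0" unfolding D_def by (intro sum.neutral) (auto simp: hit_def)
  ultimately show False by simp
qed

text \<open>Tripod rays run in even directions, so a ray met on an odd germ is traversed towards its
  vertex, which must lie ahead.\<close>

lemma D_odd_ahead:
  assumes "\<not> ev k" "\<And>t. t > 0 \<Longrightarrow> s (x + t *\<^sub>R dir k) = 0" shows "D s x k = 0"
  unfolding D_def
proof (rule sum.neutral, safe)
  fix A assume "s A \<noteq> 0"
  have False if "hit k (x - A)"
  proof -
    have h: "off k (x - A) = 0" "off (k + 1) (x - A) > 0" using that assms(1) by (auto simp: hit_def)
    have "A = x + off (k + 1) (x - A) *\<^sub>R dir k" using on_lineD[OF h(1)] by (simp add: algebra_simps)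
    then show False using assms(2)[OF h(2)] \<open>s A \<noteq> 0\<close> by simp
  qed
  then show "s A * of_bool (hit k (x - A)) = 0" by auto
qed

lemma D_even_behind:
  assumes "ev k" "\<And>t. t \<ge> 0 \<Longrightarrow> s (x - t *\<^sub>R dir k) = 0" shows "D s x k = 0"
  unfolding D_def
proof (rule sum.neutral, safe)
  fix A assume "s A \<noteq> 0"
  have False if "hit k (x - A)"
  proof -
    have h: "off k (x - A) = 0" "- off (k + 1) (x - A) \<ge> 0" using that assms(1) by (auto simp: hit_def)
    have "A = x - (- off (k + 1) (x - A)) *\<^sub>R dir k" using on_lineD[OF h(1)] by (simp add: algebra_simps)
    then show False using assms(2)[OF h(2)] \<open>s A \<noteq> 0\<close> by metis
  qed
  then show "s A * of_bool (hit k (x - A)) = 0" by auto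
qed

definition pos :: "(real^2 \<Rightarrow> real) \<Rightarrow> bool" where "pos s \<longleftrightarrow> (\<forall>x k. D s x k \<ge> 0)"

text \<open>Rigidity in terms of weights: the eventual densities along even rays encode exit points
  and exit densities at once.\<close>

definition rig :: "(real^2 \<Rightarrow> real) \<Rightarrow> bool" where
  "rig s \<longleftrightarrow> fs s \<and> pos s \<and> (\<forall>s'. fs s' \<and> pos s' \<and>
     (\<forall>x k. ev k \<longrightarrow> (\<forall>\<^sub>F t in at_top. D s' (x + t *\<^sub>R dir k) k = D s (x + t *\<^sub>R dir k) k)) \<longrightarrow> s' = s)"

end

section \<open>Rigidity excludes closed walks\<close>

context hex
begin

text \<open>One signed ray on the line of direction \<open>e\<close>. With the sign
  \<open>- sg e\<close> the difference of two translates is the indicator of a segment, whatever the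
  parity of \<open>e\<close>.\<close>

definition gam :: "6 \<Rightarrow> 6 \<Rightarrow> real^2 \<Rightarrow> real" where
  "gam e k y = (if k = e \<or> k = e + 3 then - sg e * of_bool (hit k y) else 0)"

lemma gam_add3: "gam (e + 3) k y = - gam e k y"
  by (auto simp: gam_def)

lemma hit_gam: "- sg d * of_bool (hit k y) = gam d k y - gam (d + 1) k y + gam (d + 2) k y"
  using six_rel[of k d] by (auto simp: gam_def)

definition onseg :: "6 \<Rightarrow> 6 \<Rightarrow> real \<Rightarrow> real^2 \<Rightarrow> bool" where
  "onseg e k l y \<longleftrightarrow> off e y = 0 \<and> (k = e \<and> off (e + 1) y \<le> 0 \<and> off (e + 1) y > - l \<or>
     k = e + 3 \<and> off (e + 1) y < 0 \<and> off (e + 1) y \<ge> - l)"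

lemma gam_seg: "l \<ge> 0 \<Longrightarrow> gam e k (y - l *\<^sub>R dir e) - gam e k y = of_bool (onseg e k l y)"
  by (auto simp: gam_def hit_def onseg_def sg_def)

lemma onsegD:
  assumes "onseg e k l y"
  obtains \<tau> where "y = \<tau> *\<^sub>R dir e" "k = e \<and> 0 \<le> \<tau> \<and> \<tau> < l \<or> k = e + 3 \<and> 0 < \<tau> \<and> \<tau> \<le> l"
  using that[of "- off (e + 1) y"] on_lineD[of e y] assms by (auto simp: onseg_def)

lemma sum_cyclic_shift:
  fixes f :: "nat \<Rightarrow> real"
  assumes "f n = f 0" shows "(\<Sum>i<n. f (Suc i)) = (\<Sum>i<n. f i)"
proof -
  have "(\<Sum>i<n. f (Suc i) - f i) = f n - f 0" by (induction n) auto
  then show ?thesis using assms by (simp add: sum_subtractf)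
qed

text \<open>Moving every corner of the walk to its left changes the densities by the shifted edges
  minus the original ones, plus a short connecting segment that is gained at a left turn and lost at
  a right turn; hence the density required at right turns. Exits are unchanged, so rigidity forces
  the change to vanish, and sorting the turns by place and direction then leaves neither edges nor
  turns.\<close>

lemma no_closed_walk:
  assumes rig: "rig s" and c: "c > 0" and n: "P n = P 0" "d n = d 0"
    and step: "\<And>i. i < n \<Longrightarrow> P (Suc i) = P i + l i *\<^sub>R dir (d i)"
    and l: "\<And>i. i < n \<Longrightarrow> l i \<ge> 0"
    and turn: "\<And>i. i < n \<Longrightarrow> d (Suc i) = d i \<or> d (Suc i) = d i + 1 \<and> l i > 0 \<or>
        d (Suc i) = d i + 5 \<and> D s (P (Suc i)) (d i + 1) \<ge> c"
    and fwd: "\<And>i \<tau>. i < n \<Longrightarrow> 0 \<le> \<tau> \<Longrightarrow> \<tau> < l i \<Longrightarrow> D s (P i + \<tau> *\<^sub>R dir (d i)) (d i) \<ge> c"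
    and bwd: "\<And>i \<tau>. i < n \<Longrightarrow> 0 < \<tau> \<Longrightarrow> \<tau> \<le> l i \<Longrightarrow> D s (P i + \<tau> *\<^sub>R dir (d i)) (d i + 3) \<ge> c"
    and nontriv: "\<exists>i<n. l i > 0 \<or> d (Suc i) = d i + 5"
  shows False
proof -
  have fss: "fs s" and poss: "pos s" using rig by (auto simp: rig_def)
  have n0: "n > 0" using nontriv by auto
  \<comment> \<open>A unit shift with offset 1 both from the incoming and from the outgoing line, so
    that edges move parallel to themselves.\<close>
  define v where "v i = (if d (Suc i) = d i + 1 then dir (d i + 2) else dir (d i + 1))" for i
  define V where "V i = (case i of 0 \<Rightarrow> v (n - 1) | Suc j \<Rightarrow> v j)" for i
  have V_Suc: "V (Suc i) = v i" for i by (simp add: V_def)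
  have V_n: "V n = V 0" using n0 by (cases n) (auto simp: V_def)
  have V_dir: "V i = dir (d i + 1) \<or> V i = dir (d i + 2)" if "i \<le> n" for i
  proof -
    have *: "V (Suc j) = dir (d (Suc j) + 1) \<or> V (Suc j) = dir (d (Suc j) + 2)" if "j < n" for j
      using turn[OF that] by (auto simp: V_Suc v_def)
    show ?thesis
    proof (cases i)
      case 0 then show ?thesis using *[of "n - 1"] n0 V_n n by auto
    next
      case (Suc j) then show ?thesis using * that by auto
    qed
  qed
  define Pts where "Pts = P ` {..n}"
  have fin: "finite Pts" by (simp add: Pts_def)
  \<comment> \<open>So small that no positive edge is reversed, shifts of different corners stay
    apart, and no weight lies strictly inside a connecting segment.\<close>
  have "\<exists>\<eta>>0. (\<forall>i<n. l i > 0 \<longrightarrow> \<eta> < l i) \<and> (\<forall>A\<in>Pts. \<forall>B\<in>Pts. A \<noteq> B \<longrightarrow> 2 * \<eta> < dist A B)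
      \<and> (\<forall>A\<in>Pts. \<forall>k. \<forall>\<tau>. 0 < \<tau> \<longrightarrow> \<tau> < 2 * \<eta> \<longrightarrow> s (A + \<tau> *\<^sub>R dir k) = 0)"
  proof -
    have lt: "\<forall>\<^sub>F \<eta> in at_right 0. 2 * \<eta> < z" if "z > 0" for z :: real
      by (rule eventually_at_rightI[of 0 "z / 2"]) (use that in auto)
    have "\<forall>\<^sub>F \<eta> in at_right 0. \<forall>i\<in>{i. i < n \<and> l i > 0}. 2 * \<eta> < l i"
      by (rule eventually_ball_finite) (auto intro: lt)
    moreover have "\<forall>\<^sub>F \<eta> in at_right 0. \<forall>A\<in>Pts. \<forall>B\<in>Pts - {A}. 2 * \<eta> < dist A B"
      using fin by (intro eventually_ball_finite ballI) (auto intro: lt)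
    moreover have "\<forall>\<^sub>F \<eta> in at_right 0. \<forall>A\<in>Pts. \<forall>B\<in>{B. s B \<noteq> 0} - {A}. 2 * \<eta> < dist A B"
      using fin fss by (intro eventually_ball_finite ballI) (auto simp: fs_def intro: lt)
    moreover have "\<forall>\<^sub>F \<eta> in at_right 0. (0::real) < \<eta>" by (rule eventually_at_right_less)
    ultimately have "\<forall>\<^sub>F \<eta> in at_right 0. 0 < \<eta> \<and> (\<forall>i\<in>{i. i < n \<and> l i > 0}. 2 * \<eta> < l i) \<and>
      (\<forall>A\<in>Pts. \<forall>B\<in>Pts - {A}. 2 * \<eta> < dist A B) \<and> (\<forall>A\<in>Pts. \<forall>B\<in>{B. s B \<noteq> 0} - {A}. 2 * \<eta> < dist A B)"
      by eventually_elim blast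
    then obtain \<eta> where eta: "0 < \<eta>" "\<And>i. i < n \<Longrightarrow> l i > 0 \<Longrightarrow> 2 * \<eta> < l i"
      "\<And>A B. A \<in> Pts \<Longrightarrow> B \<in> Pts \<Longrightarrow> A \<noteq> B \<Longrightarrow> 2 * \<eta> < dist A B"
      "\<And>A B. A \<in> Pts \<Longrightarrow> s B \<noteq> 0 \<Longrightarrow> A \<noteq> B \<Longrightarrow> 2 * \<eta> < dist A B"
    proof -
      assume a: "\<forall>\<^sub>F \<eta> in at_right 0. 0 < \<eta> \<and> (\<forall>i\<in>{i. i < n \<and> l i > 0}. 2 * \<eta> < l i) \<and>
        (\<forall>A\<in>Pts. \<forall>B\<in>Pts - {A}. 2 * \<eta> < dist A B) \<and> (\<forall>A\<in>Pts. \<forall>B\<in>{B. s B \<noteq> 0} - {A}. 2 * \<eta> < dist A B)"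
      show ?thesis using eventually_happens'[OF _ a] that by fastforce
    qed
    have "s (A + \<tau> *\<^sub>R dir k) = 0" if "A \<in> Pts" "0 < \<tau>" "\<tau> < 2 * \<eta>" for A \<tau> k
      using eta(4)[OF that(1), of "A + \<tau> *\<^sub>R dir k"] that by (auto simp: dist_norm)
    moreover have "\<eta> < l i" if "i < n" "l i > 0" for i using eta(1) eta(2)[OF that] by simp
    ultimately show ?thesis using eta(1,3) by blast
  qed
  then obtain \<eta> where eta: "\<eta> > 0" "\<And>i. i < n \<Longrightarrow> l i > 0 \<Longrightarrow> \<eta> < l i"
    "\<And>A B. A \<in> Pts \<Longrightarrow> B \<in> Pts \<Longrightarrow> A \<noteq> B \<Longrightarrow> 2 * \<eta> < dist A B"
    "\<And>A k \<tau>. A \<in> Pts \<Longrightarrow> 0 < \<tau> \<Longrightarrow> \<tau> < 2 * \<eta> \<Longrightarrow> s (A + \<tau> *\<^sub>R dir k) = 0" by blast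
  define T where "T = {i. i < n \<and> d (Suc i) \<noteq> d i}"
  have finT: "finite T" by (simp add: T_def)
  define P' where "P' i = P i + \<eta> *\<^sub>R V i" for i
  have P'n: "P' n = P' 0" using n V_n by (simp add: P'_def)
  \<comment> \<open>Each turn carries the weight \<open>- sg (d i)\<close> from its corner to the
    shifted corner.\<close>
  define \<Delta> where "\<Delta> A = (\<Sum>i\<in>T. - sg (d i) * (of_bool (A = P' (Suc i)) - of_bool (A = P (Suc i))))" for A
  have fsD: "fs \<Delta>" unfolding \<Delta>_def by (intro fs_sum fs_scale fs_diff fs_point)
  define third where "third k x i = (if d (Suc i) = d i + 1 then of_bool (onseg (d i + 2) k \<eta> (x - P (Suc i)))
      else if d (Suc i) = d i + 5 then - of_bool (onseg (d i + 1) k \<eta> (x - P (Suc i))) else (0::real))" for k x i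
  define sh where "sh k x i = gam (d i) k (x - P' (Suc i)) - gam (d i) k (x - P' i)" for k x i
  have DD: "D \<Delta> x k = (\<Sum>i<n. sh k x i - of_bool (onseg (d i) k (l i) (x - P i)) + third k x i)" for x k
  proof -
    let ?g = "\<lambda>i e. gam e k (x - P' i) - gam e k (x - P i)"
    have "D \<Delta> x k = (\<Sum>i\<in>T. D (\<lambda>A. - sg (d i) * (of_bool (A = P' (Suc i)) - of_bool (A = P (Suc i)))) x k)"
      unfolding \<Delta>_def by (rule D_sum) (intro fs_scale fs_diff fs_point)
    also have "\<dots> = (\<Sum>i\<in>T. - sg (d i) * (of_bool (hit k (x - P' (Suc i))) - of_bool (hit k (x - P (Suc i)))))"
      by (rule sum.cong, simp) (simp only: D_scale[OF fs_diff[OF fs_point fs_point]] D_diff[OF fs_point fs_point] D_point)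
    also have "\<dots> = (\<Sum>i\<in>T. ?g (Suc i) (d i) - ?g (Suc i) (d i + 1) + ?g (Suc i) (d i + 2))"
      unfolding right_diff_distrib hit_gam by (rule sum.cong) auto
    also have "\<dots> = (\<Sum>i\<in>T. ?g (Suc i) (d i) - ?g (Suc i) (d (Suc i)) + third k x i)"
    proof (rule sum.cong, simp)
      fix i assume "i \<in> T"
      then have i: "i < n" "d (Suc i) \<noteq> d i" by (auto simp: T_def)
      consider "d (Suc i) = d i + 1" | "d (Suc i) = d i + 5" using turn[OF i(1)] i(2) by auto
      then show "?g (Suc i) (d i) - ?g (Suc i) (d i + 1) + ?g (Suc i) (d i + 2) = ?g (Suc i) (d i) - ?g (Suc i) (d (Suc i)) + third k x i"
      proof cases
        case 1
        have "?g (Suc i) (d i + 2) = of_bool (onseg (d i + 2) k \<eta> (x - P (Suc i)))"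
          using gam_seg[of \<eta> "d i + 2" k "x - P (Suc i)"] eta(1) 1 by (simp add: P'_def V_Suc v_def algebra_simps)
        then show ?thesis using 1 by (simp add: third_def)
      next
        case 2
        have "?g (Suc i) (d i + 1) = of_bool (onseg (d i + 1) k \<eta> (x - P (Suc i)))"
          using gam_seg[of \<eta> "d i + 1" k "x - P (Suc i)"] eta(1) 2 by (simp add: P'_def V_Suc v_def algebra_simps)
        moreover have "?g (Suc i) (d i + 5) = - ?g (Suc i) (d i + 2)" using gam_add3[of "d i + 2" k] by simp
        ultimately show ?thesis using 2 by (simp add: third_def)
      qed
    qed
    also have "\<dots> = (\<Sum>i<n. ?g (Suc i) (d i) - ?g (Suc i) (d (Suc i)) + third k x i)"
      by (rule sum.mono_neutral_left) (auto simp: T_def third_def)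
    also have "\<dots> = (\<Sum>i<n. ?g (Suc i) (d i) - ?g i (d i) + third k x i)"
      using sum_cyclic_shift[of "\<lambda>i. ?g i (d i)" n] n P'n by (simp add: sum.distrib sum_subtractf)
    also have "\<dots> = (\<Sum>i<n. sh k x i - of_bool (onseg (d i) k (l i) (x - P i)) + third k x i)"
    proof (rule sum.cong, simp)
      fix i assume "i \<in> {..<n}"
      then have "i < n" by simp
      then have "gam (d i) k (x - P (Suc i)) - gam (d i) k (x - P i) = of_bool (onseg (d i) k (l i) (x - P i))"
        using gam_seg[OF l, of i "d i" k "x - P i"] step by (simp add: algebra_simps)
      then show "?g (Suc i) (d i) - ?g i (d i) + third k x i = sh k x i - of_bool (onseg (d i) k (l i) (x - P i)) + third k x i"
        by (simp add: sh_def)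
    qed
    finally show ?thesis .
  qed
  have shift: "\<exists>L\<ge>0. P' (Suc i) = P' i + L *\<^sub>R dir (d i)" if i: "i < n" for i
  proof -
    define L1 where "L1 = (if d (Suc i) = d i + 1 then - \<eta> else 0)"
    define L2 where "L2 = (if V i = dir (d i + 2) then \<eta> else 0)"
    have "l i + L1 + L2 \<ge> 0" using turn[OF i] eta(2)[OF i] eta(1) l[OF i] by (auto simp: L1_def L2_def)
    moreover have "\<eta> *\<^sub>R v i = \<eta> *\<^sub>R dir (d i + 1) + L1 *\<^sub>R dir (d i)"
      by (simp add: v_def L1_def scaleR_diff_right)
    moreover have "\<eta> *\<^sub>R V i = \<eta> *\<^sub>R dir (d i + 1) - L2 *\<^sub>R dir (d i)"
      using V_dir[of i] i by (auto simp: L2_def scaleR_diff_right)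
    ultimately show ?thesis using step[OF i]
      by (intro exI[of _ "l i + L1 + L2"]) (simp add: P'_def V_Suc scaleR_left_distrib)
  qed
  have sh: "\<exists>L\<ge>0. \<forall>k x. sh k x i = of_bool (onseg (d i) k L (x - P' i))" if i: "i < n" for i
  proof -
    obtain L where "L \<ge> 0" "P' (Suc i) = P' i + L *\<^sub>R dir (d i)" using shift[OF i] by blast
    then show ?thesis using gam_seg[of L "d i" _ "_ - P' i"]
      by (intro exI[of _ L]) (auto simp: sh_def diff_diff_eq)
  qed
  have low: "D \<Delta> x k \<ge> - real (2 * n)" "D s x k < c \<Longrightarrow> D \<Delta> x k \<ge> 0" for x k
  proof -
    have 1: "sh k x i \<ge> 0" if "i < n" for i using sh[OF that] by auto
    have t1: "third k x i \<ge> -1" for i by (auto simp: third_def)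
    have "- 2 \<le> sh k x i - of_bool (onseg (d i) k (l i) (x - P i)) + third k x i" if "i < n" for i
      using 1[OF that] t1[of i] by (cases "onseg (d i) k (l i) (x - P i)") auto
    then have "D \<Delta> x k \<ge> (\<Sum>i<n. - 2)" unfolding DD by (intro sum_mono) auto
    then show "D \<Delta> x k \<ge> - real (2 * n)" by simp
    assume less: "D s x k < c"
    have 2: "\<not> onseg (d i) k (l i) (x - P i)" if i: "i < n" for i
    proof
      assume "onseg (d i) k (l i) (x - P i)"
      then obtain \<tau> where t: "x - P i = \<tau> *\<^sub>R dir (d i)"
        "k = d i \<and> 0 \<le> \<tau> \<and> \<tau> < l i \<or> k = d i + 3 \<and> 0 < \<tau> \<and> \<tau> \<le> l i" by (rule onsegD)
      have x: "x = P i + \<tau> *\<^sub>R dir (d i)" using t(1) by (simp add: algebra_simps)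
      show False using t(2) fwd[OF i, of \<tau>] bwd[OF i, of \<tau>] less unfolding x[symmetric] by auto
    qed
    have 3: "third k x i \<ge> 0" if i: "i < n" for i
    proof (rule ccontr)
      assume "\<not> third k x i \<ge> 0"
      then have r: "d (Suc i) = d i + 5" "onseg (d i + 1) k \<eta> (x - P (Suc i))"
        by (auto simp: third_def of_bool_def split: if_splits)
      have c: "D s (P (Suc i)) (d i + 1) \<ge> c" using turn[OF i] r by auto
      from r(2) obtain \<tau> where t: "x - P (Suc i) = \<tau> *\<^sub>R dir (d i + 1)"
        "k = d i + 1 \<and> 0 \<le> \<tau> \<and> \<tau> < \<eta> \<or> k = d i + 1 + 3 \<and> 0 < \<tau> \<and> \<tau> \<le> \<eta>" by (rule onsegD)
      have x: "x = P (Suc i) + \<tau> *\<^sub>R dir (d i + 1)" using t(1) by (simp add: algebra_simps)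
      have P: "P (Suc i) \<in> Pts" using i by (auto simp: Pts_def)
      have "D s x k = D s (P (Suc i)) (d i + 1)"
      proof (cases "k = d i + 1")
        case True
        then show ?thesis unfolding x using t(2) eta(1) eta(4)[OF P]
          by (simp add: D_const'[OF fss])
      next
        case False
        then have "k = d i + 1 + 3" "0 < \<tau>" "\<tau> \<le> \<eta>" using t(2) by auto
        then show ?thesis unfolding x using D_const[of \<tau> s "P (Suc i)" "d i + 1"] eta(1) eta(4)[OF P] by simp
      qed
      then show False using less c by simp
    qed
    show "D \<Delta> x k \<ge> 0" unfolding DD
      by (rule sum_nonneg) (use 1 2 3 in \<open>auto intro!: add_nonneg_nonneg\<close>)
  qed
  \<comment> \<open>Each of the \<open>n\<close> summands of the change is at least -2, and the
    change is negative only where the density is at least \<open>c\<close>.\<close>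
  define \<epsilon> where "\<epsilon> = c / real (2 * n)"
  have eps: "\<epsilon> > 0" using c n0 by (simp add: \<epsilon>_def)
  define s' where "s' A = s A + \<epsilon> * \<Delta> A" for A
  have fs': "fs s'" unfolding s'_def using fss fsD by (auto intro!: fs_add fs_scale)
  have Ds': "D s' x k = D s x k + \<epsilon> * D \<Delta> x k" for x k
    unfolding s'_def using D_add[OF fss fs_scale[OF fsD, of \<epsilon>], of x k] D_scale[OF fsD, of \<epsilon>] by simp
  have "pos s'" unfolding pos_def
  proof (intro allI)
    fix x k
    show "D s' x k \<ge> 0"
    proof (cases "D s x k < c")
      case True
      then show ?thesis using low(2)[OF True] poss eps by (simp add: Ds' pos_def)
    next
      case False
      have "\<epsilon> * D \<Delta> x k \<ge> \<epsilon> * (- real (2 * n))" using low(1) eps by (intro mult_left_mono) auto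
      also have "\<epsilon> * (- real (2 * n)) = - c" using n0 by (simp add: \<epsilon>_def)
      finally show ?thesis using False by (simp add: Ds')
    qed
  qed
  moreover have "\<forall>\<^sub>F t in at_top. D s' (x + t *\<^sub>R dir k) k = D s (x + t *\<^sub>R dir k) k" if "ev k" for x k
  proof -
    have far: "\<forall>\<^sub>F t in at_top. \<not> onseg e k L (x + t *\<^sub>R dir k - z)" for e L z
    proof -
      have "\<forall>\<^sub>F t in at_top. (t::real) > \<bar>off (k + 1) (x - z)\<bar> + \<bar>L\<bar>" by (rule eventually_gt_at_top)
      then show ?thesis
        by eventually_elim (auto simp: onseg_def)
    qed
    have "\<forall>\<^sub>F t in at_top. \<forall>i\<in>{..<n}. sh k (x + t *\<^sub>R dir k) i - of_bool (onseg (d i) k (l i) (x + t *\<^sub>R dir k - P i)) + third k (x + t *\<^sub>R dir k) i = 0"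
    proof (rule eventually_ball_finite, simp, safe)
      fix i assume i: "i < n"
      obtain L where sh': "\<And>k y. sh k y i = of_bool (onseg (d i) k L (y - P' i))" using sh[OF i] by blast
      show "\<forall>\<^sub>F t in at_top. sh k (x + t *\<^sub>R dir k) i - of_bool (onseg (d i) k (l i) (x + t *\<^sub>R dir k - P i)) + third k (x + t *\<^sub>R dir k) i = 0"
        using far[of "d i" L "P' i"] far[of "d i" "l i" "P i"] far[of "d i + 2" \<eta> "P (Suc i)"] far[of "d i + 1" \<eta> "P (Suc i)"]
        by eventually_elim (simp add: sh' third_def)
    qed
    then show ?thesis by eventually_elim (simp add: Ds' DD)
  qed
  ultimately have "s' = s" using rig fs' unfolding rig_def by blast
  then have "s A + \<epsilon> * \<Delta> A = s A" for A unfolding s'_def by metis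
  then have zero: "\<Delta> A = 0" for A using eps by simp
  have inj: "P i = P j \<and> V i = dir e" if "i \<le> n" "j \<le> n" "P' i = P j + \<eta> *\<^sub>R dir e" for i j e
  proof -
    have "P i = P j"
    proof (rule ccontr)
      assume "P i \<noteq> P j"
      then have "2 * \<eta> < dist (P i) (P j)" using that by (intro eta(3)) (auto simp: Pts_def)
      also have "dist (P i) (P j) = norm (\<eta> *\<^sub>R dir e - \<eta> *\<^sub>R V i)"
      proof -
        have "P i - P j = \<eta> *\<^sub>R dir e - \<eta> *\<^sub>R V i" using that(3) by (simp add: P'_def algebra_simps)
        then show ?thesis by (simp add: dist_norm)
      qed
      also have "\<dots> \<le> norm (\<eta> *\<^sub>R dir e) + norm (\<eta> *\<^sub>R V i)" by (rule norm_triangle_ineq4)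
      also have "\<dots> = 2 * \<eta>" using V_dir[OF that(1)] eta(1) by (auto simp del: dir_add)
      finally show False by simp
    qed
    then show ?thesis using that(3) eta(1) by (auto simp: P'_def)
  qed
  have ndiff: "P i \<noteq> P j + \<eta> *\<^sub>R dir e" if "i \<le> n" "j \<le> n" for i j e
  proof
    assume h: "P i = P j + \<eta> *\<^sub>R dir e"
    then have "P i \<noteq> P j" using eta(1) by auto
    then have "2 * \<eta> < dist (P i) (P j)" using that by (intro eta(3)) (auto simp: Pts_def)
    then show False unfolding h using eta(1) by (simp add: dist_norm)
  qed
  \<comment> \<open>Left and right turns out of direction \<open>e\<close>, weighted by a test
    function of the corner. A left turn from \<open>e\<close> and a right turn from
    \<open>e + 1\<close> are shifted along the same \<open>dir (e + 2)\<close> with opposite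
    weights; as the total change is zero, they balance at every corner.\<close>
  define AA where "AA \<psi> e = (\<Sum>i<n. of_bool (d i = e \<and> d (Suc i) = e + 1) * \<psi> (P (Suc i)))" for \<psi> :: "real^2 \<Rightarrow> real" and e
  define BB where "BB \<psi> e = (\<Sum>i<n. of_bool (d i = e \<and> d (Suc i) = e + 5) * \<psi> (P (Suc i)))" for \<psi> :: "real^2 \<Rightarrow> real" and e
  have match: "AA \<psi> e = BB \<psi> (e + 1)" for \<psi> e
  proof -
    define S where "S = (\<lambda>i. P i + \<eta> *\<^sub>R dir (e + 2)) ` {..n}"
    have fS: "finite S" by (simp add: S_def)
    define g where "g A = \<psi> (A - \<eta> *\<^sub>R dir (e + 2))" for A
    have "0 = (\<Sum>A\<in>S. g A * \<Delta> A)" by (simp add: zero)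
    also have "\<dots> = (\<Sum>i\<in>T. \<Sum>A\<in>S. g A * (- sg (d i) * (of_bool (A = P' (Suc i)) - of_bool (A = P (Suc i)))))"
      unfolding \<Delta>_def sum_distrib_left by (rule sum.swap)
    also have "\<dots> = (\<Sum>i\<in>T. - sg (d i) * (of_bool (V (Suc i) = dir (e + 2)) * \<psi> (P (Suc i))))"
    proof (rule sum.cong, simp)
      fix i assume "i \<in> T"
      then have i: "i < n" by (simp add: T_def)
      have a: "P (Suc i) \<notin> S" using ndiff[of "Suc i"] i by (auto simp: S_def simp del: dir_add)
      have "(\<Sum>A\<in>S. g A * (- sg (d i) * (of_bool (A = P' (Suc i)) - of_bool (A = P (Suc i)))))
        = (\<Sum>A\<in>S. if A = P' (Suc i) then g A * - sg (d i) else 0)"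
        by (rule sum.cong) (use a in auto)
      also have "\<dots> = (if P' (Suc i) \<in> S then g (P' (Suc i)) * - sg (d i) else 0)" using fS by simp
      also have "P' (Suc i) \<in> S \<longleftrightarrow> V (Suc i) = dir (e + 2)"
        using inj[of "Suc i" _ "e + 2"] i by (force simp: S_def P'_def simp del: dir_add)
      finally show "(\<Sum>A\<in>S. g A * (- sg (d i) * (of_bool (A = P' (Suc i)) - of_bool (A = P (Suc i)))))
          = - sg (d i) * (of_bool (V (Suc i) = dir (e + 2)) * \<psi> (P (Suc i)))"
        by (auto simp: g_def P'_def)
    qed
    also have "\<dots> = (\<Sum>i<n. if d (Suc i) = d i then 0 else - sg (d i) * (of_bool (V (Suc i) = dir (e + 2)) * \<psi> (P (Suc i))))"
      by (rule sum.mono_neutral_cong_left) (auto simp: T_def)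
    also have "\<dots> = (\<Sum>i<n. - sg e * (of_bool (d i = e \<and> d (Suc i) = e + 1) * \<psi> (P (Suc i)) -
          of_bool (d i = e + 1 \<and> d (Suc i) = e + 1 + 5) * \<psi> (P (Suc i))))"
    proof (rule sum.cong, simp)
      fix i assume "i \<in> {..<n}"
      then have i: "i < n" by simp
      have inj_dir: "dir a = dir b \<Longrightarrow> a = b" for a b
      proof -
        assume h: "dir a = dir b"
        have "off a (dir b) = 0" "off (a + 1) (dir b) = -1" unfolding h[symmetric] by simp_all
        then show ?thesis using six_rel[of b a] by auto
      qed
      have dd: "d i + 2 = e + 2 \<longleftrightarrow> d i = e" "d i + 1 = e + 2 \<longleftrightarrow> d i = e + 1"
        using add_right_cancel[of "d i" 1 "e + 1"] by simp_all
      from turn[OF i] consider "d (Suc i) = d i" | "d (Suc i) = d i + 1" | "d (Suc i) = d i + 5" by blast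
      then show "(if d (Suc i) = d i then 0 else - sg (d i) * (of_bool (V (Suc i) = dir (e + 2)) * \<psi> (P (Suc i)))) =
          - sg e * (of_bool (d i = e \<and> d (Suc i) = e + 1) * \<psi> (P (Suc i)) -
          of_bool (d i = e + 1 \<and> d (Suc i) = e + 1 + 5) * \<psi> (P (Suc i)))"
      proof cases
        case 1 then show ?thesis by auto
      next
        case 2
        then have "V (Suc i) = dir (e + 2) \<longleftrightarrow> d i = e"
          using inj_dir[of "d i + 2" "e + 2"] dd by (auto simp: V_Suc v_def simp del: dir_add)
        then show ?thesis using 2 by auto
      next
        case 3
        then have "V (Suc i) = dir (e + 2) \<longleftrightarrow> d i = e + 1"
          using inj_dir[of "d i + 1" "e + 2"] dd by (auto simp: V_Suc v_def simp del: dir_add)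
        then show ?thesis using 3 by auto
      qed
    qed
    also have "\<dots> = - sg e * (AA \<psi> e - BB \<psi> (e + 1))"
      unfolding AA_def BB_def sum_subtractf[symmetric] sum_distrib_left ..
    finally show ?thesis by simp
  qed
  \<comment> \<open>Summation by parts turns the increments over the steps of direction
    \<open>e\<close> into turns out of \<open>e\<close> minus turns into \<open>e\<close>, and
    \<open>match\<close> cancels these. For \<open>\<psi>\<close> the coordinate along
    \<open>dir e\<close> the increments are the lengths, which therefore vanish.\<close>
  have disp: "(\<Sum>i<n. of_bool (d i = e) * (\<psi> (P (Suc i)) - \<psi> (P i))) = 0" for \<psi> :: "real^2 \<Rightarrow> real" and e
  proof -
    have "(\<Sum>i<n. of_bool (d i = e) * \<psi> (P i)) = (\<Sum>i<n. of_bool (d (Suc i) = e) * \<psi> (P (Suc i)))"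
      using sum_cyclic_shift[of "\<lambda>i. of_bool (d i = e) * \<psi> (P i)" n] n by simp
    then have "(\<Sum>i<n. of_bool (d i = e) * (\<psi> (P (Suc i)) - \<psi> (P i))) =
      (\<Sum>i<n. (of_bool (d i = e) - of_bool (d (Suc i) = e)) * \<psi> (P (Suc i)))"
      by (simp add: right_diff_distrib left_diff_distrib sum_subtractf)
    also have "\<dots> = (\<Sum>i<n. of_bool (d i = e \<and> d (Suc i) = e + 1) * \<psi> (P (Suc i)) + of_bool (d i = e \<and> d (Suc i) = e + 5) * \<psi> (P (Suc i))
      - of_bool (d i = e + 5 \<and> d (Suc i) = e + 5 + 1) * \<psi> (P (Suc i)) - of_bool (d i = e + 1 \<and> d (Suc i) = e + 1 + 5) * \<psi> (P (Suc i)))"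
    proof (rule sum.cong, simp)
      fix i assume "i \<in> {..<n}"
      then have "d (Suc i) = d i \<or> d (Suc i) = d i + 1 \<or> d (Suc i) = d i + 5" using turn by auto
      then show "(of_bool (d i = e) - of_bool (d (Suc i) = e)) * \<psi> (P (Suc i)) =
         of_bool (d i = e \<and> d (Suc i) = e + 1) * \<psi> (P (Suc i)) + of_bool (d i = e \<and> d (Suc i) = e + 5) * \<psi> (P (Suc i))
      - of_bool (d i = e + 5 \<and> d (Suc i) = e + 5 + 1) * \<psi> (P (Suc i)) - of_bool (d i = e + 1 \<and> d (Suc i) = e + 1 + 5) * \<psi> (P (Suc i))"
        using six_rel[of "d i" e] by auto
    qed
    also have "\<dots> = AA \<psi> e + BB \<psi> e - AA \<psi> (e + 5) - BB \<psi> (e + 1)"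
      unfolding AA_def BB_def by (simp only: sum.distrib sum_subtractf)
    also have "\<dots> = 0" using match[of \<psi> e] match[of \<psi> "e + 5"] by simp
    finally show ?thesis .
  qed
  have l0: "l i = 0" if "i < n" for i
  proof -
    let ?e = "d i"
    have "(\<Sum>j<n. of_bool (d j = ?e) * (- off (?e + 1) (P (Suc j)) - - off (?e + 1) (P j))) = 0" by (rule disp)
    moreover have "(\<Sum>j<n. of_bool (d j = ?e) * (- off (?e + 1) (P (Suc j)) - - off (?e + 1) (P j))) = (\<Sum>j<n. of_bool (d j = ?e) * l j)"
      by (rule sum.cong) (use step in auto)
    ultimately have "(\<Sum>j<n. of_bool (d j = ?e) * l j) = 0" by simp
    then have "\<forall>j\<in>{..<n}. of_bool (d j = ?e) * l j = 0"
      using l by (subst sum_nonneg_eq_0_iff[symmetric]) auto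
    then show ?thesis using that by force
  qed
  \<comment> \<open>A left turn is allowed only after a step of positive length.\<close>
  have "AA (\<lambda>_. 1) e = 0" for e unfolding AA_def
    by (rule sum.neutral) (use turn l0 in force)
  then have BB0: "BB (\<lambda>_. 1) e = 0" for e using match[of "\<lambda>_. 1" "e + 5"] by simp
  obtain i where i: "i < n" "d (Suc i) = d i + 5" using nontriv l0 by auto
  have "BB (\<lambda>_. 1) (d i) = 0" by (rule BB0)
  then have "\<forall>j\<in>{..<n}. of_bool (d j = d i \<and> d (Suc j) = d i + 5) * (1::real) = 0"
    unfolding BB_def by (subst sum_nonneg_eq_0_iff[symmetric]) auto
  then show False using i by force
qed

end

section \<open>Branch points, edges and the walk graph\<close>

datatype 'a walker = W 'a 6 | K 'a 6

context hex
begin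

lemma off_eqI2:
  assumes "l \<noteq> k" "l \<noteq> k + 3" "off k x = off k y" "off l x = off l y" shows "x = y"
  using six_rel[of l k] assms off_eqI[of k x y] by auto

definition pr :: "(real^2 \<Rightarrow> real) \<Rightarrow> real^2 \<Rightarrow> 6 \<Rightarrow> bool" where
  "pr s x k \<longleftrightarrow> D s x k > 0"

definition branch :: "(real^2 \<Rightarrow> real) \<Rightarrow> real^2 \<Rightarrow> bool" where
  "branch s x \<longleftrightarrow> (\<exists>k l. pr s x k \<and> pr s x l \<and> l \<noteq> k \<and> l \<noteq> k + 3)"

definition ahead :: "(real^2 \<Rightarrow> real) \<Rightarrow> real^2 \<Rightarrow> 6 \<Rightarrow> real set" where
  "ahead s x k = {t. t > 0 \<and> branch s (x + t *\<^sub>R dir k)}"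

definition fin :: "(real^2 \<Rightarrow> real) \<Rightarrow> real^2 \<Rightarrow> 6 \<Rightarrow> bool" where
  "fin s x k \<longleftrightarrow> ahead s x k \<noteq> {}"

definition len :: "(real^2 \<Rightarrow> real) \<Rightarrow> real^2 \<Rightarrow> 6 \<Rightarrow> real" where
  "len s x k = Min (ahead s x k)"

definition nb :: "(real^2 \<Rightarrow> real) \<Rightarrow> real^2 \<Rightarrow> 6 \<Rightarrow> real^2" where
  "nb s x k = x + len s x k *\<^sub>R dir k"

text \<open>The next ray present at \<open>x\<close>, clockwise from \<open>k\<close>; at branch points it is one or two steps away.\<close>

definition pv :: "(real^2 \<Rightarrow> real) \<Rightarrow> real^2 \<Rightarrow> 6 \<Rightarrow> 6" where
  "pv s x k = (if pr s x (k + 5) then k + 5 else k + 4)"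

text \<open>
  Walkers keep a white piece on their left: \<open>W B k\<close> traverses the edge leaving \<open>B\<close> in direction
  \<open>dir k\<close>, while \<open>K B k\<close> rests at \<open>B\<close> facing \<open>dir (k - 1)\<close>. Shifting the closed polygon traced by a
  cycle to its left produces another measure with the same exits. Exchanging the two kinds of
  walkers and the angles 60 and 120 degrees leaves the rules invariant, so they are self-dual.
\<close>

inductive_set GG :: "(real^2 \<Rightarrow> real) \<Rightarrow> ((real^2) walker \<times> (real^2) walker) set" for s where
  WK: "branch s B \<Longrightarrow> pr s B k \<Longrightarrow> fin s B k \<Longrightarrow> (W B k, K (nb s B k) (pv s (nb s B k) (k + 3))) \<in> GG s"
| WW: "branch s B \<Longrightarrow> pr s B k \<Longrightarrow> fin s B k \<Longrightarrow> \<not> pr s (nb s B k) (k + 2) \<Longrightarrow>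
    (W B k, W (nb s B k) (k + 1)) \<in> GG s"
| KW: "branch s B \<Longrightarrow> pr s B k \<Longrightarrow> (K B k, W B (pv s B k)) \<in> GG s"
| KK: "branch s B \<Longrightarrow> pr s B k \<Longrightarrow> pr s B (k + 5) \<Longrightarrow> (K B k, K B (k + 5)) \<in> GG s"

end

section \<open>Local geometry of a nonnegative balanced density\<close>

locale hexs = hex +
  fixes s assumes fss: "fs s" and poss: "pos s"
begin

lemma D_nonneg [simp]: "D s x k \<ge> 0"
  using poss by (simp add: pos_def)

lemma not_pr: "\<not> pr s x k \<longleftrightarrow> D s x k = 0"
  unfolding pr_def using D_nonneg[of x k] by linarith

lemma jump: "D s x k - D s x (k + 3) = sg k * s x"
  by (rule D_jump[OF fss])

lemma balance: "D s x (k + 2) - D s x (k + 5) = D s x k - D s x (k + 3)"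
  "D s x (k + 1) - D s x (k + 4) = D s x (k + 3) - D s x k"
  using jump[of x k] jump[of x "k + 2"] jump[of x "k + 1"] by simp_all

text \<open>If two adjacent rays are absent, balance also removes the rays opposite to them, and
  only one line is left. Hence adjacent rays at a branch point enclose 60 or 120 degrees.\<close>

lemma branch_gap: assumes "branch s x" shows "pr s x k \<or> pr s x (k + 1)"
proof (rule ccontr)
  assume "\<not> (pr s x k \<or> pr s x (k + 1))"
  then have z: "D s x k = 0" "D s x (k + 1) = 0" by (auto simp: not_pr)
  then have "D s x (k + 3) = 0" "D s x (k + 4) = 0"
    using balance[of x k] D_nonneg[of x "k + 3"] D_nonneg[of x "k + 4"] by linarith+
  then have p: "pr s x l \<Longrightarrow> l = k + 2 \<or> l = k + 5" for l
    using z six_rel[of l k] by (auto simp: pr_def)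
  from assms obtain a b where "pr s x a" "pr s x b" "b \<noteq> a" "b \<noteq> a + 3" by (auto simp: branch_def)
  with p[of a] p[of b] show False by auto
qed

lemma nz_branch: assumes "s x \<noteq> 0" shows "branch s x"
proof -
  obtain k where k: "sg k * s x > 0" using assms that[of 0] that[of 1] by (cases "s x > 0") (auto simp: sg_def)
  have "pr s x k" using jump[of x k] k D_nonneg[of x "k + 3"] unfolding pr_def by linarith
  moreover have "D s x (k + 2) - D s x (k + 5) = sg k * s x" using jump[of x "k + 2"] by simp
  then have "pr s x (k + 2)" using k D_nonneg[of x "k + 5"] unfolding pr_def by linarith
  ultimately show ?thesis unfolding branch_def by (intro exI[of _ k] exI[of _ "k + 2"]) auto
qed

lemma nonbranch: assumes "\<not> branch s x" shows "s x = 0" "D s x (k + 3) = D s x k" "pr s x k \<Longrightarrow> pr s x l \<longleftrightarrow> l = k \<or> l = k + 3"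
proof -
  show "s x = 0" using assms nz_branch by blast
  then show e: "D s x (k + 3) = D s x k" using jump[of x k] by simp
  assume "pr s x k"
  then show "pr s x l \<longleftrightarrow> l = k \<or> l = k + 3" using assms e unfolding branch_def by (auto simp: pr_def)
qed

lemma finite_branch: "finite {x. branch s x}"
proof -
  let ?S = "{A. s A \<noteq> 0}"
  let ?X = "\<lambda>k l A B. {x. l \<noteq> k \<and> l \<noteq> k + 3 \<and> off k x = off k A \<and> off l x = off l B}"
  have fin1: "finite (?X k l A B)" for k l A B
  proof (cases "\<exists>z. z \<in> ?X k l A B")
    case True
    then obtain z where "z \<in> ?X k l A B" by blast
    then have "?X k l A B \<subseteq> {z}" using off_eqI2[of l k] by auto
    then show ?thesis by (rule finite_subset) simp
  next
    case False
    then have "?X k l A B = {}" by blast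
    then show ?thesis by (metis finite.emptyI)
  qed
  have "{x. branch s x} \<subseteq> (\<Union>k. \<Union>l. \<Union>A\<in>?S. \<Union>B\<in>?S. ?X k l A B)"
  proof
    fix x assume "x \<in> {x. branch s x}"
    then obtain k l where "pr s x k" "pr s x l" "l \<noteq> k" "l \<noteq> k + 3"
      by (auto simp: branch_def)
    then have kl: "D s x k \<noteq> 0" "D s x l \<noteq> 0" "l \<noteq> k" "l \<noteq> k + 3" by (auto simp: pr_def)
    obtain A B where "s A \<noteq> 0" "off k A = off k x" "s B \<noteq> 0" "off l B = off l x"
      using D_nz_line[OF kl(1)] D_nz_line[OF kl(2)] by blast
    then show "x \<in> (\<Union>k. \<Union>l. \<Union>A\<in>?S. \<Union>B\<in>?S. ?X k l A B)" using kl by force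
  qed
  moreover have "finite ?S" using fss by (simp add: fs_def)
  ultimately show ?thesis using fin1 by (auto intro!: finite_UN_I intro: finite_subset)
qed

lemma finite_ahead: "finite (ahead s x k)"
proof (rule finite_imageD)
  show "finite ((\<lambda>t. x + t *\<^sub>R dir k) ` ahead s x k)"
    by (rule finite_subset[OF _ finite_branch]) (auto simp: ahead_def)
  show "inj_on (\<lambda>t. x + t *\<^sub>R dir k) (ahead s x k)" by (auto intro!: inj_onI)
qed

lemma len_props:
  assumes "fin s x k"
  shows "len s x k > 0" "branch s (nb s x k)" "\<And>t. 0 < t \<Longrightarrow> t < len s x k \<Longrightarrow> \<not> branch s (x + t *\<^sub>R dir k)"
proof -
  have m: "len s x k \<in> ahead s x k" unfolding len_def using assms finite_ahead by (intro Min_in) (auto simp: fin_def)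
  then show "len s x k > 0" "branch s (nb s x k)" by (auto simp: ahead_def nb_def)
  fix t assume "0 < t" "t < len s x k"
  then show "\<not> branch s (x + t *\<^sub>R dir k)"
    using Min_le[OF finite_ahead, of t x k] unfolding len_def[symmetric] by (auto simp: ahead_def)
qed

lemma len_eqI:
  assumes "t > 0" "branch s (x + t *\<^sub>R dir k)" "\<And>\<tau>. 0 < \<tau> \<Longrightarrow> \<tau> < t \<Longrightarrow> \<not> branch s (x + \<tau> *\<^sub>R dir k)"
  shows "fin s x k" "len s x k = t"
proof -
  have "t \<in> ahead s x k" using assms by (auto simp: ahead_def)
  then show f: "fin s x k" by (auto simp: fin_def)
  show "len s x k = t" unfolding len_def
    by (rule Min_eqI[OF finite_ahead]) (use assms in \<open>auto simp: ahead_def not_less[symmetric]\<close>)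
qed

lemma D_edge_fwd:
  assumes "fin s x k" "0 \<le> t" "t < len s x k" shows "D s (x + t *\<^sub>R dir k) k = D s x k"
  by (rule D_const'[OF fss assms(2)]) (use len_props(3)[OF assms(1)] assms(3) nz_branch in force)

lemma D_edge_bwd:
  assumes "fin s x k" "0 < t" "t \<le> len s x k" shows "D s (x + t *\<^sub>R dir k) (k + 3) = D s x k"
  by (rule D_const[OF assms(2)]) (use len_props(3)[OF assms(1)] assms(3) nz_branch in force)

lemma D_nb: "fin s x k \<Longrightarrow> D s (nb s x k) (k + 3) = D s x k"
  unfolding nb_def using len_props(1)[of x k] by (intro D_edge_bwd) auto

lemma pr_nb: "fin s x k \<Longrightarrow> pr s (nb s x k) (k + 3) \<longleftrightarrow> pr s x k"
  by (simp add: pr_def D_nb)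

lemma odd_fin: assumes "\<not> ev k" "pr s x k" shows "fin s x k"
proof (rule ccontr)
  assume "\<not> fin s x k"
  then have "s (x + t *\<^sub>R dir k) = 0" if "t > 0" for t using nz_branch that by (force simp: fin_def ahead_def)
  then have "D s x k = 0" using D_odd_ahead[OF assms(1), of s x] by blast
  then show False using assms(2) by (simp add: pr_def)
qed

lemma nb_back:
  assumes "branch s x" "fin s x k"
  shows "fin s (nb s x k) (k + 3)" "len s (nb s x k) (k + 3) = len s x k" "nb s (nb s x k) (k + 3) = x"
proof -
  let ?t = "len s x k"
  have *: "nb s x k + \<tau> *\<^sub>R dir (k + 3) = x + (?t - \<tau>) *\<^sub>R dir k" for \<tau>
    by (simp add: nb_def algebra_simps)
  have 1: "?t > 0" using len_props(1)[OF assms(2)] .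
  have 2: "branch s (nb s x k + ?t *\<^sub>R dir (k + 3))" unfolding * using assms(1) by simp
  have 3: "\<not> branch s (nb s x k + \<tau> *\<^sub>R dir (k + 3))" if "0 < \<tau>" "\<tau> < ?t" for \<tau>
    unfolding * using len_props(3)[OF assms(2), of "?t - \<tau>"] that by simp
  show "fin s (nb s x k) (k + 3)" by (rule len_eqI(1)[OF 1 2 3])
  show l: "len s (nb s x k) (k + 3) = ?t" by (rule len_eqI(2)[OF 1 2 3])
  show "nb s (nb s x k) (k + 3) = x" unfolding nb_def[of s "nb s x k"] l * by simp
qed

lemma pv_pr: assumes "branch s x" shows "pr s x (pv s x k)"
  using branch_gap[OF assms, of "k + 4"] by (auto simp: pv_def)

definition ST where "ST = (\<lambda>(B, k). W B k) ` ({B. branch s B} \<times> UNIV) \<union> (\<lambda>(B, k). K B k) ` ({B. branch s B} \<times> UNIV)"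

lemma finite_ST: "finite ST"
  unfolding ST_def using finite_branch by auto

lemma ST_iff: "W B k \<in> ST \<longleftrightarrow> branch s B" "K B k \<in> ST \<longleftrightarrow> branch s B"
  by (auto simp: ST_def)

lemma GG_ST: "GG s \<subseteq> ST \<times> ST"
proof
  fix z assume z: "z \<in> GG s"
  obtain a b where "z = (a, b)" by force
  with z show "z \<in> ST \<times> ST" by (auto elim!: GG.cases simp: ST_iff len_props(2))
qed

text \<open>A cycle is a walk as in \<open>no_closed_walk\<close>: \<open>W\<close> steps traverse
  edges, \<open>K\<close> steps have length 0 and go straight or turn right. The direction of
  \<open>K B k\<close> is \<open>k + 5\<close>, and the ray \<open>k\<close> on its left supplies
  the density that a right turn must have.\<close>

lemma acyclic_GG: assumes rig: "rig s" shows "acyclic (GG s)"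
proof (rule acyclicI, safe)
  fix x assume "(x, x) \<in> (GG s)\<^sup>+"
  then obtain n where n: "n > 0" "(x, x) \<in> GG s ^^ n" by (auto simp: trancl_power)
  then obtain f where f: "f 0 = x" "f n = x" "\<And>i. i < n \<Longrightarrow> (f i, f (Suc i)) \<in> GG s"
    unfolding relpow_fun_conv by blast
  define P where "P i = (case f i of W B k \<Rightarrow> B | K B k \<Rightarrow> B)" for i
  define d where "d i = (case f i of W B k \<Rightarrow> k | K B k \<Rightarrow> k + 5)" for i
  define l where "l i = (case f i of W B k \<Rightarrow> len s B k | K B k \<Rightarrow> 0)" for i
  define vals where "vals = {D s B k | B k. branch s B \<and> pr s B k}"
  have "finite vals"
    by (rule finite_subset[of _ "(\<lambda>(B, k). D s B k) ` ({B. branch s B} \<times> UNIV)"]) (use finite_branch in \<open>auto simp: vals_def\<close>)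
  then obtain c where c: "c > 0" "\<And>v. v \<in> vals \<Longrightarrow> v \<ge> c"
  proof -
    assume a: "\<And>c. c > 0 \<Longrightarrow> (\<And>v. v \<in> vals \<Longrightarrow> v \<ge> c) \<Longrightarrow> thesis" and fv: "finite vals"
    have "Min (insert 1 vals) > 0" using fv by (auto simp: vals_def pr_def)
    then show thesis using a[of "Min (insert 1 vals)"] fv by auto
  qed
  have cD: "branch s B \<Longrightarrow> pr s B k \<Longrightarrow> D s B k \<ge> c" for B k by (rule c(2)) (auto simp: vals_def)
  have step: "P (Suc i) = P i + l i *\<^sub>R dir (d i) \<and> l i \<ge> 0 \<and>
      (d (Suc i) = d i \<or> d (Suc i) = d i + 1 \<and> l i > 0 \<or> d (Suc i) = d i + 5 \<and> D s (P (Suc i)) (d i + 1) \<ge> c) \<and>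
      (l i > 0 \<longrightarrow> branch s (P i) \<and> pr s (P i) (d i) \<and> fin s (P i) (d i) \<and> l i = len s (P i) (d i)) \<and>
      (l i > 0 \<or> l (Suc i) > 0 \<or> d (Suc i) = d i + 5 \<or> i = n)" if "i < n" for i
    using f(3)[OF that]
  proof (cases rule: GG.cases)
    case (WK B k)
    then show ?thesis using len_props(1)[of B k] by (auto simp: P_def d_def l_def nb_def pv_def)
  next
    case (WW B k)
    then show ?thesis using len_props(1)[of B k] by (auto simp: P_def d_def l_def nb_def)
  next
    case (KW B k)
    \<comment> \<open>A resting walker that does not turn must traverse an edge next, also when the
      next step is the first one of the cycle again; this makes the closed walk nontrivial.\<close>
    have ow: "f (Suc i) = W B' k' \<Longrightarrow> i < n \<Longrightarrow> len s B' k' > 0" for B' k'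
    proof -
      assume h: "f (Suc i) = W B' k'" "i < n"
      have "(f (if Suc i < n then Suc i else 0), f (Suc (if Suc i < n then Suc i else 0))) \<in> GG s"
        using n(1) by (intro f(3)) auto
      moreover have "f (if Suc i < n then Suc i else 0) = W B' k'" using h f(1,2) by (auto simp: not_less le_Suc_eq)
      ultimately have "fin s B' k'" by (auto elim: GG.cases)
      then show "len s B' k' > 0" by (rule len_props(1))
    qed
    then show ?thesis using KW that cD[of B k] by (auto simp: P_def d_def l_def pv_def)
  next
    case (KK B k)
    then show ?thesis using cD[of B k] by (auto simp: P_def d_def l_def)
  qed
  show False
  proof (rule no_closed_walk[OF rig c(1), of P n d l])
    show "P n = P 0" "d n = d 0" using f(1,2) by (simp_all add: P_def d_def)
    show "\<exists>i<n. l i > 0 \<or> d (Suc i) = d i + 5"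
    proof -
      have l0: "l n = l 0" using f(1,2) by (simp add: l_def)
      have "l 0 > 0 \<or> l 1 > 0 \<or> d (Suc 0) = d 0 + 5" using step[of 0] n(1) by auto
      moreover have "n = 1 \<or> 1 < n" using n(1) by auto
      ultimately show ?thesis using n(1) l0 by auto
    qed
  next
    fix i \<tau> assume i: "i < n" "0 \<le> \<tau>" "\<tau> < l i"
    then show "c \<le> D s (P i + \<tau> *\<^sub>R dir (d i)) (d i)"
      using step[OF i(1)] D_edge_fwd[of "P i" "d i" \<tau>] cD[of "P i" "d i"] by auto
  next
    fix i \<tau> assume i: "i < n" "0 < \<tau>" "\<tau> \<le> l i"
    then show "c \<le> D s (P i + \<tau> *\<^sub>R dir (d i)) (d i + 3)"
      using step[OF i(1)] D_edge_bwd[of "P i" "d i" \<tau>] cD[of "P i" "d i"] by auto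
  qed (use step in blast)+
qed

end

section \<open>The cone of measures below an acyclic one is an orthant\<close>

text \<open>Recursion on the rank; the values outside \<open>T\<close> are the free
  parameters.\<close>

lemma triangular_exists:
  fixes a :: "'g \<Rightarrow> real" and r :: "'g \<Rightarrow> nat"
  assumes "finite T" and dep: "\<And>g h. g \<in> T \<Longrightarrow> h \<in> src g \<Longrightarrow> h \<in> T \<Longrightarrow> r h < r g"
  shows "\<exists>x. (\<forall>g. g \<notin> T \<longrightarrow> x g = a g) \<and> (\<forall>g\<in>T. x g = (\<Sum>h\<in>src g. x h))"
proof -
  have "\<exists>x. (\<forall>g. g \<notin> T \<longrightarrow> x g = a g) \<and> (\<forall>g\<in>T. r g < n \<longrightarrow> x g = (\<Sum>h\<in>src g. x h))" for n
  proof (induction n)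
    case 0 then show ?case by (intro exI[of _ a]) auto
  next
    case (Suc n)
    then obtain x where x: "\<And>g. g \<notin> T \<Longrightarrow> x g = a g" "\<And>g. g \<in> T \<Longrightarrow> r g < n \<Longrightarrow> x g = (\<Sum>h\<in>src g. x h)" by blast
    define y where "y g = (if g \<in> T \<and> r g = n then \<Sum>h\<in>src g. x h else x g)" for g
    have eq: "y h = x h" if "g \<in> T" "r g \<le> n" "h \<in> src g" for g h using dep[OF that(1,3)] that by (auto simp: y_def)
    have s: "(\<Sum>h\<in>src g. y h) = (\<Sum>h\<in>src g. x h)" if "g \<in> T" "r g \<le> n" for g
      by (rule sum.cong) (use eq that in auto)
    have "y g = (\<Sum>h\<in>src g. y h)" if "g \<in> T" "r g < Suc n" for g
      using that s[of g] x(2)[of g] by (cases "r g = n") (auto simp: y_def)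
    moreover have "y g = a g" if "g \<notin> T" for g using x(1) that by (simp add: y_def)
    ultimately show ?case by blast
  qed
  from this[of "Suc (Max (r ` T))"] obtain x where x: "\<forall>g. g \<notin> T \<longrightarrow> x g = a g"
    "\<forall>g\<in>T. r g < Suc (Max (r ` T)) \<longrightarrow> x g = (\<Sum>h\<in>src g. x h)" by blast
  have "r g < Suc (Max (r ` T))" if "g \<in> T" for g using that assms(1) by (simp add: less_Suc_eq_le)
  then show ?thesis using x by blast
qed

lemma triangular_nonneg:
  fixes x :: "'g \<Rightarrow> real" and r :: "'g \<Rightarrow> nat"
  assumes dep: "\<And>g h. g \<in> T \<Longrightarrow> h \<in> src g \<Longrightarrow> h \<in> T \<Longrightarrow> r h < r g"
    and "\<And>g. g \<in> T \<Longrightarrow> src g \<subseteq> G" "\<And>g. g \<in> G - T \<Longrightarrow> x g \<ge> 0" "\<And>g. g \<in> T \<Longrightarrow> x g = (\<Sum>h\<in>src g. x h)" "g \<in> G"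
  shows "x g \<ge> 0"
  using \<open>g \<in> G\<close>
proof (induction "r g" arbitrary: g rule: less_induct)
  case less
  show ?case
  proof (cases "g \<in> T")
    case True
    have "x h \<ge> 0" if "h \<in> src g" for h
      using less(1)[of h] dep[OF True that] assms(2)[OF True] assms(3)[of h] that by (cases "h \<in> T") auto
    then show ?thesis using assms(4)[OF True] by (simp add: sum_nonneg)
  next
    case False then show ?thesis using assms(3) less(2) by blast
  qed
qed

lemma triangular_unique:
  fixes x y :: "'g \<Rightarrow> real" and r :: "'g \<Rightarrow> nat"
  assumes dep: "\<And>g h. g \<in> T \<Longrightarrow> h \<in> src g \<Longrightarrow> h \<in> T \<Longrightarrow> r h < r g"
    and "\<And>g. g \<in> T \<Longrightarrow> src g \<subseteq> G" "\<And>g. g \<in> G - T \<Longrightarrow> x g = y g" "\<And>g. g \<in> T \<Longrightarrow> x g = (\<Sum>h\<in>src g. x h)"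
    "\<And>g. g \<in> T \<Longrightarrow> y g = (\<Sum>h\<in>src g. y h)" "g \<in> G"
  shows "x g = y g"
proof -
  have e: "(\<Sum>h\<in>src g. x h - y h) = x g - y g" if "g \<in> T" for g using assms(4,5)[OF that] by (simp add: sum_subtractf)
  have e': "(\<Sum>h\<in>src g. y h - x h) = y g - x g" if "g \<in> T" for g using assms(4,5)[OF that] by (simp add: sum_subtractf)
  have "x g - y g \<ge> 0"
    by (rule triangular_nonneg[where T = T and src = src and r = r and G = G and x = "\<lambda>g. x g - y g"]) (use assms e in auto)
  moreover have "y g - x g \<ge> 0"
    by (rule triangular_nonneg[where T = T and src = src and r = r and G = G and x = "\<lambda>g. y g - x g"]) (use assms e' in auto)
  ultimately show ?thesis by simp
qed

text \<open>The local constituents at a branch point: \<open>T B\<close> is the tripod at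
  \<open>B\<close>, reversed if the weight there is negative, and \<open>L B k\<close> is a full
  line through \<open>B\<close>.\<close>

datatype 'a gen = T 'a | L 'a 6

definition rep :: "6 \<Rightarrow> 6" where "rep k = (if ev k then k else k + 3)"

lemma rep_simps [simp]: "rep (k + 3) = rep k" "ev (rep k)"
  by (auto simp: rep_def)

lemma rep_eq: "rep k = rep l \<longleftrightarrow> l = k \<or> l = k + 3"
proof -
  have *: "k = l + 3 \<longleftrightarrow> l = k + 3" by auto
  have "k + 3 = l + 3 \<longleftrightarrow> l = k" by auto
  moreover have "ev k \<Longrightarrow> \<not> ev l \<Longrightarrow> l \<noteq> k" "\<not> ev k \<Longrightarrow> ev l \<Longrightarrow> l \<noteq> k" "ev k \<Longrightarrow> ev l \<Longrightarrow> l \<noteq> k + 3" "\<not> ev k \<Longrightarrow> \<not> ev l \<Longrightarrow> l \<noteq> k + 3"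
    by auto
  ultimately show ?thesis using * by (auto simp: rep_def)
qed

locale hexa = hexs +
  assumes acyc: "acyclic (GG s)"
begin

text \<open>A height on edge walkers which, by acyclicity, strictly increases along walks.\<close>

definition rk :: "real^2 \<Rightarrow> 6 \<Rightarrow> nat" where "rk B k = card {y. (y, W B k) \<in> (GG s)\<^sup>+}"

lemma rk_less: assumes "(W B k, W B' k') \<in> (GG s)\<^sup>+" shows "rk B k < rk B' k'"
  unfolding rk_def
proof (rule psubset_card_mono)
  have "(GG s)\<^sup>+ \<subseteq> ST \<times> ST" by (rule trancl_subset_Sigma) (rule GG_ST)
  then show "finite {y. (y, W B' k') \<in> (GG s)\<^sup>+}" by (intro finite_subset[OF _ finite_ST]) auto
  show "{y. (y, W B k) \<in> (GG s)\<^sup>+} \<subset> {y. (y, W B' k') \<in> (GG s)\<^sup>+}"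
    using assms acyc by (auto simp: acyclic_def dest: trancl_trans)
qed

section \<open>Turns available to a walker at the end of an edge\<close>

context
  fixes B B' k assumes b: "branch s B" "pr s B k" "fin s B k" and B': "B' = nb s B k"
begin

lemma brB': "branch s B'" unfolding B' by (rule len_props(2)[OF b(3)])

lemma prB': "pr s B' (k + 3)" unfolding B' using pr_nb[OF b(3)] b(2) by simp

lemma to_K: "pr s B' (k + 2) \<Longrightarrow> (W B k, K B' (k + 2)) \<in> GG s" "\<not> pr s B' (k + 2) \<Longrightarrow> (W B k, K B' (k + 1)) \<in> GG s"
  using GG.WK[OF b] by (simp_all add: B' pv_def)

lemma to_K1: assumes "pr s B' (k + 1)" shows "(W B k, K B' (k + 1)) \<in> (GG s)\<^sup>+"
proof (cases "pr s B' (k + 2)")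
  case True
  have "(K B' (k + 2), K B' (k + 1)) \<in> GG s" using GG.KK[OF brB' True] assms by simp
  then show ?thesis using to_K(1)[OF True] by (auto intro: trancl_trans)
qed (use to_K in auto)

lemma hop_left: assumes "pr s B' (k + 1)" shows "(W B k, W B' (k + 1)) \<in> (GG s)\<^sup>+"
proof (cases "pr s B' (k + 2)")
  case True
  have "(K B' (k + 2), W B' (k + 1)) \<in> GG s" using GG.KW[OF brB' True] assms by (simp add: pv_def)
  then show ?thesis using to_K(1)[OF True] by (auto intro: trancl_trans)
next
  case False
  then show ?thesis using GG.WW[OF b] by (auto simp: B')
qed

lemma hop_straight: assumes "pr s B' k" shows "(W B k, W B' k) \<in> (GG s)\<^sup>+"
proof (cases "pr s B' (k + 1)")
  case True
  have "(K B' (k + 1), W B' k) \<in> GG s" using GG.KW[OF brB' True] assms by (simp add: pv_def)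
  then show ?thesis using to_K1[OF True] by (auto intro: trancl_trans)
next
  case False
  then have 2: "pr s B' (k + 2)" using branch_gap[OF brB', of "k + 1"] by simp
  have "(K B' (k + 2), W B' k) \<in> GG s" using GG.KW[OF brB' 2] False by (simp add: pv_def)
  then show ?thesis using to_K(1)[OF 2] by (auto intro: trancl_trans)
qed

lemma hop_right: assumes "pr s B' (k + 1)" "pr s B' (k + 5)" shows "(W B k, W B' (k + 5)) \<in> (GG s)\<^sup>+"
proof (cases "pr s B' k")
  case True
  have "(K B' (k + 1), K B' k) \<in> GG s" using GG.KK[OF brB' assms(1)] True by simp
  moreover have "(K B' k, W B' (k + 5)) \<in> GG s" using GG.KW[OF brB' True] assms(2) by (simp add: pv_def)
  ultimately show ?thesis using to_K1[OF assms(1)] by (meson r_into_trancl' trancl_trans)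
next
  case False
  have "(K B' (k + 1), W B' (k + 5)) \<in> GG s" using GG.KW[OF brB' assms(1)] False by (simp add: pv_def)
  then show ?thesis using to_K1[OF assms(1)] by (auto intro: trancl_trans)
qed

text \<open>With the three rays ahead present, the walker can rotate clockwise on the spot until it
  faces back along its edge. This pattern decides which of the two walkers of an edge has the
  smaller rank.\<close>

lemma hop_back: assumes "pr s B' (k + 1)" "pr s B' k" "pr s B' (k + 5)" shows "(W B k, W B' (k + 3)) \<in> (GG s)\<^sup>+"
proof -
  have 1: "(K B' (k + 1), K B' k) \<in> GG s" using GG.KK[OF brB' assms(1)] assms(2) by simp
  have 2: "(K B' k, K B' (k + 5)) \<in> GG s" using GG.KK[OF brB' assms(2)] assms(3) by simp
  have 3: "(K B' (k + 5), W B' (k + 3)) \<in> (GG s)\<^sup>+"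
  proof (cases "pr s B' (k + 4)")
    case True
    have "(K B' (k + 5), K B' (k + 4)) \<in> GG s" using GG.KK[OF brB' assms(3)] True by simp
    moreover have "(K B' (k + 4), W B' (k + 3)) \<in> GG s" using GG.KW[OF brB' True] prB' by (simp add: pv_def)
    ultimately show ?thesis by (meson r_into_trancl' trancl_trans)
  next
    case False
    then show ?thesis using GG.KW[OF brB' assms(3)] by (auto simp: pv_def)
  qed
  show ?thesis using to_K1[OF assms(1)] 1 2 3 by (meson r_into_trancl' trancl_trans)
qed

end

text \<open>Otherwise a resting walker could rotate around \<open>B\<close> forever. Six rays would
  also spoil the uniqueness of coefficients, because a tripod and its reverse add up to three
  lines.\<close>

lemma not_all_six: "\<exists>k. \<not> pr s B k"
proof (rule ccontr)
  assume "\<not> (\<exists>k. \<not> pr s B k)"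
  then have p: "pr s B k" for k by blast
  have "branch s B" unfolding branch_def using p by (intro exI[of _ 0] exI[of _ 1]) auto
  then have *: "(K B k, K B (k + 5)) \<in> (GG s)\<^sup>+" for k using GG.KK p by blast
  have "(K B 0, K B 0) \<in> (GG s)\<^sup>+"
    using *[of 0, simplified] *[of 5, simplified] *[of 4, simplified] *[of 3, simplified] *[of 2, simplified] *[of 1, simplified]
    by (meson trancl_trans)
  then show False using acyc by (auto simp: acyclic_def)
qed

text \<open>Signed weights whose densities live where those of \<open>s\<close> do; the nonnegative
  ones describe the measures below a multiple of the given measure.\<close>

definition face :: "(real^2 \<Rightarrow> real) set" where
  "face = {\<sigma>. fs \<sigma> \<and> (\<forall>x k. D s x k = 0 \<longrightarrow> D \<sigma> x k = 0)}"

lemma faceD: "\<sigma> \<in> face \<Longrightarrow> fs \<sigma>" "\<sigma> \<in> face \<Longrightarrow> \<not> pr s x k \<Longrightarrow> D \<sigma> x k = 0"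
  by (auto simp: face_def not_pr)

lemma face_zero: assumes "\<sigma> \<in> face" "s x = 0" shows "\<sigma> x = 0"
proof -
  obtain k where "\<not> pr s x k" using not_all_six by blast
  then have "D s x k = 0" "D s x (k + 3) = 0" using jump[of x k] assms(2) by (auto simp: not_pr)
  then show ?thesis using faceD[OF assms(1)] D_jump[OF faceD(1)[OF assms(1)], of x k] by (auto simp: not_pr)
qed

definition gens :: "(real^2) gen set" where
  "gens = T ` {B. s B \<noteq> 0} \<union> (\<lambda>(B, k). L B k) ` {(B, k). branch s B \<and> ev k \<and> pr s B k \<and> pr s B (k + 3)}"

lemma gens_iff [simp]: "T B \<in> gens \<longleftrightarrow> s B \<noteq> 0"
  "L B k \<in> gens \<longleftrightarrow> branch s B \<and> ev k \<and> pr s B k \<and> pr s B (k + 3)"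
  by (auto simp: gens_def)

lemma finite_gens: "finite gens"
proof -
  have "finite {(B, k). branch s B \<and> ev k \<and> pr s B k \<and> pr s B (k + 3)}"
    by (rule finite_subset[of _ "{B. branch s B} \<times> UNIV"]) (auto simp: finite_branch)
  then show ?thesis using fss by (auto simp: gens_def fs_def)
qed

text \<open>For nonnegative \<open>\<sigma>\<close> in the face, the coefficient of a line is the
  smaller of its two densities at \<open>B\<close>. Which one is smaller is decided by the sign of
  \<open>s B\<close>, the same for all \<open>\<sigma>\<close>, so that the coefficient is
  linear.\<close>

definition coef :: "(real^2 \<Rightarrow> real) \<Rightarrow> (real^2) gen \<Rightarrow> real" where
  "coef \<sigma> g = (case g of T B \<Rightarrow> \<sigma> B * sgn (s B) | L B k \<Rightarrow> if s B \<ge> 0 then D \<sigma> B (k + 3) else D \<sigma> B k)"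

definition cont :: "real^2 \<Rightarrow> 6 \<Rightarrow> (real^2) gen set" where
  "cont B k = (if sg k * s B > 0 then {T B} else {}) \<union> (if pr s B (k + 3) then {L B (rep k)} else {})"

lemma finite_cont [simp]: "finite (cont B k)" by (simp add: cont_def)

lemma sum_cont: "(\<Sum>g\<in>cont B k. x g) = (if sg k * s B > 0 then x (T B) else 0) + (if pr s B (k + 3) then x (L B (rep k)) else (0::real))"
  by (auto simp: cont_def)

lemma cont_gens: "branch s B \<Longrightarrow> pr s B k \<Longrightarrow> cont B k \<subseteq> gens"
  by (auto simp: cont_def rep_def)

lemma pr_opp: "pr s B k \<Longrightarrow> \<not> sg k * s B > 0 \<Longrightarrow> pr s B (k + 3)"
  using jump[of B k] unfolding pr_def by linarith

lemma pr_sg: "sg k * s B > 0 \<Longrightarrow> pr s B k"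
  using jump[of B k] D_nonneg[of B "k + 3"] unfolding pr_def by linarith

lemma coef_L:
  assumes "\<sigma> \<in> face" shows "\<not> sg k * s B > 0 \<Longrightarrow> coef \<sigma> (L B (rep k)) = D \<sigma> B k"
    "sg k * s B > 0 \<Longrightarrow> coef \<sigma> (L B (rep k)) = D \<sigma> B (k + 3)"
proof -
  have z: "s B = 0 \<Longrightarrow> D \<sigma> B k = D \<sigma> B (k + 3)" using face_zero[OF assms] D_jump[OF faceD(1)[OF assms], of B k] by force
  show "\<not> sg k * s B > 0 \<Longrightarrow> coef \<sigma> (L B (rep k)) = D \<sigma> B k"
    using z by (cases "s B = 0") (auto simp: coef_def rep_def sg_def split: if_splits)
  show "sg k * s B > 0 \<Longrightarrow> coef \<sigma> (L B (rep k)) = D \<sigma> B (k + 3)"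
    by (auto simp: coef_def rep_def sg_def split: if_splits)
qed

lemma D_cont: assumes "\<sigma> \<in> face" "pr s B k" shows "D \<sigma> B k = (\<Sum>g\<in>cont B k. coef \<sigma> g)"
proof (cases "sg k * s B > 0")
  case True
  then have "sgn (s B) = sg k" by (auto simp: sg_def split: if_splits)
  then have "coef \<sigma> (T B) = D \<sigma> B k - D \<sigma> B (k + 3)"
    using D_jump[OF faceD(1)[OF assms(1)], of B k] by (simp add: coef_def)
  then show ?thesis using True coef_L(2)[OF assms(1) True] faceD(2)[OF assms(1), of B "k + 3"] by (auto simp: sum_cont)
next
  case False
  then show ?thesis using coef_L(1)[OF assms(1) False] pr_opp[OF assms(2) False] by (simp add: sum_cont)
qed

definition EE :: "((real^2) \<times> 6) set" where "EE = {(B, k). branch s B \<and> pr s B k \<and> fin s B k}"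

text \<open>One orientation of each edge: its equation will be solved for a coefficient at the far
  end. Equal ranks are separated by parity, so exactly one orientation is chosen.\<close>

definition CH :: "((real^2) \<times> 6) set" where
  "CH = {(B, k). (B, k) \<in> EE \<and> (rk (nb s B k) (k + 3) < rk B k \<or> rk (nb s B k) (k + 3) = rk B k \<and> ev k)}"

definition tgt :: "(real^2) \<times> 6 \<Rightarrow> (real^2) gen" where
  "tgt = (\<lambda>(B, k). if pr s (nb s B k) k then L (nb s B k) (rep k) else T (nb s B k))"

lemma EE_rev: "(B, k) \<in> EE \<Longrightarrow> (nb s B k, k + 3) \<in> EE"
  by (auto simp: EE_def len_props(2) pr_nb nb_back)

lemma CH_cases: assumes "(B, k) \<in> EE" shows "(B, k) \<in> CH \<longleftrightarrow> (nb s B k, k + 3) \<notin> CH"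
  using assms EE_rev[OF assms] nb_back(3)[of B k] by (auto simp: CH_def EE_def)

lemma CH_EE: "CH \<subseteq> EE" by (auto simp: CH_def)

lemma CH_rk: "(B, k) \<in> CH \<Longrightarrow> rk (nb s B k) (k + 3) \<le> rk B k"
  by (auto simp: CH_def)

lemma sg_all: assumes "sg k * s B > 0" shows "pr s B (k + 2)" "pr s B (k + 4)" "pr s B k"
  using pr_sg[of "k + 2" B] pr_sg[of "k + 4" B] pr_sg[of k B] assms by simp_all

text \<open>If a tripod and a line both contributed to the arriving ray, the rays
  \<open>k + 1\<close>, \<open>k\<close> and \<open>k + 5\<close> would be present, and
  \<open>hop_back\<close> would contradict the chosen orientation. So the far density is a single
  coefficient.\<close>

lemma cont_arrive: assumes "(B, k) \<in> CH" shows "cont (nb s B k) (k + 3) = {tgt (B, k)}"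
proof -
  have e: "branch s B" "pr s B k" "fin s B k" using assms CH_EE by (auto simp: EE_def)
  let ?B = "nb s B k"
  have p: "pr s ?B (k + 3)" using e pr_nb by blast
  show ?thesis
  proof (cases "pr s ?B k")
    case True
    have "\<not> sg (k + 3) * s ?B > 0"
    proof
      assume "sg (k + 3) * s ?B > 0"
      then have "pr s ?B (k + 5)" "pr s ?B (k + 1)" using sg_all[of "k + 3" ?B] by simp_all
      then have "rk B k < rk ?B (k + 3)" by (intro rk_less hop_back[OF e refl]) (use True in auto)
      then show False using CH_rk[OF assms] by simp
    qed
    then show ?thesis using True by (simp add: cont_def tgt_def)
  next
    case False
    then have "sg (k + 3) * s ?B > 0" using pr_opp[OF p] by auto
    then show ?thesis using False by (simp add: cont_def tgt_def)
  qed
qed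

lemma tgt_gens: assumes "\<delta> \<in> CH" shows "tgt \<delta> \<in> gens"
proof -
  obtain B k where d: "\<delta> = (B, k)" by force
  then have "(nb s B k, k + 3) \<in> EE" using assms CH_EE EE_rev by blast
  then have "cont (nb s B k) (k + 3) \<subseteq> gens" by (intro cont_gens) (auto simp: EE_def)
  then show ?thesis using cont_arrive assms d by auto
qed

text \<open>A coefficient solved on one edge enters the equation of another only along a walk. A
  line is left straight ahead; a tripod is left by a turn of 60 degrees, and its own rays are the
  ones that the turn requires.\<close>

lemma hop:
  assumes e: "(B0, k0) \<in> EE" and t: "tgt (B0, k0) \<in> cont B k" and "pr s B k" and k: "k \<noteq> k0 + 3"
  shows "rk B0 k0 < rk B k"
proof -
  have e': "branch s B0" "pr s B0 k0" "fin s B0 k0" using e by (auto simp: EE_def)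
  have B: "B = nb s B0 k0" using t by (auto simp: tgt_def cont_def split: if_splits)
  have p: "pr s B (k0 + 3)" unfolding B using e' pr_nb by blast
  show ?thesis
  proof (cases "pr s B k0")
    case True
    then have "rep k = rep k0" using t B by (auto simp: tgt_def cont_def split: if_splits)
    then have "k = k0" using k rep_eq[of k k0] by auto
    then show ?thesis using hop_straight[OF e' B] True by (auto intro: rk_less)
  next
    case False
    then have sgk: "sg k * s B > 0" using t B by (auto simp: tgt_def cont_def split: if_splits)
    have "sg (k0 + 3) * s B > 0" using pr_opp[OF p] False by auto
    then have 1: "pr s B (k0 + 5)" "pr s B (k0 + 1)" using sg_all[of "k0 + 3" B] by simp_all
    have "sg k \<noteq> sg k0" using sgk \<open>sg (k0 + 3) * s B > 0\<close> by (auto simp: mult_less_0_iff zero_less_mult_iff)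
    then have "k = k0 + 1 \<or> k = k0 + 5" using six_rel[of k k0] k by auto
    then show ?thesis using hop_left[OF e' B 1(2)] hop_right[OF e' B 1(2) 1(1)] by (auto intro: rk_less)
  qed
qed

text \<open>Of two edges with the same target, each would have smaller rank than the reversal of the
  other, hence smaller rank than the other itself.\<close>

lemma tgt_inj: "inj_on tgt CH"
proof (rule inj_onI)
  fix x y assume x: "x \<in> CH" and y: "y \<in> CH" and eq: "tgt x = tgt y"
  obtain B0 k0 B1 k1 where xy: "x = (B0, k0)" "y = (B1, k1)" by force
  have nbeq: "nb s B0 k0 = nb s B1 k1" using eq by (auto simp: xy tgt_def split: if_splits)
  have E: "(B0, k0) \<in> EE" "(B1, k1) \<in> EE" using x y CH_EE xy by auto
  show "x = y"
  proof (cases "k1 = k0")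
    case True
    have "nb s (nb s B0 k0) (k0 + 3) = B0" "nb s (nb s B1 k1) (k1 + 3) = B1"
      using E by (auto simp: EE_def intro: nb_back(3))
    then have "B0 = B1" using nbeq True by metis
    then show ?thesis using True xy by simp
  next
    case False
    have "rk B0 k0 < rk (nb s B1 k1) (k1 + 3)"
      by (rule hop[OF E(1)]) (use cont_arrive[of B1 k1] y xy eq EE_rev[OF E(2)] False in \<open>auto simp: EE_def\<close>)
    moreover have "rk B1 k1 < rk (nb s B0 k0) (k0 + 3)"
      by (rule hop[OF E(2)]) (use cont_arrive[of B0 k0] x xy eq EE_rev[OF E(1)] False in \<open>auto simp: EE_def\<close>)
    ultimately show ?thesis using CH_rk[of B0 k0] CH_rk[of B1 k1] x y xy by simp
  qed
qed

definition free :: "(real^2) gen set" where "free = gens - tgt ` CH"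

definition drt :: "(real^2) gen \<Rightarrow> (real^2) \<times> 6" where "drt g = inv_into CH tgt g"

lemma drt_tgt: "\<delta> \<in> CH \<Longrightarrow> drt (tgt \<delta>) = \<delta>"
  unfolding drt_def using tgt_inj by (rule inv_into_f_f)

definition src :: "(real^2) gen \<Rightarrow> (real^2) gen set" where "src g = cont (fst (drt g)) (snd (drt g))"

definition rkg :: "(real^2) gen \<Rightarrow> nat" where "rkg g = rk (fst (drt g)) (snd (drt g))"

lemma finite_CH: "finite CH"
  by (rule finite_subset[of _ "{B. branch s B} \<times> UNIV"]) (auto simp: finite_branch CH_def EE_def)

lemma src_dep: assumes "g \<in> tgt ` CH" "h \<in> src g" "h \<in> tgt ` CH" shows "rkg h < rkg g"
proof -
  obtain B k where g: "g = tgt (B, k)" "(B, k) \<in> CH" using assms(1) by auto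
  obtain B0 k0 where h: "h = tgt (B0, k0)" "(B0, k0) \<in> CH" using assms(3) by auto
  have E: "(B, k) \<in> EE" "(B0, k0) \<in> EE" using g h CH_EE by auto
  have hc: "tgt (B0, k0) \<in> cont B k" using assms(2) g h by (simp add: src_def drt_tgt)
  have "nb s B0 k0 = B" using hc by (auto simp: tgt_def cont_def split: if_splits)
  then have "k \<noteq> k0 + 3" using CH_cases[OF E(2)] g h by auto
  then have "rk B0 k0 < rk B k" using hop[OF E(2) hc] E(1) by (auto simp: EE_def)
  then show ?thesis using g h by (simp add: rkg_def drt_tgt)
qed

lemma src_gens: "g \<in> tgt ` CH \<Longrightarrow> src g \<subseteq> gens"
  using CH_EE by (auto simp: src_def drt_tgt EE_def dest!: cont_gens[THEN subsetD, rotated 2] subsetD)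

lemma D_face_edge: assumes "\<sigma> \<in> face" "fin s x k" shows "D \<sigma> (nb s x k) (k + 3) = D \<sigma> x k"
  unfolding nb_def
proof (rule D_const)
  show "len s x k > 0" by (rule len_props(1)[OF assms(2)])
  fix \<tau> assume "0 < \<tau>" "\<tau> < len s x k"
  then have "s (x + \<tau> *\<^sub>R dir k) = 0" using len_props(3)[OF assms(2)] nz_branch by blast
  then show "\<sigma> (x + \<tau> *\<^sub>R dir k) = 0" by (rule face_zero[OF assms(1)])
qed

lemma coef_tgt: assumes "\<sigma> \<in> face" "g \<in> tgt ` CH" shows "coef \<sigma> g = (\<Sum>h\<in>src g. coef \<sigma> h)"
proof -
  obtain B k where g: "g = tgt (B, k)" "(B, k) \<in> CH" using assms(2) by auto
  have E: "(B, k) \<in> EE" "(nb s B k, k + 3) \<in> EE" using g CH_EE EE_rev by auto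
  have "D \<sigma> (nb s B k) (k + 3) = coef \<sigma> g"
    using D_cont[OF assms(1), of "nb s B k" "k + 3"] E(2) cont_arrive[OF g(2)] g(1) by (auto simp: EE_def)
  moreover have "D \<sigma> B k = (\<Sum>h\<in>src g. coef \<sigma> h)"
    using D_cont[OF assms(1), of B k] E(1) g by (auto simp: EE_def src_def drt_tgt)
  ultimately show ?thesis using D_face_edge[OF assms(1), of B k] E(1) by (auto simp: EE_def)
qed

section \<open>Weights with prescribed coefficients\<close>

context
  fixes x :: "(real^2) gen \<Rightarrow> real"
  assumes xeq: "\<And>g. g \<in> tgt ` CH \<Longrightarrow> x g = (\<Sum>h\<in>src g. x h)"
begin

definition mk :: "real^2 \<Rightarrow> real" where "mk B = (if s B = 0 then 0 else x (T B) * sgn (s B))"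

lemma fs_mk: "fs mk"
  using fss unfolding fs_def by (rule rev_finite_subset) (auto simp: mk_def)

definition rho :: "real^2 \<Rightarrow> 6 \<Rightarrow> real" where "rho B k = (if pr s B k then \<Sum>g\<in>cont B k. x g else 0)"

lemma rho_jump: "rho B k - rho B (k + 3) = sg k * mk B"
proof -
  have *: "rho B k - rho B (k + 3) = sg k * mk B" if "sg k * s B > 0" for k
  proof -
    have "sgn (s B) = sg k" using that by (auto simp: sg_def split: if_splits)
    moreover have "s B \<noteq> 0" "\<not> sg (k + 3) * s B > 0" using that by auto
    ultimately show ?thesis using that pr_sg[OF that] by (auto simp: rho_def sum_cont mk_def)
  qed
  consider "sg k * s B > 0" | "sg (k + 3) * s B > 0" | "s B = 0"
    by (cases "s B > 0"; cases "s B = 0"; cases "ev k") (auto simp: sg_def)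
  then show ?thesis
  proof cases
    case 2 then show ?thesis using *[of "k + 3"] by simp
  next
    case 3
    then have "pr s B k \<longleftrightarrow> pr s B (k + 3)" using jump[of B k] by (simp add: pr_def)
    then show ?thesis using 3 by (auto simp: rho_def sum_cont mk_def)
  qed (use * in auto)
qed

lemma rho_edge: assumes "branch s B" "fin s B k" shows "rho (nb s B k) (k + 3) = rho B k"
proof (cases "pr s B k")
  case True
  have *: "rho (nb s B k) (k + 3) = rho B k" if "(B, k) \<in> CH" for B k
  proof -
    have E: "(B, k) \<in> EE" "(nb s B k, k + 3) \<in> EE" using that CH_EE EE_rev by auto
    have "x (tgt (B, k)) = (\<Sum>h\<in>cont B k. x h)" using xeq[of "tgt (B, k)"] that by (simp add: src_def drt_tgt)
    then show ?thesis using E cont_arrive[OF that] by (auto simp: rho_def EE_def)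
  qed
  have E: "(B, k) \<in> EE" using assms True by (auto simp: EE_def)
  show ?thesis using *[of B k] *[of "nb s B k" "k + 3"] CH_cases[OF E] nb_back(3)[OF assms] by auto
qed (use pr_nb[OF assms(2)] in \<open>simp add: rho_def\<close>)

lemma mk_ahead: "fin s y k \<Longrightarrow> D mk (nb s y k) (k + 3) = D mk y k"
  unfolding nb_def
proof (rule D_const)
  assume f: "fin s y k"
  show "len s y k > 0" by (rule len_props(1)[OF f])
  fix \<tau> assume "0 < \<tau>" "\<tau> < len s y k"
  then show "mk (y + \<tau> *\<^sub>R dir k) = 0" using len_props(3)[OF f] nz_branch by (auto simp: mk_def)
qed

lemma mk_none: assumes "\<not> fin s y k" "\<not> ev k" shows "D mk y k = 0"
proof -
  have "mk (y + t *\<^sub>R dir k) = 0" if "t > 0" for t using assms(1) that nz_branch by (auto simp: mk_def fin_def ahead_def)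
  then show ?thesis using D_odd_ahead[OF assms(2)] by blast
qed

text \<open>Induction towards infinity in an odd direction: past the last branch point both sides
  vanish, and jumps and edges carry the equality back.\<close>

lemma D_mk_odd: "branch s B \<Longrightarrow> \<not> ev k \<Longrightarrow> D mk B k = rho B k"
proof (induction "card (ahead s B k)" arbitrary: B rule: less_induct)
  case less
  show ?case
  proof (cases "fin s B k")
    case True
    let ?B = "nb s B k"
    have sub: "(\<lambda>t. t + len s B k) ` ahead s ?B k \<subseteq> ahead s B k - {len s B k}"
      using len_props(1)[OF True] by (auto simp: ahead_def nb_def algebra_simps)
    have "card (ahead s ?B k) = card ((\<lambda>t. t + len s B k) ` ahead s ?B k)" by (rule card_image[symmetric]) auto
    also have "\<dots> \<le> card (ahead s B k - {len s B k})" using sub finite_ahead by (intro card_mono) auto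
    also have "\<dots> < card (ahead s B k)"
      using finite_ahead len_props(1,2)[OF True] by (intro psubset_card_mono) (auto simp: ahead_def nb_def)
    finally have "D mk ?B k = rho ?B k" using less(1)[of ?B] len_props(2)[OF True] less(3) by blast
    then have "D mk ?B (k + 3) = rho ?B (k + 3)" using D_jump[OF fs_mk, of ?B k] rho_jump[of ?B k] by simp
    then show ?thesis using mk_ahead[OF True] rho_edge[OF less(2) True] by simp
  next
    case False
    then show ?thesis using mk_none[OF False less(3)] odd_fin[OF less(3), of B] by (auto simp: rho_def)
  qed
qed

lemma D_mk: assumes "branch s B" shows "D mk B k = rho B k"
proof (cases "ev k")
  case True
  then show ?thesis using D_mk_odd[OF assms, of "k + 3"] D_jump[OF fs_mk, of B k] rho_jump[of B k] by simp
qed (use D_mk_odd assms in blast)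

lemma D_mk_any: "(\<exists>B l. branch s B \<and> D mk y k = rho B l \<and> (pr s B l \<longleftrightarrow> pr s y k)) \<or> D mk y k = 0"
proof (cases "branch s y")
  case True then show ?thesis using D_mk by blast
next
  case False
  then have m: "mk y = 0" using nz_branch by (auto simp: mk_def)
  have *: "(\<exists>B l. branch s B \<and> D mk y k = rho B l \<and> (pr s B l \<longleftrightarrow> pr s y k)) \<or> D mk y k = 0" if "\<not> ev k" for k
  proof (cases "fin s y k")
    case True
    then show ?thesis using mk_ahead[OF True] D_mk[OF len_props(2)[OF True]] len_props(2)[OF True] pr_nb[OF True] by metis
  next
    case False then show ?thesis using mk_none that by blast
  qed
  show ?thesis
  proof (cases "ev k")
    case True
    have "D mk y k = D mk y (k + 3)" using D_jump[OF fs_mk, of y k] m by simp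
    moreover have "pr s y k \<longleftrightarrow> pr s y (k + 3)" using nonbranch(2)[OF False] by (simp add: pr_def)
    ultimately show ?thesis using *[of "k + 3"] True by simp
  qed (use * in blast)
qed

lemma mk_face: "mk \<in> face"
proof -
  have "D mk y k = 0" if "D s y k = 0" for y k
    using D_mk_any[of y k] that by (auto simp: rho_def pr_def)
  then show ?thesis using fs_mk by (auto simp: face_def)
qed

lemma mk_pos: assumes "\<And>g. g \<in> gens \<Longrightarrow> x g \<ge> 0" shows "pos mk"
proof -
  have "rho B k \<ge> 0" if "branch s B" for B k
    unfolding rho_def using cont_gens[OF that, of k] assms by (auto intro!: sum_nonneg)
  then show ?thesis unfolding pos_def using D_mk_any by (metis order_refl)
qed

lemma coef_mk: assumes "g \<in> gens" shows "coef mk g = x g"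
proof (cases g)
  case (T B)
  then show ?thesis using assms by (auto simp: coef_def mk_def sgn_mult_self_eq mult.assoc)
next
  case (L B k)
  then have b: "branch s B" "ev k" "pr s B k" "pr s B (k + 3)" using assms by auto
  have "D mk B l = x g" if "rep l = k" "\<not> sg l * s B > 0" for l
  proof -
    have "l = k \<or> l = k + 3" using that(1) b(2) rep_eq[of k l] by (auto simp: rep_def split: if_splits)
    then have "pr s B l" "pr s B (l + 3)" using b by auto
    then show ?thesis using D_mk[OF b(1), of l] that L by (simp add: rho_def sum_cont)
  qed
  from this[of k] this[of "k + 3"] show ?thesis using b L by (auto simp: coef_def rep_def sg_def)
qed

end

text \<open>For a tripod the sign comes from a missing ray \<open>m\<close>: on its line the jump of
  \<open>\<sigma>\<close> is the density on the opposite ray, which is nonnegative.\<close>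

lemma coef_pos: assumes "\<sigma> \<in> face" "pos \<sigma>" "g \<in> gens" shows "coef \<sigma> g \<ge> 0"
proof (cases g)
  case (L B k) then show ?thesis using assms by (auto simp: coef_def pos_def)
next
  case (T B)
  then have n: "s B \<noteq> 0" using assms by simp
  obtain k where k: "sgn (s B) = sg k" using n that[of 0] that[of 1] by (cases "s B > 0") (auto simp: sg_def)
  obtain m where m: "\<not> pr s B m" using not_all_six by blast
  have 1: "sg k * \<sigma> B \<ge> 0" if "\<not> pr s B (l + 3)" "sg l = sg k" for l
  proof -
    have "D \<sigma> B l \<ge> 0" using assms(2) by (simp add: pos_def)
    then show ?thesis using D_jump[OF faceD(1)[OF assms(1)], of B l] faceD(2)[OF assms(1) that(1)] that(2) by simp
  qed
  have sk: "sg k * s B > 0" using k n by (metis abs_sgn mult.commute zero_less_abs_iff)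
  have "sg m \<noteq> sg k" using m pr_sg[of m B] sk by auto
  then have "sg (m + 3) = sg k" by (auto simp: sg_def split: if_splits)
  then show ?thesis using 1[of "m + 3"] m T k by (simp add: coef_def mult.commute)
qed

lemma coef_add: "fs \<sigma> \<Longrightarrow> fs \<sigma>' \<Longrightarrow> coef (\<lambda>A. \<sigma> A + \<sigma>' A) g = coef \<sigma> g + coef \<sigma>' g"
  by (cases g) (auto simp: coef_def D_add algebra_simps)

lemma coef_scale: "fs \<sigma> \<Longrightarrow> coef (\<lambda>A. c * \<sigma> A) g = c * coef \<sigma> g"
  by (cases g) (auto simp: coef_def D_scale)

lemma face_eqI: assumes "\<sigma> \<in> face" "\<sigma>' \<in> face" "\<And>g. g \<in> free \<Longrightarrow> coef \<sigma> g = coef \<sigma>' g" shows "\<sigma> = \<sigma>'"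
proof
  fix B
  have e: "coef \<sigma> g = coef \<sigma>' g" if "g \<in> gens" for g
  proof (rule triangular_unique[where T = "tgt ` CH" and src = src and r = rkg and G = gens])
    show "rkg h < rkg g" if "g \<in> tgt ` CH" "h \<in> src g" "h \<in> tgt ` CH" for g h using src_dep that .
  qed (use assms src_gens coef_tgt that in \<open>auto simp: free_def\<close>)
  show "\<sigma> B = \<sigma>' B"
  proof (cases "s B = 0")
    case True then show ?thesis using face_zero assms by metis
  next
    case False
    then have "\<sigma> B * sgn (s B) = \<sigma>' B * sgn (s B)" using e[of "T B"] by (simp add: coef_def)
    then show ?thesis using False by (simp add: sgn_zero_iff)
  qed
qed

text \<open>A solved coefficient is a sum of its sources, so one free coefficient 1 and the others 0
  extend to nonnegative coefficients. Thus the free coefficients are coordinates of an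
  orthant.\<close>

lemma basis_exists: "\<exists>e. \<forall>g\<in>free. e g \<in> face \<and> pos (e g) \<and> (\<forall>h\<in>free. coef (e g) h = of_bool (h = g))"
proof -
  have "\<exists>\<sigma>. \<sigma> \<in> face \<and> pos \<sigma> \<and> (\<forall>h\<in>free. coef \<sigma> h = of_bool (h = g))" for g
  proof -
    have "\<exists>x. (\<forall>h. h \<notin> tgt ` CH \<longrightarrow> x h = (of_bool (h = g) :: real)) \<and> (\<forall>h\<in>tgt ` CH. x h = (\<Sum>h\<in>src h. x h))"
      by (rule triangular_exists[where r = rkg]) (use finite_CH src_dep in auto)
    then obtain x :: "(real^2) gen \<Rightarrow> real" where x: "\<And>h. h \<notin> tgt ` CH \<Longrightarrow> x h = of_bool (h = g)" "\<And>h. h \<in> tgt ` CH \<Longrightarrow> x h = (\<Sum>h\<in>src h. x h)"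
      by blast
    have nn: "x h \<ge> 0" if "h \<in> gens" for h
    proof (rule triangular_nonneg[where T = "tgt ` CH" and src = src and r = rkg and G = gens])
      show "rkg h < rkg g" if "g \<in> tgt ` CH" "h \<in> src g" "h \<in> tgt ` CH" for g h using src_dep that .
    qed (use x src_gens that in auto)
    have "\<forall>h\<in>free. coef (mk x) h = of_bool (h = g)" using coef_mk[OF x(2)] x(1) by (auto simp: free_def)
    then show ?thesis using mk_face[OF x(2)] mk_pos[OF x(2) nn] by blast
  qed
  then show ?thesis by metis
qed

text \<open>A branch point of degree n carries n - 2 coefficients, and every edge eliminates one.
  Each edge has two ends, and the ends of rays that belong to no edge are the exit rays.\<close>

lemma card_free: "2 * card free + 4 * card {B. branch s B} =
   card {(B, k). branch s B \<and> pr s B k \<and> \<not> fin s B k} + card {(B, k). branch s B \<and> pr s B k}"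
proof -
  let ?BR = "{B. branch s B}" and ?DG = "{(B, k). branch s B \<and> pr s B k}" and ?XX = "{(B, k). branch s B \<and> pr s B k \<and> \<not> fin s B k}"
  have finDG: "finite ?DG" by (rule finite_subset[of _ "?BR \<times> UNIV"]) (auto simp: finite_branch)
  have DG: "card ?DG = card EE + card ?XX"
  proof -
    have "finite EE" "finite ?XX" by (rule finite_subset[OF _ finDG]; auto simp: EE_def)+
    then have "card (EE \<union> ?XX) = card EE + card ?XX" by (intro card_Un_disjoint) (auto simp: EE_def)
    moreover have "EE \<union> ?XX = ?DG" by (auto simp: EE_def)
    ultimately show ?thesis by simp
  qed
  have CH: "card EE = 2 * card CH"
  proof -
    let ?r = "\<lambda>(B, k). (nb s B k, k + 3)"
    have inv: "?r (?r x) = x" if "x \<in> EE" for x using that nb_back(3) by (auto simp: EE_def)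
    have EEeq: "EE = CH \<union> ?r ` CH"
    proof
      show "EE \<subseteq> CH \<union> ?r ` CH"
      proof
        fix x assume x: "x \<in> EE"
        obtain B k where Bk: "x = (B, k)" by force
        show "x \<in> CH \<union> ?r ` CH"
        proof (cases "x \<in> CH")
          case False
          then have "?r x \<in> CH" using CH_cases[of B k] x Bk by auto
          then show ?thesis using imageI[of "?r x" CH ?r] inv[OF x] by simp
        qed simp
      qed
      show "CH \<union> ?r ` CH \<subseteq> EE" using CH_EE EE_rev by auto
    qed
    have disj: "CH \<inter> ?r ` CH = {}" using CH_cases CH_EE by auto
    have "inj_on ?r CH" by (rule inj_on_inverseI[of _ ?r]) (use inv CH_EE in blast)
    then have "card (?r ` CH) = card CH" by (rule card_image)
    then show ?thesis using EEeq card_Un_disjoint[OF finite_CH _ disj] finite_CH by simp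
  qed
  define gB where "gB B = {g. g \<in> gens \<and> (g = T B \<or> (\<exists>k. g = L B k))}" for B
  have gens_eq: "gens = (\<Union>B\<in>?BR. gB B)"
    using nz_branch by (auto simp: gB_def gens_def)
  have loc: "card (gB B) + 2 = card {k. pr s B k}" if B: "branch s B" for B
  proof -
    let ?P = "{k. ev k \<and> pr s B k}" and ?Q = "{k. ev k \<and> pr s B (k + 3)}"
    have e: "gB B = (if s B \<noteq> 0 then {T B} else {}) \<union> L B ` (?P \<inter> ?Q)" using B by (auto simp: gB_def)
    have 1: "card (gB B) = of_bool (s B \<noteq> 0) + card (?P \<inter> ?Q)"
      unfolding e by (subst card_Un_disjoint) (auto simp: card_image inj_on_def)
    have "{k. pr s B k} = ?P \<union> (\<lambda>k. k + 3) ` ?Q"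
    proof safe
      fix k assume "pr s B k" "k \<notin> (\<lambda>k. k + 3) ` ?Q"
      then show "ev k" by (force intro: image_eqI[of _ _ "k + 3"])
    qed
    then have "card {k. pr s B k} = card ?P + card ((\<lambda>k. k + 3) ` ?Q)" by (subst card_Un_disjoint[symmetric]) auto
    also have "card ((\<lambda>k. k + 3) ` ?Q) = card ?Q" by (intro card_image) (auto simp: inj_on_def)
    also have "card ?P + card ?Q = card (?P \<union> ?Q) + card (?P \<inter> ?Q)" by (rule card_Un_Int) auto
    also have "card (?P \<union> ?Q) = 2 + of_bool (s B \<noteq> 0)"
    proof (cases "s B = 0")
      case False
      then have "?P \<union> ?Q = {k. ev k}" using pr_sg[of _ B] by (cases "s B > 0") (auto simp: sg_def)
      then show ?thesis using False by (simp add: Collect_ev)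
    next
      \<comment> \<open>With zero jump the rays come in opposite pairs. One of the three lines is
        missing by \<open>not_all_six\<close>, and no second one by
        \<open>branch_gap\<close>.\<close>
      case True
      obtain m where m: "\<not> pr s B m" using not_all_six by blast
      have sym: "pr s B k \<longleftrightarrow> pr s B (k + 3)" for k using jump[of B k] True by (simp add: pr_def)
      define n where "n = rep m"
      have n: "ev n" "\<not> pr s B n" using m sym[of m] by (auto simp: n_def rep_def)
      have p: "pr s B (n + 1)" "pr s B (n + 5)" using branch_gap[OF B, of n] branch_gap[OF B, of "n + 5"] n by auto
      then have p': "pr s B (n + 4)" "pr s B (n + 2)" using sym[of "n + 1"] sym[of "n + 5"] by simp_all
      have "k = n + 2 \<or> k = n + 4" if "ev k" "pr s B k" for k using six_rel[of k n] that n by auto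
      then have "?P \<union> ?Q = {n + 2, n + 4}" using p' n sym by auto
      then show ?thesis using True by simp
    qed
    finally show ?thesis using 1 by simp
  qed
  have "card gens = (\<Sum>B\<in>?BR. card (gB B))" unfolding gens_eq
  proof (rule card_UN_disjoint)
    show "\<forall>B\<in>?BR. finite (gB B)" using finite_gens by (auto simp: gB_def)
  qed (auto simp: finite_branch gB_def)
  moreover have "card ?DG = (\<Sum>B\<in>?BR. card {k. pr s B k})"
  proof -
    have "?DG = (SIGMA B:?BR. {k. pr s B k})" by auto
    then show ?thesis by (simp add: finite_branch)
  qed
  moreover have "(\<Sum>B\<in>?BR. card {k. pr s B k}) = (\<Sum>B\<in>?BR. card (gB B) + 2)" by (rule sum.cong) (use loc in auto)
  moreover have "(\<Sum>B\<in>?BR. card (gB B) + 2) = (\<Sum>B\<in>?BR. card (gB B)) + 2 * card ?BR" by (simp only: sum.distrib) simp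
  ultimately have G: "card ?DG = card gens + 2 * card ?BR" by linarith
  have "card (tgt ` CH) = card CH" by (rule card_image[OF tgt_inj])
  then have "card free = card gens - card CH" unfolding free_def
    using finite_CH tgt_gens by (subst card_Diff_subset) auto
  moreover have "tgt ` CH \<subseteq> gens" using tgt_gens by blast
  then have "card CH \<le> card gens" using card_mono[OF finite_gens, of "tgt ` CH"] \<open>card (tgt ` CH) = card CH\<close> by simp
  ultimately show ?thesis using G DG CH by simp
qed

end

section \<open>Densities and the measure of a balanced function\<close>

lemma emeasure_off_supp:
  fixes \<mu> :: "(real^2) measure"
  assumes "sets \<mu> = sets borel" shows "emeasure \<mu> (- supp \<mu>) = 0" "open (- supp \<mu>)"
proof -
  let ?F = "{U. open U \<and> emeasure \<mu> U = 0}"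
  have eq: "- supp \<mu> = \<Union>?F" by (auto simp: supp_def)
  show "open (- supp \<mu>)" unfolding eq by auto
  obtain F' where F': "F' \<subseteq> ?F" "countable F'" "\<Union>F' = \<Union>?F" using Lindelof[of ?F] by blast
  have "emeasure \<mu> (\<Union>F') = 0"
  proof (cases "F' = {}")
    case False
    have "(\<Union>U\<in>F'. U) \<in> null_sets \<mu>"
      by (rule null_sets_UN'[OF F'(2)]) (use F'(1) assms in \<open>auto simp: null_sets_def\<close>)
    then show ?thesis by (auto simp: null_sets_def)
  qed simp
  then show "emeasure \<mu> (- supp \<mu>) = 0" using eq F' by simp
qed

lemma emeasure_eq_0_off_supp:
  fixes \<mu> :: "(real^2) measure"
  assumes "sets \<mu> = sets borel" "E \<inter> supp \<mu> = {}" shows "emeasure \<mu> E = 0"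
proof -
  have "emeasure \<mu> E \<le> emeasure \<mu> (- supp \<mu>)"
    by (rule emeasure_mono) (use assms emeasure_off_supp(2)[OF assms(1)] in auto)
  then show ?thesis using emeasure_off_supp(1)[OF assms(1)] by simp
qed

lemma measure_eqI_local:
  fixes \<mu> \<nu> :: "(real^2) measure"
  assumes s: "sets \<mu> = sets borel" "sets \<nu> = sets borel"
    and loc: "\<And>x. \<exists>U. open U \<and> x \<in> U \<and> (\<forall>E\<in>sets borel. E \<subseteq> U \<longrightarrow> emeasure \<mu> E = emeasure \<nu> E)"
  shows "\<mu> = \<nu>"
proof (rule measure_eqI)
  show "sets \<mu> = sets \<nu>" using s by simp
  fix E assume "E \<in> sets \<mu>"
  then have E: "E \<in> sets borel" using s by simp
  let ?F = "{U. open U \<and> (\<forall>E\<in>sets borel. E \<subseteq> U \<longrightarrow> emeasure \<mu> E = emeasure \<nu> E)}"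
  have un: "\<Union>?F = UNIV" using loc by (auto; blast)
  obtain F' where F': "F' \<subseteq> ?F" "countable F'" "\<Union>F' = \<Union>?F" using Lindelof[of ?F] by blast
  have ne: "F' \<noteq> {}" using F'(3) un by auto
  define U where "U = from_nat_into F'"
  have U: "range U = F'" unfolding U_def by (rule range_from_nat_into[OF ne F'(2)])
  have oU: "open (U n)" "\<And>E. E \<in> sets borel \<Longrightarrow> E \<subseteq> U n \<Longrightarrow> emeasure \<mu> E = emeasure \<nu> E" for n
    using F'(1) U by auto
  define V where "V n = E \<inter> disjointed U n" for n
  have V: "V n \<in> sets borel" "V n \<subseteq> U n" for n
  proof -
    have "range (disjointed U) \<subseteq> sets borel" by (rule sets.range_disjointed_sets) (use oU(1) in auto)
    then show "V n \<in> sets borel" unfolding V_def using E by auto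
    show "V n \<subseteq> U n" unfolding V_def using disjointed_subset[of U n] by auto
  qed
  have Vr: "range V \<subseteq> sets \<mu>" "range V \<subseteq> sets \<nu>" using V(1) s by auto
  have dV: "disjoint_family V" using disjoint_family_disjointed[of U] by (auto simp: disjoint_family_on_def V_def)
  have UV: "(\<Union>n. V n) = E" using UN_disjointed_eq[of U] U F'(3) un by (auto simp: V_def)
  have "emeasure \<mu> E = (\<Sum>n. emeasure \<mu> (V n))"
    using suminf_emeasure[OF Vr(1) dV] UV by simp
  also have "\<dots> = (\<Sum>n. emeasure \<nu> (V n))" by (simp add: oU(2)[OF V])
  also have "\<dots> = emeasure \<nu> E" using suminf_emeasure[OF Vr(2) dV] UV by simp
  finally show "emeasure \<mu> E = emeasure \<nu> E" .
qed

lemma eventually_at_right_ex: "\<forall>\<^sub>F r in at_right (0::real). P r \<Longrightarrow> \<exists>r. P r"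
  by (rule eventually_happens'[OF trivial_limit_at_right_real])

text \<open>Length in the arc parameter over an open interval; end points are null, so it agrees
  with \<open>seg_length\<close>.\<close>

definition arclen :: "real^2 \<Rightarrow> real^2 \<Rightarrow> real \<Rightarrow> (real^2) set \<Rightarrow> ennreal" where
  "arclen A v r E = emeasure lborel {\<tau> \<in> {0<..<r}. A + \<tau> *\<^sub>R v \<in> E}"

lemma affine_measurable [measurable]: "(\<lambda>\<tau>::real. A + \<tau> *\<^sub>R (v::real^2)) \<in> borel_measurable borel"
  by (intro borel_measurable_continuous_onI continuous_intros)

lemma affine_vimage_sets:
  assumes "E \<in> sets borel" "S \<in> sets borel" shows "{\<tau> \<in> S. A + \<tau> *\<^sub>R (v::real^2) \<in> E} \<in> sets (borel :: real measure)"
proof -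
  have "(\<lambda>\<tau>. A + \<tau> *\<^sub>R v) -` E \<inter> space borel \<in> sets borel" by (rule measurable_sets[OF affine_measurable assms(1)])
  moreover have "{\<tau> \<in> S. A + \<tau> *\<^sub>R v \<in> E} = S \<inter> ((\<lambda>\<tau>. A + \<tau> *\<^sub>R v) -` E \<inter> space borel)" by auto
  ultimately show ?thesis using assms(2) by auto
qed

lemma seg_length_arc:
  assumes E: "E \<in> sets borel" and r: "r > 0" and v: "norm v = 1"
  shows "seg_length A (A + r *\<^sub>R v) E = arclen A v r E"
proof -
  let ?S = "{\<tau> \<in> {0<..<r}. A + \<tau> *\<^sub>R v \<in> E}"
  have "arclen A v r E = (\<integral>\<^sup>+\<tau>. indicator ?S \<tau> \<partial>lborel)" unfolding arclen_def using affine_vimage_sets[OF E, of "{0<..<r}"] by simp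
  also have "\<dots> = \<bar>r\<bar> * (\<integral>\<^sup>+t. indicator ?S (0 + r * t) \<partial>lborel)"
    by (rule nn_integral_real_affine) (use r affine_vimage_sets[OF E, of "{0<..<r}"] in auto)
  also have "(\<integral>\<^sup>+t. indicator ?S (0 + r * t) \<partial>lborel) = (\<integral>\<^sup>+t. indicator {t \<in> {0..1}. A + t *\<^sub>R (A + r *\<^sub>R v - A) \<in> E} t \<partial>lborel)"
  proof (rule nn_integral_cong_AE)
    have "AE t in lborel. t \<noteq> (0::real)" "AE t in lborel. t \<noteq> (1::real)" by (rule AE_lborel_singleton)+
    then show "AE t in lborel. indicator ?S (0 + r * t) = (indicator {t \<in> {0..1}. A + t *\<^sub>R (A + r *\<^sub>R v - A) \<in> E} t :: ennreal)"
      by eventually_elim (use r in \<open>auto simp: indicator_def mult.commute zero_less_mult_iff\<close>)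
  qed
  also have "\<dots> = emeasure lborel {t \<in> {0..1}. A + t *\<^sub>R (A + r *\<^sub>R v - A) \<in> E}"
    by (intro nn_integral_indicator) (use affine_vimage_sets[OF E, of "{0..1}" A "A + r *\<^sub>R v - A"] in auto)
  finally show ?thesis using r v by (simp add: seg_length_def dist_norm)
qed

lemma open_segment_arc: "r > 0 \<Longrightarrow> open_segment A (A + r *\<^sub>R v) = (\<lambda>\<tau>. A + \<tau> *\<^sub>R v) ` {0<..<r}" if "v \<noteq> 0"
proof (intro equalityI subsetI)
  fix x assume r: "r > 0" and "x \<in> open_segment A (A + r *\<^sub>R v)"
  then obtain u where "0 < u" "u < 1" "x = (1 - u) *\<^sub>R A + u *\<^sub>R (A + r *\<^sub>R v)" by (auto simp: in_segment)
  then show "x \<in> (\<lambda>\<tau>. A + \<tau> *\<^sub>R v) ` {0<..<r}" using r by (intro image_eqI[of _ _ "u * r"]) (auto simp: algebra_simps)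
next
  fix x assume r: "r > 0" and "x \<in> (\<lambda>\<tau>. A + \<tau> *\<^sub>R v) ` {0<..<r}"
  then obtain \<tau> where "0 < \<tau>" "\<tau> < r" "x = A + \<tau> *\<^sub>R v" by auto
  then show "x \<in> open_segment A (A + r *\<^sub>R v)" using r that
    by (auto simp: in_segment algebra_simps intro!: exI[of _ "\<tau> / r"])
qed

lemma has_density_arc:
  assumes "norm v = 1"
  shows "has_density \<mu> A v c \<longleftrightarrow> c \<ge> 0 \<and> (\<exists>r>0. \<forall>E\<in>sets borel.
     emeasure \<mu> (E \<inter> (\<lambda>\<tau>. A + \<tau> *\<^sub>R v) ` {0<..<r}) = ennreal c * arclen A v r E)"
proof -
  have "v \<noteq> 0" using assms by auto
  then show ?thesis unfolding has_density_def
    by (intro conj_cong refl ex_cong1) (auto simp: open_segment_arc seg_length_arc assms)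
qed

lemma ray_borel: "(\<lambda>\<tau>. A + \<tau> *\<^sub>R v) ` {a<..<b} \<in> sets borel" for A v :: "real^2"
proof (cases "v = 0")
  case True
  then have "(\<lambda>\<tau>. A + \<tau> *\<^sub>R v) ` {a<..<b} \<subseteq> {A}" by auto
  then show ?thesis by (metis sets.empty_sets borel_singleton subset_singletonD sets.empty_sets)
next
  case False
  have "(\<lambda>\<tau>. A + \<tau> *\<^sub>R v) ` {a<..<b} = (\<Union>n. (\<lambda>\<tau>. A + \<tau> *\<^sub>R v) ` {a + 1 / real (Suc n)..b - 1 / real (Suc n)})"
  proof (intro equalityI subsetI)
    fix x assume "x \<in> (\<lambda>\<tau>. A + \<tau> *\<^sub>R v) ` {a<..<b}"
    then obtain \<tau> where t: "a < \<tau>" "\<tau> < b" "x = A + \<tau> *\<^sub>R v" by auto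
    obtain n where "1 / real (Suc n) < min (\<tau> - a) (b - \<tau>)" using nat_approx_posE[of "min (\<tau> - a) (b - \<tau>)"] t by auto
    then show "x \<in> (\<Union>n. (\<lambda>\<tau>. A + \<tau> *\<^sub>R v) ` {a + 1 / real (Suc n)..b - 1 / real (Suc n)})"
      using t by (intro UN_I[of n] image_eqI[of _ _ \<tau>]) auto
  next
    fix x assume "x \<in> (\<Union>n. (\<lambda>\<tau>. A + \<tau> *\<^sub>R v) ` {a + 1 / real (Suc n)..b - 1 / real (Suc n)})"
    then obtain n \<tau> where t: "a + 1 / real (Suc n) \<le> \<tau>" "\<tau> \<le> b - 1 / real (Suc n)" "x = A + \<tau> *\<^sub>R v" by auto
    have "1 / real (Suc n) > 0" by simp
    then have "a < \<tau>" "\<tau> < b" using t by linarith+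
    then show "x \<in> (\<lambda>\<tau>. A + \<tau> *\<^sub>R v) ` {a<..<b}" using t by (intro image_eqI[of _ _ \<tau>]) auto
  qed
  moreover have "closed ((\<lambda>\<tau>. A + \<tau> *\<^sub>R v) ` {p..q})" for p q
    by (intro compact_imp_closed compact_continuous_image continuous_intros) auto
  ultimately show ?thesis by (auto intro!: sets.countable_UN borel_closed)
qed

lemma density_restrict:
  assumes v: "norm v = 1" and r': "0 < r'" "r' \<le> r" and E: "E \<in> sets borel"
    and d: "\<And>E. E \<in> sets borel \<Longrightarrow> emeasure \<mu> (E \<inter> (\<lambda>\<tau>. A + \<tau> *\<^sub>R v) ` {0<..<r}) = ennreal c * arclen A v r E"
  shows "emeasure \<mu> (E \<inter> (\<lambda>\<tau>. A + \<tau> *\<^sub>R v) ` {0<..<r'}) = ennreal c * arclen A v r' E"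
proof -
  let ?R = "\<lambda>r. (\<lambda>\<tau>. A + \<tau> *\<^sub>R v) ` {0<..<r}"
  have v0: "v \<noteq> 0" using v by auto
  have "E \<inter> ?R r' = (E \<inter> ?R r') \<inter> ?R r" using r' by auto
  then have "emeasure \<mu> (E \<inter> ?R r') = ennreal c * arclen A v r (E \<inter> ?R r')" using d[of "E \<inter> ?R r'"] E ray_borel by auto
  also have "{\<tau> \<in> {0<..<r}. A + \<tau> *\<^sub>R v \<in> E \<inter> ?R r'} = {\<tau> \<in> {0<..<r'}. A + \<tau> *\<^sub>R v \<in> E}"
    using r' v0 by auto
  then have "arclen A v r (E \<inter> ?R r') = arclen A v r' E" by (simp add: arclen_def)
  finally show ?thesis .
qed

lemma arclen_UNIV: "r > 0 \<Longrightarrow> arclen A v r UNIV = ennreal r"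
proof -
  assume "r > 0"
  moreover have "{\<tau> \<in> {0<..<r}. A + \<tau> *\<^sub>R v \<in> UNIV} = {0<..<r}" by auto
  ultimately show ?thesis unfolding arclen_def by simp
qed

lemma density_mono:
  assumes v: "norm v = 1" and "has_density \<mu> A v c" "has_density \<nu> A v c'"
    and le: "\<And>E. E \<in> sets borel \<Longrightarrow> emeasure \<mu> E \<le> emeasure \<nu> E"
  shows "c \<le> c'"
proof -
  let ?R = "\<lambda>r. (\<lambda>\<tau>. A + \<tau> *\<^sub>R v) ` {0<..<r}"
  obtain r where r: "r > 0" "\<And>E. E \<in> sets borel \<Longrightarrow> emeasure \<mu> (E \<inter> ?R r) = ennreal c * arclen A v r E" and c: "c \<ge> 0"
    using assms(2) unfolding has_density_arc[OF v] by blast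
  obtain r' where r': "r' > 0" "\<And>E. E \<in> sets borel \<Longrightarrow> emeasure \<nu> (E \<inter> ?R r') = ennreal c' * arclen A v r' E" and c': "c' \<ge> 0"
    using assms(3) unfolding has_density_arc[OF v] by blast
  let ?m = "min r r'"
  have m: "?m > 0" using r r' by simp
  have "emeasure \<mu> (UNIV \<inter> ?R ?m) = ennreal c * arclen A v ?m UNIV"
    by (rule density_restrict[OF v m _ _ r(2)]) auto
  then have "ennreal c * ennreal ?m = emeasure \<mu> (UNIV \<inter> ?R ?m)" unfolding arclen_UNIV[OF m] by (rule sym)
  also have "\<dots> \<le> emeasure \<nu> (UNIV \<inter> ?R ?m)" using le ray_borel by auto
  also have "\<dots> = ennreal c' * arclen A v ?m UNIV"
    by (rule density_restrict[OF v m _ _ r'(2)]) auto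
  also have "\<dots> = ennreal c' * ennreal ?m" unfolding arclen_UNIV[OF m] ..
  finally have "ennreal (c * ?m) \<le> ennreal (c' * ?m)" using c c' m by (simp only: ennreal_mult less_imp_le)
  then have "c * ?m \<le> c' * ?m" using m c' by (subst (asm) ennreal_le_iff) auto
  then show ?thesis using m by (rule mult_right_le_imp_le)
qed

lemma density_unique: "norm v = 1 \<Longrightarrow> has_density \<mu> A v c \<Longrightarrow> has_density \<mu> A v c' \<Longrightarrow> c = c'"
  using density_mono[of v \<mu> A c \<mu> c'] density_mono[of v \<mu> A c' \<mu> c] by auto

lemma dens_eqI: "norm v = 1 \<Longrightarrow> has_density \<mu> A v c \<Longrightarrow> dens \<mu> A v = c"
  unfolding dens_def using density_unique by blast

lemma has_density_dens: "norm v = 1 \<Longrightarrow> \<exists>c. has_density \<mu> A v c \<Longrightarrow> has_density \<mu> A v (dens \<mu> A v)"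
  using dens_eqI by metis

context hex
begin

text \<open>\<open>cone_M\<close> read in six directions. As balance is stated for every
  \<open>k\<close>, the same set results whether the \<open>w j\<close> have even or odd indices, as
  happens for a measure and for its dual.\<close>

definition coneD :: "(real^2) measure set" where
  "coneD = {\<mu>. sets \<mu> = sets borel \<and>
     (\<exists>L. finite L \<and> supp \<mu> \<subseteq> (\<Union>(P, k)\<in>L. {P + t *\<^sub>R dir k | t. True})) \<and>
     (\<forall>x. emeasure \<mu> {x} = 0) \<and> (\<forall>A k. \<exists>c. has_density \<mu> A (dir k) c) \<and>
     (\<forall>A k. dens \<mu> A (dir (k + 2)) - dens \<mu> A (dir (k + 5)) = dens \<mu> A (dir k) - dens \<mu> A (dir (k + 3)))}"

lemma coneD_dens: "\<mu> \<in> coneD \<Longrightarrow> has_density \<mu> A (dir k) (dens \<mu> A (dir k))"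
  by (rule has_density_dens) (auto simp: coneD_def)

lemma line_borel: "{P + t *\<^sub>R dir k | t. True} = {x. off k x = off k P}"
proof (intro equalityI subsetI)
  fix x assume "x \<in> {x. off k x = off k P}"
  then have "x - P = (- off (k + 1) (x - P)) *\<^sub>R dir k" by (intro on_lineD) simp
  then have "x = P + (- off (k + 1) (x - P)) *\<^sub>R dir k" by (simp add: algebra_simps)
  then show "x \<in> {P + t *\<^sub>R dir k | t. True}" by blast
qed auto

lemma continuous_off [continuous_intros]: "continuous_on S (off k)"
  unfolding off_def by (intro continuous_intros)

lemma closed_line: "closed {x. off k x = c}"
  by (intro closed_Collect_eq continuous_off continuous_on_const)

abbreviation ray :: "real^2 \<Rightarrow> 6 \<Rightarrow> real \<Rightarrow> (real^2) set" where
  "ray x k r \<equiv> (\<lambda>\<tau>. x + \<tau> *\<^sub>R dir k) ` {0<..<r}"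

text \<open>A small ball meets only those lines of the cover that pass through \<open>x\<close>. Up
  to the null set \<open>{x}\<close> the measure there lives on six segments, each of constant
  density.\<close>

lemma coneD_local:
  assumes mu: "\<mu> \<in> coneD"
  shows "\<forall>\<^sub>F r in at_right 0. \<forall>E\<in>sets borel. E \<subseteq> ball x r \<longrightarrow> emeasure \<mu> E = (\<Sum>k\<in>UNIV. ennreal (dens \<mu> x (dir k)) * arclen x (dir k) r E)"
proof -
  obtain L where L: "finite L" "supp \<mu> \<subseteq> (\<Union>(P, k)\<in>L. {P + t *\<^sub>R dir k | t. True})" and sm: "sets \<mu> = sets borel"
    and pts: "\<And>x. emeasure \<mu> {x} = 0" using mu by (auto simp: coneD_def)
  have "\<forall>\<^sub>F r in at_right 0. \<forall>(P, k)\<in>L. off k x \<noteq> off k P \<longrightarrow> ball x r \<inter> {y. off k y = off k P} = {}"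
  proof (rule eventually_ball_finite[OF L(1)], safe, goal_cases)
    case (1 P k)
    show ?case
    proof (cases "off k x = off k P")
      case False
      then obtain d where "d > 0" "ball x d \<subseteq> - {y. off k y = off k P}"
        using closed_line[of k "off k P"] unfolding closed_def open_contains_ball by force
      then show ?thesis by (intro eventually_at_rightI[of 0 d]) (auto simp: subset_eq)
    qed simp
  qed
  moreover have "\<forall>\<^sub>F r in at_right 0. \<forall>k\<in>UNIV. \<forall>E\<in>sets borel. emeasure \<mu> (E \<inter> ray x k r) = ennreal (dens \<mu> x (dir k)) * arclen x (dir k) r E"
  proof (rule eventually_ball_finite, simp, safe)
    fix k
    obtain r where r: "r > 0" "\<And>E. E \<in> sets borel \<Longrightarrow> emeasure \<mu> (E \<inter> ray x k r) = ennreal (dens \<mu> x (dir k)) * arclen x (dir k) r E"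
      using coneD_dens[OF mu, of x k] unfolding has_density_arc[OF norm_dir] by blast
    show "\<forall>\<^sub>F r in at_right 0. \<forall>E\<in>sets borel. emeasure \<mu> (E \<inter> ray x k r) = ennreal (dens \<mu> x (dir k)) * arclen x (dir k) r E"
    proof (rule eventually_at_rightI[of 0 r], safe)
      fix r' E assume "r' \<in> {0<..<r}" "E \<in> sets (borel :: (real^2) measure)"
      then show "emeasure \<mu> (E \<inter> ray x k r') = ennreal (dens \<mu> x (dir k)) * arclen x (dir k) r' E"
        by (intro density_restrict[OF norm_dir _ _ _ r(2)]) auto
    qed (use r in auto)
  qed
  ultimately show ?thesis
  proof (eventually_elim, safe)
    fix r E assume h: "\<forall>(P, k)\<in>L. off k x \<noteq> off k P \<longrightarrow> ball x r \<inter> {y. off k y = off k P} = {}"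
      "\<forall>k\<in>UNIV. \<forall>E\<in>sets borel. emeasure \<mu> (E \<inter> ray x k r) = ennreal (dens \<mu> x (dir k)) * arclen x (dir k) r E"
      "E \<in> sets borel" "E \<subseteq> ball x r"
    let ?R = "\<Union>k. ray x k r"
    have bR: "?R \<in> sets borel" by (auto intro!: sets.finite_UN ray_borel)
    have sub: "supp \<mu> \<inter> ball x r \<subseteq> {x} \<union> ?R"
    proof
      fix y assume y: "y \<in> supp \<mu> \<inter> ball x r"
      then obtain P k where Pk: "(P, k) \<in> L" "off k y = off k P" using L(2) by (force simp: line_borel)
      then have "off k x = off k P" using h(1) y by blast
      then have "off k (y - x) = 0" using Pk by simp
      then obtain t where t: "y - x = t *\<^sub>R dir k" using on_lineD by blast
      then have yt: "y = x + t *\<^sub>R dir k" by (simp add: algebra_simps)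
      have "\<bar>t\<bar> < r" using y yt by (simp add: dist_norm)
      then show "y \<in> {x} \<union> ?R"
      proof (cases "t = 0")
        case False
        have "y \<in> ray x (if t > 0 then k else k + 3) r"
          using yt False \<open>\<bar>t\<bar> < r\<close> by (intro image_eqI[of _ _ "\<bar>t\<bar>"]) auto
        then show ?thesis by blast
      qed (use yt in auto)
    qed
    have "emeasure \<mu> E = emeasure \<mu> (E \<inter> ?R) + emeasure \<mu> (E - ?R)"
      using h(3) bR sm by (subst plus_emeasure) (auto intro!: arg_cong[of _ _ "emeasure \<mu>"])
    also have "emeasure \<mu> (E - ?R) = 0"
    proof -
      have "emeasure \<mu> (E - ?R) \<le> emeasure \<mu> ({x} \<union> (E - ?R - {x}))" by (rule emeasure_mono) (use h(3) bR sm in auto)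
      also have "\<dots> \<le> emeasure \<mu> {x} + emeasure \<mu> (E - ?R - {x})" by (rule emeasure_subadditive) (use h(3) bR sm in auto)
      also have "emeasure \<mu> (E - ?R - {x}) = 0" by (rule emeasure_eq_0_off_supp[OF sm]) (use sub h(4) in auto)
      finally show ?thesis using pts by simp
    qed
    also have "E \<inter> ?R = (\<Union>k\<in>UNIV. E \<inter> ray x k r)" by auto
    also have "emeasure \<mu> (\<Union>k\<in>UNIV. E \<inter> ray x k r) = (\<Sum>k\<in>UNIV. emeasure \<mu> (E \<inter> ray x k r))"
    proof (rule sum_emeasure[symmetric])
      show "(\<lambda>k. E \<inter> ray x k r) ` UNIV \<subseteq> sets \<mu>" using h(3) ray_borel sm by auto
      have "k = l" if "0 < a" "0 < b" "x + a *\<^sub>R dir k = x + b *\<^sub>R dir l" for a b k l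
      proof -
        have *: "a *\<^sub>R dir k = b *\<^sub>R dir l" using that by simp
        show ?thesis using arg_cong[OF *, of "off k"] arg_cong[OF *, of "off (k + 1)"] six_rel[of l k] that by auto
      qed
      then show "disjoint_family_on (\<lambda>k. E \<inter> ray x k r) UNIV" by (auto simp: disjoint_family_on_def)
    qed simp
    also have "\<dots> = (\<Sum>k\<in>UNIV. ennreal (dens \<mu> x (dir k)) * arclen x (dir k) r E)" using h(2,3) by simp
    finally show "emeasure \<mu> E = (\<Sum>k\<in>UNIV. ennreal (dens \<mu> x (dir k)) * arclen x (dir k) r E)" by simp
  qed
qed

lemma coneD_eqI:
  assumes "\<mu> \<in> coneD" "\<nu> \<in> coneD" "\<And>x k. dens \<mu> x (dir k) = dens \<nu> x (dir k)"
  shows "\<mu> = \<nu>"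
proof (rule measure_eqI_local)
  show "sets \<mu> = sets borel" "sets \<nu> = sets borel" using assms by (auto simp: coneD_def)
  fix x
  have "\<forall>\<^sub>F r in at_right 0. 0 < r \<and> (\<forall>E\<in>sets borel. E \<subseteq> ball x r \<longrightarrow> emeasure \<mu> E = emeasure \<nu> E)"
    using coneD_local[OF assms(1), of x] coneD_local[OF assms(2), of x] eventually_at_right_less[of 0]
    by eventually_elim (simp add: assms(3))
  then have "\<exists>r. 0 < r \<and> (\<forall>E\<in>sets borel. E \<subseteq> ball x r \<longrightarrow> emeasure \<mu> E = emeasure \<nu> E)" by (rule eventually_at_right_ex)
  then obtain r where "0 < r \<and> (\<forall>E\<in>sets borel. E \<subseteq> ball x r \<longrightarrow> emeasure \<mu> E = emeasure \<nu> E)" by blast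
  then show "\<exists>U. open U \<and> x \<in> U \<and> (\<forall>E\<in>sets borel. E \<subseteq> U \<longrightarrow> emeasure \<mu> E = emeasure \<nu> E)"
    by (intro exI[of _ "ball x r"]) auto
qed

end

lemma density_supp:
  assumes sm: "sets \<mu> = sets borel" and v: "norm v = 1" and hd: "has_density \<mu> x v c" and c: "c > 0"
  shows "x \<in> supp \<mu>"
  unfolding supp_def
proof safe
  fix U assume U: "open U" "x \<in> U" "emeasure \<mu> U = 0"
  let ?R = "\<lambda>r. (\<lambda>\<tau>. x + \<tau> *\<^sub>R v) ` {0<..<r}"
  obtain r where r: "r > 0" "\<And>E. E \<in> sets borel \<Longrightarrow> emeasure \<mu> (E \<inter> ?R r) = ennreal c * arclen x v r E"
    using hd unfolding has_density_arc[OF v] by blast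
  obtain d where d: "d > 0" "ball x d \<subseteq> U" using U open_contains_ball by blast
  have m: "min r d > 0" using r d by simp
  have "?R (min r d) \<subseteq> U" using d v by (auto simp: dist_norm subset_eq)
  then have "emeasure \<mu> (UNIV \<inter> ?R (min r d)) \<le> emeasure \<mu> U" using U sm by (intro emeasure_mono) auto
  moreover have "emeasure \<mu> (UNIV \<inter> ?R (min r d)) = ennreal c * arclen x v (min r d) UNIV"
    by (rule density_restrict[OF v m _ _ r(2)]) auto
  ultimately have "ennreal c * ennreal (min r d) \<le> 0" using U(3) unfolding arclen_UNIV[OF m] by simp
  then show False using c m by (auto simp: ennreal_eq_0_iff)
qed

section \<open>The measure with given tripod weights\<close>

context hex
begin

definition pt :: "6 \<Rightarrow> real \<Rightarrow> real \<Rightarrow> real^2" where "pt k c t = c *\<^sub>R dir (k + 1) + t *\<^sub>R dir k"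

lemma off_pt [simp]: "off k (pt k c t) = c" "off (k + 1) (pt k c t) = - t"
  by (simp_all add: pt_def)

lemma pt_off: "pt k (off k x) (- off (k + 1) x) = x"
  using off_rep[of x k] by (simp add: pt_def)

lemma pt_shift: "pt k c (t + u) = pt k c t + u *\<^sub>R dir k"
  by (simp add: pt_def algebra_simps)

lemma pt_measurable [measurable]: "pt k c \<in> borel_measurable borel"
  unfolding pt_def by (intro borel_measurable_continuous_onI continuous_intros)

lemma D_pt_measurable [measurable]: "(\<lambda>t. D s (pt k c t) k) \<in> borel_measurable borel"
proof -
  have "(\<lambda>t. of_bool (hit k (pt k c t - A)) :: real) \<in> borel_measurable borel" for A
    by (cases "c = off k A"; cases "ev k") (auto simp: hit_def of_bool_def intro!: measurable_If)
  then show ?thesis unfolding D_def by (intro borel_measurable_sum borel_measurable_times) auto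
qed

definition lint :: "(real^2 \<Rightarrow> real) \<Rightarrow> 6 \<Rightarrow> real \<Rightarrow> (real^2) set \<Rightarrow> ennreal" where
  "lint s k c E = (\<integral>\<^sup>+t. ennreal (D s (pt k c t) k) * indicator E (pt k c t) \<partial>lborel)"

text \<open>Every line is integrated once, in its even direction; at all but finitely many of its
  points the densities in the two directions agree.\<close>

definition MM :: "(real^2 \<Rightarrow> real) \<Rightarrow> (real^2) measure" where
  "MM s = measure_of UNIV (sets borel) (\<lambda>E. \<Sum>k\<in>{0, 2, 4}. \<Sum>c\<in>off k ` {A. s A \<noteq> 0}. lint s k c E)"

lemma sets_MM [simp]: "sets (MM s) = sets borel"
  unfolding MM_def using sets.sigma_sets_eq[of "borel :: (real^2) measure"] by (simp add: sets_measure_of_conv)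

lemma space_MM [simp]: "space (MM s) = UNIV"
  unfolding MM_def by (simp add: space_measure_of_conv)

lemma emeasure_MM: assumes "E \<in> sets borel"
  shows "emeasure (MM s) E = (\<Sum>k\<in>{0, 2, 4}. \<Sum>c\<in>off k ` {A. s A \<noteq> 0}. lint s k c E)"
proof (rule emeasure_measure_of[OF MM_def])
  show "positive (sets (MM s)) (\<lambda>E. \<Sum>k\<in>{0, 2, 4}. \<Sum>c\<in>off k ` {A. s A \<noteq> 0}. lint s k c E)"
    by (simp add: positive_def lint_def)
  show "countably_additive (sets (MM s)) (\<lambda>E. \<Sum>k\<in>{0, 2, 4}. \<Sum>c\<in>off k ` {A. s A \<noteq> 0}. lint s k c E)"
  proof (rule countably_additiveI)
    fix F :: "nat \<Rightarrow> (real^2) set" assume F: "range F \<subseteq> sets (MM s)" "disjoint_family F"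
    have Fb: "F i \<in> sets borel" for i using F(1) by auto
    have l: "(\<Sum>i. lint s k c (F i)) = lint s k c (\<Union>i. F i)" for k c
    proof -
      have "(\<Sum>i. lint s k c (F i)) = (\<integral>\<^sup>+t. (\<Sum>i. ennreal (D s (pt k c t) k) * indicator (F i) (pt k c t)) \<partial>lborel)"
        unfolding lint_def by (rule nn_integral_suminf[symmetric]) (use Fb in measurable)
      also have "\<dots> = lint s k c (\<Union>i. F i)" unfolding lint_def
        by (rule nn_integral_cong) (simp add: suminf_cmult_indicator[OF F(2)] ennreal_suminf_cmult suminf_indicator[OF F(2)])
      finally show ?thesis .
    qed
    show "(\<Sum>i. \<Sum>k\<in>{0, 2, 4}. \<Sum>c\<in>off k ` {A. s A \<noteq> 0}. lint s k c (F i)) = (\<Sum>k\<in>{0, 2, 4}. \<Sum>c\<in>off k ` {A. s A \<noteq> 0}. lint s k c (\<Union>i. F i))"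
      by (subst suminf_sum, simp)+ (simp add: l suminf_sum)
  qed
qed (use assms in auto)

lemma lint_zero: assumes "c \<notin> off k ` {A. s A \<noteq> 0}" shows "lint s k c E = 0"
proof -
  have "D s (pt k c t) k = 0" for t using D_nz_line[of s "pt k c t" k] assms by force
  then show ?thesis by (simp add: lint_def)
qed

lemma emeasure_MM': assumes "E \<in> sets borel" "finite S" "{A. s A \<noteq> 0} \<subseteq> S"
  shows "emeasure (MM s) E = (\<Sum>k\<in>{0, 2, 4}. \<Sum>c\<in>off k ` S. lint s k c E)"
proof -
  have "(\<Sum>c\<in>off k ` {A. s A \<noteq> 0}. lint s k c E) = (\<Sum>c\<in>off k ` S. lint s k c E)" for k
    using assms lint_zero by (intro sum.mono_neutral_left) auto
  then show ?thesis using emeasure_MM[OF assms(1)] by simp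
qed

lemma lint_null:
  assumes "E \<in> sets borel" "finite {t. pt k c t \<in> E}" shows "lint s k c E = 0"
proof -
  have "AE t in lborel. t \<notin> {t. pt k c t \<in> E}"
    by (rule AE_not_in) (use assms(2) in \<open>auto intro: finite_imp_null_set_lborel\<close>)
  then have "AE t in lborel. ennreal (D s (pt k c t) k) * indicator E (pt k c t) = 0" by eventually_elim auto
  then have "lint s k c E = (\<integral>\<^sup>+(t::real). 0 \<partial>lborel)" unfolding lint_def by (rule nn_integral_cong_AE)
  then show ?thesis by simp
qed

lemma lint_ray:
  assumes "fs s" "ev l" "k = l \<or> k = l + 3" "r > 0" "\<And>\<tau>. 0 < \<tau> \<Longrightarrow> \<tau> < r \<Longrightarrow> s (x + \<tau> *\<^sub>R dir k) = 0" and E: "E \<in> sets borel"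
  shows "lint s l (off l x) (E \<inter> ray x k r) = ennreal (D s x k) * arclen x (dir k) r E"
proof -
  define q :: real where "q = (if k = l then 1 else - 1)"
  have q: "dir k = q *\<^sub>R dir l" "\<bar>q\<bar> = 1" using assms(3) by (auto simp: q_def)
  have ptq: "pt l (off l x) (- off (l + 1) x + q * \<tau>) = x + \<tau> *\<^sub>R dir k" for \<tau>
    unfolding pt_shift pt_off q by simp
  have Dl: "D s (x + \<tau> *\<^sub>R dir k) l = D s x k" if "0 < \<tau>" "\<tau> < r" for \<tau>
  proof (cases "k = l")
    case True then show ?thesis using D_const'[OF assms(1), of \<tau> x k] that assms(5) by auto
  next
    case False
    then have "l = k + 3" using assms(3) by auto
    then show ?thesis using D_const[of \<tau> s x k] that assms(5) by auto
  qed
  let ?f = "\<lambda>t. ennreal (D s (pt l (off l x) t) l) * indicator (E \<inter> ray x k r) (pt l (off l x) t)"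
  have R: "E \<inter> ray x k r \<in> sets borel" using E ray_borel by auto
  have "lint s l (off l x) (E \<inter> ray x k r) = \<bar>q\<bar> * (\<integral>\<^sup>+\<tau>. ?f (- off (l + 1) x + q * \<tau>) \<partial>lborel)"
    unfolding lint_def by (rule nn_integral_real_affine) (use R q in \<open>auto simp: q_def\<close>)
  also have "\<dots> = (\<integral>\<^sup>+\<tau>. ennreal (D s x k) * indicator {\<tau> \<in> {0<..<r}. x + \<tau> *\<^sub>R dir k \<in> E} \<tau> \<partial>lborel)"
    unfolding ptq q(2) using Dl by (simp, intro nn_integral_cong) (auto simp: indicator_def image_iff)
  also have "\<dots> = ennreal (D s x k) * arclen x (dir k) r E"
    unfolding arclen_def using affine_vimage_sets[OF E, of "{0<..<r}"] by (subst nn_integral_cmult) auto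
  finally show ?thesis .
qed

text \<open>On a ray too short to contain weights, the line through it contributes its constant
  density, and any other line meets it in a null set.\<close>

lemma has_density_MM: assumes fs: "fs s" and pos: "pos s" shows "has_density (MM s) x (dir k) (D s x k)"
  unfolding has_density_arc[OF norm_dir]
proof (intro conjI)
  show "D s x k \<ge> 0" using pos by (simp add: pos_def)
  have "\<forall>\<^sub>F r in at_right 0. \<forall>A\<in>{A. s A \<noteq> 0} - {x}. r < dist x A"
    using fs by (intro eventually_ball_finite ballI) (auto simp: fs_def intro!: eventually_at_rightI[of 0])
  then have "\<forall>\<^sub>F r in at_right 0. 0 < r \<and> (\<forall>A\<in>{A. s A \<noteq> 0} - {x}. r < dist x A)"
    using eventually_at_right_less[of 0] by eventually_elim auto
  then have "\<exists>r. 0 < r \<and> (\<forall>A\<in>{A. s A \<noteq> 0} - {x}. r < dist x A)" by (rule eventually_at_right_ex)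
  then obtain r where r: "0 < r" "\<And>A. s A \<noteq> 0 \<Longrightarrow> A \<noteq> x \<Longrightarrow> r < dist x A" by blast
  have z: "s (x + \<tau> *\<^sub>R dir k) = 0" if "0 < \<tau>" "\<tau> < r" for \<tau>
    using r(2)[of "x + \<tau> *\<^sub>R dir k"] that by (auto simp: dist_norm)
  let ?l = "rep k"
  have l: "k = ?l \<or> k = ?l + 3" "ev ?l" by (auto simp: rep_def)
  let ?S = "insert x {A. s A \<noteq> 0}"
  have fS: "finite ?S" using fs by (simp add: fs_def)
  have "emeasure (MM s) (E \<inter> ray x k r) = ennreal (D s x k) * arclen x (dir k) r E" if E: "E \<in> sets borel" for E
  proof -
    have R: "E \<inter> ray x k r \<in> sets borel" using E ray_borel by auto
    have "lint s m c (E \<inter> ray x k r) = (if m = ?l \<and> c = off ?l x then ennreal (D s x k) * arclen x (dir k) r E else 0)" if m: "ev m" for m c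
    proof (cases "m = ?l")
      case True
      show ?thesis
      proof (cases "c = off ?l x")
        case False
        have "pt m c t \<notin> ray x k r" for t
        proof
          assume "pt m c t \<in> ray x k r"
          moreover have "off m (dir k) = 0" using True by (simp add: rep_def)
          ultimately obtain \<tau> where "pt m c t = x + \<tau> *\<^sub>R dir k" "off m (dir k) = 0" by auto
          then have "off m (pt m c t) = off m x" by (simp del: off_pt)
          then show False using False True by simp
        qed
        then have "finite {t. pt m c t \<in> E \<inter> ray x k r}" by simp
        from lint_null[OF R this] show ?thesis using False by simp
      qed (use lint_ray[OF fs l(2,1) r(1) z E] True in simp)
    next
      case False
      have nm: "m \<noteq> k" "m \<noteq> k + 3" using m l False by (auto simp: rep_def split: if_splits)
      have "t = t'" if "pt m c t \<in> ray x k r" "pt m c t' \<in> ray x k r" for t t'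
      proof -
        have "off k (pt m c t) = off k (pt m c t')" using that by auto
        then have "pt m c t = pt m c t'" by (intro off_eqI2[OF nm]) auto
        then have "off (m + 1) (pt m c t) = off (m + 1) (pt m c t')" by (rule arg_cong)
        then show ?thesis by simp
      qed
      then have "finite {t. pt m c t \<in> E \<inter> ray x k r}"
        by (cases "{t. pt m c t \<in> E \<inter> ray x k r} = {}") (auto intro!: finite_subset[of _ "{SOME t. pt m c t \<in> ray x k r}"] intro: someI2)
      then show ?thesis using lint_null[OF R] False by simp
    qed
    then have "emeasure (MM s) (E \<inter> ray x k r) = (\<Sum>m\<in>{0, 2, 4}. \<Sum>c\<in>off m ` ?S. if m = ?l \<and> c = off ?l x then ennreal (D s x k) * arclen x (dir k) r E else 0)"
      by (subst emeasure_MM'[OF R fS]) (auto simp: Collect_ev[symmetric] simp del: image_insert intro!: sum.cong)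
    also have "\<dots> = (\<Sum>m\<in>{0, 2, 4}. if m = ?l then ennreal (D s x k) * arclen x (dir k) r E else 0)"
      by (rule sum.cong) (use fS in \<open>auto simp: sum.delta\<close>)
    also have "\<dots> = ennreal (D s x k) * arclen x (dir k) r E" using l(2) by (subst sum.delta) (auto simp: ev_def)
    finally show ?thesis .
  qed
  then show "\<exists>r>0. \<forall>E\<in>sets borel. emeasure (MM s) (E \<inter> ray x k r) = ennreal (D s x k) * arclen x (dir k) r E" using r(1) by blast
qed

lemma dens_MM: "fs s \<Longrightarrow> pos s \<Longrightarrow> dens (MM s) x (dir k) = D s x k"
  by (rule dens_eqI[OF norm_dir has_density_MM])

lemma MM_coneD: assumes fs: "fs s" and pos: "pos s" shows "MM s \<in> coneD"
proof -
  interpret hexs dir s by unfold_locales (use assms in auto)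
  let ?L = "\<Union>k\<in>{0, 2, 4}. \<Union>A\<in>{A. s A \<noteq> 0}. {y. off k y = off k A}"
  have cl: "closed ?L" using fs by (auto intro!: closed_UN closed_line simp: fs_def)
  have "emeasure (MM s) (- ?L) = 0"
  proof -
    have "lint s k c (- ?L) = 0" if "k \<in> {0, 2, 4}" "c \<in> off k ` {A. s A \<noteq> 0}" for k c
    proof -
      have "pt k c t \<in> ?L" for t using that by force
      then have "indicator (- ?L) (pt k c t) = (0::ennreal)" for t by (simp only: indicator_simps Compl_iff not_not)
      then show ?thesis unfolding lint_def by simp
    qed
    moreover have "- ?L \<in> sets borel" by (rule borel_open) (use cl in \<open>simp only: closed_def\<close>)
    ultimately show ?thesis unfolding emeasure_MM[OF \<open>- ?L \<in> sets borel\<close>] by (intro sum.neutral ballI)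
  qed
  then have "supp (MM s) \<subseteq> ?L" using cl unfolding supp_def by (auto simp: closed_def)
  also have "?L \<subseteq> (\<Union>(P, k)\<in>{A. s A \<noteq> 0} \<times> {0, 2, 4}. {P + t *\<^sub>R dir k | t. True})" unfolding line_borel by force
  finally have "\<exists>L. finite L \<and> supp (MM s) \<subseteq> (\<Union>(P, k)\<in>L. {P + t *\<^sub>R dir k | t. True})"
    using fs by (intro exI[of _ "{A. s A \<noteq> 0} \<times> {0, 2, 4}"]) (auto simp: fs_def)
  moreover have "emeasure (MM s) {x} = 0" for x
  proof -
    have "lint s k c {x} = 0" for k c
    proof (rule lint_null)
      have "{t. pt k c t \<in> {x}} \<subseteq> {- off (k + 1) x}" by auto
      then show "finite {t. pt k c t \<in> {x}}" by (rule finite_subset) simp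
    qed simp
    then show ?thesis by (simp add: emeasure_MM)
  qed
  ultimately show ?thesis unfolding coneD_def
    using has_density_MM[OF assms] balance(1) by (auto simp: dens_MM[OF assms] simp del: dir_add)
qed

lemma MM_inj: assumes "fs s" "pos s" "fs s'" "pos s'" "MM s = MM s'" shows "s = s'"
proof
  fix x
  have "D s x k = D s' x k" for k using dens_MM[OF assms(1,2), of x k] dens_MM[OF assms(3,4), of x k] assms(5) by simp
  then show "s x = s' x" using D_jump[OF assms(1), of x 0] D_jump[OF assms(3), of x 0] by (simp add: sg_def)
qed

lemma MM_mono:
  assumes "fs s" "fs s'" "\<And>x k. D s x k \<le> D s' x k" "E \<in> sets borel"
  shows "emeasure (MM s) E \<le> emeasure (MM s') E"
proof -
  let ?S = "{A. s A \<noteq> 0} \<union> {A. s' A \<noteq> 0}"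
  have f: "finite ?S" using assms by (auto simp: fs_def)
  have 1: "emeasure (MM s) E = (\<Sum>k\<in>{0, 2, 4}. \<Sum>c\<in>off k ` ?S. lint s k c E)"
    "emeasure (MM s') E = (\<Sum>k\<in>{0, 2, 4}. \<Sum>c\<in>off k ` ?S. lint s' k c E)"
    by (rule emeasure_MM'[OF assms(4) f]; auto)+
  have "lint s k c E \<le> lint s' k c E" for k c
    unfolding lint_def by (intro nn_integral_mono mult_right_mono ennreal_leI assms(3)) auto
  then show ?thesis unfolding 1 by (intro sum_mono)
qed

lemma MM_sum:
  assumes "finite I" "\<And>i. i \<in> I \<Longrightarrow> fs (f i)" "\<And>i. i \<in> I \<Longrightarrow> pos (f i)" "E \<in> sets borel"
  shows "emeasure (MM (\<lambda>A. \<Sum>i\<in>I. f i A)) E = (\<Sum>i\<in>I. emeasure (MM (f i)) E)"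
proof -
  let ?S = "\<Union>i\<in>I. {A. f i A \<noteq> 0}"
  have fS: "finite ?S" using assms by (auto simp: fs_def)
  have "(\<Sum>i\<in>I. f i A) \<noteq> 0 \<Longrightarrow> \<exists>i\<in>I. f i A \<noteq> 0" for A by (metis sum.neutral)
  then have sub: "{A. (\<Sum>i\<in>I. f i A) \<noteq> 0} \<subseteq> ?S" by auto
  have l: "lint (\<lambda>A. \<Sum>i\<in>I. f i A) k c E = (\<Sum>i\<in>I. lint (f i) k c E)" for k c
  proof -
    have "lint (\<lambda>A. \<Sum>i\<in>I. f i A) k c E = (\<integral>\<^sup>+t. (\<Sum>i\<in>I. ennreal (D (f i) (pt k c t) k) * indicator E (pt k c t)) \<partial>lborel)"
      unfolding lint_def
    proof (rule nn_integral_cong)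
      fix t
      have "ennreal (D (\<lambda>A. \<Sum>i\<in>I. f i A) (pt k c t) k) = (\<Sum>i\<in>I. ennreal (D (f i) (pt k c t) k))"
        using assms(2,3) by (subst D_sum) (auto simp: pos_def sum_ennreal)
      then show "ennreal (D (\<lambda>A. \<Sum>i\<in>I. f i A) (pt k c t) k) * indicator E (pt k c t) = (\<Sum>i\<in>I. ennreal (D (f i) (pt k c t) k) * indicator E (pt k c t))"
        by (simp add: sum_distrib_right)
    qed
    also have "\<dots> = (\<Sum>i\<in>I. lint (f i) k c E)" unfolding lint_def by (rule nn_integral_sum) (use assms(4) in measurable)
    finally show ?thesis .
  qed
  have "emeasure (MM (f i)) E = (\<Sum>k\<in>{0, 2, 4}. \<Sum>c\<in>off k ` ?S. lint (f i) k c E)" if "i \<in> I" for i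
    using that by (intro emeasure_MM'[OF assms(4) fS]) auto
  then have "(\<Sum>i\<in>I. emeasure (MM (f i)) E) = (\<Sum>i\<in>I. \<Sum>k\<in>{0, 2, 4}. \<Sum>c\<in>off k ` ?S. lint (f i) k c E)" by simp
  also have "\<dots> = (\<Sum>k\<in>{0, 2, 4}. \<Sum>c\<in>off k ` ?S. \<Sum>i\<in>I. lint (f i) k c E)"
    by (subst sum.swap, rule sum.cong[OF refl], rule sum.swap)
  also have "\<dots> = emeasure (MM (\<lambda>A. \<Sum>i\<in>I. f i A)) E" by (subst emeasure_MM'[OF assms(4) fS sub]) (simp add: l)
  finally show ?thesis by simp
qed

lemma MM_scale: assumes "fs s" "c \<ge> 0" shows "MM (\<lambda>A. c * s A) = scale_measure (ennreal c) (MM s)"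
proof (rule measure_eqI)
  fix E assume "E \<in> sets (MM (\<lambda>A. c * s A))"
  then have E: "E \<in> sets borel" by simp
  have f: "finite {A. s A \<noteq> 0}" using assms by (simp add: fs_def)
  have "lint (\<lambda>A. c * s A) k x E = ennreal c * lint s k x E" for k x
    unfolding lint_def D_scale[OF assms(1)] using assms(2) E
    by (subst nn_integral_cmult[symmetric]) (auto simp: ennreal_mult' mult.assoc intro!: nn_integral_cong)
  moreover have "emeasure (MM (\<lambda>A. c * s A)) E = (\<Sum>k\<in>{0, 2, 4}. \<Sum>x\<in>off k ` {A. s A \<noteq> 0}. lint (\<lambda>A. c * s A) k x E)"
    by (rule emeasure_MM'[OF E f]) auto
  ultimately show "emeasure (MM (\<lambda>A. c * s A)) E = emeasure (scale_measure (ennreal c) (MM s)) E"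
    using E by (simp only: emeasure_scale_measure emeasure_MM[OF E] sum_distrib_left)
qed simp

lemma MM_zero: "MM (\<lambda>A. 0) = null_measure borel"
  by (rule measure_eqI) (auto simp: emeasure_MM)

lemma supp_MM: assumes fs: "fs s" and pos: "pos s" shows "supp (MM s) = {x. \<exists>k. pr s x k}"
proof -
  note c = MM_coneD[OF assms]
  have "x \<in> supp (MM s)" if x: "pr s x k" for x k
    using density_supp[OF sets_MM norm_dir has_density_MM[OF assms]] x by (simp add: pr_def)
  moreover have "x \<notin> supp (MM s)" if "\<And>k. \<not> pr s x k" for x
  proof -
    have z: "D s x k = 0" for k using that[of k] pos by (auto simp: pr_def pos_def not_less intro: antisym)
    have "\<forall>\<^sub>F r in at_right 0. 0 < r \<and> (\<forall>E\<in>sets borel. E \<subseteq> ball x r \<longrightarrow> emeasure (MM s) E = 0)"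
      using coneD_local[OF c, of x] eventually_at_right_less[of 0]
      by eventually_elim (simp add: dens_MM[OF assms] z)
    then have "\<exists>r. 0 < r \<and> (\<forall>E\<in>sets borel. E \<subseteq> ball x r \<longrightarrow> emeasure (MM s) E = 0)" by (rule eventually_at_right_ex)
  then obtain r where "0 < r \<and> (\<forall>E\<in>sets borel. E \<subseteq> ball x r \<longrightarrow> emeasure (MM s) E = 0)" by blast
    then have "open (ball x r) \<and> x \<in> ball x r \<and> emeasure (MM s) (ball x r) = 0" by auto
    then show ?thesis unfolding supp_def by blast
  qed
  ultimately show ?thesis by blast
qed

end

lemma emeasure_lborel_reflect:
  assumes "S \<in> sets borel" "\<bar>q\<bar> = 1" shows "emeasure lborel {\<sigma>. a + q * \<sigma> \<in> S} = emeasure lborel (S :: real set)"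
proof -
  have "(\<lambda>\<sigma>. a + q * \<sigma>) -` S \<inter> space borel \<in> sets borel"
    by (rule measurable_sets[OF _ assms(1)]) measurable
  then have m: "{\<sigma>. a + q * \<sigma> \<in> S} \<in> sets borel" by (simp add: vimage_def)
  have "emeasure lborel S = (\<integral>\<^sup>+t. indicator S t \<partial>lborel)" using assms(1) by simp
  also have "\<dots> = \<bar>q\<bar> * (\<integral>\<^sup>+t. indicator S (a + q * t) \<partial>lborel)"
    by (rule nn_integral_real_affine) (use assms in auto)
  also have "\<dots> = (\<integral>\<^sup>+t. indicator {\<sigma>. a + q * \<sigma> \<in> S} t \<partial>lborel)"
    unfolding assms(2) by (simp add: indicator_def)
  also have "\<dots> = emeasure lborel {\<sigma>. a + q * \<sigma> \<in> S}" using m by simp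
  finally show ?thesis by simp
qed

section \<open>Recovering the weights from the densities\<close>

context hex
begin

lemma dens_near:
  assumes mu: "\<mu> \<in> coneD"
  shows "\<exists>e>0. \<forall>\<tau>. 0 < \<tau> \<longrightarrow> \<tau> < e \<longrightarrow> dens \<mu> (x + \<tau> *\<^sub>R dir k) (dir k) = dens \<mu> x (dir k) \<and>
    dens \<mu> (x + \<tau> *\<^sub>R dir k) (dir (k + 3)) = dens \<mu> x (dir k)"
proof -
  let ?c = "dens \<mu> x (dir k)"
  obtain r where r: "r > 0" "?c \<ge> 0" "\<And>E. E \<in> sets borel \<Longrightarrow> emeasure \<mu> (E \<inter> ray x k r) = ennreal ?c * arclen x (dir k) r E"
    using coneD_dens[OF mu, of x k] unfolding has_density_arc[OF norm_dir] by blast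
  have "dens \<mu> (x + \<tau> *\<^sub>R dir k) (dir l) = ?c" if t: "0 < \<tau>" "\<tau> < r" and l: "l = k \<or> l = k + 3" for \<tau> l
  proof (rule dens_eqI[OF norm_dir])
    define q :: real where "q = (if l = k then 1 else - 1)"
    have q: "dir l = q *\<^sub>R dir k" "\<bar>q\<bar> = 1" using l by (auto simp: q_def)
    define \<rho> where "\<rho> = (if l = k then r - \<tau> else \<tau>)"
    let ?y = "x + \<tau> *\<^sub>R dir k"
    have y: "?y + \<sigma> *\<^sub>R dir l = x + (\<tau> + q * \<sigma>) *\<^sub>R dir k" for \<sigma> by (simp add: q algebra_simps)
    have "emeasure \<mu> (E \<inter> ray ?y l \<rho>) = ennreal ?c * arclen ?y (dir l) \<rho> E" if E: "E \<in> sets borel" for E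
    proof -
      have sub: "ray ?y l \<rho> \<subseteq> ray x k r"
      proof
        fix z assume "z \<in> ray ?y l \<rho>"
        then obtain \<sigma> where s: "0 < \<sigma>" "\<sigma> < \<rho>" "z = ?y + \<sigma> *\<^sub>R dir l" by auto
        have "0 < \<tau> + q * \<sigma>" "\<tau> + q * \<sigma> < r" using s t by (auto simp: q_def \<rho>_def split: if_splits)
        then show "z \<in> ray x k r" unfolding s(3) y by auto
      qed
      then have "E \<inter> ray ?y l \<rho> = (E \<inter> ray ?y l \<rho>) \<inter> ray x k r" by blast
      then have "emeasure \<mu> (E \<inter> ray ?y l \<rho>) = ennreal ?c * arclen x (dir k) r (E \<inter> ray ?y l \<rho>)"
        using r(3)[of "E \<inter> ray ?y l \<rho>"] E ray_borel by auto
      also have "arclen x (dir k) r (E \<inter> ray ?y l \<rho>) = arclen ?y (dir l) \<rho> E"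
      proof -
        let ?S = "{\<tau> \<in> {0<..<r}. x + \<tau> *\<^sub>R dir k \<in> E \<inter> ray ?y l \<rho>}"
        have "emeasure lborel {\<sigma>. \<tau> + q * \<sigma> \<in> ?S} = emeasure lborel ?S"
          by (rule emeasure_lborel_reflect[OF affine_vimage_sets q(2)]) (use E ray_borel in auto)
        moreover have "\<tau> + q * \<sigma> \<in> ?S \<longleftrightarrow> 0 < \<sigma> \<and> \<sigma> < \<rho> \<and> ?y + \<sigma> *\<^sub>R dir l \<in> E" for \<sigma>
        proof -
          have "x + (\<tau> + q * \<sigma>) *\<^sub>R dir k \<in> ray ?y l \<rho> \<longleftrightarrow> 0 < \<sigma> \<and> \<sigma> < \<rho>"
            unfolding y[symmetric] by (auto simp: inj_image_mem_iff)
          moreover have "0 < \<sigma> \<Longrightarrow> \<sigma> < \<rho> \<Longrightarrow> 0 < \<tau> + q * \<sigma> \<and> \<tau> + q * \<sigma> < r" using t by (auto simp: q_def \<rho>_def split: if_splits)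
          ultimately show ?thesis unfolding y by auto
        qed
        ultimately show ?thesis by (simp add: arclen_def)
      qed
      finally show ?thesis .
    qed
    moreover have "\<rho> > 0" using t by (simp add: \<rho>_def)
    ultimately show "has_density \<mu> ?y (dir l) ?c" unfolding has_density_arc[OF norm_dir] using r(2) by blast
  qed
  then show ?thesis using r(1) by blast
qed

text \<open>At each inner point the density is constant for a while on either side, and the
  hypothesis equates the two sides; connectedness does the rest.\<close>

lemma dens_const:
  assumes mu: "\<mu> \<in> coneD" and t: "t > 0"
    and z: "\<And>\<tau>. 0 < \<tau> \<Longrightarrow> \<tau> < t \<Longrightarrow> dens \<mu> (x + \<tau> *\<^sub>R dir k) (dir (k + 3)) = dens \<mu> (x + \<tau> *\<^sub>R dir k) (dir k)"
  shows "dens \<mu> (x + t *\<^sub>R dir k) (dir (k + 3)) = dens \<mu> x (dir k)"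
proof -
  let ?h = "\<lambda>\<tau>. dens \<mu> (x + \<tau> *\<^sub>R dir k) (dir k)"
  have bwd: "x + a *\<^sub>R dir k + \<sigma> *\<^sub>R dir (k + 3) = x + (a - \<sigma>) *\<^sub>R dir k" for a \<sigma> by (simp add: algebra_simps)
  have const: "?h a = ?h b" if ab: "a \<in> {0<..<t}" "b \<in> {0<..<t}" for a b
  proof (rule connected_local_const[of "{0<..<t}" a b ?h])
    show "connected {0<..<t}" by simp
    show "\<forall>a\<in>{0<..<t}. \<forall>\<^sub>F b in at a within {0<..<t}. ?h a = ?h b"
    proof
      fix a assume a: "a \<in> {0<..<t}"
      let ?y = "x + a *\<^sub>R dir k"
      obtain e1 where e1: "e1 > 0" "\<And>\<tau>. 0 < \<tau> \<Longrightarrow> \<tau> < e1 \<Longrightarrow> dens \<mu> (?y + \<tau> *\<^sub>R dir k) (dir k) = dens \<mu> ?y (dir k)"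
        using dens_near[OF mu, of ?y k] by blast
      obtain e2 where e2: "e2 > 0" "\<And>\<tau>. 0 < \<tau> \<Longrightarrow> \<tau> < e2 \<Longrightarrow> dens \<mu> (?y + \<tau> *\<^sub>R dir (k + 3)) (dir (k + 3 + 3)) = dens \<mu> ?y (dir (k + 3))"
        using dens_near[OF mu, of ?y "k + 3"] by blast
      have "?h a = ?h b" if b: "b \<noteq> a" "dist b a < min e1 e2" for b
      proof (cases "b > a")
        case True
        have "?y + (b - a) *\<^sub>R dir k = x + b *\<^sub>R dir k" by (simp add: algebra_simps)
        moreover have "dens \<mu> (?y + (b - a) *\<^sub>R dir k) (dir k) = ?h a"
          by (rule e1(2)) (use b True in \<open>auto simp: dist_real_def\<close>)
        ultimately show ?thesis by (simp only:)
      next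
        case False
        have "?y + (a - b) *\<^sub>R dir (k + 3) = x + b *\<^sub>R dir k" unfolding bwd by simp
        moreover have "dens \<mu> (?y + (a - b) *\<^sub>R dir (k + 3)) (dir (k + 3 + 3)) = dens \<mu> ?y (dir (k + 3))"
          by (rule e2(2)) (use b False in \<open>auto simp: dist_real_def\<close>)
        moreover have "k + 3 + 3 = k" by simp
        ultimately have "dens \<mu> (x + b *\<^sub>R dir k) (dir k) = dens \<mu> ?y (dir (k + 3))" by (simp only:)
        then show ?thesis using z[of a] a by simp
      qed
      then show "\<forall>\<^sub>F b in at a within {0<..<t}. ?h a = ?h b"
        unfolding eventually_at using e1(1) e2(1) by (intro exI[of _ "min e1 e2"]) auto
    qed
  qed (use ab in auto)
  obtain e1 where e1: "e1 > 0" "\<And>\<tau>. 0 < \<tau> \<Longrightarrow> \<tau> < e1 \<Longrightarrow> ?h \<tau> = dens \<mu> x (dir k)"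
    using dens_near[OF mu, of x k] by blast
  obtain e2 where e2: "e2 > 0" "\<And>\<tau>. 0 < \<tau> \<Longrightarrow> \<tau> < e2 \<Longrightarrow> dens \<mu> (x + t *\<^sub>R dir k + \<tau> *\<^sub>R dir (k + 3)) (dir (k + 3 + 3)) = dens \<mu> (x + t *\<^sub>R dir k) (dir (k + 3))"
    using dens_near[OF mu, of "x + t *\<^sub>R dir k" "k + 3"] by blast
  define a where "a = min e1 t / 2"
  define b where "b = t - min e2 t / 2"
  have "?h b = dens \<mu> (x + t *\<^sub>R dir k) (dir (k + 3))"
    using e2(2)[of "min e2 t / 2"] e2(1) t unfolding bwd b_def by (simp del: dir_add)
  moreover have "?h a = dens \<mu> x (dir k)" using e1 t by (simp add: a_def)
  moreover have "?h a = ?h b" using e1 e2 t by (intro const) (auto simp: a_def b_def)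
  ultimately show ?thesis by simp
qed

text \<open>Pigeonhole: infinitely many points of the germ lie on finitely many lines, so some line
  contains two of them and is parallel to the germ.\<close>

lemma dens_nz_line:
  assumes mu: "\<mu> \<in> coneD" and Ls: "finite Ls" "supp \<mu> \<subseteq> (\<Union>(P, k)\<in>Ls. {P + t *\<^sub>R dir k | t. True})" and nz: "dens \<mu> x (dir k) \<noteq> 0"
  shows "\<exists>(P, l)\<in>Ls. (l = k \<or> l = k + 3) \<and> off l x = off l P"
proof -
  obtain e where e: "e > 0" "\<And>\<tau>. 0 < \<tau> \<Longrightarrow> \<tau> < e \<Longrightarrow> dens \<mu> (x + \<tau> *\<^sub>R dir k) (dir k) = dens \<mu> x (dir k)"
    using dens_near[OF mu, of x k] by blast
  have "dens \<mu> x (dir k) > 0" using coneD_dens[OF mu, of x k] nz by (simp add: has_density_def)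
  then have "x + \<tau> *\<^sub>R dir k \<in> supp \<mu>" if "0 < \<tau>" "\<tau> < e" for \<tau>
    using density_supp[OF _ norm_dir coneD_dens[OF mu, of "x + \<tau> *\<^sub>R dir k" k]] e(2)[OF that] mu by (auto simp: coneD_def)
  then have "\<exists>p\<in>Ls. off (snd p) (x + \<tau> *\<^sub>R dir k) = off (snd p) (fst p)" if "\<tau> \<in> {0<..<e}" for \<tau>
  proof -
    have "x + \<tau> *\<^sub>R dir k \<in> (\<Union>(P, k)\<in>Ls. {x. off k x = off k P})"
      by (rule subsetD[OF Ls(2)[unfolded line_borel]])
        (use that \<open>\<And>\<tau>. 0 < \<tau> \<Longrightarrow> \<tau> < e \<Longrightarrow> x + \<tau> *\<^sub>R dir k \<in> supp \<mu>\<close> in simp)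
    then show ?thesis by force
  qed
  then obtain f where f: "\<And>\<tau>. \<tau> \<in> {0<..<e} \<Longrightarrow> f \<tau> \<in> Ls \<and> off (snd (f \<tau>)) (x + \<tau> *\<^sub>R dir k) = off (snd (f \<tau>)) (fst (f \<tau>))" by metis
  have "\<not> inj_on f {0<..<e}"
  proof
    assume "inj_on f {0<..<e}"
    moreover have "finite (f ` {0<..<e})" by (rule finite_subset[OF _ Ls(1)]) (use f in blast)
    ultimately show False using finite_imageD infinite_Ioo[OF e(1)] by blast
  qed
  then obtain a b where ab: "a \<in> {0<..<e}" "b \<in> {0<..<e}" "a \<noteq> b" "f a = f b" by (auto simp: inj_on_def)
  obtain P l where p: "f a = (P, l)" by force
  have h: "off l (x + a *\<^sub>R dir k) = off l P" "off l (x + b *\<^sub>R dir k) = off l P" using f[OF ab(1)] f[OF ab(2)] unfolding ab(4)[symmetric] p by simp_all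
  then have "(a - b) * off l (dir k) = 0" unfolding off_lin left_diff_distrib by linarith
  then have 0: "off l (dir k) = 0" using ab(3) by simp
  then have "l = k \<or> l = k + 3" using six_rel[of l k] by auto
  moreover have "off l x = off l P" using h(1) 0 by simp
  moreover have "(P, l) \<in> Ls" using f[OF ab(1)] p by simp
  ultimately show ?thesis by blast
qed

text \<open>The weights are the jumps of the density. Densities in odd directions are found by going
  outwards to where they vanish, which is the use of the hypothesis at infinity; the even ones
  follow from the jumps.\<close>

lemma coneD_rep:
  assumes mu: "\<mu> \<in> coneD"
    and far: "\<And>x k. \<not> ev k \<Longrightarrow> \<forall>\<^sub>F t in at_top. dens \<mu> (x + t *\<^sub>R dir k) (dir k) = 0"
  shows "\<exists>s. fs s \<and> pos s \<and> \<mu> = MM s \<and> (\<forall>x k. D s x k = dens \<mu> x (dir k))"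
proof -
  define s where "s x = dens \<mu> x (dir 0) - dens \<mu> x (dir 3)" for x
  have bal: "dens \<mu> A (dir (k + 2)) - dens \<mu> A (dir (k + 5)) = dens \<mu> A (dir k) - dens \<mu> A (dir (k + 3))" for A k
    using mu unfolding coneD_def by blast
  have bal': "dens \<mu> x (dir k) - dens \<mu> x (dir (k + 3)) = sg k * s x" for x k
    using six_cases[of k] bal[of x 0] bal[of x 2] bal[of x 4]
    by (elim disjE; simp add: s_def sg_def del: dir_add)
  obtain Ls where Ls: "finite Ls" "supp \<mu> \<subseteq> (\<Union>(P, k)\<in>Ls. {P + t *\<^sub>R dir k | t. True})" using mu by (auto simp: coneD_def)
  have nz: "\<exists>(P, l)\<in>Ls. (l = k \<or> l = k + 3) \<and> off l x = off l P" if "s x \<noteq> 0" for x k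
  proof -
    have "dens \<mu> x (dir k) \<noteq> 0 \<or> dens \<mu> x (dir (k + 3)) \<noteq> 0" using bal'[of x k] that by (auto simp del: dir_add)
    then show ?thesis using dens_nz_line[OF mu Ls, of x k] dens_nz_line[OF mu Ls, of x "k + 3"] by (auto simp del: dir_add)
  qed
  have fs: "fs s"
  proof -
    let ?X = "\<lambda>p q. {x. (snd p \<noteq> snd q \<and> snd p \<noteq> snd q + 3) \<and> off (snd p) x = off (snd p) (fst p) \<and> off (snd q) x = off (snd q) (fst q)}"
    have "finite (?X p q)" for p q
    proof (cases "\<exists>z. z \<in> ?X p q")
      case True
      then obtain z where "z \<in> ?X p q" by blast
      then have "?X p q \<subseteq> {z}" using off_eqI2[of "snd p" "snd q"] by auto
      then show ?thesis by (rule finite_subset) simp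
    next
      case False
      then have "?X p q = {}" by blast
      then show ?thesis by (metis finite.emptyI)
    qed
    moreover have "{x. s x \<noteq> 0} \<subseteq> (\<Union>p\<in>Ls. \<Union>q\<in>Ls. ?X p q)"
    proof
      fix x assume "x \<in> {x. s x \<noteq> 0}"
      then have x: "s x \<noteq> 0" by simp
      obtain P l Q m where "(P, l) \<in> Ls" "l = 0 \<or> l = 3" "off l x = off l P" "(Q, m) \<in> Ls" "m = 2 \<or> m = 5" "off m x = off m Q"
        using nz[OF x, of 0] nz[OF x, of 2] by auto
      then show "x \<in> (\<Union>p\<in>Ls. \<Union>q\<in>Ls. ?X p q)" by (intro UN_I[of "(P, l)"] UN_I[of "(Q, m)"]) auto
    qed
    ultimately show ?thesis unfolding fs_def using Ls(1) by (auto intro: finite_subset)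
  qed
  have odd: "D s x k = dens \<mu> x (dir k)" if k: "\<not> ev k" for x k
  proof (induction "card {\<tau>. \<tau> > 0 \<and> s (x + \<tau> *\<^sub>R dir k) \<noteq> 0}" arbitrary: x rule: less_induct)
    case less
    let ?S = "\<lambda>x. {\<tau>. \<tau> > 0 \<and> s (x + \<tau> *\<^sub>R dir k) \<noteq> 0}"
    have fS: "finite (?S x)" for x
    proof (rule finite_imageD)
      show "finite ((\<lambda>t. x + t *\<^sub>R dir k) ` ?S x)" using fs unfolding fs_def by (rule rev_finite_subset) auto
    qed (auto intro!: inj_onI)
    have eq: "dens \<mu> y (dir (k + 3)) = dens \<mu> y (dir k)" if "s y = 0" for y using bal'[of y k] that by (simp del: dir_add)
    show ?case
    proof (cases "?S x = {}")
      case True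
      have c: "dens \<mu> (x + t *\<^sub>R dir k) (dir k) = dens \<mu> x (dir k)" if "t > 0" for t
        using dens_const[OF mu that, of x k] eq True that by (auto simp del: dir_add)
      have "\<forall>\<^sub>F t::real in at_top. dens \<mu> x (dir k) = 0"
        using far[OF k, of x] eventually_gt_at_top[of "0::real"] by eventually_elim (use c in auto)
      then have "dens \<mu> x (dir k) = 0" using eventually_happens'[OF trivial_limit_at_top_linorder] by blast
      moreover have "D s x k = 0" using True by (intro D_odd_ahead[OF k]) auto
      ultimately show ?thesis by simp
    next
      case False
      define t where "t = Min (?S x)"
      have t: "t \<in> ?S x" unfolding t_def using fS False by (intro Min_in)
      have z: "s (x + \<tau> *\<^sub>R dir k) = 0" if "0 < \<tau>" "\<tau> < t" for \<tau>
        using Min_le[OF fS, of \<tau> x] that unfolding t_def[symmetric] by auto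
      let ?y = "x + t *\<^sub>R dir k"
      have "(\<lambda>\<tau>. \<tau> + t) ` ?S ?y \<subseteq> ?S x - {t}" using t by (auto simp: algebra_simps)
      then have "card (?S ?y) \<le> card (?S x - {t})"
        by (subst card_image[of "\<lambda>\<tau>. \<tau> + t", symmetric]) (use fS in \<open>auto intro!: card_mono\<close>)
      also have "\<dots> < card (?S x)" by (rule card_Diff1_less[OF fS t])
      finally have IH: "D s ?y k = dens \<mu> ?y (dir k)" by (rule less)
      have "D s ?y (k + 3) = D s x k" using t z by (intro D_const) auto
      moreover have "dens \<mu> ?y (dir (k + 3)) = dens \<mu> x (dir k)"
        using dens_const[OF mu, of t x k] t z eq by (auto simp del: dir_add)
      ultimately show ?thesis using IH D_jump[OF fs, of ?y k] bal'[of ?y k] by (simp del: dir_add)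
    qed
  qed
  have all: "D s x k = dens \<mu> x (dir k)" for x k
  proof (cases "ev k")
    case True
    then show ?thesis using odd[of "k + 3" x] D_jump[OF fs, of x k] bal'[of x k] by (simp del: dir_add)
  qed (use odd in blast)
  have pos: "pos s" unfolding pos_def all using coneD_dens[OF mu] by (auto simp: has_density_def)
  have "\<mu> = MM s" by (rule coneD_eqI[OF mu MM_coneD[OF fs pos]]) (simp add: dens_MM[OF fs pos] all)
  then show ?thesis using fs pos all by blast
qed

lemma D_odd_far: assumes "fs s" "\<not> ev k" shows "\<forall>\<^sub>F t in at_top. D s (x + t *\<^sub>R dir k) k = 0"
proof -
  have "\<forall>\<^sub>F t in at_top. \<forall>A\<in>{A. s A \<noteq> 0}. t > off (k + 1) (x - A)"
    using assms(1) by (intro eventually_ball_finite ballI eventually_gt_at_top) (auto simp: fs_def)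
  then show ?thesis
  proof eventually_elim
    fix t assume t: "\<forall>A\<in>{A. s A \<noteq> 0}. t > off (k + 1) (x - A)"
    show "D s (x + t *\<^sub>R dir k) k = 0" unfolding D_def
      by (rule sum.neutral) (use t assms(2) in \<open>force simp: hit_def\<close>)
  qed
qed

lemma coneD_below:
  assumes nu: "\<nu> \<in> coneD" and s: "fs s" "pos s" and le: "\<And>E. E \<in> sets borel \<Longrightarrow> emeasure \<nu> E \<le> emeasure (MM s) E"
  shows "\<exists>\<sigma>. fs \<sigma> \<and> pos \<sigma> \<and> \<nu> = MM \<sigma> \<and> (\<forall>x k. D \<sigma> x k \<le> D s x k)"
proof -
  have d: "dens \<nu> x (dir k) \<le> D s x k" for x k
    by (rule density_mono[OF norm_dir coneD_dens[OF nu] has_density_MM[OF s] le])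
  have n: "dens \<nu> x (dir k) \<ge> 0" for x k using coneD_dens[OF nu, of x k] by (simp add: has_density_def)
  have "\<forall>\<^sub>F t in at_top. dens \<nu> (x + t *\<^sub>R dir k) (dir k) = 0" if "\<not> ev k" for x k
    using D_odd_far[OF s(1) that, of x] by eventually_elim (use d n in \<open>metis order_antisym\<close>)
  then show ?thesis using coneD_rep[OF nu] d by metis
qed

end

section \<open>Extremal decompositions\<close>

context hexa
begin

lemma coef_sum: "(\<And>i. i \<in> I \<Longrightarrow> fs (f i)) \<Longrightarrow> coef (\<lambda>A. \<Sum>i\<in>I. f i A) g = (\<Sum>i\<in>I. coef (f i) g)"
proof (induction I rule: infinite_finite_induct)
  case (insert i I)
  have "fs (f i)" "fs (\<lambda>A. \<Sum>i\<in>I. f i A)" using insert by (auto intro!: fs_sum)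
  then show ?case using insert coef_add[of "f i" "\<lambda>A. \<Sum>i\<in>I. f i A" g] by simp
qed (cases g; simp add: coef_def)+

lemma face_scale: "\<sigma> \<in> face \<Longrightarrow> (\<lambda>A. c * \<sigma> A) \<in> face"
  by (auto simp: face_def D_scale intro: fs_scale)

lemma face_sum: "(\<And>i. i \<in> I \<Longrightarrow> f i \<in> face) \<Longrightarrow> (\<lambda>A. \<Sum>i\<in>I. f i A) \<in> face"
  unfolding face_def by (auto simp: D_sum intro!: fs_sum sum.neutral)

lemma face_self: "s \<in> face" using fss by (auto simp: face_def)

lemma face_below: "fs \<sigma> \<Longrightarrow> pos \<sigma> \<Longrightarrow> \<tau> \<in> face \<Longrightarrow> (\<And>x k. D \<sigma> x k \<le> D \<tau> x k) \<Longrightarrow> \<sigma> \<in> face"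
proof -
  assume h: "fs \<sigma>" "pos \<sigma>" "\<tau> \<in> face" "\<And>x k. D \<sigma> x k \<le> D \<tau> x k"
  have "D \<sigma> x k = 0" if "D s x k = 0" for x k
    using h(4)[of x k] h(2,3) that by (auto simp: pos_def face_def intro: order_antisym)
  then show ?thesis using h(1) by (simp add: face_def)
qed

lemma finite_free: "finite free" using finite_gens by (simp add: free_def)

lemma coef_self_pos: "g \<in> gens \<Longrightarrow> coef s g > 0"
  by (cases g) (auto simp: coef_def pr_def zero_less_mult_iff)

text \<open>A dominated measure of the face has free coefficients that are componentwise smaller.
  Hence the extremal measures of the face are the positive multiples of the basis elements, and a
  decomposition into inequivalent ones must use each basis element with the coefficient of
  \<open>s\<close>, which is positive.\<close>

lemma ext_decomposition:
  assumes cw: "cone_M w = coneD"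
  shows "\<exists>!S. extremal_decomposition w (MM s) S" "ext w (MM s) = card free"
proof -
  obtain e where e: "\<And>g. g \<in> free \<Longrightarrow> e g \<in> face" "\<And>g. g \<in> free \<Longrightarrow> pos (e g)"
    "\<And>g h. g \<in> free \<Longrightarrow> h \<in> free \<Longrightarrow> coef (e g) h = of_bool (h = g)" using basis_exists by blast
  have fse: "g \<in> free \<Longrightarrow> fs (e g)" for g using e(1) faceD(1) by blast
  have coefc: "coef (\<lambda>A. c * e g A) h = c * of_bool (h = g)" if "g \<in> free" "h \<in> free" for c g h
    using coef_scale[OF fse[OF that(1)]] e(3) that by simp
  have pose: "pos (\<lambda>A. c * e g A)" if "g \<in> free" "c \<ge> 0" for c g
    using e(2)[OF that(1)] that(2) by (simp add: pos_def D_scale[OF fse[OF that(1)]])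
  have rep: "\<sigma> = (\<lambda>A. \<Sum>g\<in>free. coef \<sigma> g * e g A)" if s: "\<sigma> \<in> face" for \<sigma>
  proof (rule face_eqI[OF s])
    show "(\<lambda>A. \<Sum>g\<in>free. coef \<sigma> g * e g A) \<in> face" by (intro face_sum face_scale e(1))
    fix h assume h: "h \<in> free"
    have "coef (\<lambda>A. \<Sum>g\<in>free. coef \<sigma> g * e g A) h = (\<Sum>g\<in>free. coef (\<lambda>A. coef \<sigma> g * e g A) h)"
      by (rule coef_sum) (intro fs_scale fse)
    also have "\<dots> = (\<Sum>g\<in>free. if g = h then coef \<sigma> h else 0)" by (rule sum.cong) (use coefc h in auto)
    finally show "coef \<sigma> h = coef (\<lambda>A. \<Sum>g\<in>free. coef \<sigma> g * e g A) h" using h finite_free by simp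
  qed
  have coefD: "0 \<le> coef \<sigma> h \<and> coef \<sigma> h \<le> coef \<rho> h" if "\<sigma> \<in> face" "pos \<sigma>" "\<rho> \<in> face" "\<And>x k. D \<sigma> x k \<le> D \<rho> x k" "h \<in> free" for \<sigma> \<rho> h
  proof -
    have g: "h \<in> gens" using that by (simp add: free_def)
    have d: "D (\<lambda>A. \<rho> A - \<sigma> A) x k = D \<rho> x k - D \<sigma> x k" for x k using that faceD(1) D_diff by blast
    have "(\<lambda>A. \<rho> A - \<sigma> A) \<in> face" using that(1,3) by (auto simp: face_def D_diff intro: fs_diff)
    moreover have "pos (\<lambda>A. \<rho> A - \<sigma> A)" using that(4) by (simp add: pos_def d)
    ultimately have "coef (\<lambda>A. \<rho> A - \<sigma> A) h \<ge> 0" using coef_pos g by blast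
    moreover have "coef (\<lambda>A. \<rho> A - \<sigma> A + \<sigma> A) h = coef (\<lambda>A. \<rho> A - \<sigma> A) h + coef \<sigma> h"
      by (rule coef_add) (use that(1,3) faceD(1) in \<open>auto intro!: fs_diff\<close>)
    moreover have "(\<lambda>A. \<rho> A - \<sigma> A + \<sigma> A) = \<rho>" by simp
    ultimately show ?thesis using coef_pos[OF that(1,2) g] by simp
  qed
  have mult: "multiple_of (MM (\<lambda>A. c * e g A)) (MM (\<lambda>A. c' * e g A))" if "g \<in> free" "c \<ge> 0" "c' > 0" for g c c'
    unfolding multiple_of_def
  proof (intro exI conjI)
    show "c / c' \<ge> 0" using that by simp
    show "MM (\<lambda>A. c * e g A) = scale_measure (ennreal (c / c')) (MM (\<lambda>A. c' * e g A))"
      using MM_scale[of "\<lambda>A. c' * e g A" "c / c'"] fs_scale[OF fse[OF that(1)], of c'] that by (simp add: mult.assoc[symmetric])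
  qed
  have multD: "g = h" if md: "multiple_of (MM (\<lambda>A. c * e g A)) (MM (\<lambda>A. c' * e h A))" "g \<in> free" "h \<in> free" "c > 0" "c' > 0" for g h c c'
  proof -
    note that = md
    obtain b where b: "b \<ge> 0" "MM (\<lambda>A. c * e g A) = scale_measure (ennreal b) (MM (\<lambda>A. c' * e h A))"
      using md(1) by (auto simp: multiple_of_def)
    have "MM (\<lambda>A. c * e g A) = MM (\<lambda>A. b * (c' * e h A))" using b MM_scale[of "\<lambda>A. c' * e h A" b] fs_scale[OF fse[OF that(3)]] by simp
    then have "MM (\<lambda>A. c * e g A) = MM (\<lambda>A. (b * c') * e h A)" by (simp add: mult.assoc)
    then have "(\<lambda>A. c * e g A) = (\<lambda>A. (b * c') * e h A)"
      using that b by (intro MM_inj fs_scale fse pose) auto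
    then have "coef (\<lambda>A. c * e g A) g = coef (\<lambda>A. (b * c') * e h A) g" by simp
    then have "c * of_bool (g = g) = b * c' * of_bool (g = h)"
      unfolding coefc[OF md(2,2)] coefc[OF md(3,2)] .
    then show ?thesis using md(4) by (cases "g = h") auto
  qed
  have below: "\<exists>\<rho>. \<rho> \<in> face \<and> pos \<rho> \<and> \<nu> = MM \<rho> \<and> (\<forall>x k. D \<rho> x k \<le> D \<sigma> x k)"
    if "\<nu> \<in> cone_M w" "\<sigma> \<in> face" "pos \<sigma>" "\<And>E. E \<in> sets borel \<Longrightarrow> emeasure \<nu> E \<le> emeasure (MM \<sigma>) E" for \<nu> \<sigma>
    using coneD_below[of \<nu> \<sigma>] that faceD(1) face_below cw by blast
  have ext1: "extremal w (MM (\<lambda>A. c * e g A))" if g: "g \<in> free" and c: "c > 0" for g c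
    unfolding extremal_def
  proof (intro conjI ballI impI)
    have p: "pos (\<lambda>A. c * e g A)" "fs (\<lambda>A. c * e g A)" "(\<lambda>A. c * e g A) \<in> face" using pose g c fse fs_scale face_scale e(1) by auto
    show "MM (\<lambda>A. c * e g A) \<in> cone_M w" unfolding cw using MM_coneD p by blast
    show "MM (\<lambda>A. c * e g A) \<noteq> null_measure borel"
    proof
      assume "MM (\<lambda>A. c * e g A) = null_measure borel"
      then have "(\<lambda>A. c * e g A) = (\<lambda>A. 0)" unfolding MM_zero[symmetric] using p by (intro MM_inj) (auto simp: fs_def pos_def)
      then have "coef (\<lambda>A. c * e g A) g = coef (\<lambda>A. 0) g" by simp
      moreover have "coef (\<lambda>A. 0) g = 0" by (cases g) (auto simp: coef_def)
      ultimately show False using coefc[OF g g, of c] c by simp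
    qed
    fix \<nu> assume nu: "\<nu> \<in> cone_M w" "\<forall>E\<in>sets borel. emeasure \<nu> E \<le> emeasure (MM (\<lambda>A. c * e g A)) E"
    then obtain \<rho> where r: "\<rho> \<in> face" "pos \<rho>" "\<nu> = MM \<rho>" "\<And>x k. D \<rho> x k \<le> D (\<lambda>A. c * e g A) x k"
      using below[OF nu(1) p(3,1)] by blast
    have cr: "coef \<rho> h = (if h = g then coef \<rho> g else 0)" "coef \<rho> h \<ge> 0" if "h \<in> free" for h
      using coefD[OF r(1,2) p(3) r(4) that] coefc[OF g that, of c] by (auto split: if_splits)
    have "\<rho> = (\<lambda>A. \<Sum>h\<in>free. coef \<rho> h * e h A)" by (rule rep[OF r(1)])
    also have "\<dots> = (\<lambda>A. \<Sum>h\<in>free. if h = g then coef \<rho> g * e g A else 0)"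
    proof
      fix A show "(\<Sum>h\<in>free. coef \<rho> h * e h A) = (\<Sum>h\<in>free. if h = g then coef \<rho> g * e g A else 0)"
        by (rule sum.cong[OF refl]) (subst cr(1), auto)
    qed
    also have "\<dots> = (\<lambda>A. coef \<rho> g * e g A)" using g finite_free by simp
    finally have "\<nu> = MM (\<lambda>A. coef \<rho> g * e g A)" using r(3) by simp
    then show "multiple_of \<nu> (MM (\<lambda>A. c * e g A))" using mult[OF g _ c] cr(2)[OF g] by simp
  qed
  have ext2: "\<exists>g\<in>free. \<exists>c>0. \<sigma> = (\<lambda>A. c * e g A)" if s: "\<sigma> \<in> face" "pos \<sigma>" and ex: "extremal w (MM \<sigma>)" for \<sigma>
  proof -
    have cn: "coef \<sigma> g \<ge> 0" if "g \<in> free" for g using coef_pos[OF s] that by (simp add: free_def)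
    have "\<exists>g\<in>free. coef \<sigma> g \<noteq> 0"
    proof (rule ccontr)
      assume "\<not> (\<exists>g\<in>free. coef \<sigma> g \<noteq> 0)"
      then have "\<sigma> = (\<lambda>A. 0)" using rep[OF s(1)] by (metis (no_types, lifting) mult_zero_left sum.neutral)
      then show False using ex MM_zero by (simp add: extremal_def)
    qed
    then obtain g where g: "g \<in> free" "coef \<sigma> g > 0" using cn by (metis order_le_less)
    let ?\<rho> = "\<lambda>A. coef \<sigma> g * e g A"
    have p: "pos ?\<rho>" "fs ?\<rho>" using pose g fse fs_scale by auto
    have "D ?\<rho> x k \<le> D \<sigma> x k" for x k
    proof -
      have "D ?\<rho> x k \<le> (\<Sum>h\<in>free. D (\<lambda>A. coef \<sigma> h * e h A) x k)"
        by (rule member_le_sum[OF g(1)]) (use finite_free pose cn in \<open>auto simp: pos_def\<close>)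
      also have "\<dots> = D (\<lambda>A. \<Sum>h\<in>free. coef \<sigma> h * e h A) x k" by (rule D_sum[symmetric]) (intro fs_scale fse)
      also have "\<dots> = D \<sigma> x k" using rep[OF s(1)] by simp
      finally show ?thesis .
    qed
    then have "emeasure (MM ?\<rho>) E \<le> emeasure (MM \<sigma>) E" if "E \<in> sets borel" for E
      using MM_mono[OF p(2) faceD(1)[OF s(1)] _ that] by blast
    moreover have "MM ?\<rho> \<in> cone_M w" unfolding cw using MM_coneD p by blast
    ultimately obtain c where c: "c \<ge> 0" "MM ?\<rho> = scale_measure (ennreal c) (MM \<sigma>)"
      using ex by (auto simp: extremal_def multiple_of_def)
    have "MM ?\<rho> = MM (\<lambda>A. c * \<sigma> A)" using c MM_scale faceD(1)[OF s(1)] by simp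
    then have eq: "?\<rho> = (\<lambda>A. c * \<sigma> A)"
    proof (intro MM_inj p)
      show "fs (\<lambda>A. c * \<sigma> A)" "pos (\<lambda>A. c * \<sigma> A)" using c s faceD(1)[OF s(1)] by (auto simp: pos_def D_scale intro: fs_scale)
    qed
    have "coef ?\<rho> g = coef (\<lambda>A. c * \<sigma> A) g" using eq by (rule arg_cong)
    then have "coef \<sigma> g = c * coef \<sigma> g" using coefc[OF g(1) g(1), of "coef \<sigma> g"] coef_scale[OF faceD(1)[OF s(1)], of c g] by simp
    then have "c = 1" using g(2) by simp
    then have "\<sigma> = ?\<rho>" using eq by simp
    then show ?thesis using g by blast
  qed
  define m where "m g = coef s g" for g
  have m: "m g > 0" if "g \<in> free" for g using coef_self_pos that by (auto simp: m_def free_def)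
  define S0 where "S0 = (\<lambda>g. MM (\<lambda>A. m g * e g A)) ` free"
  have inj: "inj_on (\<lambda>g. MM (\<lambda>A. m g * e g A)) free"
  proof (rule inj_onI)
    fix g h assume gh: "g \<in> free" "h \<in> free" "MM (\<lambda>A. m g * e g A) = MM (\<lambda>A. m h * e h A)"
    have "multiple_of (MM (\<lambda>A. m h * e h A)) (MM (\<lambda>A. m h * e h A))" using mult[OF gh(2) _ m[OF gh(2)]] m[OF gh(2)] by simp
    then show "g = h" using multD[of "m g" g "m h" h] gh m by simp
  qed
  have dec: "extremal_decomposition w (MM s) S0"
    unfolding extremal_decomposition_def
  proof (intro conjI ballI impI)
    show "finite S0" using finite_free by (simp add: S0_def)
    show "extremal w \<nu>" if "\<nu> \<in> S0" for \<nu> using that ext1 m by (auto simp: S0_def)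
    show "\<not> multiple_of \<nu> \<nu>'" if "\<nu> \<in> S0" "\<nu>' \<in> S0" "\<nu> \<noteq> \<nu>'" for \<nu> \<nu>'
      using that multD m unfolding S0_def by blast
    fix E :: "(real^2) set" assume E: "E \<in> sets borel"
    have "emeasure (MM s) E = emeasure (MM (\<lambda>A. \<Sum>g\<in>free. m g * e g A)) E" using rep[OF face_self] by (simp add: m_def)
    also have "\<dots> = (\<Sum>g\<in>free. emeasure (MM (\<lambda>A. m g * e g A)) E)"
      by (rule MM_sum[OF finite_free _ _ E]) (use fse fs_scale pose m in \<open>auto intro!: fs_scale pose less_imp_le\<close>)
    also have "\<dots> = (\<Sum>\<nu>\<in>S0. emeasure \<nu> E)" unfolding S0_def using inj by (simp add: sum.reindex)
    finally show "emeasure (MM s) E = (\<Sum>\<nu>\<in>S0. emeasure \<nu> E)" .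
  qed
  have uniq: "S = S0" if S: "extremal_decomposition w (MM s) S" for S
  proof -
    have fS: "finite S" and exS: "\<And>\<nu>. \<nu> \<in> S \<Longrightarrow> extremal w \<nu>"
      and ineq: "\<And>\<nu> \<nu>'. \<nu> \<in> S \<Longrightarrow> \<nu>' \<in> S \<Longrightarrow> \<nu> \<noteq> \<nu>' \<Longrightarrow> \<not> multiple_of \<nu> \<nu>'"
      and sumS: "\<And>E. E \<in> sets borel \<Longrightarrow> emeasure (MM s) E = (\<Sum>\<nu>\<in>S. emeasure \<nu> E)"
      using S unfolding extremal_decomposition_def by auto
    have "\<exists>g c. g \<in> free \<and> c > 0 \<and> \<nu> = MM (\<lambda>A. c * e g A)" if nu: "\<nu> \<in> S" for \<nu>
    proof -
      have "emeasure \<nu> E \<le> emeasure (MM s) E" if "E \<in> sets borel" for E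
        unfolding sumS[OF that] by (rule member_le_sum[OF nu]) (use fS in auto)
      moreover have "\<nu> \<in> cone_M w" using exS[OF nu] by (simp add: extremal_def)
      ultimately obtain \<rho> where "\<rho> \<in> face" "pos \<rho>" "\<nu> = MM \<rho>" using below[OF _ face_self poss] by blast
      then show ?thesis using ext2 exS[OF nu] by blast
    qed
    then obtain \<gamma> \<kappa> where gk: "\<And>\<nu>. \<nu> \<in> S \<Longrightarrow> \<gamma> \<nu> \<in> free \<and> \<kappa> \<nu> > 0 \<and> \<nu> = MM (\<lambda>A. \<kappa> \<nu> * e (\<gamma> \<nu>) A)" by metis
    have injg: "inj_on \<gamma> S"
    proof (rule inj_onI, rule ccontr)
      fix \<nu> \<nu>' assume h: "\<nu> \<in> S" "\<nu>' \<in> S" "\<gamma> \<nu> = \<gamma> \<nu>'" "\<nu> \<noteq> \<nu>'"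
      have "multiple_of (MM (\<lambda>A. \<kappa> \<nu> * e (\<gamma> \<nu>) A)) (MM (\<lambda>A. \<kappa> \<nu>' * e (\<gamma> \<nu>) A))" using gk[OF h(1)] gk[OF h(2)] by (intro mult) auto
      then show False using ineq[OF h(1,2,4)] gk[OF h(1)] gk[OF h(2)] h(3) by simp
    qed
    let ?t = "\<lambda>A. \<Sum>\<nu>\<in>S. \<kappa> \<nu> * e (\<gamma> \<nu>) A"
    have ft: "fs ?t" by (intro fs_sum fs_scale fse) (use gk in auto)
    have pt: "pos ?t" unfolding pos_def
      by (subst D_sum) (use gk fse pose in \<open>auto intro!: sum_nonneg fs_scale simp: pos_def less_imp_le\<close>)
    have "MM s = MM ?t"
    proof (rule measure_eqI)
      fix E assume "E \<in> sets (MM s)"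
      then have E: "E \<in> sets borel" by simp
      have "emeasure (MM s) E = (\<Sum>\<nu>\<in>S. emeasure (MM (\<lambda>A. \<kappa> \<nu> * e (\<gamma> \<nu>) A)) E)"
        unfolding sumS[OF E] by (rule sum.cong) (use gk in auto)
      also have "\<dots> = emeasure (MM ?t) E"
        by (rule MM_sum[OF fS _ _ E, symmetric]) (use gk fse in \<open>auto intro!: fs_scale pose less_imp_le\<close>)
      finally show "emeasure (MM s) E = emeasure (MM ?t) E" .
    qed simp
    then have st: "s = ?t" by (intro MM_inj fss poss ft pt)
    have mh: "m h = (\<Sum>\<nu>\<in>S. if \<gamma> \<nu> = h then \<kappa> \<nu> else 0)" if h: "h \<in> free" for h
    proof -
      have "m h = coef ?t h" unfolding m_def using st by simp
      also have "\<dots> = (\<Sum>\<nu>\<in>S. coef (\<lambda>A. \<kappa> \<nu> * e (\<gamma> \<nu>) A) h)" by (rule coef_sum) (intro fs_scale fse, use gk in auto)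
      also have "\<dots> = (\<Sum>\<nu>\<in>S. if \<gamma> \<nu> = h then \<kappa> \<nu> else 0)" by (rule sum.cong) (use gk coefc h in auto)
      finally show ?thesis .
    qed
    have km: "\<kappa> \<nu> = m (\<gamma> \<nu>)" if nu: "\<nu> \<in> S" for \<nu>
    proof -
      have "m (\<gamma> \<nu>) = (\<Sum>\<nu>'\<in>S. if \<nu>' = \<nu> then \<kappa> \<nu> else 0)"
        unfolding mh[OF conjunct1[OF gk[OF nu]]] by (rule sum.cong) (use injg nu in \<open>auto simp: inj_on_def\<close>)
      then show ?thesis using fS nu by simp
    qed
    have onto: "\<exists>\<nu>\<in>S. \<gamma> \<nu> = h" if h: "h \<in> free" for h
    proof (rule ccontr)
      assume "\<not> (\<exists>\<nu>\<in>S. \<gamma> \<nu> = h)"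
      then have "m h = 0" unfolding mh[OF h] by (auto intro!: sum.neutral)
      then show False using m[OF h] by simp
    qed
    show "S = S0"
    proof
      have eq: "\<nu> = MM (\<lambda>A. m (\<gamma> \<nu>) * e (\<gamma> \<nu>) A)" if "\<nu> \<in> S" for \<nu> using gk[OF that] unfolding km[OF that] by blast
      show "S \<subseteq> S0"
      proof
        fix \<nu> assume "\<nu> \<in> S"
        then show "\<nu> \<in> S0" unfolding S0_def using eq gk by (intro image_eqI[of _ _ "\<gamma> \<nu>"]) auto
      qed
      show "S0 \<subseteq> S"
      proof
        fix \<nu> assume "\<nu> \<in> S0"
        then obtain h where h: "h \<in> free" "\<nu> = MM (\<lambda>A. m h * e h A)" by (auto simp: S0_def)
        obtain \<nu>' where "\<nu>' \<in> S" "\<gamma> \<nu>' = h" using onto[OF h(1)] by blast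
        then show "\<nu> \<in> S" using eq[of \<nu>'] h(2) by simp
      qed
    qed
  qed
  show ex1: "\<exists>!S. extremal_decomposition w (MM s) S" using dec uniq by blast
  have "(THE S. extremal_decomposition w (MM s) S) = S0" using dec uniq by (rule the_equality)
  then show "ext w (MM s) = card free" unfolding ext_def using card_image[OF inj] by (simp add: S0_def)
qed

end

section \<open>Displacements of the white pieces\<close>

context hex
begin

text \<open>\<open>gp j k y\<close>: the germ at \<open>y\<close> of the open sector between \<open>dir k\<close> and \<open>dir (k + 1)\<close> lies to the
  left of the line through \<open>0\<close> with direction \<open>dir j\<close>.\<close>

definition mid :: "6 \<Rightarrow> real^2" where "mid k = dir k + dir (k + 1)"

definition gp :: "6 \<Rightarrow> 6 \<Rightarrow> real^2 \<Rightarrow> bool" where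
  "gp j k y \<longleftrightarrow> off j y > 0 \<or> off j y = 0 \<and> off j (mid k) > 0"

text \<open>The displacement of the three sectors of a unit tripod at \<open>0\<close>.\<close>

definition tg :: "6 \<Rightarrow> real^2 \<Rightarrow> real^2" where
  "tg k y = (if gp 0 k y \<and> \<not> gp 2 k y then dir 1 else if gp 4 k y \<and> \<not> gp 0 k y then dir 0 else 0)"

text \<open>Displacement of the piece that contains the sector \<open>k\<close> at \<open>x\<close>,
  obtained by superposing those of the single tripods.\<close>

definition tau :: "(real^2 \<Rightarrow> real) \<Rightarrow> real^2 \<Rightarrow> 6 \<Rightarrow> real^2" where
  "tau s x k = (\<Sum>A | s A \<noteq> 0. s A *\<^sub>R tg k (x - A))"

text \<open>The bilinear form with \<open>bil x (dir (k + 2)) = off k x\<close>; \<open>tau s\<close> is the gradient with respect to it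
  of a piecewise linear function which is convex if \<open>pos s\<close>.\<close>

definition bil :: "real^2 \<Rightarrow> real^2 \<Rightarrow> real" where
  "bil x p = off 0 x * off 0 p + off 1 x * off 2 p"

lemma bil_lin [simp]: "bil x (p + q) = bil x p + bil x q" "bil x (p - q) = bil x p - bil x q" "bil x (c *\<^sub>R p) = c * bil x p"
  "bil (x + y) p = bil x p + bil y p" "bil (x - y) p = bil x p - bil y p" "bil (c *\<^sub>R x) p = c * bil x p" "bil x (- p) = - bil x p" "bil (- x) p = - bil x p"
  "bil x 0 = 0" "bil 0 x = 0"
  by (simp_all add: bil_def algebra_simps)

lemma dir_num: "dir 2 = dir 1 - dir 0" "dir 3 = - dir 0" "dir 4 = - dir 1" "dir 5 = dir 0 - dir 1"
  using dir_add[of 0] by simp_all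

lemma off_num: "off 2 x = off 1 x - off 0 x" "off 3 x = - off 0 x" "off 4 x = - off 1 x" "off 5 x = off 0 x - off 1 x"
  using off_add[of 0 x] by simp_all

lemma off_dir_num: "off 0 (dir 0) = 0" "off 0 (dir 1) = 1" "off 1 (dir 0) = - 1" "off 1 (dir 1) = 0"
  using off_dir[of 0] by simp_all

lemma bil_dir: "bil x (dir (k + 2)) = off k x"
  using six_cases[of k] by (auto simp: bil_def dir_num off_num off_dir_num)

lemma bil_dir': "bil (dir k) p = off (k + 5) p"
  using six_cases[of k] by (auto simp: bil_def dir_num off_num off_dir_num)

lemma mid_sign: "off i (mid j) > 0 \<longleftrightarrow> j = i \<or> j = i + 1 \<or> j = i + 2"
  unfolding mid_def off_lin using six_rel[of j i] by (elim disjE) simp_all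

lemma mid_num: "off 0 (mid 0) = 1" "off 0 (mid 1) = 2" "off 0 (mid 2) = 1" "off 0 (mid 3) = -1" "off 0 (mid 4) = -2" "off 0 (mid 5) = -1"
  "off 1 (mid 0) = -1" "off 1 (mid 1) = 1" "off 1 (mid 2) = 2" "off 1 (mid 3) = 1" "off 1 (mid 4) = -1" "off 1 (mid 5) = -2"
  unfolding mid_def off_lin by (simp_all add: dir_num off_dir_num)

lemma tg_jump: "tg (k + 1) y - tg k y = of_bool (hit (k + 1) y) *\<^sub>R dir (k + 3)"
proof -
  show ?thesis
  proof (cases "off (k + 1) y = 0")
    case False
    have "gp j (k + 1) y \<longleftrightarrow> gp j k y" for j
    proof (cases "k + 1 = j \<or> k + 1 = j + 3")
      case True
      then have "off j y \<noteq> 0" using False off_add(2)[of j y] by (metis neg_equal_0_iff_equal)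
      then show ?thesis by (simp add: gp_def)
    next
      case no: False
      have "(k + 1 = j \<or> k + 1 = j + 1 \<or> k + 1 = j + 2) \<longleftrightarrow> (k = j \<or> k = j + 1 \<or> k = j + 2)"
        using six_rel[of k j] no by (elim disjE) simp_all
      then show ?thesis unfolding gp_def mid_sign by simp
    qed
    then have "tg (k + 1) y = tg k y" unfolding tg_def by simp
    moreover have "\<not> hit (k + 1) y" using False by (simp add: hit_def)
    ultimately show ?thesis by simp
  next
    case True
    note d = tg_def gp_def hit_def mid_num off_num dir_num
    consider "k = 0" | "k = 1" | "k = 2" | "k = 3" | "k = 4" | "k = 5" using six_cases[of k] by blast
    then show ?thesis
    proof cases
      case 1 then show ?thesis using True by (cases "off 0 y" "0::real" rule: linorder_cases) (simp_all add: d)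
    next
      case 2 then show ?thesis using True by (cases "off 0 y" "0::real" rule: linorder_cases) (simp_all add: d)
    next
      case 3 then show ?thesis using True by (cases "off 1 y" "0::real" rule: linorder_cases) (simp_all add: d)
    next
      case 4 then show ?thesis using True by (cases "off 0 y" "0::real" rule: linorder_cases) (simp_all add: d)
    next
      case 5 then show ?thesis using True by (cases "off 0 y" "0::real" rule: linorder_cases) (simp_all add: d)
    next
      case 6 then show ?thesis using True by (cases "off 1 y" "0::real" rule: linorder_cases) (simp_all add: d)
    qed
  qed
qed

text \<open>This is the rule of inflation: the piece to the left of a ray of index \<open>i\<close>
  is displaced, relative to the one on the right, by the density times
  \<open>dir (i + 2)\<close>.\<close>

lemma tau_jump: "tau s x (k + 1) - tau s x k = D s x (k + 1) *\<^sub>R dir (k + 3)"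
proof -
  have "tau s x (k + 1) - tau s x k = (\<Sum>A | s A \<noteq> 0. s A *\<^sub>R (tg (k + 1) (x - A) - tg k (x - A)))"
    unfolding tau_def by (simp add: sum_subtractf scaleR_diff_right)
  also have "\<dots> = (\<Sum>A | s A \<noteq> 0. (s A * of_bool (hit (k + 1) (x - A))) *\<^sub>R dir (k + 3))" unfolding tg_jump by simp
  finally show ?thesis unfolding D_def scaleR_sum_left .
qed

lemma tau_step: "tau s x (k + 5) = tau s x k - D s x k *\<^sub>R dir (k + 2)"
proof -
  have "tau s x (k + 5 + 1) - tau s x (k + 5) = D s x (k + 5 + 1) *\<^sub>R dir (k + 5 + 3)" by (rule tau_jump)
  then have "tau s x k - tau s x (k + 5) = D s x k *\<^sub>R dir (k + 2)" by (simp only: six_normalize) (simp del: dir_add)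
  then show ?thesis by (simp add: algebra_simps)
qed

text \<open>Close to \<open>x\<close> in a direction \<open>v\<close> of the half-open sector \<open>m\<close>, only the displacements of the
  sectors bordering on \<open>v\<close> occur.\<close>

lemma gp_near:
  assumes v: "v = a *\<^sub>R dir m + b *\<^sub>R dir (m + 1)" "a > 0" "b \<ge> 0"
  shows "\<forall>\<^sub>F e in at_right 0. \<forall>i j. gp i j (y + e *\<^sub>R v) \<longleftrightarrow> gp i (if b > 0 \<or> off m (mid j) > 0 then m else m + 5) y"
proof -
  have "\<forall>\<^sub>F e in at_right 0. \<forall>i\<in>UNIV. off i y \<noteq> 0 \<longrightarrow> \<bar>e * off i v\<bar> < \<bar>off i y\<bar>"
  proof (rule eventually_ball_finite, simp, intro ballI)
    fix i :: 6
    show "\<forall>\<^sub>F e in at_right 0. off i y \<noteq> 0 \<longrightarrow> \<bar>e * off i v\<bar> < \<bar>off i y\<bar>"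
    proof (cases "off i y = 0")
      case False
      have t: "((\<lambda>e. \<bar>e * off i v\<bar>) \<longlongrightarrow> \<bar>0 * off i v\<bar>) (at_right 0)" by (intro tendsto_intros)
      have "\<forall>\<^sub>F e in at_right 0. \<bar>e * off i v\<bar> < \<bar>off i y\<bar>" by (rule order_tendstoD(2)[OF t]) (use False in simp)
      then show ?thesis by eventually_elim simp
    qed simp
  qed
  then show ?thesis using eventually_at_right_less[of "0::real"]
  proof (eventually_elim, intro allI)
    fix e i j assume h: "\<forall>i\<in>UNIV. off i y \<noteq> 0 \<longrightarrow> \<bar>e * off i v\<bar> < \<bar>off i y\<bar>" and e: "0 < (e::real)"
    show "gp i j (y + e *\<^sub>R v) \<longleftrightarrow> gp i (if b > 0 \<or> off m (mid j) > 0 then m else m + 5) y"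
    proof (cases "off i y = 0")
      case False
      then have "\<bar>e * off i v\<bar> < \<bar>off i y\<bar>" using h by blast
      then have "off i y + e * off i v > 0 \<longleftrightarrow> off i y > 0" "off i y + e * off i v \<noteq> 0" by linarith+
      then show ?thesis using False by (auto simp: gp_def)
    next
      case True
      have ep: "e * c > 0 \<longleftrightarrow> c > 0" "e * c = 0 \<longleftrightarrow> c = 0" for c using e by (auto simp: zero_less_mult_iff)
      have "off i v > 0 \<or> off i v = 0 \<and> off i (mid j) > 0 \<longleftrightarrow> off i (mid (if b > 0 \<or> off m (mid j) > 0 then m else m + 5)) > 0"
      proof -
        have o: "off m v = b" "off (m + 1) v = - a" "off (m + 2) v = - a - b" "off (m + 3) v = - b" "off (m + 4) v = a" "off (m + 5) v = a + b"
          by (simp_all add: v(1))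
        show ?thesis using six_rel[of i m] v(2,3)
          by (elim disjE; hypsubst) (use six_rel[of j m] in \<open>auto simp: o mid_sign simp del: off_add\<close>)
      qed
      then show ?thesis using True e by (simp only: gp_def off_lin ep add_0 less_irrefl simp_thms)
    qed
  qed
qed

lemma tau_near:
  assumes fs: "fs s" and v: "v = a *\<^sub>R dir m + b *\<^sub>R dir (m + 1)" "a > 0" "b \<ge> 0"
  shows "\<forall>\<^sub>F e in at_right 0. \<forall>j. tau s (x + e *\<^sub>R v) j = tau s x (if b > 0 \<or> off m (mid j) > 0 then m else m + 5)"
proof -
  have "\<forall>\<^sub>F e in at_right 0. \<forall>A\<in>{A. s A \<noteq> 0}. \<forall>i j. gp i j (x - A + e *\<^sub>R v) \<longleftrightarrow> gp i (if b > 0 \<or> off m (mid j) > 0 then m else m + 5) (x - A)"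
    using fs by (intro eventually_ball_finite ballI gp_near[OF v]) (auto simp: fs_def)
  then show ?thesis
  proof (eventually_elim, intro allI)
    fix e j assume h: "\<forall>A\<in>{A. s A \<noteq> 0}. \<forall>i j. gp i j (x - A + e *\<^sub>R v) \<longleftrightarrow> gp i (if b > 0 \<or> off m (mid j) > 0 then m else m + 5) (x - A)"
    show "tau s (x + e *\<^sub>R v) j = tau s x (if b > 0 \<or> off m (mid j) > 0 then m else m + 5)" unfolding tau_def
    proof (rule sum.cong, simp)
      fix A assume A: "A \<in> {A. s A \<noteq> 0}"
      have "x + e *\<^sub>R v - A = x - A + e *\<^sub>R v" by simp
      then show "s A *\<^sub>R tg j (x + e *\<^sub>R v - A) = s A *\<^sub>R tg (if b > 0 \<or> off m (mid j) > 0 then m else m + 5) (x - A)"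
        using h A unfolding tg_def by (simp only:)
    qed
  qed
qed

lemma sector_cases:
  assumes "v \<noteq> 0" obtains m a b where "v = a *\<^sub>R dir m + b *\<^sub>R dir (m + 1)" "a > 0" "b \<ge> 0"
proof -
  define p where "p = - off 1 v"
  define q where "q = off 0 v"
  have v: "v = q *\<^sub>R dir 1 + p *\<^sub>R dir 0" using off_rep[of v 0] by (simp add: p_def q_def)
  have nz: "p \<noteq> 0 \<or> q \<noteq> 0" using v assms by auto
  consider "p > 0" "q \<ge> 0" | "p \<le> 0" "p + q > 0" | "q > 0" "p + q \<le> 0" | "p < 0" "q \<le> 0" | "p \<ge> 0" "p + q < 0" | "q < 0" "p + q \<ge> 0"
    using nz by linarith
  then show ?thesis
  proof cases
    case 1 then show ?thesis by (intro that[of p 0 q]) (auto simp: v)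
  next
    case 2 then show ?thesis by (intro that[of "p + q" 1 "- p"]) (auto simp: v dir_num algebra_simps)
  next
    case 3 then show ?thesis by (intro that[of q 2 "- p - q"]) (auto simp: v dir_num algebra_simps)
  next
    case 4 then show ?thesis by (intro that[of "- p" 3 "- q"]) (auto simp: v dir_num algebra_simps)
  next
    case 5 then show ?thesis by (intro that[of "- p - q" 4 "p"]) (auto simp: v dir_num algebra_simps)
  next
    case 6 then show ?thesis by (intro that[of "- q" 5 "p + q"]) (auto simp: v dir_num algebra_simps)
  qed
qed

end

context hexs
begin

text \<open>The value is largest in the sector containing \<open>v\<close>. Rotating away on either
  side, each ray crossed lowers it by a density times a nonnegative offset, which is 0 for a ray
  along \<open>v\<close>.\<close>

lemma tau_rotate:
  assumes v: "v = a *\<^sub>R dir m + b *\<^sub>R dir (m + 1)" "a > 0" "b \<ge> 0"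
  shows "bil v (tau s x m - tau s x j) \<ge> 0" "b = 0 \<Longrightarrow> bil v (tau s x (m + 5)) = bil v (tau s x m)"
proof -
  have st: "bil v (tau s x (k + 5)) = bil v (tau s x k) - D s x k * off k v" for k
    unfolding tau_step by (simp add: bil_dir del: dir_add)
  have o: "off m v = b" "off (m + 1) v = - a" by (simp_all add: v)
  have p: "D s x k * c \<ge> 0" if "c \<ge> 0" for k c using that by simp
  have 1: "bil v (tau s x (m + 5)) \<le> bil v (tau s x m)" using st[of m] p[of b m] v o by simp
  have 2: "bil v (tau s x (m + 4)) \<le> bil v (tau s x (m + 5))" using st[of "m + 5"] p[of "a + b" "m + 5"] v o by simp
  have 3: "bil v (tau s x (m + 3)) \<le> bil v (tau s x (m + 4))" using st[of "m + 4"] p[of a "m + 4"] v o by simp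
  have 4: "bil v (tau s x (m + 1)) \<le> bil v (tau s x m)" using st[of "m + 1"] p[of a "m + 1"] v o by simp
  have 5: "bil v (tau s x (m + 2)) \<le> bil v (tau s x (m + 1))" using st[of "m + 2"] p[of "a + b" "m + 2"] v o by (simp add: right_diff_distrib distrib_left)
  show "bil v (tau s x m - tau s x j) \<ge> 0" using six_rel[of j m] 1 2 3 4 5 by auto
  show "b = 0 \<Longrightarrow> bil v (tau s x (m + 5)) = bil v (tau s x m)" using st[of m] o by simp
qed

lemma tau_local_mono:
  assumes "v \<noteq> 0" shows "\<forall>\<^sub>F e in at_right 0. \<forall>i j. bil v (tau s x j) \<le> bil v (tau s (x + e *\<^sub>R v) i)"
proof -
  obtain m a b where v: "v = a *\<^sub>R dir m + b *\<^sub>R dir (m + 1)" "a > 0" "b \<ge> 0" using sector_cases[OF assms] by blast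
  show ?thesis using tau_near[OF fss v, of x]
  proof eventually_elim
    fix e assume h: "\<forall>j. tau s (x + e *\<^sub>R v) j = tau s x (if b > 0 \<or> off m (mid j) > 0 then m else m + 5)"
    have "bil v (tau s (x + e *\<^sub>R v) i) = bil v (tau s x m)" for i
      using h tau_rotate(2)[OF v] v(3) by (auto simp: not_less)
    then show "\<forall>i j. bil v (tau s x j) \<le> bil v (tau s (x + e *\<^sub>R v) i)" using tau_rotate(1)[OF v, of x] by simp
  qed
qed

lemma tau_mono: "bil (y - x) (tau s y i - tau s x j) \<ge> 0"
proof (cases "y = x")
  case False
  define v where "v = y - x"
  have v0: "v \<noteq> 0" using False by (simp add: v_def)
  \<comment> \<open>The estimates on both sides of each point of the segment are chained by
    \<open>Bolzano\<close>. The condition \<open>a < b\<close> matters: different sectors of one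
    point need not satisfy the inequality.\<close>
  define P where "P = (\<lambda>a b :: real. a < b \<longrightarrow> (\<forall>i j. bil v (tau s (x + a *\<^sub>R v) j) \<le> bil v (tau s (x + b *\<^sub>R v) i)))"
  have "P 0 1"
  proof (rule Bolzano)
    show "P a c" if "P a b" "P b c" "a \<le> b" "b \<le> c" for a b c
    proof (cases "a = b \<or> b = c")
      case False
      then have "a < b" "b < c" using that by auto
      then show ?thesis using that(1,2) unfolding P_def by (meson order_trans)
    qed (use that in auto)
    fix t :: real
    obtain d1 where d1: "d1 > 0" "\<And>e. 0 < e \<Longrightarrow> e < d1 \<Longrightarrow> \<forall>i j. bil v (tau s (x + t *\<^sub>R v) j) \<le> bil v (tau s (x + t *\<^sub>R v + e *\<^sub>R v) i)"
      using tau_local_mono[OF v0, of "x + t *\<^sub>R v"] unfolding eventually_at_right_field by auto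
    obtain d2 where d2: "d2 > 0" "\<And>e. 0 < e \<Longrightarrow> e < d2 \<Longrightarrow> \<forall>i j. bil (- v) (tau s (x + t *\<^sub>R v) j) \<le> bil (- v) (tau s (x + t *\<^sub>R v + e *\<^sub>R (- v)) i)"
      using tau_local_mono[of "- v" "x + t *\<^sub>R v"] v0 unfolding eventually_at_right_field by auto
    have up: "\<forall>i j. bil v (tau s (x + t *\<^sub>R v) j) \<le> bil v (tau s (x + b *\<^sub>R v) i)" if "t < b" "b < t + d1" for b
      using d1(2)[of "b - t"] that by (simp add: algebra_simps)
    have dn: "\<forall>i j. bil v (tau s (x + a *\<^sub>R v) j) \<le> bil v (tau s (x + t *\<^sub>R v) i)" if "a < t" "t - d2 < a" for a
      using d2(2)[of "t - a"] that by (simp add: algebra_simps)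
    show "\<exists>d>0. \<forall>a b. a \<le> t \<and> t \<le> b \<and> b - a < d \<longrightarrow> P a b"
    proof (intro exI[of _ "min d1 d2"] conjI allI impI)
      fix a b assume h: "a \<le> t \<and> t \<le> b \<and> b - a < min d1 d2"
      show "P a b" unfolding P_def
      proof (intro impI allI)
        fix i j assume "a < b"
        consider "a = t" "t < b" | "a < t" "b = t" | "a < t" "t < b" using h \<open>a < b\<close> by linarith
        then show "bil v (tau s (x + a *\<^sub>R v) j) \<le> bil v (tau s (x + b *\<^sub>R v) i)"
        proof cases
          case 3
          have "bil v (tau s (x + a *\<^sub>R v) j) \<le> bil v (tau s (x + t *\<^sub>R v) 0)" using dn[of a] 3 h by auto
          also have "\<dots> \<le> bil v (tau s (x + b *\<^sub>R v) i)" using up[of b] 3 h by auto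
          finally show ?thesis .
        qed (use up[of b] dn[of a] h in auto)
      qed
    qed (use d1 d2 in auto)
  qed simp
  then have "bil v (tau s x j) \<le> bil v (tau s (x + v) i)" by (simp add: P_def)
  then show ?thesis by (simp add: v_def)
qed simp

text \<open>The piece to the left of an edge is seen as sector \<open>k\<close> at its start and as
  sector \<open>k + 2\<close> at its end.\<close>

lemma tau_edge:
  assumes t: "t > 0" and z: "\<And>\<tau>. 0 < \<tau> \<Longrightarrow> \<tau> < t \<Longrightarrow> D s (x + \<tau> *\<^sub>R dir k) (k + 1) = 0 \<and> D s (x + \<tau> *\<^sub>R dir k) (k + 2) = 0"
  shows "tau s (x + t *\<^sub>R dir k) (k + 2) = tau s x k" "0 < \<tau> \<Longrightarrow> \<tau> < t \<Longrightarrow> tau s (x + \<tau> *\<^sub>R dir k) k = tau s x k"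
proof -
  have fwd: "\<exists>d>0. \<forall>e. 0 < e \<longrightarrow> e < d \<longrightarrow> tau s (y + e *\<^sub>R dir k) k = tau s y k" for y
    using tau_near[OF fss, of "dir k" 1 k 0 y] unfolding eventually_at_right_field by (auto simp: mid_def)
  have bwd: "\<exists>d>0. \<forall>e. 0 < e \<longrightarrow> e < d \<longrightarrow> tau s (y - e *\<^sub>R dir k) k = tau s y (k + 2)" for y
    using tau_near[OF fss, of "dir (k + 3)" 1 "k + 3" 0 y] unfolding eventually_at_right_field by (auto simp: mid_def)
  have eq: "tau s (x + \<tau> *\<^sub>R dir k) (k + 2) = tau s (x + \<tau> *\<^sub>R dir k) k" if "0 < \<tau>" "\<tau> < t" for \<tau>
    using tau_jump[of s "x + \<tau> *\<^sub>R dir k" k] tau_jump[of s "x + \<tau> *\<^sub>R dir k" "k + 1"] z[OF that] by simp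
  let ?h = "\<lambda>\<tau>. tau s (x + \<tau> *\<^sub>R dir k) k"
  have const: "?h a = ?h b" if ab: "a \<in> {0<..<t}" "b \<in> {0<..<t}" for a b
  proof (rule connected_local_const[of "{0<..<t}" a b ?h])
    show "\<forall>a\<in>{0<..<t}. \<forall>\<^sub>F b in at a within {0<..<t}. ?h a = ?h b"
    proof
      fix a assume a: "a \<in> {0<..<t}"
      obtain d1 where d1: "d1 > 0" "\<And>e. 0 < e \<Longrightarrow> e < d1 \<Longrightarrow> tau s (x + a *\<^sub>R dir k + e *\<^sub>R dir k) k = ?h a" using fwd by blast
      obtain d2 where d2: "d2 > 0" "\<And>e. 0 < e \<Longrightarrow> e < d2 \<Longrightarrow> tau s (x + a *\<^sub>R dir k - e *\<^sub>R dir k) k = tau s (x + a *\<^sub>R dir k) (k + 2)" using bwd by blast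
      have "?h a = ?h b" if "b \<noteq> a" "dist b a < min d1 d2" for b
      proof (cases "b > a")
        case True
        then show ?thesis using d1(2)[of "b - a"] that by (simp add: dist_real_def algebra_simps)
      next
        case False
        then show ?thesis using d2(2)[of "a - b"] that eq[of a] a by (simp add: dist_real_def algebra_simps)
      qed
      then show "\<forall>\<^sub>F b in at a within {0<..<t}. ?h a = ?h b"
        unfolding eventually_at using d1(1) d2(1) by (intro exI[of _ "min d1 d2"]) auto
    qed
  qed (use ab in auto)
  obtain d1 where d1: "d1 > 0" "\<And>e. 0 < e \<Longrightarrow> e < d1 \<Longrightarrow> ?h e = tau s x k" using fwd[of x] by blast
  obtain d2 where d2: "d2 > 0" "\<And>e. 0 < e \<Longrightarrow> e < d2 \<Longrightarrow> tau s (x + t *\<^sub>R dir k - e *\<^sub>R dir k) k = tau s (x + t *\<^sub>R dir k) (k + 2)"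
    using bwd by blast
  have a: "?h (min d1 t / 2) = tau s x k" using d1 t by simp
  have "x + t *\<^sub>R dir k - (min d2 t / 2) *\<^sub>R dir k = x + (t - min d2 t / 2) *\<^sub>R dir k" by (simp add: algebra_simps)
  moreover have "tau s (x + t *\<^sub>R dir k - (min d2 t / 2) *\<^sub>R dir k) k = tau s (x + t *\<^sub>R dir k) (k + 2)"
    by (rule d2(2)) (use d2(1) t in auto)
  ultimately have b: "?h (t - min d2 t / 2) = tau s (x + t *\<^sub>R dir k) (k + 2)" by (simp only:)
  show "tau s (x + t *\<^sub>R dir k) (k + 2) = tau s x k"
    using const[of "min d1 t / 2" "t - min d2 t / 2"] a b d1(1) d2(1) t by simp
  show "tau s (x + \<tau> *\<^sub>R dir k) k = tau s x k" if "0 < \<tau>" "\<tau> < t"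
    using const[of "min d1 t / 2" \<tau>] a d1(1) t that by simp
qed

definition wt :: real where "wt = (\<Sum>A | s A \<noteq> 0. s A)"

lemma tg_far: assumes "ev k" shows "\<forall>\<^sub>F r in at_top. \<forall>j. off (k + 5) (tg j (y + r *\<^sub>R dir k)) = of_bool (k = 0)"
proof -
  have "\<forall>\<^sub>F r in at_top. r > \<bar>off 0 y\<bar> + \<bar>off 1 y\<bar>" by (rule eventually_gt_at_top)
  then show ?thesis
  proof (eventually_elim, intro allI)
    fix r j assume r: "r > \<bar>off 0 y\<bar> + \<bar>off 1 y\<bar>"
    let ?z = "y + r *\<^sub>R dir k"
    consider "k = 0" | "k = 2" | "k = 4" using assms by (auto simp: ev_def)
    then show "off (k + 5) (tg j (y + r *\<^sub>R dir k)) = of_bool (k = 0)"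
    proof cases
      case 1
      have "off 2 ?z < 0" unfolding 1 off_lin off_num off_dir_num using r by simp
      moreover have "off 4 ?z > 0" unfolding 1 off_lin off_num off_dir_num using r by linarith
      ultimately have "off 2 ?z < 0" "off 4 ?z > 0" .
      then have "\<not> gp 2 j ?z" "gp 4 j ?z" by (auto simp: gp_def)
      then show ?thesis using 1 by (simp add: tg_def off_num off_dir_num)
    next
      case 2
      have "off 0 ?z > 0" unfolding 2 dir_num off_lin off_dir_num using r by simp
      then have "gp 0 j ?z" by (auto simp: gp_def)
      then show ?thesis using 2 by (simp add: tg_def off_num off_dir_num)
    next
      case 3
      have "off 0 ?z < 0" unfolding 3 dir_num off_lin off_dir_num using r by linarith
      then have "\<not> gp 0 j ?z" by (auto simp: gp_def)
      then show ?thesis using 3 by (simp add: tg_def off_num off_dir_num)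
    qed
  qed
qed

text \<open>Far out in direction \<open>dir k\<close> all tripods take the same value of
  \<open>off (k + 5)\<close>, and \<open>tau_mono\<close> bounds the value at \<open>x\<close> by
  it. The three bounds place all displacements in the triangle of size \<open>wt\<close>.\<close>

lemma tau_bound: assumes "ev k" shows "off (k + 5) (tau s x j) \<le> wt * of_bool (k = 0)"
proof -
  have "\<forall>\<^sub>F r in at_top. \<forall>A\<in>{A. s A \<noteq> 0}. \<forall>j. off (k + 5) (tg j (x - A + r *\<^sub>R dir k)) = of_bool (k = 0)"
    using fss by (intro eventually_ball_finite ballI tg_far[OF assms]) (auto simp: fs_def)
  then have "\<forall>\<^sub>F r in at_top. r > 0 \<and> (\<forall>A\<in>{A. s A \<noteq> 0}. \<forall>j. off (k + 5) (tg j (x - A + r *\<^sub>R dir k)) = of_bool (k = 0))"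
    using eventually_gt_at_top[of "0::real"] by eventually_elim simp
  then have "\<exists>r. r > 0 \<and> (\<forall>A\<in>{A. s A \<noteq> 0}. \<forall>j. off (k + 5) (tg j (x - A + r *\<^sub>R dir k)) = of_bool (k = 0))"
    by (rule eventually_happens'[OF trivial_limit_at_top_linorder])
  then obtain r where r: "r > 0" "\<And>A j. s A \<noteq> 0 \<Longrightarrow> off (k + 5) (tg j (x - A + r *\<^sub>R dir k)) = of_bool (k = 0)" by blast
  let ?y = "x + r *\<^sub>R dir k"
  have "off (k + 5) (tau s ?y j) = (\<Sum>A | s A \<noteq> 0. s A * off (k + 5) (tg j (x - A + r *\<^sub>R dir k)))"
    unfolding tau_def off_sum by (rule sum.cong) (simp_all add: algebra_simps)
  also have "\<dots> = wt * of_bool (k = 0)" unfolding wt_def sum_distrib_right using r(2) by (intro sum.cong) auto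
  finally have y: "off (k + 5) (tau s ?y j) = wt * of_bool (k = 0)" .
  have "bil (?y - x) (tau s ?y j - tau s x j) \<ge> 0" by (rule tau_mono)
  then have "r * (off (k + 5) (tau s ?y j) - off (k + 5) (tau s x j)) \<ge> 0" by (simp add: bil_dir' right_diff_distrib del: off_add)
  then show ?thesis using r(1) y by (simp add: zero_le_mult_iff)
qed

end

section \<open>The triangle and its frame\<close>

context hex
begin

definition cor :: "real \<Rightarrow> 6 \<Rightarrow> real^2" where
  "cor r d = (if d = 2 then r *\<^sub>R dir 0 else if d = 4 then r *\<^sub>R dir 1 else 0)"

text \<open>For even \<open>d\<close>, the side of the triangle with direction \<open>dir d\<close> joins \<open>cor r d\<close> to \<open>cor r (d + 2)\<close>.\<close>

definition TT :: "real \<Rightarrow> (real^2) set" where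
  "TT r = {x. \<forall>d. ev d \<longrightarrow> off d (x - cor r d) \<ge> 0}"

lemma cor_next: "ev d \<Longrightarrow> cor r (d + 2) = cor r d + r *\<^sub>R dir d"
  by (auto simp: ev_def cor_def dir_num scaleR_diff_right)

lemma off_cor:
  assumes "ev d"
  shows "off d (cor r (d + 2)) = off d (cor r d)" "off (d + 1) (cor r (d + 2)) = off (d + 1) (cor r d) - r"
    "off (d + 2) (cor r (d + 2)) = off (d + 2) (cor r d) - r" "off d (cor r (d + 4)) = off d (cor r d) + r"
    "off (d + 1) (cor r (d + 4)) = off (d + 1) (cor r d)"
proof -
  have e: "cor r (d + 4) = cor r d + r *\<^sub>R dir d + r *\<^sub>R dir (d + 2)"
    using cor_next[of "d + 2" r] cor_next[OF assms, of r] assms by simp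
  show "off d (cor r (d + 2)) = off d (cor r d)" "off (d + 1) (cor r (d + 2)) = off (d + 1) (cor r d) - r"
    "off (d + 2) (cor r (d + 2)) = off (d + 2) (cor r d) - r" "off d (cor r (d + 4)) = off d (cor r d) + r"
    "off (d + 1) (cor r (d + 4)) = off (d + 1) (cor r d)"
    unfolding e cor_next[OF assms] by simp_all
qed

text \<open>In barycentric coordinates the three distances to the sides add up to \<open>r\<close>.\<close>

lemma TT_iff:
  assumes "ev d"
  shows "x \<in> TT r \<longleftrightarrow> off d (x - cor r d) \<ge> 0 \<and> off (d + 1) (x - cor r d) \<le> 0 \<and> off (d + 2) (x - cor r d) \<ge> - r"
proof -
  have "x \<in> TT r \<longleftrightarrow> off d (x - cor r d) \<ge> 0 \<and> off (d + 2) (x - cor r (d + 2)) \<ge> 0 \<and> off (d + 4) (x - cor r (d + 4)) \<ge> 0"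
  proof
    assume "x \<in> TT r"
    then show "off d (x - cor r d) \<ge> 0 \<and> off (d + 2) (x - cor r (d + 2)) \<ge> 0 \<and> off (d + 4) (x - cor r (d + 4)) \<ge> 0"
      using assms ev_add(2,4)[of d] unfolding TT_def by blast
  next
    assume h: "off d (x - cor r d) \<ge> 0 \<and> off (d + 2) (x - cor r (d + 2)) \<ge> 0 \<and> off (d + 4) (x - cor r (d + 4)) \<ge> 0"
    have "off e (x - cor r e) \<ge> 0" if "ev e" for e
    proof -
      have "e = d \<or> e = d + 2 \<or> e = d + 4" using six_rel[of e d] that assms by auto
      then show ?thesis using h by metis
    qed
    then show "x \<in> TT r" by (simp add: TT_def)
  qed
  moreover have "off (d + 2) (x - cor r (d + 2)) = off (d + 2) (x - cor r d) + r"
    unfolding off_lin off_cor(3)[OF assms] by simp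
  moreover have "off (d + 4) (x - cor r (d + 4)) = - off (d + 1) (x - cor r d)"
    unfolding off_lin off_add(3) off_cor(5)[OF assms] by simp
  ultimately show ?thesis by auto
qed

lemma cor_TT: assumes "r > 0" "ev d" shows "cor r d \<in> TT r"
  using TT_iff[OF assms(2), of "cor r d" r] assms by simp

lemma convex_TT: "convex (TT r)"
proof -
  have "convex {x. off d (x - cor r d) \<ge> 0}" for d
  proof -
    have "{x. off d (x - cor r d) \<ge> 0} = {x. off d x \<ge> off d (cor r d)}" by auto
    moreover have "convex {x. off d x \<ge> c}" for c
    proof (rule convexI)
      fix x y u v assume h: "x \<in> {x. off d x \<ge> c}" "y \<in> {x. off d x \<ge> c}" "0 \<le> u" "0 \<le> v" "u + v = (1::real)"
      have "u * off d x + v * off d y \<ge> u * c + v * c" using h by (intro add_mono mult_left_mono) auto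
      then show "u *\<^sub>R x + v *\<^sub>R y \<in> {x. off d x \<ge> c}" using h by (simp add: distrib_right[symmetric])
    qed
    ultimately show ?thesis by simp
  qed
  moreover have "TT r = (\<Inter>d\<in>{d. ev d}. {x. off d (x - cor r d) \<ge> 0})" by (auto simp: TT_def)
  ultimately show ?thesis by (auto intro: convex_INT)
qed

definition fr :: "real \<Rightarrow> real^2 \<Rightarrow> real" where
  "fr r A = (\<Sum>d\<in>{d. ev d}. of_bool (A = cor r d))"

lemma fs_fr: "fs (fr r)"
  unfolding fr_def by (intro fs_sum fs_point)

lemma D_fr: "D (fr r) x k = (\<Sum>d\<in>{d. ev d}. of_bool (hit k (x - cor r d)))"
  unfolding fr_def by (subst D_sum) (auto simp: D_point)

lemma fr_cor: assumes "r > 0" "ev d" shows "fr r (cor r d) = 1"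
proof -
  have "cor r e = cor r d \<longleftrightarrow> e = d" if e: "ev e" for e
  proof -
    have "cor r (d + 2) \<noteq> cor r d" "cor r (d + 4) \<noteq> cor r d"
      using off_cor(2,4)[OF assms(2), of r] assms(1) by fastforce+
    then show ?thesis using six_rel[of e d] assms(2) e by auto
  qed
  then have "cor r d = cor r e \<longleftrightarrow> e = d" if "ev e" for e using that by metis
  then have "fr r (cor r d) = (\<Sum>e\<in>{e. ev e}. if e = d then 1 else 0)" unfolding fr_def by (intro sum.cong) simp_all
  then show ?thesis using assms(2) by simp
qed

lemma fr_zero: "(\<And>d. ev d \<Longrightarrow> A \<noteq> cor r d) \<Longrightarrow> fr r A = 0"
  unfolding fr_def by (intro sum.neutral) auto

lemma fr_TT: "r > 0 \<Longrightarrow> fr r A \<noteq> 0 \<Longrightarrow> A \<in> TT r"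
  using fr_zero[of A r] cor_TT[of r] by blast

text \<open>Total weight on a line; for even \<open>k\<close> it is the density with which the line
  continues to infinity.\<close>

definition LS :: "(real^2 \<Rightarrow> real) \<Rightarrow> 6 \<Rightarrow> real \<Rightarrow> real" where
  "LS s k c = (\<Sum>A | s A \<noteq> 0 \<and> off k A = c. s A)"

lemma LS_superset: "finite S \<Longrightarrow> {A. s A \<noteq> 0 \<and> off k A = c} \<subseteq> S \<Longrightarrow> S \<subseteq> {A. off k A = c} \<Longrightarrow> LS s k c = (\<Sum>A\<in>S. s A)"
  unfolding LS_def by (rule sum.mono_neutral_left) auto

lemma LS_add: assumes "fs s" "fs s'" shows "LS (\<lambda>A. s A + s' A) k c = LS s k c + LS s' k c"
proof -
  let ?S = "{A. (s A \<noteq> 0 \<or> s' A \<noteq> 0) \<and> off k A = c}"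
  have f: "finite ?S" by (rule finite_subset[of _ "{A. s A \<noteq> 0} \<union> {A. s' A \<noteq> 0}"]) (use assms in \<open>auto simp: fs_def\<close>)
  have "LS (\<lambda>A. s A + s' A) k c = (\<Sum>A\<in>?S. s A + s' A)" "LS s k c = (\<Sum>A\<in>?S. s A)" "LS s' k c = (\<Sum>A\<in>?S. s' A)"
    by (rule LS_superset[OF f]; auto)+
  then show ?thesis by (simp add: sum.distrib)
qed

lemma D_far_eq:
  assumes fs: "fs s" and "ev k" "\<And>A. s A \<noteq> 0 \<Longrightarrow> off k A = off k x \<Longrightarrow> off (k + 1) (x - A) \<le> 0" shows "D s x k = LS s k (off k x)"
proof -
  have True: "finite {A. s A \<noteq> 0}" using fs by (simp add: fs_def)
  have "LS s k (off k x) = (\<Sum>A | s A \<noteq> 0. if off k A = off k x then s A else 0)"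
    unfolding LS_def using True by (simp add: sum.inter_filter[symmetric] Collect_conj_eq[symmetric])
  also have "\<dots> = D s x k" unfolding D_def by (rule sum.cong) (use assms in \<open>auto simp: hit_def\<close>)
  finally show ?thesis by simp
qed

lemma D_far: assumes "fs s" "ev k" shows "\<forall>\<^sub>F t in at_top. D s (x + t *\<^sub>R dir k) k = LS s k (off k x)"
proof -
  have "\<forall>\<^sub>F t in at_top. \<forall>A\<in>{A. s A \<noteq> 0}. t \<ge> off (k + 1) (x - A)"
    using assms(1) by (intro eventually_ball_finite ballI eventually_ge_at_top) (auto simp: fs_def)
  then show ?thesis
  proof eventually_elim
    fix t assume t: "\<forall>A\<in>{A. s A \<noteq> 0}. t \<ge> off (k + 1) (x - A)"
    have "D s (x + t *\<^sub>R dir k) k = LS s k (off k (x + t *\<^sub>R dir k))"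
      by (rule D_far_eq[OF assms]) (use t in auto)
    then show "D s (x + t *\<^sub>R dir k) k = LS s k (off k x)" by simp
  qed
qed

lemma rig_LS: "rig s \<longleftrightarrow> fs s \<and> pos s \<and> (\<forall>s'. fs s' \<and> pos s' \<and> (\<forall>k c. ev k \<longrightarrow> LS s' k c = LS s k c) \<longrightarrow> s' = s)"
proof -
  have eq: "(\<forall>x k. ev k \<longrightarrow> (\<forall>\<^sub>F t in at_top. D s' (x + t *\<^sub>R dir k) k = D s (x + t *\<^sub>R dir k) k)) \<longleftrightarrow> (\<forall>k c. ev k \<longrightarrow> LS s' k c = LS s k c)"
    if f: "fs s" "fs s'" for s'
  proof safe
    fix k c assume h: "\<forall>x k. ev k \<longrightarrow> (\<forall>\<^sub>F t in at_top. D s' (x + t *\<^sub>R dir k) k = D s (x + t *\<^sub>R dir k) k)" and k: "ev k"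
    let ?x = "pt k c 0"
    have "\<forall>\<^sub>F t::real in at_top. LS s' k c = LS s k c"
      using h[rule_format, OF k, of ?x] D_far[OF f(1) k, of ?x] D_far[OF f(2) k, of ?x] by eventually_elim simp
    then show "LS s' k c = LS s k c" by simp
  next
    fix x k assume h: "\<forall>k c. ev k \<longrightarrow> LS s' k c = LS s k c" and k: "ev k"
    show "\<forall>\<^sub>F t in at_top. D s' (x + t *\<^sub>R dir k) k = D s (x + t *\<^sub>R dir k) k"
      using D_far[OF f(1) k, of x] D_far[OF f(2) k, of x] by eventually_elim (use h k in simp)
  qed
  show ?thesis unfolding rig_def
  proof (rule conj_cong[OF refl], rule conj_cong[OF refl], rule iff_allI)
    fix s' assume "fs s"
    then show "(fs s' \<and> pos s' \<and> (\<forall>x k. ev k \<longrightarrow> (\<forall>\<^sub>F t in at_top. D s' (x + t *\<^sub>R dir k) k = D s (x + t *\<^sub>R dir k) k)) \<longrightarrow> s' = s)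
      = (fs s' \<and> pos s' \<and> (\<forall>k c. ev k \<longrightarrow> LS s' k c = LS s k c) \<longrightarrow> s' = s)" using eq[of s'] by satx
  qed
qed

lemma D_nonneg_line:
  assumes "\<And>A. off k A = off k x \<Longrightarrow> s A \<ge> 0" shows "D s x k \<ge> 0"
  unfolding D_def by (rule sum_nonneg) (use assms in \<open>auto simp: hit_def\<close>)

text \<open>No weight lies beyond the line, so by \<open>D_odd_ahead\<close> the odd ray
  \<open>d + 5\<close> pointing there is empty. The jump is then the density of the opposite even
  ray.\<close>

lemma extreme_line:
  assumes "fs s" "pos s" "ev d" "\<And>A. s A \<noteq> 0 \<Longrightarrow> off d A \<ge> c" "off d B = c" shows "s B \<ge> 0" "D s B (d + 5) = 0"
proof -
  show z: "D s B (d + 5) = 0"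
  proof (rule D_odd_ahead)
    fix t :: real assume t: "t > 0"
    show "s (B + t *\<^sub>R dir (d + 5)) = 0"
    proof (rule ccontr)
      assume "s (B + t *\<^sub>R dir (d + 5)) \<noteq> 0"
      then have "off d (B + t *\<^sub>R dir (d + 5)) \<ge> c" by (rule assms(4))
      then show False using assms(5) t by simp
    qed
  qed (use assms in simp)
  have "D s B (d + 2) - D s B (d + 5) = sg (d + 2) * s B" using D_jump[OF assms(1), of B "d + 2"] by simp
  moreover have "D s B (d + 2) \<ge> 0" using assms(2) by (simp add: pos_def)
  ultimately show "s B \<ge> 0" using z assms(3) by (simp add: sg_def)
qed

text \<open>On the outermost line carrying weights of \<open>s'\<close> these are nonnegative, so
  its sum is positive; but the sums of \<open>s\<close> vanish on lines beyond a side.\<close>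

lemma supp_TT_LS:
  assumes s: "fs s" "pos s" "\<And>A. s A \<noteq> 0 \<Longrightarrow> A \<in> TT r" and s': "fs s'" "pos s'"
    and ls: "\<And>k c. ev k \<Longrightarrow> LS s' k c = LS s k c" and A: "s' A \<noteq> 0"
  shows "A \<in> TT r"
proof (rule ccontr)
  assume "A \<notin> TT r"
  then obtain d where d: "ev d" "off d A < off d (cor r d)" by (auto simp: TT_def not_le)
  let ?S = "{A. s' A \<noteq> 0}"
  have fS: "finite ?S" using s' by (simp add: fs_def)
  define c where "c = Min (off d ` ?S)"
  have c: "c \<in> off d ` ?S" unfolding c_def using A fS by (intro Min_in) auto
  have min: "off d B \<ge> c" if "s' B \<noteq> 0" for B unfolding c_def using that fS by (intro Min_le) auto
  have lt: "c < off d (cor r d)" using min[OF A] d(2) by simp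
  obtain B where B: "s' B \<noteq> 0" "off d B = c" using c by auto
  have nn: "s' X \<ge> 0" if "off d X = c" for X using extreme_line(1)[OF s' d(1) min that] by blast
  have "LS s' d c > 0" unfolding LS_def
  proof (rule sum_pos2[of _ B])
    show "finite {A. s' A \<noteq> 0 \<and> off d A = c}" using fS by (rule rev_finite_subset) auto
    show "0 < s' B" using B nn[of B] by simp
  qed (use B nn in auto)
  moreover have "LS s d c = 0" unfolding LS_def
    by (rule sum.neutral) (use s(3) d(1) lt in \<open>force simp: TT_def\<close>)
  ultimately show False using ls[OF d(1), of c] by simp
qed

text \<open>The line through a corner parallel to the opposite side meets the triangle in that
  corner only.\<close>

lemma LS_corner:
  assumes "\<And>A. s A \<noteq> 0 \<Longrightarrow> A \<in> TT r" "ev d" shows "LS s (d + 2) (off (d + 2) (cor r d)) = s (cor r d)"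
proof -
  have "A = cor r d" if "s A \<noteq> 0" "off (d + 2) A = off (d + 2) (cor r d)" for A
  proof -
    have "off d (A - cor r d) \<ge> 0" "off (d + 1) (A - cor r d) \<le> 0" using assms(1)[OF that(1)] TT_iff[OF assms(2)] by auto
    moreover have "off (d + 2) (A - cor r d) = 0" using that(2) by simp
    ultimately have "off d A = off d (cor r d)" "off (d + 1) A = off (d + 1) (cor r d)" by simp_all
    then show ?thesis by (rule off_eqI)
  qed
  then have "LS s (d + 2) (off (d + 2) (cor r d)) = (\<Sum>A\<in>{cor r d}. s A)" by (intro LS_superset) auto
  then show ?thesis by simp
qed

lemma fr_hit_cases:
  assumes "ev d" "hit k (x - cor r d)"
  shows "(k = d \<or> k = d + 3) \<and> off d x = off d (cor r d) \<or> (k = d + 4 \<or> k = d + 1) \<and> off (d + 4) x = off (d + 4) (cor r (d + 4))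
    \<or> (k = d + 2 \<or> k = d + 5) \<and> off (d + 2) x = off (d + 2) (cor r d)"
proof -
  have k: "off k x = off k (cor r d)" using assms(2) by (simp add: hit_def)
  have e: "off (d + 4) (cor r (d + 4)) = off (d + 4) (cor r d)" using off_cor(5)[OF assms(1), of r] by simp
  show ?thesis unfolding e using six_rel[of k d] k by (elim disjE) auto
qed

end

locale hext = hexs +
  fixes r :: real
  assumes r: "r > 0" and suppTT: "s A \<noteq> 0 \<Longrightarrow> A \<in> TT r"
begin

definition u :: "real^2 \<Rightarrow> real" where "u A = s A + fr r A"

lemma fs_u: "fs u" unfolding u_def using fss fs_fr by (intro fs_add)

lemma D_u: "D u x k = D s x k + D (fr r) x k"
  unfolding u_def by (rule D_add[OF fss fs_fr])

lemma pos_u: "pos u" unfolding pos_def D_u D_fr by (auto intro!: add_nonneg_nonneg sum_nonneg)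

lemma u_supp: "u A \<noteq> 0 \<Longrightarrow> A \<in> TT r"
  using suppTT fr_TT[OF r, of A] by (cases "s A = 0") (auto simp: u_def)

lemma side_min: assumes "ev d" "s A \<noteq> 0" shows "off d A \<ge> off d (cor r d)"
  using suppTT[OF assms(2)] assms(1) by (simp add: TT_def)

lemma side_nonneg: assumes "ev d" "off d B = off d (cor r d)" shows "s B \<ge> 0"
  using extreme_line(1)[OF fss poss assms(1) side_min[OF assms(1)] assms(2)] .

lemma cor_nonneg: "ev d \<Longrightarrow> s (cor r d) \<ge> 0"
  using side_nonneg[of d "cor r d"] by simp

lemma u_cor: "ev d \<Longrightarrow> u (cor r d) \<ge> 1"
  using fr_cor[OF r, of d] cor_nonneg[of d] by (simp add: u_def)

text \<open>A competitor has the same weights at the corners, since these are line sums. Subtracting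
  the frame keeps it nonnegative, because every line met by the frame then carries nonnegative
  weights only. Rigidity of \<open>s\<close> applies to the remainder.\<close>

lemma rig_u: assumes rig: "rig s" shows "rig u"
  unfolding rig_LS
proof (intro conjI allI impI fs_u pos_u, elim conjE)
  fix u' assume u': "fs u'" "pos u'" and ls: "\<forall>k c. ev k \<longrightarrow> LS u' k c = LS u k c"
  have TT': "u' A \<noteq> 0 \<Longrightarrow> A \<in> TT r" for A using supp_TT_LS[OF fs_u pos_u u_supp u'] ls by blast
  have min': "off d A \<ge> off d (cor r d)" if "ev d" "u' A \<noteq> 0" for d A using TT'[OF that(2)] that(1) by (simp add: TT_def)
  have cor': "u' (cor r d) = u (cor r d)" if "ev d" for d
    using LS_corner[of u' r d] LS_corner[of u r d] TT' u_supp that ls by simp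
  define s' where "s' A = u' A - fr r A" for A
  have fs': "fs s'" unfolding s'_def using u' fs_fr by (intro fs_diff)
  have D': "D s' x k = D u' x k - D (fr r) x k" for x k unfolding s'_def by (rule D_diff[OF u'(1) fs_fr])
  have nn_side: "s' B \<ge> 0" if d: "ev d" "off d B = off d (cor r d)" for d B
  proof (cases "\<exists>e. ev e \<and> B = cor r e")
    case True
    then obtain e where e: "ev e" "B = cor r e" by blast
    then show ?thesis using cor'[OF e(1)] u_cor[OF e(1)] fr_cor[OF r e(1)] by (simp add: s'_def)
  next
    case False
    then have "fr r B = 0" by (intro fr_zero) auto
    moreover have "u' B \<ge> 0" using extreme_line(1)[OF u' d(1) min'[OF d(1)] d(2)] .
    ultimately show ?thesis by (simp add: s'_def)
  qed
  have nn_cor: "s' B \<ge> 0" if d: "ev d" "off (d + 2) B = off (d + 2) (cor r d)" for d B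
  proof (cases "u' B = 0 \<and> fr r B = 0")
    case False
    then have BT: "B \<in> TT r" using TT' fr_TT[OF r, of B] by blast
    then have "off d (B - cor r d) \<ge> 0" "off (d + 1) (B - cor r d) \<le> 0" using TT_iff[OF d(1)] by auto
    then have "off d B = off d (cor r d)" using d(2) by simp
    then show ?thesis using nn_side[OF d(1)] by blast
  qed (simp add: s'_def)
  have "pos s'" unfolding pos_def
  proof (intro allI)
    fix x k
    show "D s' x k \<ge> 0"
    proof (cases "\<exists>d. ev d \<and> hit k (x - cor r d)")
      case False
      then have "D (fr r) x k = 0" unfolding D_fr by (intro sum.neutral) auto
      then show ?thesis using u'(2) by (simp add: D' pos_def)
    next
      case True
      then obtain d where d: "ev d" "hit k (x - cor r d)" by blast
      have "s' A \<ge> 0" if A: "off k A = off k x" for A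
      proof -
        consider (1) "k = d \<or> k = d + 3" "off d x = off d (cor r d)"
          | (2) "k = d + 4 \<or> k = d + 1" "off (d + 4) x = off (d + 4) (cor r (d + 4))"
          | (3) "k = d + 2 \<or> k = d + 5" "off (d + 2) x = off (d + 2) (cor r d)"
          using fr_hit_cases[OF d] by satx
        then show ?thesis
        proof cases
          case 1
          then have "off d A = off d (cor r d)" using A by auto
          then show ?thesis using nn_side[OF d(1)] by blast
        next
          case 2
          then have "off (d + 4) A = off (d + 4) (cor r (d + 4))" using A by auto
          then show ?thesis using nn_side[of "d + 4" A] d(1) by simp
        next
          case 3
          then have "off (d + 2) A = off (d + 2) (cor r d)" using A by auto
          then show ?thesis using nn_cor[OF d(1)] by blast
        qed
      qed
      then show ?thesis by (rule D_nonneg_line)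
    qed
  qed
  moreover have "LS s' k c = LS s k c" if "ev k" for k c
  proof -
    have "u' = (\<lambda>A. s' A + fr r A)" "u = (\<lambda>A. s A + fr r A)" by (auto simp: s'_def u_def)
    then have "LS u' k c = LS (\<lambda>A. s' A + fr r A) k c" "LS u k c = LS (\<lambda>A. s A + fr r A) k c" by simp_all
    then show ?thesis using ls that LS_add[OF fs' fs_fr] LS_add[OF fss fs_fr] by simp
  qed
  ultimately have "s' = s" using rig fs' unfolding rig_LS by blast
  then show "u' = u" unfolding s'_def u_def by (metis add.commute diff_add_cancel)
qed

end

section \<open>Flags of the framed measure\<close>

context hext
begin

abbreviation on :: "6 \<Rightarrow> real^2 \<Rightarrow> bool" where "on d x \<equiv> off d x = off d (cor r d)"

lemma side_ray: assumes "ev d" "x \<in> TT r" "on d x" shows "D u x d \<ge> 1" "x \<noteq> cor r d \<Longrightarrow> D u x (d + 3) \<ge> 1" "D u x (d + 5) = 0"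
proof -
  have o: "off (d + 1) (x - cor r d) \<le> 0" using assms TT_iff[OF assms(1)] by blast
  have fr1: "D (fr r) x k \<ge> 1" if "hit k (x - cor r d)" for k
  proof -
    have "D (fr r) x k \<ge> (\<Sum>e\<in>{d}. of_bool (hit k (x - cor r e)))" unfolding D_fr using assms(1) by (intro sum_mono2) auto
    then show ?thesis using that by simp
  qed
  have "hit d (x - cor r d)" using o assms by (simp add: hit_def)
  then show "D u x d \<ge> 1" using fr1[of d] D_nonneg[of x d] unfolding D_u by linarith
  show "D u x (d + 3) \<ge> 1" if "x \<noteq> cor r d"
  proof -
    have "off (d + 1) (x - cor r d) \<noteq> 0" using that off_eqI[of d x "cor r d"] assms(3) by auto
    then have "hit (d + 3) (x - cor r d)" using o assms by (simp add: hit_def)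
    then show ?thesis using fr1[of "d + 3"] D_nonneg[of x "d + 3"] unfolding D_u by linarith
  qed
  show "D u x (d + 5) = 0"
    by (rule extreme_line(2)[OF fs_u pos_u assms(1) _ assms(3)]) (use u_supp assms(1) in \<open>auto simp: TT_def\<close>)
qed

lemma D_s_le_u: "D s x k \<le> D u x k"
  unfolding D_u D_fr by (simp add: sum_nonneg)

lemma off_dir_sign: "off d (dir k) > 0 \<longleftrightarrow> k = d + 1 \<or> k = d + 2" "off d (dir k) < 0 \<longleftrightarrow> k = d + 4 \<or> k = d + 5"
  "off d (dir k) = 0 \<longleftrightarrow> k = d \<or> k = d + 3"
  using six_rel[of k d] by (elim disjE; simp)+

text \<open>Beyond side \<open>d\<close>, every ray lies on a tripod ray that has come out through
  that side. Its direction is \<open>d + 4\<close> or \<open>d + 1\<close>, and these are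
  opposite.\<close>

lemma branch_TT: assumes "branch u B" shows "B \<in> TT r"
proof (rule ccontr)
  assume "B \<notin> TT r"
  then obtain d where d: "ev d" "off d B < off d (cor r d)" by (auto simp: TT_def not_le)
  have min: "off d A \<ge> off d (cor r d)" if "u A \<noteq> 0" for A using u_supp[OF that] d(1) by (simp add: TT_def)
  have ray: "k = d + 4 \<or> k = d + 1" if p: "pr u B k" for k
  proof (cases "ev k")
    case True
    have "\<exists>t\<ge>0. u (B - t *\<^sub>R dir k) \<noteq> 0"
    proof (rule ccontr)
      assume "\<not> (\<exists>t\<ge>0. u (B - t *\<^sub>R dir k) \<noteq> 0)"
      then have "D u B k = 0" by (intro D_even_behind[OF True]) blast
      then show False using p by (simp add: pr_def)
    qed
    then obtain t where t: "t \<ge> 0" "u (B - t *\<^sub>R dir k) \<noteq> 0" by blast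
    then have "t * off d (dir k) < 0" using min[OF t(2)] d(2) by simp
    then have "off d (dir k) < 0" using t(1) by (simp add: mult_less_0_iff)
    then show ?thesis using True d(1) by (auto simp: off_dir_sign)
  next
    case False
    have "\<exists>t>0. u (B + t *\<^sub>R dir k) \<noteq> 0"
    proof (rule ccontr)
      assume "\<not> (\<exists>t>0. u (B + t *\<^sub>R dir k) \<noteq> 0)"
      then have "D u B k = 0" by (intro D_odd_ahead[OF False]) blast
      then show False using p by (simp add: pr_def)
    qed
    then obtain t where t: "t > 0" "u (B + t *\<^sub>R dir k) \<noteq> 0" by blast
    then have "t * off d (dir k) > 0" using min[OF t(2)] d(2) by simp
    then have "off d (dir k) > 0" using t(1) by (simp add: zero_less_mult_iff)
    then show ?thesis using False d(1) by (auto simp: off_dir_sign)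
  qed
  obtain a b where "pr u B a" "pr u B b" "b \<noteq> a" "b \<noteq> a + 3" using assms by (auto simp: branch_def)
  moreover from this have "a = d + 4 \<or> a = d + 1" "b = d + 4 \<or> b = d + 1" using ray by blast+
  ultimately show False by (elim disjE) simp_all
qed

text \<open>The sector between \<open>dir k\<close> and \<open>dir (k + 1)\<close> at \<open>B\<close> points into the triangle.\<close>

definition inn :: "real^2 \<Rightarrow> 6 \<Rightarrow> bool" where
  "inn B k \<longleftrightarrow> B \<in> TT r \<and> (\<forall>d. ev d \<and> on d B \<longrightarrow> k = d \<or> k = d + 1 \<or> k = d + 2)"

text \<open>A flag is an oriented edge of the framed measure with a white piece on its left. An edge
  inside the triangle gives two flags, an edge on a side gives one.\<close>

definition FF :: "((real^2) \<times> 6) set" where "FF = {(B, k). branch u B \<and> pr u B k \<and> inn B k}"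

definition BF :: "((real^2) \<times> 6) set" where "BF = {(B, k). (B, k) \<in> FF \<and> ev k \<and> on k B}"

end

section \<open>Walks around the white pieces of the framed measure\<close>

locale framed = hext + assumes rig: "rig s"
begin

sublocale U: hexs dir u
  by unfold_locales (rule fs_u, rule pos_u)

sublocale U: hexa dir u
  by unfold_locales (rule U.acyclic_GG[OF rig_u[OF rig]])

lemma FF_D: assumes "(B, k) \<in> FF" shows "branch u B" "pr u B k" "inn B k" "B \<in> TT r"
  using assms by (auto simp: FF_def inn_def)

lemma finite_FF: "finite FF"
  by (rule finite_subset[of _ "{B. branch u B} \<times> UNIV"]) (auto simp: FF_def U.finite_branch)

text \<open>The ray heads for side \<open>d\<close>, which is part of the framed support, so it
  meets a branch point there at the latest; \<open>T\<close> below is the distance.\<close>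

lemma ray_fin: assumes b: "branch u B" "pr u B k" and d: "ev d" "k = d + 4 \<or> k = d + 5" "\<not> on d B"
  shows "fin u B k" "0 \<le> t \<Longrightarrow> t \<le> len u B k \<Longrightarrow> B + t *\<^sub>R dir k \<in> TT r" "nb u B k \<in> TT r"
proof -
  note BT = branch_TT[OF b(1)]
  define T where "T = off d (B - cor r d)"
  have odk: "off d (dir k) = - 1" using d(2) by auto
  have T: "T > 0"
  proof -
    have "T \<ge> 0" using BT d(1) by (simp add: T_def TT_def)
    moreover have "T \<noteq> 0" using d by (auto simp: T_def)
    ultimately show ?thesis by simp
  qed
  have inTT: "B + t *\<^sub>R dir k \<in> TT r" if "0 \<le> t" "t \<le> T" for t
    unfolding TT_def
  proof (intro CollectI allI impI)
    fix e assume e: "ev e"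
    have B: "off e (B - cor r e) \<ge> 0" using BT e by (simp add: TT_def)
    show "0 \<le> off e (B + t *\<^sub>R dir k - cor r e)"
    proof (cases "e = d")
      case True then show ?thesis using that odk by (simp add: T_def)
    next
      case False
      have "e = d + 2 \<or> e = d + 4" using six_rel[of e d] False e d(1) by auto
      then have "\<not> off e (dir k) < 0" unfolding off_dir_sign using d(2) by (elim disjE) simp_all
      then have "t * off e (dir k) \<ge> 0" using that by simp
      then show ?thesis using B by simp
    qed
  qed
  let ?y = "B + T *\<^sub>R dir k"
  have y: "?y \<in> TT r" "on d ?y" using inTT[of T] T odk by (auto simp: T_def)
  have "\<exists>t. 0 < t \<and> t \<le> T \<and> branch u (B + t *\<^sub>R dir k)"
  proof (rule ccontr)
    assume no: "\<not> (\<exists>t. 0 < t \<and> t \<le> T \<and> branch u (B + t *\<^sub>R dir k))"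
    have "D u ?y (k + 3) = D u B k"
      by (rule D_const[OF T]) (use no U.nz_branch in force)
    then have "pr u ?y (k + 3)" using b(2) by (simp add: pr_def)
    moreover have "pr u ?y d" using side_ray(1)[OF d(1) y] by (simp add: pr_def)
    moreover have "k + 3 \<noteq> d \<and> k + 3 \<noteq> d + 3" using d(2) by auto
    ultimately have "branch u ?y" unfolding branch_def by blast
    then show False using no T by blast
  qed
  then obtain t where t: "0 < t" "t \<le> T" "branch u (B + t *\<^sub>R dir k)" by blast
  then show fin: "fin u B k" by (auto simp: fin_def ahead_def)
  have "len u B k \<le> T" using U.len_props(3)[OF fin t(1)] t by force
  then show i: "0 \<le> t \<Longrightarrow> t \<le> len u B k \<Longrightarrow> B + t *\<^sub>R dir k \<in> TT r" for t using inTT by simp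
  show "nb u B k \<in> TT r" unfolding nb_def using U.len_props(1)[OF fin] by (intro i) auto
qed

lemma FF_fin: assumes f: "(B, k) \<in> FF" shows "fin u B k" "0 \<le> t \<Longrightarrow> t \<le> len u B k \<Longrightarrow> B + t *\<^sub>R dir k \<in> TT r" "nb u B k \<in> TT r"
proof -
  note b = FF_D[OF f]
  define d where "d = (if ev k then k + 2 else k + 1)"
  have d: "ev d" "k = d + 4 \<or> k = d + 5" by (auto simp: d_def)
  moreover have "\<not> on d B" using b(3) d by (auto simp: inn_def)
  ultimately show "fin u B k" "0 \<le> t \<Longrightarrow> t \<le> len u B k \<Longrightarrow> B + t *\<^sub>R dir k \<in> TT r" "nb u B k \<in> TT r"
    using ray_fin[OF b(1,2)] by blast+
qed

definition lam :: "(real^2) \<times> 6 \<Rightarrow> real" where "lam = (\<lambda>(B, k). len u B k)"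

text \<open>Displacement of the piece to the left of the flag. It uses \<open>s\<close>, not
  \<open>u\<close>: the frame contributes lengths but no displacement.\<close>

definition sig :: "(real^2) \<times> 6 \<Rightarrow> real^2" where "sig = (\<lambda>(B, k). tau s B k)"

text \<open>The next flag of the same white piece, which stays on the left.\<close>

definition phi :: "(real^2) \<times> 6 \<Rightarrow> (real^2) \<times> 6" where
  "phi = (\<lambda>(B, k). (nb u B k, pv u (nb u B k) (k + 3)))"

definition opp :: "(real^2) \<times> 6 \<Rightarrow> (real^2) \<times> 6" where "opp = (\<lambda>(B, k). (nb u B k, k + 3))"

lemma FF_nb: assumes f: "(B, k) \<in> FF" and e: "ev e" "on e (nb u B k)"
  shows "k = e \<and> on e B \<or> k = e + 4 \<or> k = e + 5"
proof -
  note b = FF_D[OF f]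
  have fin: "fin u B k" using FF_fin[OF f] by simp
  have l: "len u B k > 0" by (rule U.len_props(1)[OF fin])
  have B: "off e B = off e (cor r e) - len u B k * off e (dir k)" using e(2) by (simp add: nb_def)
  moreover have "off e (cor r e) \<le> off e B" using b(4) e(1) by (simp add: TT_def)
  ultimately have "len u B k * off e (dir k) \<le> 0" by linarith
  then have "\<not> off e (dir k) > 0" using l by (simp add: mult_le_0_iff)
  moreover have "k \<noteq> e + 3"
  proof
    assume k: "k = e + 3"
    then have "on e B" using B by simp
    then show False using b(3) e(1) k by (auto simp: inn_def)
  qed
  moreover have "on e B" if "k = e" using B that by simp
  ultimately show ?thesis using six_rel[of k e] by (auto simp: off_dir_sign)
qed

lemma lam_pos: "f \<in> FF \<Longrightarrow> lam f > 0"
  using FF_fin(1) U.len_props(1) by (cases f) (auto simp: lam_def)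

lemma pv_cases: "pv u x (k + 3) = k + 2 \<or> pv u x (k + 3) = k + 1"
  by (auto simp: pv_def)

lemma phi_dir: "snd (phi (B, k)) = k + 1 \<or> snd (phi (B, k)) = k + 2"
  using pv_cases[of "nb u B k" k] by (auto simp: phi_def)

lemma phi_FF: assumes f: "f \<in> FF" shows "phi f \<in> FF"
proof -
  obtain B k where Bk: "f = (B, k)" by force
  note g = f[unfolded Bk]
  note b = FF_D[OF g] FF_fin[OF g]
  let ?B = "nb u B k"
  have br: "branch u ?B" by (rule U.len_props(2)[OF b(5)])
  have "inn ?B (pv u ?B (k + 3))" unfolding inn_def
  proof (intro conjI allI impI b(7), elim conjE)
    fix e assume e: "ev e" "on e ?B"
    from FF_nb[OF g e] consider "k = e" | "k = e + 4" | "k = e + 5" by blast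
    then show "pv u ?B (k + 3) = e \<or> pv u ?B (k + 3) = e + 1 \<or> pv u ?B (k + 3) = e + 2"
    proof cases
      case 2
      have "pr u ?B e" using side_ray(1)[OF e(1) b(7) e(2)] by (simp add: pr_def)
      then show ?thesis using 2 by (simp add: pv_def)
    qed (use pv_cases[of ?B k] in auto)
  qed
  then show ?thesis using br U.pv_pr[OF br] by (simp add: Bk phi_def FF_def)
qed

lemma opp_FF: assumes f: "f \<in> FF - BF" shows "opp f \<in> FF - BF" "opp (opp f) = f"
proof -
  obtain B k where Bk: "f = (B, k)" by force
  have g: "(B, k) \<in> FF" "\<not> (ev k \<and> on k B)" using f by (auto simp: Bk BF_def)
  note b = FF_D[OF g(1)] FF_fin[OF g(1)]
  let ?B = "nb u B k"
  have br: "branch u ?B" by (rule U.len_props(2)[OF b(5)])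
  have "inn ?B (k + 3)" unfolding inn_def
  proof (intro conjI allI impI b(7), elim conjE)
    fix e assume e: "ev e" "on e ?B"
    show "k + 3 = e \<or> k + 3 = e + 1 \<or> k + 3 = e + 2" using FF_nb[OF g(1) e] g(2) e(1) by auto
  qed
  moreover have "\<not> (ev (k + 3) \<and> on (k + 3) ?B)"
  proof
    assume "ev (k + 3) \<and> on (k + 3) ?B"
    with FF_nb[OF g(1), of "k + 3"] show False by auto
  qed
  ultimately show "opp f \<in> FF - BF" using br U.pr_nb[OF b(5)] b(2) by (simp add: Bk opp_def FF_def BF_def)
  show "opp (opp f) = f" using U.nb_back(3)[OF b(1,5)] by (simp add: Bk opp_def)
qed

lemma phi_inj: "inj_on phi FF"
proof (rule inj_onI)
  fix f g assume fg: "f \<in> FF" "g \<in> FF" "phi f = phi g"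
  obtain B k C l where Bk: "f = (B, k)" "g = (C, l)" by force
  have h: "nb u B k = nb u C l" "pv u (nb u B k) (k + 3) = pv u (nb u B k) (l + 3)" using fg(3) by (auto simp: Bk phi_def)
  have b: "branch u B" "fin u B k" "pr u B k" "branch u C" "fin u C l" "pr u C l" using fg FF_D FF_fin(1) by (auto simp: Bk)
  have p: "pr u (nb u B k) (k + 3)" "pr u (nb u B k) (l + 3)" using b U.pr_nb h(1) by metis+
  have "k = l" using six_rel[of l k] by (elim disjE) (use h(2) p in \<open>simp_all add: pv_def split: if_splits\<close>)
  moreover have "nb u (nb u B k) (k + 3) = B" "nb u (nb u C l) (l + 3) = C" using b by (auto intro: U.nb_back(3))
  then have "B = C" using h(1) \<open>k = l\<close> by metis
  ultimately show "f = g" using Bk by simp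
qed

lemma phi_bij: "bij_betw phi FF FF"
proof -
  have "phi ` FF = FF" using phi_FF by (intro endo_inj_surj[OF finite_FF] phi_inj) blast
  then show ?thesis using phi_inj by (simp add: bij_betw_def)
qed

lemma interior: assumes f: "(B, k) \<in> FF" and t: "0 < t" "t < len u B k"
  shows "D s (B + t *\<^sub>R dir k) (k + 1) = 0" "D s (B + t *\<^sub>R dir k) (k + 2) = 0"
proof -
  note b = FF_D[OF f] FF_fin[OF f]
  have nb: "\<not> branch u (B + t *\<^sub>R dir k)" by (rule U.len_props(3)[OF b(5) t])
  have "pr u (B + t *\<^sub>R dir k) k" using U.D_edge_fwd[OF b(5), of t] t b(2) by (simp add: pr_def)
  from U.nonbranch(3)[OF nb this, of "k + 1"] U.nonbranch(3)[OF nb this, of "k + 2"]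
  have "\<not> pr u (B + t *\<^sub>R dir k) (k + 1)" "\<not> pr u (B + t *\<^sub>R dir k) (k + 2)" by simp_all
  then show "D s (B + t *\<^sub>R dir k) (k + 1) = 0" "D s (B + t *\<^sub>R dir k) (k + 2) = 0"
    using D_s_le_u[of "B + t *\<^sub>R dir k"] D_nonneg unfolding U.not_pr by (metis order_antisym)+
qed

lemma tau_nb: assumes f: "(B, k) \<in> FF" shows "tau s (nb u B k) (k + 2) = sig (B, k)"
  unfolding nb_def sig_def prod.case
  by (rule tau_edge(1)[OF U.len_props(1)[OF FF_fin(1)[OF f]]]) (use interior[OF f] in blast)

lemma sig_phi: assumes f: "f \<in> FF" shows "sig (phi f) = sig f"
proof -
  obtain B k where Bk: "f = (B, k)" by force
  note g = f[unfolded Bk]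
  have "tau s (nb u B k) (pv u (nb u B k) (k + 3)) = tau s (nb u B k) (k + 2)"
  proof (cases "pr u (nb u B k) (k + 2)")
    case False
    then have "D s (nb u B k) (k + 2) = 0" using D_s_le_u[of "nb u B k" "k + 2"] D_nonneg[of "nb u B k" "k + 2"] unfolding U.not_pr by simp
    then have "tau s (nb u B k) (k + 1) = tau s (nb u B k) (k + 2)" using tau_jump[of s "nb u B k" "k + 1"] by simp
    then show ?thesis using False by (simp add: pv_def)
  qed (simp add: pv_def)
  then show ?thesis using tau_nb[OF g] by (simp add: Bk phi_def sig_def)
qed

lemma D_s_nb: assumes f: "(B, k) \<in> FF" shows "D s (nb u B k) (k + 3) = D s B k"
  unfolding nb_def
proof (rule D_const)
  note b = FF_D[OF f] FF_fin[OF f]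
  show "len u B k > 0" by (rule U.len_props(1)[OF b(5)])
  fix t assume t: "0 < t" "t < len u B k"
  show "s (B + t *\<^sub>R dir k) = 0"
  proof (rule ccontr)
    assume "s (B + t *\<^sub>R dir k) \<noteq> 0"
    then have "branch s (B + t *\<^sub>R dir k)" by (rule nz_branch)
    then have "pr s (B + t *\<^sub>R dir k) (k + 1) \<or> pr s (B + t *\<^sub>R dir k) (k + 1 + 1)" by (rule branch_gap)
    then show False using interior[OF f t] by (simp add: pr_def)
  qed
qed

lemma sig_opp: assumes f: "(B, k) \<in> FF" shows "sig (opp (B, k)) = sig (B, k) + D s B k *\<^sub>R dir (k + 5)"
proof -
  have "tau s (nb u B k) (k + 3) - tau s (nb u B k) (k + 2) = D s (nb u B k) (k + 3) *\<^sub>R dir (k + 5)"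
    using tau_jump[of s "nb u B k" "k + 2"] by simp
  then show ?thesis using tau_nb[OF f] D_s_nb[OF f] by (simp add: opp_def sig_def algebra_simps)
qed

text \<open>Only the flags along the sides lie on the frame; any other flag owes its density to
  \<open>s\<close>.\<close>

lemma D_s_inner: assumes "(B, k) \<in> FF - BF" shows "D s B k > 0"
proof -
  have f: "(B, k) \<in> FF" "\<not> (ev k \<and> on k B)" using assms by (auto simp: BF_def)
  note b = FF_D[OF f(1)]
  have "\<not> hit k (B - cor r d)" if d: "ev d" for d
  proof
    assume h: "hit k (B - cor r d)"
    consider (1) "k = d \<or> k = d + 3" "on d B" | (2) "k = d + 4 \<or> k = d + 1" "on (d + 4) B"
      | (3) "k = d + 2 \<or> k = d + 5" "off (d + 2) B = off (d + 2) (cor r d)"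
      using fr_hit_cases[OF d h] by satx
    then show False
    proof cases
      case 1 then show ?thesis using b(3) d f(2) by (auto simp: inn_def)
    next
      case 2
      have "k = d + 4 \<or> k = d + 4 + 1 \<or> k = d + 4 + 2" using b(3) d 2(2) unfolding inn_def by (metis ev_add(4))
      then have "k = d + 4" using 2(1) by (elim disjE) simp_all
      then show ?thesis using 2(2) f(2) d by simp
    next
      case 3
      have "off d (B - cor r d) \<ge> 0" "off (d + 1) (B - cor r d) \<le> 0" using b(4) TT_iff[OF d] by auto
      then have e: "on d B" "off (d + 1) B = off (d + 1) (cor r d)" using 3(2) by simp_all
      then have "B = cor r d" by (rule off_eqI)
      then have "on (d + 4) B" using off_cor(5)[OF d, of r] by simp
      then have "k = d + 4 \<or> k = d + 4 + 1 \<or> k = d + 4 + 2" using b(3) d unfolding inn_def by (metis ev_add(4))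
      moreover have "k = d \<or> k = d + 1 \<or> k = d + 2" using b(3) d e(1) by (auto simp: inn_def)
      ultimately show ?thesis using f(2) d e(1) by auto
    qed
  qed
  then have "D (fr r) B k = 0" unfolding D_fr by (intro sum.neutral) auto
  then show ?thesis using b(2) by (simp add: pr_def D_u)
qed

text \<open>The region displaced by \<open>sig f\<close> lies to the left of the edge of \<open>f\<close>.\<close>

lemma face_left: assumes f: "(B, k) \<in> FF" and x: "x \<in> TT r" "tau s x l = sig (B, k)" shows "off k (x - B) \<ge> 0"
proof (cases "(B, k) \<in> BF")
  case True
  then show ?thesis using x(1) by (auto simp: BF_def TT_def)
next
  case False
  then have D: "D s B k > 0" using D_s_inner f by blast
  have "bil (x - B) (tau s x l - tau s B (k + 5)) \<ge> 0" by (rule tau_mono)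
  moreover have "tau s x l - tau s B (k + 5) = D s B k *\<^sub>R dir (k + 2)" using x(2) tau_step[of s B k] by (simp add: sig_def del: dir_add)
  ultimately have "D s B k * off k (x - B) \<ge> 0" by (simp add: bil_dir del: dir_add off_lin)
  then show ?thesis using D by (simp add: zero_le_mult_iff)
qed

lemma face_left_nb: assumes f: "(B, k) \<in> FF" and g: "(C, l) \<in> FF" "sig (C, l) = sig (B, k)"
  shows "off k (C - B) \<ge> 0" "off k (nb u C l - B) \<ge> 0"
  using face_left[OF f FF_D(4)[OF g(1)], of l] face_left[OF f FF_fin(3)[OF g(1)], of "l + 2"] g(2) tau_nb[OF g(1)]
  by (simp_all add: sig_def)

text \<open>By \<open>face_left\<close> both flags lie on one line. Were one of them ahead,
  \<open>face_left\<close> for the flag following the other would keep its end from passing the end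
  of the other, so its start would be a branch point inside an edge.\<close>

lemma sig_dir_inj: assumes f: "(B, k) \<in> FF" and g: "(C, k) \<in> FF" "sig (C, k) = sig (B, k)" shows "C = B"
proof -
  have *: "\<not> off (k + 1) (B - C) > 0" if f: "(B, k) \<in> FF" and g: "(C, k) \<in> FF" "sig (C, k) = sig (B, k)" and z: "off k (C - B) = 0" for B C
  proof
    assume t: "off (k + 1) (B - C) > 0"
    let ?t = "off (k + 1) (B - C)"
    have C: "C = B + ?t *\<^sub>R dir k" using on_lineD[OF z] by (simp add: algebra_simps)
    note b = FF_D[OF f] FF_fin[OF f]
    have "phi (B, k) \<in> FF" "sig (phi (B, k)) = sig (B, k)" using phi_FF sig_phi f by auto
    then have p: "(nb u B k, snd (phi (B, k))) \<in> FF" "sig (nb u B k, snd (phi (B, k))) = sig (B, k)" by (auto simp: phi_def)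
    have "off (snd (phi (B, k))) (nb u C k - nb u B k) \<ge> 0" using face_left_nb(2)[OF p(1) g(1)] p(2) g(2) by simp
    moreover have "nb u C k - nb u B k = (?t + len u C k - len u B k) *\<^sub>R dir k"
    proof -
      have CB: "C - B = ?t *\<^sub>R dir k" using C by (metis add_diff_cancel_left')
      have "nb u C k - nb u B k = (C - B) + (len u C k - len u B k) *\<^sub>R dir k" by (simp add: nb_def algebra_simps)
      then show ?thesis unfolding CB scaleR_left_distrib[symmetric] by (simp only: add_diff_eq)
    qed
    moreover have "off (snd (phi (B, k))) (dir k) = - 1" using phi_dir[of B k] by auto
    ultimately have "?t + len u C k \<le> len u B k" by simp
    moreover have "len u C k > 0" using lam_pos[OF g(1)] by (simp add: lam_def)
    ultimately have "\<not> branch u (B + ?t *\<^sub>R dir k)" using U.len_props(3)[OF b(5), of ?t] t by simp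
    then show False using FF_D(1)[OF g(1)] C by simp
  qed
  have "off k (C - B) \<ge> 0" "off k (B - C) \<ge> 0" using face_left_nb(1)[OF f g] face_left_nb(1)[OF g(1) f] g(2) by simp_all
  then have z: "off k (C - B) = 0" "off k (B - C) = 0" by simp_all
  have "off (k + 1) (B - C) = 0" using *[OF f g z(1)] *[OF g(1) f g(2)[symmetric] z(2)] by simp
  then show ?thesis using off_eqI[of k C B] z by simp
qed

text \<open>Let a displacement lie strictly inside the dual edge. Comparing with the displacements
  on both sides, or with the side of the triangle, puts every point displaced in this way on the
  line of the edge. Then consecutive flags of that piece would be parallel, but \<open>phi\<close>
  always turns.\<close>

lemma no_crossing:
  assumes f: "(B, k) \<in> FF" and g: "(C, l) \<in> FF" "sig (C, l) = sig (B, k) + \<theta> *\<^sub>R dir (k + 5)"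
    and th: "\<theta> > 0" "(B, k) \<in> BF \<or> \<theta> < D s B k"
  shows False
proof -
  have key: "off k (x - B) = 0" if x: "x \<in> TT r" "tau s x i = sig (C, l)" for x i
  proof -
    have "bil (x - B) (tau s x i - tau s B k) \<ge> 0" by (rule tau_mono)
    moreover have "tau s x i - tau s B k = - (\<theta> *\<^sub>R dir (k + 2))" using x(2) g(2) by (simp add: sig_def algebra_simps)
    ultimately have 1: "off k (x - B) \<le> 0" using th(1) by (simp add: bil_dir mult_le_0_iff del: dir_add off_lin)
    have "off k (x - B) \<ge> 0"
    proof (cases "(B, k) \<in> BF")
      case True then show ?thesis using x(1) by (auto simp: BF_def TT_def)
    next
      case False
      have "bil (x - B) (tau s x i - tau s B (k + 5)) \<ge> 0" by (rule tau_mono)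
      moreover have "tau s x i - tau s B (k + 5) = (D s B k - \<theta>) *\<^sub>R dir (k + 2)"
        using x(2) g(2) tau_step[of s B k] by (simp add: sig_def algebra_simps)
      ultimately have "(D s B k - \<theta>) * off k (x - B) \<ge> 0" by (simp add: bil_dir del: dir_add off_lin)
      then show ?thesis using th False by (simp add: zero_le_mult_iff)
    qed
    then show ?thesis using 1 by simp
  qed
  have line: "m = k \<or> m = k + 3" if "(A, m) \<in> FF" "sig (A, m) = sig (C, l)" for A m
  proof -
    have "off k (A - B) = 0" using key[of A m] FF_D(4)[OF that(1)] that(2) by (simp add: sig_def)
    moreover have "off k (nb u A m - B) = 0" using key[of "nb u A m" "m + 2"] FF_fin(3)[OF that(1)] tau_nb[OF that(1)] that(2) by simp
    ultimately have "len u A m * off k (dir m) = 0" by (simp add: nb_def algebra_simps)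
    then have "off k (dir m) = 0" using lam_pos[OF that(1)] by (simp add: lam_def)
    then show ?thesis by (simp add: off_dir_sign)
  qed
  have "phi (C, l) \<in> FF" "sig (phi (C, l)) = sig (C, l)" using phi_FF sig_phi g by auto
  then have "snd (phi (C, l)) = k \<or> snd (phi (C, l)) = k + 3" using line[of "fst (phi (C, l))"] by simp
  then show False using line[OF g(1) refl] phi_dir[of C l] by auto
qed

text \<open>Let two dual edges share an inner point. Comparing the displacements on both sides of
  the first edge with those of the second puts both ends of the first edge on the line of the
  second; for edges on a side, the triangle replaces the outer displacement.\<close>

lemma no_double_crossing:
  assumes f: "(B, k) \<in> FF" and g: "(C, l) \<in> FF" and p: "sig (B, k) + \<theta> *\<^sub>R dir (k + 5) = sig (C, l) + \<theta>' *\<^sub>R dir (l + 5)"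
    and th: "\<theta> > 0" "(B, k) \<in> BF \<or> \<theta> < D s B k" and th': "\<theta>' > 0" "(C, l) \<in> BF \<or> \<theta>' < D s C l"
  shows "l = k \<or> l = k + 3"
proof -
  have R: "tau s B (k + 5) = sig (B, k) + D s B k *\<^sub>R dir (k + 5)" if "(B, k) \<in> FF" for B k
    using tau_step[of s B k] by (simp add: sig_def algebra_simps)
  have key: "off k (y - C) = 0 \<and> off l (y - C) = 0"
    if y: "y \<in> TT r" "tau s y i = sig (B, k)" "tau s y j = sig (B, k) + D s B k *\<^sub>R dir (k + 5)" and yk: "off k y = off k B" for y i j
  proof -
    let ?a = "off k (y - C)" and ?c = "off l (y - C)"
    let ?P = "sig (B, k) + \<theta> *\<^sub>R dir (k + 5)"
    have M: "\<alpha> * ?a \<ge> \<beta> * ?c" if "tau s y i = ?P + \<alpha> *\<^sub>R dir (k + 2)" "tau s C j = ?P + \<beta> *\<^sub>R dir (l + 2)" for \<alpha> \<beta> i j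
    proof -
      have "bil (y - C) (tau s y i - tau s C j) \<ge> 0" by (rule tau_mono)
      moreover have "tau s y i - tau s C j = \<alpha> *\<^sub>R dir (k + 2) - \<beta> *\<^sub>R dir (l + 2)" using that by simp
      ultimately show ?thesis by (simp add: bil_dir del: dir_add off_lin)
    qed
    have y1: "tau s y i = ?P + \<theta> *\<^sub>R dir (k + 2)" using y(2) by (simp add: algebra_simps)
    have y2: "tau s y j = ?P + (\<theta> - D s B k) *\<^sub>R dir (k + 2)" using y(3) by (simp add: algebra_simps)
    have c1: "tau s C l = ?P + \<theta>' *\<^sub>R dir (l + 2)" unfolding p by (simp add: sig_def algebra_simps)
    have c2: "tau s C (l + 5) = ?P + (\<theta>' - D s C l) *\<^sub>R dir (l + 2)" unfolding p R[OF g] by (simp add: algebra_simps)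
    have 1: "\<theta> * ?a \<ge> \<theta>' * ?c" using M[OF y1 c1] .
    have 2: "\<theta> * ?a \<ge> (\<theta>' - D s C l) * ?c" using M[OF y1 c2] .
    have 3: "(\<theta> - D s B k) * ?a \<ge> \<theta>' * ?c" using M[OF y2 c1] .
    have 4: "(\<theta> - D s B k) * ?a \<ge> (\<theta>' - D s C l) * ?c" using M[OF y2 c2] .
    have CT: "C \<in> TT r" using FF_D(4)[OF g] .
    have a5: "?a \<le> 0" if "(B, k) \<in> BF" using that CT yk by (auto simp: BF_def TT_def)
    have c5: "?c \<ge> 0" if "(C, l) \<in> BF" using that y(1) by (auto simp: BF_def TT_def)
    have mx: "z * ?a \<ge> 0" if "z * ?a \<ge> \<theta>' * ?c" "z * ?a \<ge> (\<theta>' - D s C l) * ?c" for z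
    proof (cases "?c \<ge> 0")
      case True
      then have "\<theta>' * ?c \<ge> 0" using th'(1) by simp
      then show ?thesis using that by linarith
    next
      case False
      then have "\<theta>' - D s C l < 0" using c5 th'(2) by auto
      then have "(\<theta>' - D s C l) * ?c \<ge> 0" using False by (intro mult_nonpos_nonpos) auto
      then show ?thesis using that by linarith
    qed
    have "?a \<ge> 0" using mx[OF 1 2] th(1) by (simp add: zero_le_mult_iff)
    moreover have "?a \<le> 0"
    proof (cases "(B, k) \<in> BF")
      case False
      then have "\<theta> - D s B k < 0" using th(2) by simp
      then show ?thesis using mx[OF 3 4] by (auto simp: zero_le_mult_iff)
    qed (rule a5)
    ultimately have a0: "?a = 0" by simp
    have "\<theta>' * ?c \<le> 0" using 1 a0 by simp
    then have "?c \<le> 0" using th'(1) by (simp add: mult_le_0_iff)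
    moreover have "?c \<ge> 0"
    proof (cases "(C, l) \<in> BF")
      case False
      then have "\<theta>' - D s C l < 0" using th'(2) by simp
      moreover have "(\<theta>' - D s C l) * ?c \<le> 0" using 2 a0 by simp
      ultimately show ?thesis by (simp add: mult_le_0_iff)
    qed (rule c5)
    ultimately show ?thesis using a0 by simp
  qed
  have "off l (B - C) = 0" using key[of B k "k + 5"] FF_D(4)[OF f] R[OF f] by (simp add: sig_def)
  moreover have "off l (nb u B k - C) = 0"
    using key[of "nb u B k" "k + 2" "k + 3"] FF_fin(3)[OF f] tau_nb[OF f] sig_opp[OF f] by (simp add: opp_def sig_def nb_def)
  ultimately have "len u B k * off l (dir k) = 0" by (simp add: nb_def algebra_simps)
  then have "off l (dir k) = 0" using lam_pos[OF f] by (simp add: lam_def)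
  then show ?thesis by (auto simp: off_dir_sign)
qed

text \<open>At the end of the edge the piece has an angle of 60 degrees, which leaves room for an
  edge of direction \<open>k + 1\<close> only at its tip; such an edge would have length 0.\<close>

lemma corner_exact:
  assumes f: "(B, k) \<in> FF" and p: "snd (phi (B, k)) = k + 2" and g: "(C, k + 1) \<in> FF" "sig (C, k + 1) = sig (B, k)"
  shows False
proof -
  let ?N = "nb u B k"
  have ph: "(?N, k + 2) \<in> FF" "sig (?N, k + 2) = sig (B, k)" using phi_FF[OF f] sig_phi[OF f] p by (auto simp: phi_def)
  have key: "off k (x - ?N) = 0" if "off k (x - B) \<ge> 0" "off (k + 2) (x - ?N) \<ge> 0" "off (k + 1) (x - C) = 0" for x
  proof -
    have "off k (x - ?N) \<ge> 0" using that(1) by (simp add: nb_def)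
    moreover have "off (k + 1) (?N - C) \<ge> 0"
      using face_left[OF g(1) FF_fin(3)[OF f], of "k + 2"] tau_nb[OF f] g(2) by simp
    ultimately show ?thesis using that(2,3) by simp
  qed
  have "off k (C - ?N) = 0" by (rule key) (use face_left_nb(1)[OF f g] face_left_nb(1)[OF ph(1) g(1)] ph(2) g(2) in simp_all)
  moreover have "off k (nb u C (k + 1) - ?N) = 0"
    by (rule key) (use face_left_nb(2)[OF f g] face_left_nb(2)[OF ph(1) g(1)] ph(2) g(2) in \<open>simp_all add: nb_def[of _ C]\<close>)
  ultimately have "len u C (k + 1) = 0" by (simp add: nb_def[of _ C])
  then show False using lam_pos[OF g(1)] by (simp add: lam_def)
qed

text \<open>\<open>phi\<close> permutes the flags with a common displacement, so the edge vectors
  telescope: the boundary of a piece closes up.\<close>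

lemma closing: "(\<Sum>f | f \<in> FF \<and> sig f = p. lam f *\<^sub>R dir (snd f)) = 0"
proof -
  let ?S = "{f. f \<in> FF \<and> sig f = p}"
  have fS: "finite ?S" using finite_FF by simp
  have bij: "bij_betw phi ?S ?S"
  proof -
    have "phi ` ?S \<subseteq> ?S" using phi_FF sig_phi by auto
    moreover have "inj_on phi ?S" using phi_inj by (rule inj_on_subset) auto
    ultimately show ?thesis using endo_inj_surj[OF fS] by (auto simp: bij_betw_def)
  qed
  have "lam f *\<^sub>R dir (snd f) = fst (phi f) - fst f" for f by (cases f) (simp add: lam_def phi_def nb_def)
  then have "(\<Sum>f\<in>?S. lam f *\<^sub>R dir (snd f)) = (\<Sum>f\<in>?S. fst (phi f)) - (\<Sum>f\<in>?S. fst f)" by (simp add: sum_subtractf)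
  also have "(\<Sum>f\<in>?S. fst (phi f)) = (\<Sum>f\<in>?S. fst f)" using sum.reindex_bij_betw[OF bij, of fst] by simp
  finally show ?thesis by simp
qed

end

section \<open>The dual measure\<close>

context hex
begin

text \<open>Reversing the cyclic order preserves the relation of the hexagon. The shift by 1 makes
  the odd directions even, as the exits of the dual demand, and a flag of direction \<open>k\<close>
  has its dual edge in direction \<open>2 - k\<close>.\<close>

definition ddir :: "6 \<Rightarrow> real^2" where "ddir k = dir (1 - k)"

lemma hex_ddir: "hex ddir"
proof
  show "norm (ddir k) = 1" for k by (simp add: ddir_def)
  have "dir (5 - k + 1) = dir (5 - k) + dir (5 - k + 2)" for k by (rule dir_sum)
  moreover have "1 - (k + 2) = 5 - k" for k :: 6 by simp
  ultimately show "ddir (k + 1) = ddir k + ddir (k + 2)" for k by (simp add: ddir_def add.commute del: dir_add)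
qed

end

context framed
begin

sublocale d: hex ddir by (rule hex_ddir)

lemma ddir_dual: "ddir (2 - k) = dir (k + 5)"
  by (simp add: ddir_def add.commute del: dir_add)

lemma d_off: "d.off (2 - k) x = off (k + 2) x" "d.off (3 - k) x = off (k + 1) x"
proof -
  have i: "2 - k + 1 = 2 - (k + 5)" "2 - k + 2 = 2 - (k + 4)" "3 - k + 1 = 2 - (k + 4)" "3 - k + 2 = 2 - (k + 3)"
    "k + 2 + 1 = k + 3" "k + 2 + 2 = k + 4" "k + 1 + 1 = k + 2" "k + 1 + 2 = k + 3" "k + 5 + 5 = k + 4" "k + 4 + 5 = k + 3" "k + 3 + 5 = k + 2" by (simp_all add: algebra_simps)
  show "d.off (2 - k) x = off (k + 2) x" unfolding d.off_def off_def i ddir_dual by (simp only: add.commute)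
  show "d.off (3 - k) x = off (k + 1) x" unfolding d.off_def off_def i ddir_dual by (simp only: add.commute)
qed

lemma d_hit: "d.hit (2 - k) y \<longleftrightarrow> off (k + 2) y = 0 \<and> (if ev k then off (k + 1) y \<le> 0 else off (k + 1) y > 0)"
  using d_off[of k y] by (simp add: d.hit_def)

text \<open>The jump of the dual at \<open>p\<close> on one line, read off from the lengths of the
  edges whose left piece is displaced to \<open>p\<close>. That the other two lines give the same
  jump is \<open>closing\<close>.\<close>

definition tt :: "real^2 \<Rightarrow> real" where
  "tt p = (\<Sum>f | f \<in> FF \<and> sig f = p. lam f * (of_bool (snd f = 0) - of_bool (snd f = 3)))"

lemma tt_even: assumes "ev k" shows "tt p = (\<Sum>f | f \<in> FF \<and> sig f = p. lam f * (of_bool (snd f = k) - of_bool (snd f = k + 3)))"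
proof -
  have c: "(\<Sum>f | f \<in> FF \<and> sig f = p. lam f * off m (dir (snd f))) = 0" for m
    using arg_cong[OF closing[of p], of "off m"] by (simp add: off_sum)
  have eq: "tt p - (\<Sum>f | f \<in> FF \<and> sig f = p. lam f * (of_bool (snd f = k) - of_bool (snd f = k + 3)))
    = (\<Sum>f | f \<in> FF \<and> sig f = p. lam f * (of_bool (snd f = 0) - of_bool (snd f = 3) - (of_bool (snd f = k) - of_bool (snd f = k + 3))))"
    unfolding tt_def sum_subtractf[symmetric] by (simp add: right_diff_distrib)
  consider "k = 0" | "k = 2" | "k = 4" using assms by (auto simp: ev_def)
  then have "(\<Sum>f | f \<in> FF \<and> sig f = p. lam f * (of_bool (snd f = 0) - of_bool (snd f = 3) - (of_bool (snd f = k) - of_bool (snd f = k + 3)))) = 0"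
  proof cases
    case 2
    have "lam f * (of_bool (snd f = 0) - of_bool (snd f = 3) - (of_bool (snd f = k) - of_bool (snd f = k + 3))) = - (lam f * off 1 (dir (snd f)))" for f
      using six_cases[of "snd f"] 2 by (elim disjE) (simp_all add: dir_num off_dir_num)
    then show ?thesis using c[of 1] by (simp add: sum_negf)
  next
    case 3
    have "lam f * (of_bool (snd f = 0) - of_bool (snd f = 3) - (of_bool (snd f = k) - of_bool (snd f = k + 3))) = lam f * off 5 (dir (snd f))" for f
      using six_cases[of "snd f"] 3 by (elim disjE) (simp_all add: dir_num off_num off_dir_num)
    then show ?thesis using c[of 5] by (simp only:)
  qed simp
  then show ?thesis using eq by simp
qed

lemma tt_start: "tt p \<noteq> 0 \<Longrightarrow> p \<in> sig ` FF"
proof (rule ccontr)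
  assume "tt p \<noteq> 0" "p \<notin> sig ` FF"
  then have "{f. f \<in> FF \<and> sig f = p} = {}" by auto
  then have "tt p = 0" unfolding tt_def by (simp only: sum.empty)
  then show False using \<open>tt p \<noteq> 0\<close> by simp
qed

lemma fs_tt: "fs tt"
  unfolding fs_def by (rule finite_subset[of _ "sig ` FF"]) (use tt_start finite_FF in auto)

text \<open>The dual edge of the flag \<open>f\<close> leaves \<open>sig f\<close> in direction \<open>dir (snd f - 1)\<close>.\<close>

definition seg :: "(real^2) \<times> 6 \<Rightarrow> real \<Rightarrow> real^2 \<Rightarrow> bool" where
  "seg f \<theta> p \<longleftrightarrow> p = sig f + \<theta> *\<^sub>R dir (snd f + 5) \<and> (f \<in> BF \<or> \<theta> < D s (fst f) (snd f))"

lemma BF_even: "f \<in> BF \<Longrightarrow> ev (snd f)" by (auto simp: BF_def)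

lemma lam_opp: "f \<in> FF \<Longrightarrow> lam (opp f) = lam f"
  using U.nb_back(2) FF_D(1) FF_fin(1) by (cases f) (auto simp: lam_def opp_def)

lemma hit_seg:
  assumes f: "f \<in> FF" and k: "snd f = k" "ev k"
  shows "of_bool (d.hit (2 - k) (p - sig f)) - of_bool (f \<notin> BF \<and> d.hit (2 - k) (p - sig (opp f))) = (of_bool (\<exists>\<theta>\<ge>0. seg f \<theta> p) :: real)"
proof -
  obtain B where B: "f = (B, k)" using k by (cases f) auto
  have so: "sig (opp f) = sig f + D s B k *\<^sub>R dir (k + 5)" using sig_opp[of B k] f B by simp
  have Dn: "D s B k \<ge> 0" by simp
  obtain y where y: "y = p - sig f" by simp
  have eq: "p = sig f + \<theta> *\<^sub>R dir (k + 5) \<longleftrightarrow> off (k + 2) y = 0 \<and> off (k + 1) y = - \<theta>" for \<theta>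
  proof -
    have "p = sig f + \<theta> *\<^sub>R dir (k + 5) \<longleftrightarrow> y = \<theta> *\<^sub>R dir (k + 5)" unfolding y by (auto simp: algebra_simps simp del: dir_add)
    also have "\<dots> \<longleftrightarrow> off (k + 2) y = 0 \<and> off (k + 1) y = - \<theta>"
    proof
      assume h: "off (k + 2) y = 0 \<and> off (k + 1) y = - \<theta>"
      show "y = \<theta> *\<^sub>R dir (k + 5)" by (rule off_eqI[of k]) (use h in simp_all)
    qed simp
    finally show ?thesis .
  qed
  have y': "p - sig (opp f) = y - D s B k *\<^sub>R dir (k + 5)" unfolding so y by simp
  have o2: "d.hit (2 - k) (p - sig (opp f)) \<longleftrightarrow> off (k + 2) y = 0 \<and> off (k + 1) y + D s B k \<le> 0"
    unfolding d_hit y' using k(2) by simp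
  have o1: "d.hit (2 - k) (p - sig f) \<longleftrightarrow> off (k + 2) y = 0 \<and> off (k + 1) y \<le> 0" unfolding d_hit y using k(2) by simp
  have o3: "(\<exists>\<theta>\<ge>0. seg f \<theta> p) \<longleftrightarrow> off (k + 2) y = 0 \<and> off (k + 1) y \<le> 0 \<and> (f \<in> BF \<or> - off (k + 1) y < D s B k)"
  proof
    assume "off (k + 2) y = 0 \<and> off (k + 1) y \<le> 0 \<and> (f \<in> BF \<or> - off (k + 1) y < D s B k)"
    then show "\<exists>\<theta>\<ge>0. seg f \<theta> p" unfolding seg_def k(1) eq using B by (intro exI[of _ "- off (k + 1) y"]) auto
  qed (use B eq k(1) in \<open>auto simp: seg_def\<close>)
  obtain a b where ab: "off (k + 2) y = a" "off (k + 1) y = b" by simp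
  have "b + D s B k \<le> 0 \<Longrightarrow> b \<le> 0" using Dn by linarith
  then show ?thesis unfolding o1 o2 o3 ab of_bool_def by auto
qed

text \<open>A finite dual edge is the difference of the rays from its two ends, and
  \<open>opp\<close> pairs these ends. A flag on a side has no partner, so its ray stays infinite
  and becomes an exit of the dual.\<close>

lemma D_tt_even: assumes k: "ev k"
  shows "d.D tt p (2 - k) = (\<Sum>f | f \<in> FF \<and> snd f = k. lam f * of_bool (\<exists>\<theta>\<ge>0. seg f \<theta> p))"
proof -
  let ?h = "\<lambda>q. of_bool (d.hit (2 - k) (p - q)) :: real"
  let ?A = "{f. f \<in> FF \<and> snd f = k}" and ?B = "{f. f \<in> FF \<and> snd f = k + 3}"
  have fin: "finite ?A" "finite ?B" using finite_FF by auto
  have "d.D tt p (2 - k) = (\<Sum>q\<in>sig ` FF. tt q * ?h q)"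
    by (rule d.D_superset) (use finite_FF tt_start in auto)
  also have "\<dots> = (\<Sum>q\<in>sig ` FF. \<Sum>f | f \<in> FF \<and> sig f = q. lam f * (of_bool (snd f = k) - of_bool (snd f = k + 3)) * ?h (sig f))"
    unfolding tt_even[OF k] sum_distrib_right by (intro sum.cong refl) auto
  also have "\<dots> = (\<Sum>f\<in>FF. lam f * (of_bool (snd f = k) - of_bool (snd f = k + 3)) * ?h (sig f))"
    by (rule sum.group) (use finite_FF in auto)
  also have "\<dots> = (\<Sum>f\<in>FF. (if snd f = k then lam f * ?h (sig f) else 0) - (if snd f = k + 3 then lam f * ?h (sig f) else 0))"
    by (rule sum.cong) auto
  also have "\<dots> = (\<Sum>f\<in>?A. lam f * ?h (sig f)) - (\<Sum>f\<in>?B. lam f * ?h (sig f))"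
    unfolding sum_subtractf by (simp add: sum.inter_filter[OF finite_FF, symmetric])
  also have "(\<Sum>f\<in>?B. lam f * ?h (sig f)) = (\<Sum>f\<in>?A - BF. lam f * ?h (sig (opp f)))"
  proof (rule sum.reindex_bij_witness[of _ opp opp])
    fix f assume f: "f \<in> ?B"
    then have "f \<notin> BF" using BF_even[of f] k by auto
    then have f': "f \<in> FF - BF" using f by simp
    show "opp (opp f) = f" using opp_FF(2)[OF f'] .
    show "opp f \<in> ?A - BF" using opp_FF(1)[OF f'] f by (cases f) (auto simp: opp_def)
    show "lam (opp f) * ?h (sig (opp (opp f))) = lam f * ?h (sig f)" using opp_FF(2)[OF f'] lam_opp f by simp
  next
    fix f assume f: "f \<in> ?A - BF"
    then have f': "f \<in> FF - BF" by simp
    show "opp (opp f) = f" using opp_FF(2)[OF f'] .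
    show "opp f \<in> ?B" using opp_FF(1)[OF f'] f by (cases f) (auto simp: opp_def)
  qed
  also have "\<dots> = (\<Sum>f\<in>?A. lam f * of_bool (f \<notin> BF \<and> d.hit (2 - k) (p - sig (opp f))))"
    using fin by (intro sum.mono_neutral_cong_left) auto
  also have "(\<Sum>f\<in>?A. lam f * ?h (sig f)) - \<dots> = (\<Sum>f\<in>?A. lam f * of_bool (\<exists>\<theta>\<ge>0. seg f \<theta> p))"
    unfolding sum_subtractf[symmetric] right_diff_distrib[symmetric] by (rule sum.cong) (use hit_seg k in auto)
  finally show ?thesis .
qed

lemma seg_zero: assumes "f \<in> FF" shows "(\<exists>\<theta>\<ge>0. seg f \<theta> p) \<longleftrightarrow> sig f = p \<or> (\<exists>\<theta>>0. seg f \<theta> p)"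
proof -
  obtain B k where f: "f = (B, k)" by force
  have "seg f 0 p \<longleftrightarrow> sig f = p" using assms D_s_inner[of B k] by (auto simp: seg_def f)
  then show ?thesis by (metis order_le_less)
qed

lemma seg_pos_ne: "\<theta> > 0 \<Longrightarrow> seg f \<theta> p \<Longrightarrow> sig f \<noteq> p"
  by (auto simp: seg_def simp del: dir_add)

lemma D_tt_odd: assumes k: "\<not> ev k"
  shows "d.D tt p (2 - k) = (\<Sum>f | f \<in> FF \<and> snd f = k + 3. lam f * of_bool (\<exists>\<theta>>0. seg f \<theta> p)) + (\<Sum>f | f \<in> FF \<and> snd f = k. lam f * of_bool (sig f = p))"
proof -
  have fin: "finite {f. f \<in> FF \<and> P f}" for P using finite_FF by simp
  have "2 - k + 3 = 2 - (k + 3)" by (simp add: algebra_simps)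
  then have j: "d.D tt p (2 - k) = d.D tt p (2 - (k + 3)) - tt p"
    using d.D_jump[OF fs_tt, of p "2 - k"] k by (simp add: sg_def)
  have "tt p = (\<Sum>f | f \<in> FF \<and> sig f = p. lam f * (of_bool (snd f = k + 3) - of_bool (snd f = k + 3 + 3)))"
    by (rule tt_even) (use k in simp)
  also have "\<dots> = (\<Sum>f\<in>FF. (if snd f = k + 3 then lam f * of_bool (sig f = p) else 0) - (if snd f = k then lam f * of_bool (sig f = p) else 0))"
    by (rule sum.mono_neutral_cong_left) (use finite_FF in auto)
  also have "\<dots> = (\<Sum>f | f \<in> FF \<and> snd f = k + 3. lam f * of_bool (sig f = p)) - (\<Sum>f | f \<in> FF \<and> snd f = k. lam f * of_bool (sig f = p))"
    unfolding sum_subtractf by (simp add: sum.inter_filter[OF finite_FF, symmetric])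
  finally have t: "tt p = \<dots>" .
  have "(\<Sum>f | f \<in> FF \<and> snd f = k + 3. lam f * of_bool (\<exists>\<theta>\<ge>0. seg f \<theta> p)) - (\<Sum>f | f \<in> FF \<and> snd f = k + 3. lam f * of_bool (sig f = p))
    = (\<Sum>f | f \<in> FF \<and> snd f = k + 3. lam f * of_bool (\<exists>\<theta>>0. seg f \<theta> p))"
    unfolding sum_subtractf[symmetric] right_diff_distrib[symmetric]
  proof (rule sum.cong[OF refl])
    fix f assume "f \<in> {f. f \<in> FF \<and> snd f = k + 3}"
    then have f: "f \<in> FF" by simp
    show "lam f * (of_bool (\<exists>\<theta>\<ge>0. seg f \<theta> p) - of_bool (sig f = p)) = lam f * of_bool (\<exists>\<theta>>0. seg f \<theta> p)"
      using seg_pos_ne[of _ f p] by (cases "sig f = p") (auto simp: seg_zero[OF f])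
  qed
  then show ?thesis using j t D_tt_even[of "k + 3" p] k by simp
qed

lemma pos_tt: "d.pos tt"
  unfolding d.pos_def
proof (intro allI)
  fix p and \<kappa> :: 6
  have k: "\<kappa> = 2 - (2 - \<kappa>)" by simp
  have n: "lam f * of_bool P \<ge> 0" if "f \<in> FF" for f P using lam_pos[OF that] by simp
  show "d.D tt p \<kappa> \<ge> 0"
  proof (cases "ev \<kappa>")
    case True
    then show ?thesis using n by (subst k, subst D_tt_even) (auto intro!: sum_nonneg)
  next
    case False
    then show ?thesis using n by (subst k, subst D_tt_odd) (auto intro!: sum_nonneg add_nonneg_nonneg)
  qed
qed

sublocale T: hexs ddir tt
  by unfold_locales (rule fs_tt, rule pos_tt)

lemma seg_not_start: assumes "f \<in> FF" "g \<in> FF" "\<theta> > 0" shows "\<not> seg f \<theta> (sig g)"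
  using no_crossing[of "fst f" "snd f" "fst g" "snd g" \<theta>] assms by (auto simp: seg_def simp del: dir_add)

text \<open>By \<open>no_crossing\<close> no dual edge passes through a displacement, so only those
  starting there contribute.\<close>

lemma D_tt_start: assumes "g \<in> FF" shows "d.D tt (sig g) (2 - k) = (\<Sum>f | f \<in> FF \<and> snd f = k. lam f * of_bool (sig f = sig g))"
proof (cases "ev k")
  case True
  have "(\<exists>\<theta>\<ge>0. seg f \<theta> (sig g)) \<longleftrightarrow> sig f = sig g" if "f \<in> FF" for f
    using seg_zero[OF that] seg_not_start[OF that assms] by blast
  then show ?thesis unfolding D_tt_even[OF True] by (intro sum.cong) auto
next
  case False
  have "(\<Sum>f | f \<in> FF \<and> snd f = k + 3. lam f * of_bool (\<exists>\<theta>>0. seg f \<theta> (sig g))) = 0"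
    by (rule sum.neutral) (use seg_not_start assms in auto)
  then show ?thesis unfolding D_tt_odd[OF False] by simp
qed

lemma D_tt_flag: assumes "(B, k) \<in> FF" shows "d.D tt (sig (B, k)) (2 - k) = lam (B, k)"
proof -
  have "d.D tt (sig (B, k)) (2 - k) = (\<Sum>f | f \<in> FF \<and> snd f = k. if f = (B, k) then lam (B, k) else 0)"
    unfolding D_tt_start[OF assms] by (rule sum.cong) (use sig_dir_inj[OF assms] in auto)
  then show ?thesis using finite_FF assms by simp
qed

lemma dpr_start: assumes "g \<in> FF" shows "d.pr tt (sig g) (2 - k) \<longleftrightarrow> (\<exists>C. (C, k) \<in> FF \<and> sig (C, k) = sig g)"
proof
  assume "d.pr tt (sig g) (2 - k)"
  then have "(\<Sum>f | f \<in> FF \<and> snd f = k. lam f * of_bool (sig f = sig g)) \<noteq> 0" unfolding d.pr_def D_tt_start[OF assms] by simp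
  then obtain f where "f \<in> FF" "snd f = k" "sig f = sig g" by (rule sum.not_neutral_contains_not_neutral) (auto split: if_splits)
  then show "\<exists>C. (C, k) \<in> FF \<and> sig (C, k) = sig g" by (metis prod.collapse)
next
  assume "\<exists>C. (C, k) \<in> FF \<and> sig (C, k) = sig g"
  then obtain C where C: "(C, k) \<in> FF" "sig (C, k) = sig g" by blast
  then show "d.pr tt (sig g) (2 - k)" using D_tt_flag[OF C(1)] lam_pos[OF C(1)] by (simp add: d.pr_def)
qed

lemma dpr_flag: "(B, k) \<in> FF \<Longrightarrow> d.pr tt (sig (B, k)) (2 - k)"
  using dpr_start by blast

text \<open>At a displacement, two consecutive flags of the piece give non-parallel rays. Elsewhere
  all rays come from inner points of dual edges, and these are parallel by
  \<open>no_double_crossing\<close>.\<close>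

lemma dbranch_iff: "d.branch tt p \<longleftrightarrow> p \<in> sig ` FF"
proof
  assume "p \<in> sig ` FF"
  then obtain B k where f: "(B, k) \<in> FF" "p = sig (B, k)" by auto
  have ph: "phi (B, k) \<in> FF" "sig (phi (B, k)) = p" using phi_FF sig_phi f by auto
  have "d.pr tt p (2 - snd (phi (B, k)))" using dpr_flag[of "fst (phi (B, k))" "snd (phi (B, k))"] ph by simp
  moreover have "d.pr tt p (2 - k)" using dpr_flag f by simp
  moreover have "2 - snd (phi (B, k)) \<noteq> 2 - k" "2 - snd (phi (B, k)) \<noteq> 2 - k + 3" using phi_dir[of B k] by (auto simp: algebra_simps)
  ultimately show "d.branch tt p" unfolding d.branch_def by blast
next
  assume br: "d.branch tt p"
  show "p \<in> sig ` FF"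
  proof (rule ccontr)
    assume no: "p \<notin> sig ` FF"
    have seg: "\<exists>f \<theta>. f \<in> FF \<and> \<theta> > 0 \<and> seg f \<theta> p \<and> (snd f = k \<or> snd f = k + 3)" if p: "d.pr tt p (2 - k)" for k
    proof (cases "ev k")
      case True
      have "(\<Sum>f | f \<in> FF \<and> snd f = k. lam f * of_bool (\<exists>\<theta>\<ge>0. seg f \<theta> p)) \<noteq> 0" using p unfolding d.pr_def D_tt_even[OF True] by simp
      then obtain f where "f \<in> FF" "snd f = k" "\<exists>\<theta>\<ge>0. seg f \<theta> p" by (rule sum.not_neutral_contains_not_neutral) (auto split: if_splits)
      moreover have "sig f \<noteq> p" using no \<open>f \<in> FF\<close> by blast
      ultimately show ?thesis using seg_zero[of f p] by blast
    next
      case False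
      have z: "(\<Sum>f | f \<in> FF \<and> snd f = k. lam f * of_bool (sig f = p)) = 0" by (rule sum.neutral) (use no in auto)
      have "(\<Sum>f | f \<in> FF \<and> snd f = k + 3. lam f * of_bool (\<exists>\<theta>>0. seg f \<theta> p)) \<noteq> 0" using p z unfolding d.pr_def D_tt_odd[OF False] by simp
      then obtain f where "f \<in> FF" "snd f = k + 3" "\<exists>\<theta>>0. seg f \<theta> p" by (rule sum.not_neutral_contains_not_neutral) (auto split: if_splits)
      then show ?thesis by blast
    qed
    obtain a b where ab: "d.pr tt p a" "d.pr tt p b" "b \<noteq> a" "b \<noteq> a + 3" using br by (auto simp: d.branch_def)
    obtain f \<theta> where f: "f \<in> FF" "\<theta> > 0" "seg f \<theta> p" "snd f = 2 - a \<or> snd f = 2 - a + 3" using seg[of "2 - a"] ab(1) by auto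
    obtain g \<theta>' where g: "g \<in> FF" "\<theta>' > 0" "seg g \<theta>' p" "snd g = 2 - b \<or> snd g = 2 - b + 3" using seg[of "2 - b"] ab(2) by auto
    have "snd g = snd f \<or> snd g = snd f + 3"
      using no_double_crossing[of "fst f" "snd f" "fst g" "snd g" \<theta> \<theta>'] f g by (simp add: seg_def del: dir_add)
    moreover have "b = a \<or> b = a + 1 \<or> b = a + 2 \<or> b = a + 3 \<or> b = a + 4 \<or> b = a + 5" by (rule six_rel)
    ultimately show False using f(4) g(4) ab(3,4) by (elim disjE) simp_all
  qed
qed

lemma dual_edge: assumes f: "(B, k) \<in> FF"
  shows "(B, k) \<notin> BF \<Longrightarrow> d.fin tt (sig (B, k)) (2 - k) \<and> d.nb tt (sig (B, k)) (2 - k) = sig (opp (B, k))"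
    "(B, k) \<in> BF \<Longrightarrow> \<not> d.fin tt (sig (B, k)) (2 - k)"
proof -
  have pt: "sig (B, k) + t *\<^sub>R ddir (2 - k) = sig (B, k) + t *\<^sub>R dir (k + 5)" for t unfolding ddir_dual ..
  show "d.fin tt (sig (B, k)) (2 - k) \<and> d.nb tt (sig (B, k)) (2 - k) = sig (opp (B, k))" if nb: "(B, k) \<notin> BF"
  proof -
    have D: "D s B k > 0" using D_s_inner f nb by blast
    have o: "opp (B, k) \<in> FF" using opp_FF(1) f nb by blast
    have "d.branch tt (sig (B, k) + D s B k *\<^sub>R ddir (2 - k))" unfolding pt sig_opp[OF f, symmetric] dbranch_iff using o by blast
    moreover have "\<not> d.branch tt (sig (B, k) + t *\<^sub>R ddir (2 - k))" if t: "0 < t" "t < D s B k" for t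
    proof
      assume "d.branch tt (sig (B, k) + t *\<^sub>R ddir (2 - k))"
      then obtain g where g: "g \<in> FF" "sig (B, k) + t *\<^sub>R dir (k + 5) = sig g" unfolding pt dbranch_iff by blast
      have "seg (B, k) t (sig g)" unfolding seg_def g(2)[symmetric] using t by simp
      then show False using seg_not_start[OF f g(1) t(1)] by blast
    qed
    ultimately have "d.fin tt (sig (B, k)) (2 - k)" "d.len tt (sig (B, k)) (2 - k) = D s B k" using T.len_eqI[OF D] by blast+
    then show ?thesis unfolding d.nb_def ddir_dual sig_opp[OF f] by simp
  qed
  show "\<not> d.fin tt (sig (B, k)) (2 - k)" if b: "(B, k) \<in> BF"
  proof -
    have "\<not> d.branch tt (sig (B, k) + t *\<^sub>R ddir (2 - k))" if t: "0 < t" for t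
    proof
      assume "d.branch tt (sig (B, k) + t *\<^sub>R ddir (2 - k))"
      then obtain g where g: "g \<in> FF" "sig (B, k) + t *\<^sub>R dir (k + 5) = sig g" unfolding pt dbranch_iff by blast
      have "seg (B, k) t (sig g)" unfolding seg_def g(2)[symmetric] using b by simp
      then show False using seg_not_start[OF f g(1) t] by blast
    qed
    then show ?thesis by (auto simp: d.fin_def d.ahead_def)
  qed
qed

text \<open>An angle of 120 degrees of the piece at the end of the edge becomes an angle of 60
  degrees at the dual branch point; for an angle of 60 degrees, \<open>corner_exact\<close> says
  that the ray in between is missing.\<close>

lemma dpr_next: assumes f: "(B, k) \<in> FF" shows "d.pr tt (sig (B, k)) (2 - k + 5) \<longleftrightarrow> \<not> pr u (nb u B k) (k + 2)"
proof -
  have e: "2 - k + 5 = 2 - (k + 1)" by (simp add: algebra_simps)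
  show ?thesis
  proof (cases "pr u (nb u B k) (k + 2)")
    case True
    then have "snd (phi (B, k)) = k + 2" by (simp add: phi_def pv_def)
    then have "\<not> d.pr tt (sig (B, k)) (2 - (k + 1))" unfolding dpr_start[OF f] using corner_exact[OF f] by blast
    then show ?thesis using True e by simp
  next
    case False
    then have p: "phi (B, k) = (nb u B k, k + 1)" by (simp add: phi_def pv_def)
    have "d.pr tt (sig (B, k)) (2 - (k + 1))" using dpr_flag[of "nb u B k" "k + 1"] phi_FF[OF f] sig_phi[OF f] unfolding p by simp
    then show ?thesis using False e by simp
  qed
qed

lemma pv_dual: assumes f: "(B, k) \<in> FF" shows "d.pv tt (sig (B, k)) (2 - k) = 2 - snd (phi (B, k))"
  unfolding d.pv_def dpr_next[OF f] by (simp add: phi_def pv_def algebra_simps)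

text \<open>Duality turns the walkers of the dual measure into walkers of the framed measure, exchanging
  the two kinds.\<close>

definition flagat :: "real^2 \<Rightarrow> 6 \<Rightarrow> (real^2) \<times> 6" where
  "flagat p \<kappa> = (THE f. f \<in> FF \<and> sig f = p \<and> snd f = 2 - \<kappa>)"

lemma flagat: "(B, k) \<in> FF \<Longrightarrow> flagat (sig (B, k)) (2 - k) = (B, k)"
  unfolding flagat_def by (rule the_equality) (use sig_dir_inj in auto)

definition hom :: "(real^2) walker \<Rightarrow> (real^2) walker" where
  "hom z = (case z of W p \<kappa> \<Rightarrow> (case flagat p \<kappa> of (B, k) \<Rightarrow> K B k) | K p \<kappa> \<Rightarrow> (case flagat p \<kappa> of (B, k) \<Rightarrow> W B k))"

lemma dual_flag: assumes "d.branch tt p" "d.pr tt p \<kappa>" obtains B k where "(B, k) \<in> FF" "p = sig (B, k)" "\<kappa> = 2 - k"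
proof -
  obtain g where "g \<in> FF" "p = sig g" using assms(1) by (auto simp: dbranch_iff)
  moreover have "\<kappa> = 2 - (2 - \<kappa>)" by simp
  ultimately show ?thesis using dpr_start[of g "2 - \<kappa>"] assms(2) that[of _ "2 - \<kappa>"] by auto
qed

lemma hom_GG: assumes "(a, b) \<in> d.GG tt" shows "(hom a, hom b) \<in> GG u"
  using assms
proof (cases rule: d.GG.cases)
  case (WK p \<kappa>)
  obtain B k where f: "(B, k) \<in> FF" "p = sig (B, k)" "\<kappa> = 2 - k" using dual_flag[OF WK(3,4)] .
  have nb: "(B, k) \<notin> BF" using dual_edge(2)[OF f(1)] WK(5) f by auto
  have o: "(nb u B k, k + 3) \<in> FF" "opp (nb u B k, k + 3) = (B, k)" using opp_FF[of "(B, k)"] f(1) nb by (auto simp: opp_def)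
  have nbp: "d.nb tt p \<kappa> = sig (nb u B k, k + 3)" using dual_edge(1)[OF f(1) nb] f by (simp add: opp_def)
  have e: "\<kappa> + 3 = 2 - (k + 3)" using f(3) by (simp add: algebra_simps)
  have bck: "nb u (nb u B k) (k + 3) = B" using U.nb_back(3) FF_D(1)[OF f(1)] FF_fin(1)[OF f(1)] by blast
  have ph: "phi (nb u B k, k + 3) = (B, pv u B k)" by (simp add: phi_def bck)
  have "d.pv tt (d.nb tt p \<kappa>) (\<kappa> + 3) = 2 - pv u B k" unfolding nbp e pv_dual[OF o(1)] ph by simp
  then have "b = K (sig (B, pv u B k)) (2 - pv u B k)"
    using WK(2) nbp sig_phi[OF o(1)] ph by simp
  moreover have "(B, pv u B k) \<in> FF" using phi_FF[OF o(1)] ph by simp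
  ultimately have "hom b = W B (pv u B k)" by (simp add: hom_def flagat)
  moreover have "hom a = K B k" using WK(1) f by (simp add: hom_def flagat)
  ultimately show ?thesis using GG.KW FF_D[OF f(1)] by simp
next
  case (WW p \<kappa>)
  obtain B k where f: "(B, k) \<in> FF" "p = sig (B, k)" "\<kappa> = 2 - k" using dual_flag[OF WW(3,4)] .
  have nb: "(B, k) \<notin> BF" using dual_edge(2)[OF f(1)] WW(5) f by auto
  have o: "(nb u B k, k + 3) \<in> FF" using opp_FF[of "(B, k)"] f(1) nb by (auto simp: opp_def)
  have nbp: "d.nb tt p \<kappa> = sig (nb u B k, k + 3)" using dual_edge(1)[OF f(1) nb] f by (simp add: opp_def)
  have bck: "nb u (nb u B k) (k + 3) = B" using U.nb_back(3) FF_D(1)[OF f(1)] FF_fin(1)[OF f(1)] by blast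
  have "\<kappa> + 2 = 2 - (k + 3) + 5" using f(3) by (simp add: algebra_simps)
  then have p5: "pr u B (k + 5)" using WW(6) dpr_next[OF o] unfolding nbp bck by (simp add: add.assoc)
  then have ph: "phi (nb u B k, k + 3) = (B, k + 5)" by (simp add: phi_def bck pv_def)
  have "\<kappa> + 1 = 2 - (k + 5)" using f(3) by (simp add: algebra_simps)
  then have "b = W (sig (B, k + 5)) (2 - (k + 5))" using WW(2) nbp sig_phi[OF o] ph by simp
  moreover have "(B, k + 5) \<in> FF" using phi_FF[OF o] ph by simp
  ultimately have "hom b = K B (k + 5)" by (simp only: hom_def flagat walker.case prod.case)
  moreover have "hom a = K B k" using WW(1) f by (simp add: hom_def flagat)
  ultimately show ?thesis using GG.KK FF_D[OF f(1)] p5 by simp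
next
  case (KW p \<kappa>)
  obtain B k where f: "(B, k) \<in> FF" "p = sig (B, k)" "\<kappa> = 2 - k" using dual_flag[OF KW(3,4)] .
  have ph: "phi (B, k) = (nb u B k, pv u (nb u B k) (k + 3))" by (simp add: phi_def)
  have "b = W (sig (phi (B, k))) (2 - snd (phi (B, k)))" using KW(2) f pv_dual[OF f(1)] sig_phi[OF f(1)] by simp
  then have "hom b = K (nb u B k) (pv u (nb u B k) (k + 3))" using phi_FF[OF f(1)] unfolding ph by (simp add: hom_def flagat)
  moreover have "hom a = W B k" using KW(1) f by (simp add: hom_def flagat)
  ultimately show ?thesis using GG.WK FF_D[OF f(1)] FF_fin[OF f(1)] by simp
next
  case (KK p \<kappa>)
  obtain B k where f: "(B, k) \<in> FF" "p = sig (B, k)" "\<kappa> = 2 - k" using dual_flag[OF KK(3,4)] .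
  have n: "\<not> pr u (nb u B k) (k + 2)" using KK(5) dpr_next[OF f(1)] f by simp
  then have ph: "phi (B, k) = (nb u B k, k + 1)" by (simp add: phi_def pv_def)
  have "\<kappa> + 5 = 2 - (k + 1)" using f(3) by (simp add: algebra_simps)
  then have "b = K (sig (nb u B k, k + 1)) (2 - (k + 1))" using KK(2) f sig_phi[OF f(1)] ph by simp
  moreover have "(nb u B k, k + 1) \<in> FF" using phi_FF[OF f(1)] ph by simp
  ultimately have "hom b = W (nb u B k) (k + 1)" by (simp only: hom_def flagat walker.case prod.case)
  moreover have "hom a = W B k" using KK(1) f by (simp add: hom_def flagat)
  ultimately show ?thesis using GG.WW FF_D[OF f(1)] FF_fin[OF f(1)] n by simp
qed

lemma acyclic_dual: "acyclic (d.GG tt)"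
proof (rule acyclicI, safe)
  fix x assume "(x, x) \<in> (d.GG tt)\<^sup>+"
  moreover have "(hom a, hom b) \<in> (GG u)\<^sup>+" if "(a, b) \<in> (d.GG tt)\<^sup>+" for a b
    using that by (induction rule: trancl_induct) (auto dest: hom_GG intro: trancl_into_trancl)
  ultimately show False using U.acyc by (auto simp: acyclic_def)
qed

sublocale T: hexa ddir tt
  by unfold_locales (rule acyclic_dual)

end

section \<open>Counting extremal summands\<close>

context hexs
begin

text \<open>Of the six sectors around a branch point, an angle of 60 degrees takes one and an angle
  of 120 degrees takes two; so the missing rays correspond to the angles of 120 degrees.\<close>

lemma card_gaps: "6 * card {B. branch s B} = card {(B, k). branch s B \<and> pr s B k} + card {(B, k). branch s B \<and> pr s B k \<and> \<not> pr s B (k + 1)}"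
proof -
  let ?N = "{B. branch s B}"
  let ?P = "{(B, k). branch s B \<and> pr s B k}" and ?A = "{(B, k). branch s B \<and> \<not> pr s B k}"
  have fin: "finite ?P" "finite ?A" by (rule finite_subset[of _ "?N \<times> UNIV"]; auto simp: finite_branch)+
  have "card (?N \<times> (UNIV :: 6 set)) = 6 * card ?N" by (simp add: card_cartesian_product)
  moreover have "?N \<times> UNIV = ?P \<union> ?A" by auto
  moreover have "card (?P \<union> ?A) = card ?P + card ?A" by (rule card_Un_disjoint[OF fin]) auto
  moreover have "card {(B, k). branch s B \<and> pr s B k \<and> \<not> pr s B (k + 1)} = card ?A"
  proof (rule bij_betw_same_card, rule bij_betw_byWitness[where f = "\<lambda>(B, k). (B, k + 1)" and f' = "\<lambda>(B, k). (B, k + 5)"])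
    have "pr s B (k + 5)" if "branch s B" "\<not> pr s B k" for B k using branch_gap[OF that(1), of "k + 5"] that(2) by simp
    then show "(\<lambda>(B, k). (B, k + 5)) ` ?A \<subseteq> {(B, k). branch s B \<and> pr s B k \<and> \<not> pr s B (k + 1)}" by auto
  qed auto
  ultimately show ?thesis by simp
qed

end

context hext
begin

lemma on_cor: "ev d \<Longrightarrow> on (d + 4) (cor r d)" "ev d \<Longrightarrow> on d B \<Longrightarrow> on (d + 4) B \<Longrightarrow> B = cor r d"
  using off_cor(5)[of d r] off_eqI[of d B "cor r d"] by auto

lemma frame_line_nonneg: assumes d: "ev d" "hit k (x - cor r d)" and A: "off k A = off k x" shows "s A \<ge> 0"
proof -
  consider (1) "k = d \<or> k = d + 3" "off d x = off d (cor r d)"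
    | (2) "k = d + 4 \<or> k = d + 1" "off (d + 4) x = off (d + 4) (cor r (d + 4))"
    | (3) "k = d + 2 \<or> k = d + 5" "off (d + 2) x = off (d + 2) (cor r d)"
    using fr_hit_cases[OF d] by satx
  then show ?thesis
  proof cases
    case 1
    then have "on d A" using A by auto
    then show ?thesis using side_nonneg[OF d(1)] by blast
  next
    case 2
    then have "on (d + 4) A" using A by auto
    then show ?thesis using side_nonneg[of "d + 4" A] d(1) by simp
  next
    case 3
    then have o: "off (d + 2) A = off (d + 2) (cor r d)" using A by auto
    show ?thesis
    proof (cases "s A = 0")
      case False
      then have "off d (A - cor r d) \<ge> 0" "off (d + 1) (A - cor r d) \<le> 0" using suppTT TT_iff[OF d(1)] by auto
      then have "on d A" using o by simp
      then show ?thesis using side_nonneg[OF d(1)] by blast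
    qed simp
  qed
qed

end

context framed
begin

text \<open>Incidences of branch points with sides, so that a corner is counted twice.\<close>

definition SI :: "((real^2) \<times> 6) set" where "SI = {(B, d). branch u B \<and> ev d \<and> on d B}"

lemma finite_SI: "finite SI"
  by (rule finite_subset[of _ "{B. branch u B} \<times> UNIV"]) (auto simp: SI_def U.finite_branch)

lemma SI_ray: assumes "(B, d) \<in> SI" shows "pr u B (d + 4)" "\<not> pr u B (d + 5)" "\<not> fin u B (d + 4)" "pr u B d"
proof -
  have b: "branch u B" "ev d" "on d B" "B \<in> TT r" using assms branch_TT by (auto simp: SI_def)
  show p5: "\<not> pr u B (d + 5)" using side_ray(3)[OF b(2,4,3)] by (simp add: pr_def)
  show "pr u B d" using side_ray(1)[OF b(2,4,3)] by (simp add: pr_def)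
  show "pr u B (d + 4)" using U.branch_gap[OF b(1), of "d + 4"] p5 by simp
  show "\<not> fin u B (d + 4)"
  proof
    assume "fin u B (d + 4)"
    then obtain t where t: "t > 0" "branch u (B + t *\<^sub>R dir (d + 4))" by (auto simp: fin_def ahead_def simp del: dir_add)
    have "off d (B + t *\<^sub>R dir (d + 4) - cor r d) \<ge> 0" using branch_TT[OF t(2)] b(2) by (simp add: TT_def del: dir_add off_lin)
    then show False using t(1) b(3) by simp
  qed
qed

lemma exits_SI: "{(B, k). branch u B \<and> pr u B k \<and> \<not> fin u B k} = (\<lambda>(B, d). (B, d + 4)) ` SI"
proof (rule set_eqI, safe)
  fix B k assume h: "branch u B" "pr u B k" "\<not> fin u B k"
  have e: "ev (k + 2)" using U.odd_fin[of k B] h by auto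
  have "on (k + 2) B" using ray_fin(1)[OF h(1,2) e] h(3) by force
  then have "(B, k + 2) \<in> SI" using h(1) e by (simp add: SI_def del: off_add)
  then show "(B, k) \<in> (\<lambda>(B, d). (B, d + 4)) ` SI" by force
next
  fix B d assume f: "(B, d) \<in> SI"
  show "branch u B" using f by (simp add: SI_def)
  show "pr u B (d + 4)" "fin u B (d + 4) \<Longrightarrow> False" using SI_ray[OF f] by auto
qed

text \<open>The rays that are neither flags nor exits run backwards along a side; the corner at
  which the side starts has none.\<close>

lemma rim_SI: "{(B, k). branch u B \<and> pr u B k \<and> fin u B k \<and> \<not> inn B k} = (\<lambda>(B, d). (B, d + 3)) ` {(B, d). (B, d) \<in> SI \<and> B \<noteq> cor r d}"
proof (rule set_eqI, safe)
  fix B k assume h: "branch u B" "pr u B k" "fin u B k" "\<not> inn B k"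
  then obtain e where e: "ev e" "on e B" "k \<noteq> e" "k \<noteq> e + 1" "k \<noteq> e + 2" using branch_TT by (auto simp: inn_def)
  then have f: "(B, e) \<in> SI" using h(1) by (simp add: SI_def)
  have k: "k = e + 3" using six_rel[of k e] SI_ray[OF f] h e by auto
  moreover have "B \<noteq> cor r e"
  proof
    assume B: "B = cor r e"
    then have "(B, e + 4) \<in> SI" using h(1) e(1) on_cor(1)[OF e(1)] by (simp add: SI_def)
    then show False using SI_ray(2)[of B "e + 4"] h(2) k by simp
  qed
  ultimately show "(B, k) \<in> (\<lambda>(B, d). (B, d + 3)) ` {(B, d). (B, d) \<in> SI \<and> B \<noteq> cor r d}" using f by force
next
  fix B d assume f: "(B, d) \<in> SI" "B \<noteq> cor r d"
  have b: "branch u B" "ev d" "on d B" "B \<in> TT r" using f branch_TT by (auto simp: SI_def)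
  show "branch u B" using b by simp
  show p: "pr u B (d + 3)" using side_ray(2)[OF b(2,4,3) f(2)] by (simp add: pr_def)
  show "fin u B (d + 3)" by (rule U.odd_fin[OF _ p]) (use b in simp)
  assume "inn B (d + 3)"
  then show False using b by (auto simp: inn_def)
qed

lemma cor_branch: "ev d \<Longrightarrow> branch u (cor r d)"
  using u_cor[of d] by (intro U.nz_branch) auto

lemma cor_inj: assumes "ev d" "ev e" "cor r d = cor r e" shows "d = e"
proof -
  have "fr r (cor r d) \<ge> (\<Sum>x\<in>{d, e}. of_bool (cor r d = cor r x))" unfolding fr_def using assms(1,2) by (intro sum_mono2) auto
  then show ?thesis using fr_cor[OF r assms(1)] assms(3) by (cases "d = e") auto
qed

lemma card_corners: "card {(B, d). (B, d) \<in> SI \<and> B \<noteq> cor r (d + c)} + 3 = card SI" if c: "c = 0 \<or> c = 2"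
proof -
  let ?C = "(\<lambda>d. (cor r (d + c), d)) ` {d. ev d}"
  have "on d (cor r (d + c))" if "ev d" for d using c on_cor(1)[of "d + 2"] that by auto
  then have sub: "?C \<subseteq> SI" using cor_branch c by (auto simp: SI_def)
  have "{(B, d). (B, d) \<in> SI \<and> B \<noteq> cor r (d + c)} = SI - ?C" by (auto simp: SI_def)
  moreover have "card ?C = 3" unfolding Collect_ev by (subst card_image) (auto simp: inj_on_def)
  moreover have "card ?C \<le> card SI" by (rule card_mono[OF finite_SI sub])
  ultimately show ?thesis using card_Diff_subset[OF finite_subset[OF sub finite_SI] sub] by simp
qed

text \<open>A corner is the end of one side and the start of another, and only the latter gives a
  flag.\<close>

lemma BF_SI: "BF = {(B, d). (B, d) \<in> SI \<and> B \<noteq> cor r (d + 2)}"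
proof -
  have 1: "(B, d) \<in> SI \<and> B \<noteq> cor r (d + 2)" if f: "(B, d) \<in> BF" for B d
  proof -
    have b: "(B, d) \<in> FF" "ev d" "on d B" using f by (auto simp: BF_def)
    have "\<not> on (d + 2) B"
    proof
      assume "on (d + 2) B"
      then have "d = d + 2 \<or> d = d + 2 + 1 \<or> d = d + 2 + 2" using FF_D(3)[OF b(1)] b(2) ev_add(2)[of d] unfolding inn_def by blast
      then show False by simp
    qed
    then show ?thesis using b FF_D by (auto simp: SI_def)
  qed
  have 2: "(B, d) \<in> BF" if f: "(B, d) \<in> SI" "B \<noteq> cor r (d + 2)" for B d
  proof -
  have b: "branch u B" "ev d" "on d B" "B \<in> TT r" using f branch_TT by (auto simp: SI_def)
  have "inn B d" unfolding inn_def
  proof (intro conjI allI impI b(4), elim conjE)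
    fix e assume e: "ev e" "on e B"
    have "e \<noteq> d + 2" using on_cor(2)[of "d + 2" B] e b f(2) by auto
    then show "d = e \<or> d = e + 1 \<or> d = e + 2" using six_rel[of d e] e(1) b(2) by auto
  qed
  then show ?thesis using b SI_ray(4)[OF f(1)] by (simp add: BF_def FF_def)
  qed
  show ?thesis using 1 2 by auto
qed

lemma dual_pr: "{(p, \<kappa>). d.branch tt p \<and> d.pr tt p \<kappa> \<and> Q p \<kappa>} = (\<lambda>f. (sig f, 2 - snd f)) ` {f. f \<in> FF \<and> Q (sig f) (2 - snd f)}"
proof (rule set_eqI, safe)
  fix p \<kappa> assume h: "d.branch tt p" "d.pr tt p \<kappa>" "Q p \<kappa>"
  obtain B k where "(B, k) \<in> FF" "p = sig (B, k)" "\<kappa> = 2 - k" using dual_flag[OF h(1,2)] .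
  then show "(p, \<kappa>) \<in> (\<lambda>f. (sig f, 2 - snd f)) ` {f. f \<in> FF \<and> Q (sig f) (2 - snd f)}" using h(3) by (auto intro!: image_eqI[of _ _ "(B, k)"])
qed (use dbranch_iff dpr_flag in \<open>auto simp del: dir_add\<close>)

lemma dual_inj: "inj_on (\<lambda>f. (sig f, 2 - snd f)) FF"
proof (rule inj_onI)
  fix f g assume h: "f \<in> FF" "g \<in> FF" "(sig f, 2 - snd f) = (sig g, 2 - snd g)"
  then have "snd f = snd g" by auto
  then show "f = g" using sig_dir_inj[of "fst f" "snd f" "fst g"] h by (metis prod.collapse prod.inject)
qed

lemma card_dual: "card {(p, \<kappa>). d.branch tt p \<and> d.pr tt p \<kappa> \<and> Q p \<kappa>} = card {f. f \<in> FF \<and> Q (sig f) (2 - snd f)}"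
  unfolding dual_pr by (rule card_image) (rule inj_on_subset[OF dual_inj], auto)

lemma dpr_prev: assumes f: "(B, k) \<in> FF" shows "d.pr tt (sig (B, k)) (2 - k + 1) \<longleftrightarrow> \<not> pr u B (k + 1)"
proof -
  obtain f0 where f0: "f0 \<in> FF" "phi f0 = (B, k)" using phi_bij f unfolding bij_betw_def by (metis imageE)
  obtain B0 k0 where e: "f0 = (B0, k0)" by force
  have g: "(B0, k0) \<in> FF" using f0 e by simp
  have B: "B = nb u B0 k0" "k = pv u B (k0 + 3)" using f0(2) e by (auto simp: phi_def)
  have sg: "sig (B, k) = sig (B0, k0)" using sig_phi[OF f0(1)] f0(2) e by simp
  show ?thesis
  proof (cases "pr u B (k0 + 2)")
    case True
    then have k: "k = k0 + 2" using B(2) by (simp add: pv_def)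
    have "pr u B (k + 1)" using U.pr_nb[OF FF_fin(1)[OF g]] FF_D(2)[OF g] k B(1) by simp
    moreover have "2 - k + 1 = 2 - k0 + 5" using k by (simp add: algebra_simps)
    ultimately show ?thesis using dpr_next[OF g] True B(1) unfolding sg by simp
  next
    case False
    then have k: "k = k0 + 1" using B(2) by (simp add: pv_def)
    have "2 - k + 1 = 2 - k0" using k by (simp add: algebra_simps)
    then show ?thesis using dpr_flag[OF g] False k unfolding sg by simp
  qed
qed

text \<open>\<open>card_gaps\<close> eliminates the numbers of branch points from the two instances
  of \<open>card_free\<close>. Since angles are exchanged, the angles of 120 degrees of both
  measures inside the triangle add up to the number of flags, which cancels; incidences with the
  sides remain, and the three corners produce the constant.\<close>

theorem frame_count: "card U.free + card T.free = card BF + 1"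
proof -
  let ?N = "{B. branch u B}" and ?PR = "{(B, k). branch u B \<and> pr u B k}"
  let ?X = "{(B, k). branch u B \<and> pr u B k \<and> \<not> fin u B k}"
  let ?R = "{(B, k). branch u B \<and> pr u B k \<and> fin u B k \<and> \<not> inn B k}"
  let ?F1 = "{f. f \<in> FF \<and> pr u (fst f) (snd f + 1)}" and ?F0 = "{f. f \<in> FF \<and> \<not> pr u (fst f) (snd f + 1)}"
  have finP: "finite ?PR" by (rule finite_subset[of _ "?N \<times> UNIV"]) (auto simp: U.finite_branch)
  have fX: "finite ?X" "finite ?R" by (rule finite_subset[OF _ finP]; auto)+
  have cX: "card ?X = card SI" unfolding exits_SI by (rule card_image) (auto simp: inj_on_def)
  have cR: "card ?R + 3 = card SI" unfolding rim_SI using card_corners[of 0] by (subst card_image) (auto simp: inj_on_def)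
  have cB: "card BF + 3 = card SI" unfolding BF_SI using card_corners[of 2] by simp
  have XF: "?X \<inter> FF = {}" using FF_fin(1) by auto
  have "?PR = (FF \<union> ?X) \<union> ?R"
  proof (rule set_eqI, safe)
    fix B k assume "branch u B" "pr u B k" "(B, k) \<notin> FF" "fin u B k" "inn B k"
    then show False by (simp add: FF_def)
  qed (auto simp: FF_def)
  moreover have "card ((FF \<union> ?X) \<union> ?R) = card (FF \<union> ?X) + card ?R"
    by (rule card_Un_disjoint) (use finite_FF fX in \<open>auto simp: FF_def\<close>)
  moreover have "card (FF \<union> ?X) = card FF + card ?X" by (rule card_Un_disjoint) (use finite_FF fX XF in auto)
  ultimately have cP: "card ?PR = card FF + card ?X + card ?R" by simp
  have R1: "pr u B (k + 1)" if "(B, k) \<in> ?R" for B k using that SI_ray(1) unfolding rim_SI by auto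
  have X1: "\<not> pr u B (k + 1)" if "(B, k) \<in> ?X" for B k using that SI_ray(2) unfolding exits_SI by auto
  \<comment> \<open>An angle of 120 degrees lies to the left of a flag or of an exit ray; to the
    left of a ray running backwards along a side there is an exit ray at 60 degrees.\<close>
  have "(B, k) \<in> {(B, k). branch u B \<and> pr u B k \<and> \<not> pr u B (k + 1)} \<longleftrightarrow> (B, k) \<in> ?F0 \<union> ?X" for B k
    using R1[of B k] X1[of B k] by (auto simp: FF_def)
  then have "{(B, k). branch u B \<and> pr u B k \<and> \<not> pr u B (k + 1)} = ?F0 \<union> ?X" by (intro set_eqI) (simp only: split_paired_all)
  moreover have "card (?F0 \<union> ?X) = card ?F0 + card ?X" by (rule card_Un_disjoint) (use finite_FF fX XF in auto)
  ultimately have 6: "6 * card ?N = card ?PR + card ?F0 + card ?X" using U.card_gaps by simp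
  have "FF = ?F1 \<union> ?F0" by auto
  moreover have "card (?F1 \<union> ?F0) = card ?F1 + card ?F0" by (rule card_Un_disjoint) (use finite_FF in auto)
  ultimately have F01: "card FF = card ?F1 + card ?F0" by simp
  have dP: "card {(p, \<kappa>). d.branch tt p \<and> d.pr tt p \<kappa>} = card FF" using card_dual[of "\<lambda>_ _. True"] by simp
  have "{f. f \<in> FF \<and> \<not> d.fin tt (sig f) (2 - snd f)} = BF"
  proof (rule set_eqI)
    fix f :: "(real^2) \<times> 6"
    obtain B k where f: "f = (B, k)" by force
    show "f \<in> {f. f \<in> FF \<and> \<not> d.fin tt (sig f) (2 - snd f)} \<longleftrightarrow> f \<in> BF"
    proof (cases "f \<in> FF")
      case True then show ?thesis using dual_edge[of B k] f by auto
    qed (use f in \<open>auto simp: BF_def\<close>)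
  qed
  then have dX: "card {(p, \<kappa>). d.branch tt p \<and> d.pr tt p \<kappa> \<and> \<not> d.fin tt p \<kappa>} = card BF" using card_dual[of "\<lambda>p \<kappa>. \<not> d.fin tt p \<kappa>"] by simp
  have "{f. f \<in> FF \<and> \<not> d.pr tt (sig f) (2 - snd f + 1)} = ?F1" using dpr_prev by auto
  then have d6: "6 * card {p. d.branch tt p} = card FF + card ?F1"
    using T.card_gaps card_dual[of "\<lambda>p \<kappa>. \<not> d.pr tt p (\<kappa> + 1)"] dP by simp
  have "2 * card U.free + 4 * card ?N = card ?X + card ?PR" by (rule U.card_free)
  moreover have "2 * card T.free + 4 * card {p. d.branch tt p} = card BF + card FF" using T.card_free dX dP by simp
  ultimately show ?thesis using cX cR cB cP 6 F01 d6 by linarith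
qed

end

section \<open>Removing the frame\<close>

lemma homogeneous_solution:
  fixes M :: "'a \<Rightarrow> 'b \<Rightarrow> real"
  assumes "finite G" "finite F" "card G < card F"
  shows "\<exists>x. (\<exists>f\<in>F. x f \<noteq> 0) \<and> (\<forall>g\<in>G. (\<Sum>f\<in>F. x f * M f g) = 0)"
  using assms
proof (induction G arbitrary: F M rule: finite_induct)
  case empty
  then have "F \<noteq> {}" by auto
  then show ?case by (intro exI[of _ "\<lambda>_. 1"]) auto
next
  case (insert g0 G)
  show ?case
  proof (cases "\<forall>f\<in>F. M f g0 = 0")
    case True
    have "card G < card F" using insert by simp
    then obtain x where "\<exists>f\<in>F. x f \<noteq> 0" "\<forall>g\<in>G. (\<Sum>f\<in>F. x f * M f g) = 0" using insert.IH[OF insert.prems(1), of M] by blast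
    then show ?thesis using True by (intro exI[of _ x]) auto
  next
    case False
    then obtain f0 where f0: "f0 \<in> F" "M f0 g0 \<noteq> 0" by blast
    define M' where "M' f g = M f g - M f g0 / M f0 g0 * M f0 g" for f g
    have "card G < card (F - {f0})" "finite (F - {f0})" using insert f0 by auto
    then obtain x where x: "\<exists>f\<in>F - {f0}. x f \<noteq> 0" "\<forall>g\<in>G. (\<Sum>f\<in>F - {f0}. x f * M' f g) = 0" using insert.IH[of "F - {f0}" M'] by blast
    define y where "y = x(f0 := - (\<Sum>f\<in>F - {f0}. x f * M f g0) / M f0 g0)"
    have eq: "(\<Sum>f\<in>F. y f * M f g) = (\<Sum>f\<in>F - {f0}. x f * M' f g)" for g
    proof -
      have "(\<Sum>f\<in>F. y f * M f g) = y f0 * M f0 g + (\<Sum>f\<in>F - {f0}. y f * M f g)" by (rule sum.remove[OF insert.prems(1) f0(1)])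
      also have "(\<Sum>f\<in>F - {f0}. y f * M f g) = (\<Sum>f\<in>F - {f0}. x f * M f g)" by (rule sum.cong) (auto simp: y_def)
      also have "y f0 * M f0 g = - (\<Sum>f\<in>F - {f0}. x f * (M f g0 / M f0 g0 * M f0 g))"
        by (simp add: y_def sum_distrib_left sum_distrib_right sum_divide_distrib mult_ac)
      finally show ?thesis by (simp add: M'_def right_diff_distrib sum_subtractf)
    qed
    have "(\<Sum>f\<in>F - {f0}. x f * M' f g0) = 0" using f0(2) by (intro sum.neutral) (simp add: M'_def)
    moreover have "\<exists>f\<in>F. y f \<noteq> 0" using x(1) by (auto simp: y_def)
    ultimately show ?thesis using x(2) eq by (intro exI[of _ y]) auto
  qed
qed

context framed
begin

sublocale hexa dir s
  by unfold_locales (rule acyclic_GG[OF rig])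

definition free_corners :: "6 set" where "free_corners = {d. ev d \<and> s (cor r d) = 0}"

lemma face_U: "\<sigma> \<in> face \<Longrightarrow> \<sigma> \<in> U.face"
proof -
  assume "\<sigma> \<in> face"
  moreover have "D s x k = 0" if "D u x k = 0" for x k using D_s_le_u[of x k] D_nonneg[of x k] that by linarith
  ultimately show ?thesis by (auto simp: face_def U.face_def)
qed

lemma corner_U: assumes "ev d" shows "(\<lambda>A. of_bool (A = cor r d)) \<in> U.face"
proof -
  have "D (\<lambda>A. of_bool (A = cor r d)) x k \<le> D u x k" for x k
  proof -
    have "(\<Sum>e\<in>{d}. of_bool (hit k (x - cor r e))) \<le> D (fr r) x k" unfolding D_fr using assms by (intro sum_mono2) auto
    then have "of_bool (hit k (x - cor r d)) \<le> D (fr r) x k" by (simp only: sum.insert sum.empty finite.emptyI empty_iff add_0_right not_False_eq_True)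
    then show ?thesis using D_nonneg[of x k] unfolding D_point D_u by linarith
  qed
  then show ?thesis by (intro U.face_below[OF fs_point _ U.face_self]) (auto simp: pos_def D_point)
qed

text \<open>Where the frame meets a germ, all weights of \<open>s\<close> on its line are
  nonnegative. If \<open>s\<close> has density 0 there, each of its weights hitting the germ
  vanishes, so \<open>\<sigma>\<close> could have such weights only at free corners.\<close>

lemma U_face_cut: assumes \<sigma>: "\<sigma> \<in> U.face" and z: "\<And>d. d \<in> free_corners \<Longrightarrow> \<sigma> (cor r d) = 0" shows "\<sigma> \<in> face"
proof -
  have "D \<sigma> x k = 0" if D0: "D s x k = 0" for x k
  proof (cases "\<exists>d. ev d \<and> hit k (x - cor r d)")
    case False
    then have "D (fr r) x k = 0" unfolding D_fr by (intro sum.neutral) auto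
    then have "D u x k = 0" using D0 by (simp add: D_u)
    then show ?thesis using \<sigma> by (auto simp: U.face_def)
  next
    case True
    then obtain d where d: "ev d" "hit k (x - cor r d)" by blast
    have nn: "s A * of_bool (hit k (x - A)) \<ge> 0" for A
      using frame_line_nonneg[OF d, of A] by (cases "hit k (x - A)") (auto simp: hit_def)
    have "(\<Sum>A | s A \<noteq> 0. s A * of_bool (hit k (x - A))) = 0" using D0 by (simp add: D_def)
    then have all: "s A * of_bool (hit k (x - A)) = 0" if "s A \<noteq> 0" for A
      using sum_nonneg_eq_0_iff[of "{A. s A \<noteq> 0}" "\<lambda>A. s A * of_bool (hit k (x - A))"] nn fss that by (auto simp: fs_def)
    have "\<sigma> A = 0" if "hit k (x - A)" for A
    proof -
      have sA: "s A = 0" using all[of A] that by auto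
      show ?thesis
      proof (cases "\<exists>e. ev e \<and> A = cor r e")
        case True
        then show ?thesis using z sA by (auto simp: free_corners_def)
      next
        case False
        then have "u A = 0" using sA fr_zero[of A r] by (auto simp: u_def)
        then show ?thesis by (rule U.face_zero[OF \<sigma>])
      qed
    qed
    then show ?thesis unfolding D_def by (intro sum.neutral) auto
  qed
  then show ?thesis using \<sigma> by (auto simp: face_def U.face_def)
qed

text \<open>The framed face is the direct sum of the face of \<open>s\<close> and the unit tripods
  at the free corners. Each inequality between the dimensions is refuted by a homogeneous system
  with more unknowns than equations.\<close>

lemma card_free_U: "card U.free = card free + card free_corners"
proof (rule ccontr)
  assume ne: "card U.free \<noteq> card free + card free_corners"
  obtain e where e: "\<And>g. g \<in> free \<Longrightarrow> e g \<in> face" "\<And>g h. g \<in> free \<Longrightarrow> h \<in> free \<Longrightarrow> coef (e g) h = of_bool (h = g)"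
    using basis_exists by metis
  obtain E where E: "\<And>g. g \<in> U.free \<Longrightarrow> E g \<in> U.face" "\<And>g h. g \<in> U.free \<Longrightarrow> h \<in> U.free \<Longrightarrow> U.coef (E g) h = of_bool (h = g)"
    using U.basis_exists by metis
  let ?I = "free <+> free_corners"
  have fI: "finite ?I" using finite_free by simp
  have cI: "card ?I = card free + card free_corners" using finite_free by (simp add: card_Plus)
  consider "card U.free < card ?I" | "card ?I < card U.free" using ne cI by linarith
  then show False
  proof cases
    case 1
    define v where "v i = (case i of Inl g \<Rightarrow> e g | Inr d \<Rightarrow> (\<lambda>A. of_bool (A = cor r d)))" for i
    have vU: "v i \<in> U.face" if "i \<in> ?I" for i using that e(1) face_U corner_U by (auto simp: v_def free_corners_def)
    obtain x where x: "\<exists>i\<in>?I. x i \<noteq> 0" "\<forall>h\<in>U.free. (\<Sum>i\<in>?I. x i * U.coef (v i) h) = 0"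
      using homogeneous_solution[OF U.finite_free fI 1, of "\<lambda>i h. U.coef (v i) h"] by blast
    have fsv: "fs (v i)" if "i \<in> ?I" for i using vU[OF that] by (rule U.faceD(1))
    have "(\<lambda>A. \<Sum>i\<in>?I. x i * v i A) = (\<lambda>A. 0)"
    proof (rule U.face_eqI)
      show "(\<lambda>A. \<Sum>i\<in>?I. x i * v i A) \<in> U.face" using vU by (intro U.face_sum U.face_scale)
      show "(\<lambda>A. 0) \<in> U.face" using U.face_scale[OF U.face_self, of 0] by simp
      fix h assume h: "h \<in> U.free"
      have "U.coef (\<lambda>A. \<Sum>i\<in>?I. x i * v i A) h = (\<Sum>i\<in>?I. x i * U.coef (v i) h)"
        using fsv by (subst U.coef_sum) (auto simp: U.coef_scale intro!: fs_scale sum.cong)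
      also have "\<dots> = 0" using x(2) h by blast
      finally show "U.coef (\<lambda>A. \<Sum>i\<in>?I. x i * v i A) h = U.coef (\<lambda>A. 0) h" using U.coef_scale[OF fss, of 0 h] by simp
    qed
    then have 0: "(\<Sum>g\<in>free. x (Inl g) * e g A) + (\<Sum>d\<in>free_corners. x (Inr d) * of_bool (A = cor r d)) = 0" for A
      using finite_free fun_cong[of "\<lambda>A. \<Sum>i\<in>?I. x i * v i A" "\<lambda>A. 0" A] by (simp add: sum.Plus v_def)
    have r0: "x (Inr d) = 0" if d: "d \<in> free_corners" for d
    proof -
      have "s (cor r d) = 0" "ev d" using d by (auto simp: free_corners_def)
      then have "(\<Sum>g\<in>free. x (Inl g) * e g (cor r d)) = 0" using e(1) face_zero by (intro sum.neutral) auto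
      moreover have "(\<Sum>c\<in>free_corners. x (Inr c) * of_bool (cor r d = cor r c)) = (\<Sum>c\<in>free_corners. if c = d then x (Inr d) else 0)"
        using cor_inj[OF \<open>ev d\<close>] by (intro sum.cong) (auto simp: free_corners_def)
      ultimately show ?thesis using 0[of "cor r d"] d by simp
    qed
    then have z: "(\<lambda>A. \<Sum>g\<in>free. x (Inl g) * e g A) = (\<lambda>A. 0)" using 0 by simp
    have l0: "x (Inl h) = 0" if h: "h \<in> free" for h
    proof -
      have "(\<Sum>g\<in>free. x (Inl g) * coef (e g) h) = coef (\<lambda>A. \<Sum>g\<in>free. x (Inl g) * e g A) h"
        using e(1) faceD(1) by (subst coef_sum) (auto simp: coef_scale intro!: fs_scale sum.cong)
      also have "\<dots> = 0" unfolding z using coef_scale[OF fss, of 0 h] by simp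
      finally show ?thesis using h finite_free by (simp add: e(2) cong: sum.cong)
    qed
    show False using x(1) r0 l0 by auto
  next
    case 2
    define M where "M g i = (case i of Inl h \<Rightarrow> coef (E g) h | Inr d \<Rightarrow> E g (cor r d))" for g i
    obtain x where x: "\<exists>g\<in>U.free. x g \<noteq> 0" "\<forall>i\<in>?I. (\<Sum>g\<in>U.free. x g * M g i) = 0"
      using homogeneous_solution[OF fI U.finite_free 2, of M] by blast
    let ?\<sigma> = "\<lambda>A. \<Sum>g\<in>U.free. x g * E g A"
    have fsE: "fs (E g)" if "g \<in> U.free" for g using E(1)[OF that] by (rule U.faceD(1))
    have \<sigma>: "?\<sigma> \<in> face"
    proof (rule U_face_cut)
      show "?\<sigma> \<in> U.face" using E(1) by (intro U.face_sum U.face_scale)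
      show "?\<sigma> (cor r d) = 0" if "d \<in> free_corners" for d using bspec[OF x(2) InrI[OF that]] by (simp add: M_def)
    qed
    have "?\<sigma> = (\<lambda>A. 0)"
    proof (rule face_eqI[OF \<sigma>])
      show "(\<lambda>A. 0) \<in> face" using face_scale[OF face_self, of 0] by simp
      fix h assume h: "h \<in> free"
      have "coef ?\<sigma> h = (\<Sum>g\<in>U.free. x g * coef (E g) h)"
        using fsE by (subst coef_sum) (auto simp: coef_scale intro!: fs_scale sum.cong)
      also have "\<dots> = 0" using bspec[OF x(2) InlI[OF h]] by (simp add: M_def)
      finally show "coef ?\<sigma> h = coef (\<lambda>A. 0) h" using coef_scale[OF fss, of 0 h] by simp
    qed
    then have "x h = 0" if h: "h \<in> U.free" for h
    proof -
      assume z: "?\<sigma> = (\<lambda>A. 0)"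
      have "(\<Sum>g\<in>U.free. x g * U.coef (E g) h) = U.coef ?\<sigma> h"
        using fsE by (subst U.coef_sum) (auto simp: U.coef_scale intro!: fs_scale sum.cong)
      also have "\<dots> = 0" unfolding z using U.coef_scale[OF fss, of 0 h] by simp
      finally show ?thesis using h U.finite_free by (simp add: E(2) cong: sum.cong)
    qed
    then show False using x(1) by auto
  qed
qed

end

section \<open>Measures attached to the triangle\<close>

context hex
begin

lemma TT_hull: assumes r: "r > 0" shows "TT r = convex hull {0, r *\<^sub>R dir 0, r *\<^sub>R dir 1}"
proof
  have "cor r 0 = 0" "cor r 2 = r *\<^sub>R dir 0" "cor r 4 = r *\<^sub>R dir 1" "ev 0" "ev 2" "ev 4" by (simp_all add: cor_def ev_def)
  then show "convex hull {0, r *\<^sub>R dir 0, r *\<^sub>R dir 1} \<subseteq> TT r"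
    using cor_TT[OF r, of 0] cor_TT[OF r, of 2] cor_TT[OF r, of 4] by (intro hull_minimal convex_TT) auto
  show "TT r \<subseteq> convex hull {0, r *\<^sub>R dir 0, r *\<^sub>R dir 1}"
  proof
    fix x assume "x \<in> TT r"
    then have h: "off 0 x \<ge> 0" "off 1 x \<le> 0" "off 2 x \<ge> - r" using TT_iff[of 0 x r] by (simp_all add: cor_def ev_def)
    have "off 2 x = off 1 x - off 0 x" by (rule off_num(1))
    then have s: "off 0 x - off 1 x \<le> r" using h(3) by linarith
    have "x = (1 - off 0 x / r - (- off 1 x / r)) *\<^sub>R 0 + (- off 1 x / r) *\<^sub>R (r *\<^sub>R dir 0) + (off 0 x / r) *\<^sub>R (r *\<^sub>R dir 1)"
      using off_rep[of x 0] r by simp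
    moreover have "off 0 x / r \<ge> 0" "- off 1 x / r \<ge> 0" "1 - off 0 x / r - (- off 1 x / r) \<ge> 0"
      using h r s by (simp_all add: field_simps)
    ultimately show "x \<in> convex hull {0, r *\<^sub>R dir 0, r *\<^sub>R dir 1}"
      unfolding convex_hull_3 mem_Collect_eq
      by (intro exI[of _ "1 - off 0 x / r - (- off 1 x / r)"] exI[of _ "- off 1 x / r"] exI[of _ "off 0 x / r"] conjI) (assumption | simp)+
  qed
qed

lemma frontier_TT: "frontier (TT r) = {x \<in> TT r. \<exists>d. ev d \<and> off d x = off d (cor r d)}"
proof -
  have cl: "closed (TT r)"
  proof -
    have "TT r = (\<Inter>d\<in>{d. ev d}. {x. off d (cor r d) \<le> off d x})" by (auto simp: TT_def)
    moreover have "closed {x. off d (cor r d) \<le> off d x}" for d by (intro closed_Collect_le continuous_intros)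
    ultimately show ?thesis by (simp add: closed_INT)
  qed
  have "x \<in> interior (TT r) \<longleftrightarrow> (\<forall>d. ev d \<longrightarrow> off d (cor r d) < off d x)" for x
  proof
    assume "x \<in> interior (TT r)"
    then obtain e where e: "e > 0" "ball x e \<subseteq> TT r" by (auto simp: mem_interior)
    show "\<forall>d. ev d \<longrightarrow> off d (cor r d) < off d x"
    proof (intro allI impI)
      fix d assume d: "ev d"
      have "x + (e / 2) *\<^sub>R dir (d + 4) \<in> ball x e" using e(1) by (simp add: dist_norm del: dir_add)
      then have "off d (x + (e / 2) *\<^sub>R dir (d + 4) - cor r d) \<ge> 0" using e(2) d by (auto simp: TT_def simp del: dir_add off_lin)
      then show "off d (cor r d) < off d x" using e(1) by simp
    qed
  next
    assume h: "\<forall>d. ev d \<longrightarrow> off d (cor r d) < off d x"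
    let ?O = "\<Inter>d\<in>{d. ev d}. {x. off d (cor r d) < off d x}"
    have "open ?O" by (intro open_INT ballI open_Collect_less continuous_intros) auto
    moreover have "?O \<subseteq> TT r" by (auto simp: TT_def less_imp_le)
    ultimately show "x \<in> interior (TT r)" using h by (intro interiorI[of ?O]) auto
  qed
  then show ?thesis unfolding frontier_def closure_closed[OF cl] by (force simp: TT_def not_less intro: order_antisym)
qed

text \<open>A line that is not parallel to the segment meets it at most once, and finitely many
  points do not cover it.\<close>

lemma parallel_ray:
  assumes F: "finite F" and ab: "a < b"
    and c: "\<And>t. a < t \<Longrightarrow> t < b \<Longrightarrow> \<exists>A l t'. (A, l) \<in> F \<and> P + t *\<^sub>R dir k = A + t' *\<^sub>R dir l \<and> Q A l t'"
  shows "\<exists>A l t t'. (A, l) \<in> F \<and> a < t \<and> t < b \<and> P + t *\<^sub>R dir k = A + t' *\<^sub>R dir l \<and> Q A l t' \<and> (l = k \<or> l = k + 3)"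
proof (rule ccontr)
  assume no: "\<not> ?thesis"
  define f where "f = (\<lambda>(A, l). off l (A - P) / off l (dir k))"
  have "{a<..<b} \<subseteq> f ` F"
  proof
    fix t assume t: "t \<in> {a<..<b}"
    then obtain A l t' where A: "(A, l) \<in> F" "P + t *\<^sub>R dir k = A + t' *\<^sub>R dir l" "Q A l t'" using c[of t] by auto
    then have l: "\<not> (l = k \<or> l = k + 3)" using no t by auto
    then have "off l (dir k) \<noteq> 0" using six_rel[of l k] by (elim disjE) simp_all
    moreover have "t * off l (dir k) = off l (A - P)" using arg_cong[OF A(2), of "off l"] by simp
    ultimately have "t = f (A, l)" by (simp add: f_def field_simps)
    then show "t \<in> f ` F" using A(1) by blast
  qed
  then have "finite {a<..<b}" using F by (meson finite_imageI finite_subset)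
  then show False using infinite_Ioo[OF ab] by blast
qed

end

context hext
begin

lemma branch_s_TT: assumes "branch s B" shows "B \<in> TT r"
proof -
  have "pr s B k \<Longrightarrow> pr u B k" for k using D_s_le_u[of B k] D_nonneg[of B k] by (auto simp: pr_def)
  then show ?thesis using assms branch_TT by (auto simp: branch_def)
qed

text \<open>The point at which the ray from \<open>P\<close> in the even direction \<open>dir k\<close> leaves the triangle.\<close>

definition xp :: "6 \<Rightarrow> real^2 \<Rightarrow> real^2" where "xp k P = P + off (k + 2) (P - cor r (k + 2)) *\<^sub>R dir k"

lemma xp: assumes k: "ev k" and P: "P \<in> TT r" shows "xp k P \<in> TT r" "on (k + 2) (xp k P)" "off k (xp k P) = off k P"
proof -
  let ?T = "off (k + 2) (P - cor r (k + 2))"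
  have T: "?T \<ge> 0" using P k by (simp add: TT_def del: off_lin off_add)
  show o: "on (k + 2) (xp k P)" "off k (xp k P) = off k P" by (simp_all add: xp_def)
  show "xp k P \<in> TT r" unfolding TT_def
  proof (intro CollectI allI impI)
    fix e assume e: "ev e"
    show "0 \<le> off e (xp k P - cor r e)"
    proof (cases "e = k + 2")
      case True then show ?thesis using o by simp
    next
      case False
      then have "k \<noteq> e + 4" "k \<noteq> e + 5" using e k by auto
      then have "off e (dir k) \<ge> 0" using off_dir_sign(2)[of e k] by (simp add: not_less)
      then have "?T * off e (dir k) \<ge> 0" using T by (simp del: off_lin off_add)
      moreover have "off e (P - cor r e) \<ge> 0" using P e by (simp add: TT_def del: off_lin)
      ultimately show ?thesis unfolding xp_def by (simp del: off_add)
    qed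
  qed
qed

lemma xp_unique: assumes "on (k + 2) A" "off k A = off k P" shows "xp k P = A"
  by (rule off_eqI[of k]) (use assms in \<open>simp_all add: xp_def\<close>)

lemma exit_D: assumes k: "ev k" and A: "A \<in> TT r" "on (k + 2) A" and t: "t \<ge> 0"
  shows "D s (A + t *\<^sub>R dir k) k = LS s k (off k A)"
proof -
  have "D s (A + t *\<^sub>R dir k) k = LS s k (off k (A + t *\<^sub>R dir k))"
  proof (rule D_far_eq[OF fss k])
    fix P assume P: "s P \<noteq> 0" "off k P = off k (A + t *\<^sub>R dir k)"
    have "off (k + 2) P \<ge> off (k + 2) (cor r (k + 2))" using side_min[of "k + 2" P] k P(1) by simp
    then show "off (k + 1) (A + t *\<^sub>R dir k - P) \<le> 0" using A(2) P(2) t by simp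
  qed
  then show ?thesis by simp
qed

lemma exit_outside: assumes "ev k" "A \<in> TT r" "on (k + 2) A" "t > 0" shows "A + t *\<^sub>R dir k \<notin> TT r"
proof
  assume "A + t *\<^sub>R dir k \<in> TT r"
  then have "off (k + 2) (A + t *\<^sub>R dir k - cor r (k + 2)) \<ge> 0" using assms(1) by (simp add: TT_def del: off_lin off_add)
  then show False using assms(3,4) by simp
qed

lemma outside_ray: assumes x: "x \<notin> TT r" "pr s x k"
  obtains A l t where "ev l" "A \<in> TT r" "on (l + 2) A" "pr s A l" "t > 0" "x = A + t *\<^sub>R dir l"
proof -
  note res = that
  have even: thesis if l: "ev l" "pr s x l" for l
  proof -
    have "\<exists>t\<ge>0. s (x - t *\<^sub>R dir l) \<noteq> 0"
    proof (rule ccontr)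
      assume "\<not> ?thesis"
      then have "D s x l = 0" by (intro D_even_behind[OF l(1)]) blast
      then show False using l(2) by (simp add: pr_def)
    qed
    then obtain t where t: "t \<ge> 0" "s (x - t *\<^sub>R dir l) \<noteq> 0" by blast
    let ?P = "x - t *\<^sub>R dir l"
    have P: "?P \<in> TT r" by (rule suppTT[OF t(2)])
    let ?A = "xp l ?P"
    note A = xp[OF l(1) P]
    let ?t = "- off (l + 1) (x - ?A)"
    have xA: "x = ?A + ?t *\<^sub>R dir l" using on_lineD[of l "x - ?A"] A(3) by (simp add: algebra_simps)
    have "?t > 0"
    proof (rule ccontr)
      assume n: "\<not> ?t > 0"
      have "x \<in> TT r" unfolding TT_def
      proof (intro CollectI allI impI)
        fix e assume e: "ev e"
        have P0: "off e (?P - cor r e) \<ge> 0" and A0: "off e (?A - cor r e) \<ge> 0" using P A(1) e by (simp_all add: TT_def del: off_lin)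
        show "off e (x - cor r e) \<ge> 0"
        proof (cases "off e (dir l) \<ge> 0")
          case True
          then have "t * off e (dir l) \<ge> 0" using t(1) by simp
          then show ?thesis using P0 by simp
        next
          case False
          then have "?t * off e (dir l) \<ge> 0" using n by (intro mult_nonpos_nonpos) auto
          moreover have "off e x = off e ?A + ?t * off e (dir l)" using arg_cong[OF xA, of "off e"] by (simp only: off_lin)
          ultimately show ?thesis using A0 by (simp del: off_add)
        qed
      qed
      then show False using x(1) by simp
    qed
    moreover have "pr s ?A l" using exit_D[OF l(1) A(1,2), of 0] exit_D[OF l(1) A(1,2), of ?t] xA \<open>?t > 0\<close> l(2) by (simp add: pr_def)
    ultimately show ?thesis using res[OF l(1) A(1,2) _ _ xA] by blast
  qed
  show ?thesis
  proof (cases "ev k")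
    case False
    have "s x = 0" using x(1) suppTT by blast
    then have "pr s x (k + 3)" using jump[of x k] x(2) by (simp add: pr_def)
    then show ?thesis using even[of "k + 3"] False by simp
  qed (use even x(2) in blast)
qed

definition XS :: "((real^2) \<times> 6) set" where "XS = {(A, k). ev k \<and> A \<in> TT r \<and> on (k + 2) A \<and> pr s A k}"

lemma XS_sub: "(A, k) \<in> XS \<Longrightarrow> A \<in> xp k ` {P. s P \<noteq> 0}"
proof -
  assume "(A, k) \<in> XS"
  then have h: "ev k" "on (k + 2) A" "D s A k \<noteq> 0" by (auto simp: XS_def pr_def)
  obtain P where "s P \<noteq> 0" "off k P = off k A" using D_nz_line[OF h(3)] by blast
  then show "A \<in> xp k ` {P. s P \<noteq> 0}" using xp_unique[OF h(2), of P] by force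
qed

lemma finite_XS: "finite XS"
proof (rule finite_subset)
  show "XS \<subseteq> (\<Union>k. xp k ` {P. s P \<noteq> 0}) \<times> UNIV" using XS_sub by fast
  show "finite ((\<Union>k. xp k ` {P. s P \<noteq> 0}) \<times> (UNIV :: 6 set))" using fss by (auto simp: fs_def)
qed

text \<open>In each even direction every weight leaves the triangle exactly once, at its point
  \<open>xp k\<close>.\<close>

lemma XS_sum: assumes k: "ev k" shows "(\<Sum>A | (A, k) \<in> XS. D s A k) = wt"
proof -
  let ?S = "{P. s P \<noteq> 0}"
  have fS: "finite ?S" using fss by (simp add: fs_def)
  have "(\<Sum>A | (A, k) \<in> XS. D s A k) = (\<Sum>A\<in>xp k ` ?S. D s A k)"
  proof (rule sum.mono_neutral_left)
    show "{A. (A, k) \<in> XS} \<subseteq> xp k ` ?S" using XS_sub by blast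
    show "\<forall>A\<in>xp k ` ?S - {A. (A, k) \<in> XS}. D s A k = 0" 
      using xp[OF k suppTT] k by (auto simp: XS_def not_pr[symmetric] simp del: off_add)
  qed (use fS in simp)
  also have "\<dots> = (\<Sum>A\<in>xp k ` ?S. \<Sum>P | P \<in> ?S \<and> xp k P = A. s P)"
  proof (rule sum.cong[OF refl])
    fix A assume "A \<in> xp k ` ?S"
    then have A: "A \<in> TT r" "on (k + 2) A" using xp[OF k suppTT] by auto
    have "D s A k = LS s k (off k A)" using exit_D[OF k A, of 0] by simp
    also have "\<dots> = (\<Sum>P | P \<in> ?S \<and> xp k P = A. s P)" unfolding LS_def
    proof (rule sum.cong)
      show "{P. s P \<noteq> 0 \<and> off k P = off k A} = {P. P \<in> ?S \<and> xp k P = A}" 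
      proof (intro Collect_cong iffI; elim conjE; intro conjI)
        fix P assume P: "s P \<noteq> 0" "off k P = off k A"
        show "P \<in> ?S" using P(1) by simp
        show "xp k P = A" by (rule xp_unique[OF A(2)]) (rule P(2)[symmetric])
      next
        fix P assume P: "P \<in> ?S" "xp k P = A"
        show "s P \<noteq> 0" using P(1) by simp
        show "off k P = off k A" using xp(3)[OF k suppTT, of P] P by simp
      qed
    qed simp
    finally show "D s A k = (\<Sum>P | P \<in> ?S \<and> xp k P = A. s P)" .
  qed
  also have "\<dots> = wt" unfolding wt_def by (rule sum.group) (use fS in auto)
  finally show ?thesis .
qed

end

text \<open>\<open>e\<close> gives the exit directions, always at even indices. The case
  \<open>w = e\<close> serves the measure, the other case its dual.\<close>

locale tri_dirs = hex +
  fixes w e :: "3 \<Rightarrow> real^2" and ix :: "3 \<Rightarrow> 6"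
  assumes ix: "bij_betw ix UNIV {k. ev k}" and e: "e j = dir (ix j)" and we: "w = e \<or> w = (\<lambda>j. - e j)"
    and tri_TT: "r > 0 \<Longrightarrow> Defs.tri w r = TT r"
begin

lemma ev_ix [simp]: "ev (ix j)" using ix by (auto simp: bij_betw_def)

lemma ix_ex: "ev k \<Longrightarrow> \<exists>j. ix j = k"
  using ix unfolding bij_betw_def by (metis imageE mem_Collect_eq)

lemma w_cases: "w j = dir (ix j) \<or> w j = - dir (ix j)" using we e by auto

lemma dir_w: "\<exists>j. dir k = w j \<or> dir k = - w j"
proof (cases "ev k")
  case True
  then obtain j where "ix j = k" using ix_ex by blast
  then show ?thesis using w_cases[of j] by (intro exI[of _ j]) auto
next
  case False
  then obtain j where "ix j = k + 3" using ix_ex[of "k + 3"] by auto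
  then show ?thesis using w_cases[of j] by (intro exI[of _ j]) auto
qed

lemma w_dir: "\<exists>k. w j = dir k \<and> - w j = dir (k + 3)"
  using w_cases[of j]
proof
  assume "w j = - dir (ix j)" then show ?thesis by (intro exI[of _ "ix j + 3"]) simp
qed (auto intro: exI[of _ "ix j"])

lemma range_dir: "range w \<union> range (\<lambda>j. - w j) = range dir"
proof (rule equalityI; rule subsetI)
  fix v assume "v \<in> range w \<union> range (\<lambda>j. - w j)"
  then obtain j where "v = w j \<or> v = - w j" by blast
  then show "v \<in> range dir" using w_dir[of j] by (metis rangeI)
next
  fix v assume "v \<in> range dir"
  then obtain k where "v = dir k" by blast
  then show "v \<in> range w \<union> range (\<lambda>j. - w j)" using dir_w[of k] by (metis (mono_tags, lifting) UnI1 UnI2 rangeI)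
qed

lemma cone_M_eq: "cone_M w = coneD"
proof (rule set_eqI)
  fix \<mu> :: "(real^2) measure"
  have lines: "(\<exists>L. finite L \<and> supp \<mu> \<subseteq> (\<Union>(P, j)\<in>L. {P + t *\<^sub>R w j | t. True})) \<longleftrightarrow>
    (\<exists>L. finite L \<and> supp \<mu> \<subseteq> (\<Union>(P, k)\<in>L. {P + t *\<^sub>R dir k | t. True}))"
  proof -
    obtain kx where kx: "\<And>j. w j = dir (kx j)" using w_dir by metis
    obtain jx where jx: "\<And>k. dir k = w (jx k) \<or> dir k = - w (jx k)" using dir_w by metis
    have l: "{P + t *\<^sub>R dir k | t. True} = {P + t *\<^sub>R w (jx k) | t. True}" for P k
      using jx[of k] by (auto intro: exI[of _ "- _"])
    show ?thesis
    proof
      assume "\<exists>L. finite L \<and> supp \<mu> \<subseteq> (\<Union>(P, j)\<in>L. {P + t *\<^sub>R w j | t. True})"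
      then obtain L' where "finite L'" "supp \<mu> \<subseteq> (\<Union>(P, j)\<in>L'. {P + t *\<^sub>R w j | t. True})" by blast
      then show "\<exists>L. finite L \<and> supp \<mu> \<subseteq> (\<Union>(P, k)\<in>L. {P + t *\<^sub>R dir k | t. True})"
        by (intro exI[of _ "(\<lambda>(P, j). (P, kx j)) ` L'"]) (auto simp: kx split_beta)
    next
      assume "\<exists>L. finite L \<and> supp \<mu> \<subseteq> (\<Union>(P, k)\<in>L. {P + t *\<^sub>R dir k | t. True})"
      then obtain L' where "finite L'" "supp \<mu> \<subseteq> (\<Union>(P, k)\<in>L'. {P + t *\<^sub>R dir k | t. True})" by blast
      then show "\<exists>L. finite L \<and> supp \<mu> \<subseteq> (\<Union>(P, j)\<in>L. {P + t *\<^sub>R w j | t. True})"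
        unfolding l by (intro exI[of _ "(\<lambda>(P, k). (P, jx k)) ` L'"]) (auto simp: split_beta)
    qed
  qed
  have hd: "(\<forall>A j. (\<exists>c. has_density \<mu> A (w j) c) \<and> (\<exists>c. has_density \<mu> A (- w j) c)) \<longleftrightarrow> (\<forall>A k. \<exists>c. has_density \<mu> A (dir k) c)"
    using dir_w w_dir by metis
  have bal: "(\<forall>A j k. dens \<mu> A (w j) - dens \<mu> A (- w j) = dens \<mu> A (w k) - dens \<mu> A (- w k)) \<longleftrightarrow>
    (\<forall>A k. dens \<mu> A (dir (k + 2)) - dens \<mu> A (dir (k + 5)) = dens \<mu> A (dir k) - dens \<mu> A (dir (k + 3)))"
  proof -
    define \<delta> where "\<delta> A k = dens \<mu> A (dir k) - dens \<mu> A (dir (k + 3))" for A k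
    have d3: "\<delta> A (k + 3) = - \<delta> A k" for A k by (simp add: \<delta>_def)
    have L1: "(\<forall>A j k. dens \<mu> A (w j) - dens \<mu> A (- w j) = dens \<mu> A (w k) - dens \<mu> A (- w k)) \<longleftrightarrow> (\<forall>A j k. \<delta> A (ix j) = \<delta> A (ix k))"
      using we by (elim disjE) (auto simp: \<delta>_def e algebra_simps)
    have "(\<forall>A k. \<delta> A (k + 2) = \<delta> A k) \<longleftrightarrow> (\<forall>A j k. \<delta> A (ix j) = \<delta> A (ix k))"
    proof
      assume h: "\<forall>A k. \<delta> A (k + 2) = \<delta> A k"
      have "\<delta> A k = \<delta> A 0" if "ev k" for A k
        using that h[THEN spec, THEN spec, of A 0] h[THEN spec, THEN spec, of A 2] by (auto simp: ev_def)
      then show "\<forall>A j k. \<delta> A (ix j) = \<delta> A (ix k)" using ev_ix by metis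
    next
      assume h: "\<forall>A j k. \<delta> A (ix j) = \<delta> A (ix k)"
      have even: "\<delta> A (k + 2) = \<delta> A k" if "ev k" for A k using h ix_ex[OF that] ix_ex[of "k + 2"] that by (metis ev_add(2))
      have "\<delta> A (k + 2) = \<delta> A k" if "\<not> ev k" for A k using even[of "k + 3" A] d3[of A k] d3[of A "k + 2"] that by simp
      then show "\<forall>A k. \<delta> A (k + 2) = \<delta> A k" using even by blast
    qed
    then show ?thesis unfolding L1 by (simp add: \<delta>_def)
  qed
  show "\<mu> \<in> cone_M w \<longleftrightarrow> \<mu> \<in> coneD" unfolding cone_M_def coneD_def mem_Collect_eq lines hd bal ..
qed

lemma inj_dir: "inj dir"
proof (rule injI)
  fix k l :: 6 assume "dir k = dir l"
  then have "off l (dir k) = 0" "off (l + 1) (dir k) = - 1" by simp_all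
  then show "k = l" using six_rel[of k l] by (elim disjE) auto
qed

lemma branch_points_iff: "A \<in> branch_points w \<mu> \<longleftrightarrow> card {k. dens \<mu> A (dir k) \<noteq> 0} \<ge> 3"
proof -
  have "{v \<in> range w \<union> range (\<lambda>j. - w j). dens \<mu> A v \<noteq> 0} = dir ` {k. dens \<mu> A (dir k) \<noteq> 0}" unfolding range_dir by auto
  moreover have "card \<dots> = card {k. dens \<mu> A (dir k) \<noteq> 0}" by (rule card_image) (rule inj_on_subset[OF inj_dir], simp)
  ultimately show ?thesis by (simp add: branch_points_def)
qed

text \<open>By \<open>branch_gap\<close> each of the pairs 0 and 1, 2 and 3, 4 and 5 contains a ray,
  so two non-parallel rays entail three.\<close>

lemma branch_points_MM: assumes "fs s" "pos s" shows "branch_points w (MM s) = {x. branch s x}"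
proof -
  interpret hexs dir s by unfold_locales (rule assms)+
  have "card {k. pr s x k} \<ge> 3 \<longleftrightarrow> branch s x" for x
  proof
    assume b: "branch s x"
    define f where "f k = (if pr s x k then k else k + 1)" for k
    have f: "\<And>k. pr s x (f k)" "\<And>k. f k = k \<or> f k = k + 1" using branch_gap[OF b] by (auto simp: f_def)
    have "card {f 0, f 2, f 4} \<le> card {k. pr s x k}" by (rule card_mono) (use f in auto)
    moreover have "card {f 0, f 2, f 4} = 3" using f(2)[of 0] f(2)[of 2] f(2)[of 4] by (elim disjE) simp_all
    ultimately show "card {k. pr s x k} \<ge> 3" by simp
  next
    assume c: "card {k. pr s x k} \<ge> 3"
    then obtain a where a: "pr s x a" by (metis Collect_empty_eq card.empty not_numeral_le_zero)
    have "\<not> {k. pr s x k} \<subseteq> {a, a + 3}"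
    proof
      assume "{k. pr s x k} \<subseteq> {a, a + 3}"
      then have "card {k. pr s x k} \<le> card {a, a + 3}" by (rule card_mono[rotated]) simp
      then show False using c card_insert_le_m1[of 2 "{a + 3}" a] by simp
    qed
    then show "branch s x" using a by (auto simp: branch_def)
  qed
  moreover have "dens (MM s) x (dir k) \<noteq> 0 \<longleftrightarrow> pr s x k" for x k using not_pr[of x k] by (auto simp: dens_MM[OF assms])
  ultimately show ?thesis by (simp add: set_eq_iff branch_points_iff)
qed

text \<open>To apply \<open>coneD_rep\<close>, suppose that the density survives far out in an odd
  direction. The exit half-lines would cover a segment there, one of them would be parallel to it by
  \<open>parallel_ray\<close>, and its starting point would lie still further ahead, outside the
  triangle.\<close>

lemma cone_tri_rep: assumes r: "r > 0" and mu: "\<mu> \<in> cone_tri w e r"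
  obtains s where "fs s" "pos s" "\<And>A. s A \<noteq> 0 \<Longrightarrow> A \<in> TT r" "\<mu> = MM s"
proof -
  have D: "\<mu> \<in> coneD" and bp: "branch_points w \<mu> \<subseteq> TT r" using mu by (auto simp: cone_tri_def cone_M_eq tri_TT[OF r])
  obtain F where F: "finite F" "F \<subseteq> frontier (TT r) \<times> UNIV" "supp \<mu> - TT r = (\<Union>(A, j)\<in>F. halfline A (e j))"
    using mu by (auto simp: cone_tri_def tri_TT[OF r])
  have sm: "sets \<mu> = sets borel" using D by (simp add: coneD_def)
  have far: "\<forall>\<^sub>F t in at_top. dens \<mu> (x + t *\<^sub>R dir k) (dir k) = 0" if k: "\<not> ev k" for x k
  proof -
    let ?T = "off (k + 1) (x - cor r (k + 1))"
    have out: "x + t *\<^sub>R dir k \<notin> TT r" if "t > ?T" for t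
    proof
      assume "x + t *\<^sub>R dir k \<in> TT r"
      then have "off (k + 1) (x + t *\<^sub>R dir k - cor r (k + 1)) \<ge> 0" using k by (simp add: TT_def del: off_lin)
      then show False using that by simp
    qed
    have "dens \<mu> (x + t *\<^sub>R dir k) (dir k) = 0" if t: "t > ?T" for t
    proof (rule ccontr)
      assume nz: "dens \<mu> (x + t *\<^sub>R dir k) (dir k) \<noteq> 0"
      let ?y = "x + t *\<^sub>R dir k"
      obtain \<epsilon> where \<epsilon>: "\<epsilon> > 0" "\<And>\<tau>. 0 < \<tau> \<Longrightarrow> \<tau> < \<epsilon> \<Longrightarrow> dens \<mu> (?y + \<tau> *\<^sub>R dir k) (dir k) = dens \<mu> ?y (dir k)"
        using dens_near[OF D, of ?y k] by blast
      have "\<exists>A l t'. (A, l) \<in> (\<lambda>(A, j). (A, ix j)) ` F \<and> ?y + \<tau> *\<^sub>R dir k = A + t' *\<^sub>R dir l \<and> t' > 0" if \<tau>: "0 < \<tau>" "\<tau> < \<epsilon>" for \<tau>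
      proof -
        let ?z = "?y + \<tau> *\<^sub>R dir k"
        have hd: "has_density \<mu> ?z (dir k) (dens \<mu> ?z (dir k))" by (rule coneD_dens[OF D])
        then have "dens \<mu> ?z (dir k) \<ge> 0" by (simp add: has_density_def)
        then have "dens \<mu> ?z (dir k) > 0" using \<epsilon>(2)[OF \<tau>] nz by simp
        then have "?z \<in> supp \<mu>" using density_supp[OF sm norm_dir hd] by blast
        moreover have "?z \<notin> TT r" using out[of "t + \<tau>"] t \<tau> by (simp add: scaleR_left_distrib add.assoc)
        ultimately have "?z \<in> (\<Union>(A, j)\<in>F. halfline A (e j))" using F(3) by blast
        then obtain A j t' where "(A, j) \<in> F" "t' > 0" "?z = A + t' *\<^sub>R e j" by (auto simp: halfline_def)
        then show ?thesis unfolding e by force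
      qed
      from parallel_ray[OF _ \<epsilon>(1), of "(\<lambda>(A, j). (A, ix j)) ` F" ?y k "\<lambda>_ _ t'. t' > 0", OF _ this] F(1)
      obtain A j \<tau> t' where A: "(A, j) \<in> F" "0 < \<tau>" "?y + \<tau> *\<^sub>R dir k = A + t' *\<^sub>R dir (ix j)" "t' > 0" "ix j = k \<or> ix j = k + 3"
        by auto
      have ixj: "ix j = k + 3" using A(5) ev_ix[of j] k by auto
      have "A = x + (t + \<tau> + t') *\<^sub>R dir k" using A(3) unfolding ixj by (simp add: algebra_simps)
      moreover have "A \<in> TT r" using A(1) F(2) by (auto simp: frontier_TT)
      ultimately show False using out[of "t + \<tau> + t'"] t A(2,4) by simp
    qed
    then show ?thesis using eventually_gt_at_top[of ?T] by (rule eventually_mono[rotated]) blast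
  qed
  obtain s where s: "fs s" "pos s" "\<mu> = MM s" using coneD_rep[OF D far] by blast
  interpret hexs dir s by unfold_locales (rule s)+
  have "A \<in> TT r" if "s A \<noteq> 0" for A using nz_branch[OF that] bp branch_points_MM[OF s(1,2)] s(3) by auto
  then show ?thesis using that s by blast
qed

end

locale tri_meas = tri_dirs dir w e ix + hext dir s r for dir w e ix s r
begin

lemma MM_cone_tri: "MM s \<in> cone_tri w e r" and exits_MM: "exits w e r (MM s) = {(A, j). (A, ix j) \<in> XS}"
proof -
  have sp: "supp (MM s) = {x. \<exists>k. pr s x k}" by (rule supp_MM[OF fss poss])
  have half: "halfline A (e j) \<subseteq> supp (MM s) - TT r" if "(A, ix j) \<in> XS" for A j
  proof
    fix x assume "x \<in> halfline A (e j)"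
    then obtain t where t: "t > 0" "x = A + t *\<^sub>R dir (ix j)" by (auto simp: halfline_def e)
    have A: "A \<in> TT r" "on (ix j + 2) A" "pr s A (ix j)" using that by (auto simp: XS_def)
    have "pr s x (ix j)" using exit_D[OF ev_ix A(1,2), of 0] exit_D[OF ev_ix A(1,2), of t] A(3) t by (simp add: pr_def)
    then show "x \<in> supp (MM s) - TT r" using exit_outside[OF ev_ix A(1,2) t(1)] t(2) sp by blast
  qed
  have XSj: "\<exists>j. ix j = l" if "(A, l) \<in> XS" for A l using ix_ex that by (auto simp: XS_def)
  have cover: "supp (MM s) - TT r = (\<Union>(A, j)\<in>{(A, j). (A, ix j) \<in> XS}. halfline A (e j))"
  proof (rule set_eqI, rule iffI)
    fix x assume "x \<in> supp (MM s) - TT r"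
    then obtain k where "x \<notin> TT r" "pr s x k" using sp by blast
    then obtain A l t where A: "ev l" "A \<in> TT r" "on (l + 2) A" "pr s A l" "t > 0" "x = A + t *\<^sub>R dir l" by (rule outside_ray)
    then have "(A, l) \<in> XS" by (simp add: XS_def del: off_add)
    moreover from this obtain j where "ix j = l" using XSj by blast
    ultimately show "x \<in> (\<Union>(A, j)\<in>{(A, j). (A, ix j) \<in> XS}. halfline A (e j))" using A by (auto simp: halfline_def e)
  qed (use half in blast)
  have fin: "finite {(A, j). (A, ix j) \<in> XS}"
  proof (rule finite_subset)
    show "{(A, j). (A, ix j) \<in> XS} \<subseteq> fst ` XS \<times> UNIV" by force
  qed (use finite_XS in simp)
  have fr: "A \<in> frontier (TT r)" if "(A, ix j) \<in> XS" for A j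
    using that ev_add(2)[of "ix j"] unfolding frontier_TT XS_def by blast
  show "MM s \<in> cone_tri w e r" unfolding cone_tri_def cone_M_eq tri_TT[OF r]
    using MM_coneD[OF fss poss] branch_s_TT branch_points_MM[OF fss poss] fin fr cover by (auto intro!: exI[of _ "{(A, j). (A, ix j) \<in> XS}"])
  show "exits w e r (MM s) = {(A, j). (A, ix j) \<in> XS}"
  proof -
    have "(A, ix j) \<in> XS" if fA: "A \<in> frontier (TT r)" and h: "halfline A (e j) \<subseteq> supp (MM s) - TT r" for A j
    proof -
      have A: "A \<in> TT r" using fA by (simp add: frontier_TT)
      let ?k = "ix j"
      have out: "A + t *\<^sub>R dir ?k \<notin> TT r" if "t > 0" for t using h that by (auto simp: halfline_def e)
      have o: "on (?k + 2) A"
      proof (rule ccontr)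
        assume n: "\<not> on (?k + 2) A"
        let ?t = "off (?k + 2) (A - cor r (?k + 2))"
        have "?t \<ge> 0" using A by (simp add: TT_def del: off_lin off_add)
        then have "?t > 0" using n by (simp add: order_le_less)
        then show False using out[of ?t] xp(1)[OF ev_ix A, of j] by (simp add: xp_def)
      qed
      have "\<exists>B l t'. (B, l) \<in> XS \<and> A + t *\<^sub>R dir ?k = B + t' *\<^sub>R dir l \<and> True" if "0 < t" "t < 1" for t
      proof -
        have "A + t *\<^sub>R dir ?k \<in> supp (MM s) - TT r" using h that(1) by (auto simp: halfline_def e)
        then obtain B i t' where "(B, ix i) \<in> XS" "A + t *\<^sub>R dir ?k = B + t' *\<^sub>R e i" unfolding cover by (auto simp: halfline_def)
        then show ?thesis unfolding e by blast
      qed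
      from parallel_ray[OF finite_XS zero_less_one this] obtain B l t t' where
        B: "(B, l) \<in> XS" "A + t *\<^sub>R dir ?k = B + t' *\<^sub>R dir l" "l = ?k \<or> l = ?k + 3" by auto
      have l: "l = ?k" using B(1,3) ev_ix[of j] by (auto simp: XS_def)
      have "off ?k A = off ?k B" using arg_cong[OF B(2), of "off ?k"] unfolding l by simp
      then have "A = B" using xp_unique[OF o, of B] xp_unique[of ?k B B] B(1) unfolding l by (simp add: XS_def)
      then show ?thesis using B(1) l by simp
    qed
    then show ?thesis unfolding exits_def tri_TT[OF r] using half fr by blast
  qed
qed

lemma dens_e: "dens (MM s) A (e j) = D s A (ix j)"
  unfolding e by (rule dens_MM[OF fss poss])

lemma weight_MM: "weight w e r (MM s) = wt"
proof -
  have "(\<Sum>A | (A, j) \<in> exits w e r (MM s). dens (MM s) A (e j)) = wt" for j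
    unfolding exits_MM dens_e using XS_sum[OF ev_ix[of j]] by simp
  then show ?thesis unfolding weight_def by (intro the_equality) auto
qed

text \<open>\<open>supp_TT_LS\<close> puts a competitor with equal line sums into the triangle; then
  it has the same exits and exit densities, since these are line sums.\<close>

lemma rigid_rig: assumes "rigid w e r (MM s)" shows "rig s"
  unfolding rig_LS
proof (intro conjI allI impI fss poss, elim conjE)
  fix s' assume s': "fs s'" "pos s'" and ls: "\<forall>k c. ev k \<longrightarrow> LS s' k c = LS s k c"
  have TT': "s' A \<noteq> 0 \<Longrightarrow> A \<in> TT r" for A using supp_TT_LS[OF fss poss suppTT s'] ls by blast
  interpret s': tri_meas dir w e ix s' r by unfold_locales (use s' r TT' in auto)
  have X: "D s' A k = D s A k" if "ev k" "A \<in> TT r" "on (k + 2) A" for A k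
    using exit_D[OF that, of 0] s'.exit_D[OF that, of 0] ls that(1) by simp
  then have "XS = s'.XS" by (auto simp: XS_def s'.XS_def pr_def simp del: off_add)
  then have ex: "exits w e r (MM s') = exits w e r (MM s)" unfolding exits_MM s'.exits_MM by simp
  have "\<forall>(A, j)\<in>exits w e r (MM s). dens (MM s') A (e j) = dens (MM s) A (e j)"
    unfolding exits_MM dens_e s'.dens_e using X by (auto simp: XS_def)
  then have "MM s' = MM s" using assms s'.MM_cone_tri ex unfolding rigid_def by blast
  then show "s' = s" using MM_inj s' fss poss by blast
qed

end

section \<open>Attachment points, edges and pieces\<close>

context hexs
begin

lemma tau_free: assumes "\<And>k. \<not> pr s x k" shows "tau s x j = tau s x 0"
proof -
  have "tau s x (k + 1) = tau s x k" for k using tau_jump[of s x k] assms[of "k + 1"] by (simp add: not_pr)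
  from this[of 0] this[of 1] this[of 2] this[of 3] this[of 4] show ?thesis using six_cases[of j] by (elim disjE) simp_all
qed

lemma tau_free_iff: "(\<forall>k. \<not> pr s x k) \<longleftrightarrow> (\<forall>j. tau s x j = tau s x 0)"
proof
  assume h: "\<forall>j. tau s x j = tau s x 0"
  show "\<forall>k. \<not> pr s x k"
  proof
    fix k
    have "D s x k *\<^sub>R dir (k + 2) = 0" using tau_step[of s x k] spec[OF h, of k] spec[OF h, of "k + 5"] by simp
    then show "\<not> pr s x k" unfolding not_pr by (simp del: dir_add)
  qed
qed (use tau_free in blast)

text \<open>A nonempty set of this kind will be a component of the complement of the support, which
  makes the displacement a function of the piece.\<close>

definition lev :: "real^2 \<Rightarrow> (real^2) set" where "lev q = {x. (\<forall>k. \<not> pr s x k) \<and> tau s x 0 = q}"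

lemma tau_segment: assumes free: "\<And>y k. y \<in> closed_segment x z \<Longrightarrow> \<not> pr s y k" shows "tau s z 0 = tau s x 0"
proof (cases "z = x")
  case False
  let ?v = "z - x"
  define f where "f t = tau s (x + t *\<^sub>R ?v) 0" for t
  have fr: "\<not> pr s (x + t *\<^sub>R ?v) k" if "t \<in> {0..1}" for t k
    by (rule free) (use that in \<open>auto simp: in_segment algebra_simps intro!: exI[of _ t]\<close>)
  have step: "\<forall>\<^sub>F \<epsilon> in at_right 0. tau s (x + t *\<^sub>R ?v + \<epsilon> *\<^sub>R v) 0 = f t" if t: "t \<in> {0..1}" and v: "v \<noteq> 0" for t v
  proof -
    obtain m a b where m: "v = a *\<^sub>R dir m + b *\<^sub>R dir (m + 1)" "a > 0" "b \<ge> 0" by (rule sector_cases[OF v])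
    show ?thesis using tau_near[OF fss m, of "x + t *\<^sub>R ?v"]
    proof eventually_elim
      case (elim \<epsilon>)
      then show ?case using tau_free[OF fr[OF t]] unfolding f_def by metis
    qed
  qed
  have "f 0 = f 1"
  proof (rule connected_local_const[of "{0..1::real}"])
    show "\<forall>t\<in>{0..1}. \<forall>\<^sub>F t' in at t within {0..1}. f t = f t'"
    proof
      fix t :: real assume t: "t \<in> {0..1}"
      have "\<forall>\<^sub>F t' in at_right t. f t = f t'" unfolding eventually_at_right_to_0[of _ t]
        using step[OF t, of ?v] False by (auto elim!: eventually_mono simp: f_def algebra_simps)
      moreover have "\<forall>\<^sub>F t' in at_left t. f t = f t'" unfolding eventually_at_left_to_right eventually_at_right_to_0[of _ "- t"]
        using step[OF t, of "- ?v"] False by (auto elim!: eventually_mono simp: f_def algebra_simps)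
      ultimately have "\<forall>\<^sub>F t' in at t. f t = f t'" by (simp add: eventually_at_split)
      then show "\<forall>\<^sub>F t' in at t within {0..1}. f t = f t'" by (rule filter_leD[OF at_le, rotated]) simp
    qed
  qed auto
  then show ?thesis by (simp add: f_def)
qed simp

text \<open>By monotonicity the displacement is constant along a segment joining two points with equal
  displacements, so the segment crosses no ray of the support.\<close>

lemma lev_segment: assumes x: "x \<in> lev q" and z: "z \<in> lev q" and y: "y \<in> closed_segment x z" shows "\<not> pr s y k"
proof
  assume pk: "pr s y k"
  obtain t where t: "y = x + t *\<^sub>R (z - x)" "0 \<le> t" "t \<le> 1" using y by (auto simp: in_segment algebra_simps)
  have "t \<noteq> 0" "t \<noteq> 1" using t pk x z by (auto simp: lev_def)
  then have t01: "0 < t" "t < 1" using t by auto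
  let ?v = "z - x"
  have tx: "tau s x j = q" and tz: "tau s z j = q" for j using tau_free x z by (auto simp: lev_def)
  have key: "off l ?v = 0" if l: "pr s p l" and p: "p = x + c *\<^sub>R ?v" and c: "0 < c" "c < 1" for p l c
  proof -
    have "bil (p - x) (tau s p j - tau s x j) \<ge> 0" "bil (z - p) (tau s z j - tau s p j) \<ge> 0" for j by (rule tau_mono)+
    moreover have "p - x = c *\<^sub>R ?v" "z - p = (1 - c) *\<^sub>R ?v" using p by (auto simp: algebra_simps)
    ultimately have "c * bil ?v (tau s p j - q) \<ge> 0" "(1 - c) * bil ?v (q - tau s p j) \<ge> 0" for j by (metis bil_lin(6) tx tz)+
    then have e: "bil ?v (tau s p j) = bil ?v q" for j using c by (simp add: zero_le_mult_iff del: bil_lin(5)) (meson order_antisym)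
    have "D s p l *\<^sub>R dir (l + 2) = tau s p l - tau s p (l + 5)" using tau_step[of s p l] by simp
    then have "bil ?v (D s p l *\<^sub>R dir (l + 2)) = 0" using e by (simp del: bil_lin(5) dir_add)
    then have "D s p l * off l ?v = 0" by (simp only: bil_lin(3) bil_dir)
    then show ?thesis using l by (simp add: pr_def)
  qed
  have kv: "off k ?v = 0" using key[OF pk t(1) t01] .
  have no: "s (x + c *\<^sub>R ?v) = 0" if c: "0 < c" "c < 1" for c
  proof (rule ccontr)
    assume "s (x + c *\<^sub>R ?v) \<noteq> 0"
    then obtain a b where ab: "pr s (x + c *\<^sub>R ?v) a" "pr s (x + c *\<^sub>R ?v) b" "b \<noteq> a" "b \<noteq> a + 3" using nz_branch unfolding branch_def by blast
    have "off a ?v = 0" "off b ?v = 0" using key[OF ab(1) refl c] key[OF ab(2) refl c] by auto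
    then have "?v = 0" using off_eqI2[OF ab(3,4), of ?v 0] by auto
    then show False using pk x t(1) by (auto simp: lev_def)
  qed
  define a where "a = - off (k + 1) ?v"
  have va: "?v = a *\<^sub>R dir k" using on_lineD[OF kv] by (simp add: a_def)
  have "a \<noteq> 0" using va pk x t(1) by (auto simp: lev_def)
  have *: False if a: "a > 0" and w: "z' = y + h *\<^sub>R dir l" "h > 0" "pr s y l" "z' \<in> lev q" "\<And>g. 0 < g \<Longrightarrow> g < h \<Longrightarrow> s (y + g *\<^sub>R dir l) = 0" for z' h l a
  proof -
    have "D s z' (l + 3) = D s y l" unfolding w(1) by (rule D_const[OF w(2)]) (use w(5) in blast)
    then have "pr s z' (l + 3)" using w(3) by (simp add: pr_def)
    then show False using w(4) by (simp add: lev_def)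
  qed
  have sy: "s y = 0" using no[OF t01] t(1) by simp
  show False
  proof (cases "a > 0")
    case True
    show False
    proof (rule *[of 1 z "(1 - t) * a" k])
      show "z = y + ((1 - t) * a) *\<^sub>R dir k" unfolding t(1) scaleR_scaleR[symmetric] va[symmetric] by (simp add: algebra_simps)
      fix g assume g: "0 < g" "g < (1 - t) * a"
      have "y + g *\<^sub>R dir k = x + (t + g / a) *\<^sub>R ?v" unfolding t(1) va using True by (simp add: algebra_simps)
      moreover have "g / a < 1 - t" "0 < g / a" using g True by (simp_all add: pos_divide_less_eq)
      then have "t + g / a < 1" "0 < t + g / a" using t01 by linarith+
      ultimately show "s (y + g *\<^sub>R dir k) = 0" using no by simp
    qed (use True t01 pk z in auto)
  next
    case False
    then have a: "- a > 0" using \<open>a \<noteq> 0\<close> by simp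
    show False
    proof (rule *[of 1 x "t * - a" k])
      show "x = y + (t * - a) *\<^sub>R dir k" unfolding t(1) scaleR_minus_left[symmetric] using va by (simp add: algebra_simps)
      fix g assume g: "0 < g" "g < t * - a"
      have "y + g *\<^sub>R dir k = x + (t + g / a) *\<^sub>R ?v" unfolding t(1) va using a by (simp add: algebra_simps)
      moreover have "g / - a < t" by (simp only: pos_divide_less_eq[OF a] g(2))
      then have "t + g / a < 1" "0 < t + g / a" using t01 divide_pos_pos[OF g(1) a] minus_divide_right[of g a] by linarith+
      ultimately show "s (y + g *\<^sub>R dir k) = 0" using no by simp
    qed (use a t01 pk x in \<open>auto simp: mult_pos_neg\<close>)
  qed
qed

text \<open>Connected because convex by \<open>lev_segment\<close>; maximal because the displacement
  is locally constant off the support.\<close>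

lemma lev_pieces: assumes "x \<in> lev q" shows "lev q \<in> pieces (MM s)"
proof -
  have sp: "- supp (MM s) = {x. \<forall>k. \<not> pr s x k}" using supp_MM[OF fss poss] by auto
  have op: "open {x. \<forall>k. \<not> pr s x k}" using emeasure_off_supp(2)[OF sets_MM, of s] unfolding sp .
  have "convex (lev q)" unfolding convex_contains_segment
  proof (intro ballI subsetI)
    fix a b y assume ab: "a \<in> lev q" "b \<in> lev q" and y: "y \<in> closed_segment a b"
    have "tau s y 0 = tau s a 0"
      by (rule tau_segment) (use lev_segment[OF ab] y subset_closed_segment[of a y a b] in auto)
    then show "y \<in> lev q" using lev_segment[OF ab y] ab by (simp add: lev_def)
  qed
  then have con: "connected (lev q)" by (rule convex_connected)
  have max: "c \<subseteq> lev q" if c: "connected c" "c \<subseteq> {x. \<forall>k. \<not> pr s x k}" "lev q \<subseteq> c" for c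
  proof
    fix y assume y: "y \<in> c"
    have "tau s x 0 = tau s y 0"
    proof (rule connected_local_const[OF c(1), where f = "\<lambda>x. tau s x 0"])
      show "\<forall>a\<in>c. \<forall>\<^sub>F b in at a within c. tau s a 0 = tau s b 0"
      proof
        fix a assume "a \<in> c"
        then have "a \<in> {x. \<forall>k. \<not> pr s x k}" using c(2) by blast
        then obtain e where e: "e > 0" "ball a e \<subseteq> {x. \<forall>k. \<not> pr s x k}" by (rule openE[OF op])
        have "tau s a 0 = tau s b 0" if "b \<in> ball a e" for b
        proof (rule tau_segment[symmetric])
          have "closed_segment a b \<subseteq> ball a e" using that e(1) by (intro closed_segment_subset) auto
          then show "\<not> pr s y k" if "y \<in> closed_segment a b" for y k using e(2) that by blast
        qed
        then show "\<forall>\<^sub>F b in at a within c. tau s a 0 = tau s b 0"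
          unfolding eventually_at using e(1) by (intro exI[of _ e]) (auto simp: dist_commute)
      qed
    qed (use assms c y in auto)
    then show "y \<in> lev q" using y c(2) assms by (auto simp: lev_def)
  qed
  show ?thesis unfolding pieces_def sp in_components_maximal
    using assms con max by (auto simp: lev_def)
qed

lemma germ: assumes "D s m (k + 1) = 0" "D s m (k + 2) = 0"
  shows "\<forall>\<^sub>F \<epsilon> in at_right 0. m + \<epsilon> *\<^sub>R dir (k + 2) \<in> lev (tau s m k)"
proof -
  have eq: "tau s m (k + 1) = tau s m k" "tau s m (k + 2) = tau s m k"
    using tau_jump[of s m k] tau_jump[of s m "k + 1"] assms by auto
  have "dir (k + 2) = 1 *\<^sub>R dir (k + 2) + 0 *\<^sub>R dir (k + 2 + 1)" by simp
  from tau_near[OF fss this zero_less_one order_refl, of m] show ?thesis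
  proof eventually_elim
    case (elim \<epsilon>)
    have all: "tau s (m + \<epsilon> *\<^sub>R dir (k + 2)) j = tau s m k" for j using spec[OF elim, of j] eq by (simp split: if_splits del: dir_add)
    then show ?case using tau_free_iff[of "m + \<epsilon> *\<^sub>R dir (k + 2)"] by (simp add: lev_def)
  qed
qed

lemma side_piece_lev: assumes "D s (midpoint A B) (k + 1) = 0" "D s (midpoint A B) (k + 2) = 0"
  shows "side_piece (MM s) A B (dir (k + 2)) = lev (tau s (midpoint A B) k)" "midpoint A B \<in> closure (lev (tau s (midpoint A B) k))"
    "\<exists>x. x \<in> lev (tau s (midpoint A B) k)"
proof -
  let ?m = "midpoint A B" and ?C = "lev (tau s (midpoint A B) k)"
  note g = germ[OF assms]
  obtain \<epsilon> where "?m + \<epsilon> *\<^sub>R dir (k + 2) \<in> ?C" using eventually_at_right_ex[OF g] by blast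
  then show ne: "\<exists>x. x \<in> ?C" by blast
  then have P: "?C \<in> pieces (MM s)" using lev_pieces by blast
  show "side_piece (MM s) A B (dir (k + 2)) = ?C" unfolding side_piece_def
  proof (rule the_equality)
    fix C assume C: "C \<in> pieces (MM s) \<and> (\<forall>\<^sub>F \<epsilon> in at_right 0. ?m + \<epsilon> *\<^sub>R dir (k + 2) \<in> C)"
    then have "\<forall>\<^sub>F \<epsilon> in at_right 0. ?m + \<epsilon> *\<^sub>R dir (k + 2) \<in> C \<and> ?m + \<epsilon> *\<^sub>R dir (k + 2) \<in> ?C" using g by (auto intro: eventually_conj)
    then obtain \<epsilon> where "?m + \<epsilon> *\<^sub>R dir (k + 2) \<in> C \<inter> ?C" using eventually_at_right_ex by blast
    then show "C = ?C" using components_eq[of C _ ?C] C P unfolding pieces_def by blast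
  qed (use P g in blast)
  show "?m \<in> closure ?C"
  proof (rule Lim_in_closed_set[OF closed_closure])
    show "\<forall>\<^sub>F \<epsilon> in at_right 0. ?m + \<epsilon> *\<^sub>R dir (k + 2) \<in> closure ?C" using g by (rule eventually_mono) (use closure_subset in blast)
    have "((\<lambda>\<epsilon>. ?m + \<epsilon> *\<^sub>R dir (k + 2)) \<longlongrightarrow> ?m + 0 *\<^sub>R dir (k + 2)) (at_right 0)" by (intro tendsto_intros)
    then show "((\<lambda>\<epsilon>. ?m + \<epsilon> *\<^sub>R dir (k + 2)) \<longlongrightarrow> ?m) (at_right 0)" by (simp del: dir_add)
  qed simp
qed

lemma TT_tau: "tau s x j \<in> TT wt"
proof -
  have "off 5 (tau s x j) \<le> wt" "off (2 + 5) (tau s x j) \<le> 0" "off (4 + 5) (tau s x j) \<le> 0"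
    using tau_bound[of 0 x j] tau_bound[of 2 x j] tau_bound[of 4 x j] by (auto simp: ev_def)
  then show ?thesis unfolding TT_iff[of 0, simplified ev_def, simplified] by (simp add: cor_def off_num)
qed

text \<open>Displacements lie in the triangle of size \<open>wt\<close>. For
  \<open>wt \<le> 0\<close> they all vanish, so no ray is crossed and there is no jump.\<close>

lemma wt_pos: assumes "s A \<noteq> 0" shows "wt > 0"
proof -
  have TT0: "off 0 (tau s x j) \<ge> 0 \<and> off 1 (tau s x j) \<le> 0 \<and> off 2 (tau s x j) \<ge> - wt" for x j
    using TT_tau[of x j] TT_iff[of 0 "tau s x j" wt] by (simp add: cor_def ev_def)
  have "tau s x j = 0" if w: "wt \<le> 0" for x j
  proof (rule off_eqI[of 0])
    show "off 0 (tau s x j) = off 0 0" "off (0 + 1) (tau s x j) = off (0 + 1) 0" using TT0[of x j] w by (simp_all add: off_num)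
  qed
  then have "wt \<le> 0 \<Longrightarrow> \<not> pr s A 0 \<and> \<not> pr s A 3" using tau_free_iff[of A] by simp
  then show ?thesis using jump[of A 0] assms by (force simp: not_pr sg_def ev_def)
qed

end

section \<open>Attachment points and edges in terms of flags\<close>

locale puzzle = framed dir s r + tri_dirs dir w w ix for dir s r w ix +
  assumes ix_next: "ix (j + 1) = ix j + 2" and corner_cor: "corner w r j = cor r (ix j + 2)"
begin

sublocale tri_meas dir w w ix s r ..

lemma supp_pr: "x \<in> supp (MM s) \<longleftrightarrow> (\<exists>k. pr s x k)"
  using supp_MM[OF fss poss] by simp

lemma pr_s_u: "pr s B k \<Longrightarrow> pr u B k"
  using D_s_le_u[of B k] by (auto simp: pr_def)

lemma branch_s_u: "branch s B \<Longrightarrow> branch u B"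
  using pr_s_u by (auto simp: branch_def)

lemma frame_hit: assumes x: "x \<in> TT r" and d: "ev d" "hit k (x - cor r d)"
  shows "(k = d \<or> k = d + 3) \<and> on d x \<or> (k = d + 4 \<or> k = d + 1) \<and> on (d + 4) x \<or> (k = d + 2 \<or> k = d + 5) \<and> x = cor r d"
proof -
  have "x = cor r d" if "off (d + 2) x = off (d + 2) (cor r d)"
  proof -
    have "off d (x - cor r d) \<ge> 0" "off (d + 1) (x - cor r d) \<le> 0" using x TT_iff[OF d(1)] by auto
    then have "on d x" "off (d + 1) x = off (d + 1) (cor r d)" using that by simp_all
    then show ?thesis by (rule off_eqI)
  qed
  then show ?thesis using fr_hit_cases[OF d] by satx
qed

lemma exit_points_XS: "exit_points w w r (MM s) = fst ` XS"
proof -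
  have "\<exists>j. (A, ix j) \<in> XS" if "(A, k) \<in> XS" for A k using ix_ex[of k] that by (auto simp: XS_def)
  then show ?thesis unfolding exit_points_def exits_MM by force
qed

lemma XS_branch: assumes "(A, k) \<in> XS" shows "branch u A" "on (k + 2) A" "ev (k + 2)"
proof -
  have h: "ev k" "A \<in> TT r" "on (k + 2) A" "pr s A k" using assms by (auto simp: XS_def)
  then show "on (k + 2) A" "ev (k + 2)" by simp_all
  have "pr u A (k + 2)" using side_ray(1)[of "k + 2" A] h by (simp add: pr_def)
  moreover have "k \<noteq> k + 2" "k \<noteq> k + 2 + 3" by simp_all
  ultimately show "branch u A" unfolding branch_def using pr_s_u[OF h(4)] by blast
qed

lemma side_exit: assumes A: "branch u A" "ev d" "on d A" and nc: "\<And>e. ev e \<Longrightarrow> A \<noteq> cor r e" shows "(A, d + 4) \<in> XS"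
proof -
  have SI: "(A, d) \<in> SI" using A by (simp add: SI_def)
  have AT: "A \<in> TT r" by (rule branch_TT[OF A(1)])
  have "\<not> hit (d + 4) (A - cor r e)" if e: "ev e" for e
  proof
    assume "hit (d + 4) (A - cor r e)"
    from frame_hit[OF AT e this] nc[OF e] consider "d + 4 = e" "on e A" | "d + 4 = e + 3" | "d + 4 = e + 4" "on (e + 4) A" | "d + 4 = e + 1" by blast
    then show False
    proof cases
      case 1 then show ?thesis using on_cor(2)[OF A(2,3)] nc[OF A(2)] by simp
    next
      case 2 then show ?thesis using A(2) e by (metis ev_add(3,4))
    next
      case 3 then show ?thesis using on_cor(2)[OF A(2,3)] nc[OF A(2)] by simp
    next
      case 4 then show ?thesis using A(2) e by (metis ev_add(1,4))
    qed
  qed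
  then have "D (fr r) A (d + 4) = 0" unfolding D_fr by (intro sum.neutral) auto
  then have "pr s A (d + 4)" using SI_ray(1)[OF SI] by (simp add: pr_def D_u)
  then show ?thesis using A AT by (simp add: XS_def)
qed

text \<open>By \<open>LS_corner\<close> the exit parallel to the opposite side carries precisely the
  weight of the corner.\<close>

lemma corner_exit: assumes d: "ev d" shows "(cor r d, d + 2) \<in> XS \<longleftrightarrow> s (cor r d) \<noteq> 0"
proof -
  have o: "on (d + 2 + 2) (cor r d)" "cor r d \<in> TT r" "ev (d + 2)" using on_cor(1)[OF d] cor_TT[OF r d] d by simp_all
  have "D s (cor r d) (d + 2) = LS s (d + 2) (off (d + 2) (cor r d))" using exit_D[OF o(3,2,1), of 0] by simp
  then have "D s (cor r d) (d + 2) = s (cor r d)" using LS_corner[OF suppTT d] by simp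
  then have "pr s (cor r d) (d + 2) \<longleftrightarrow> s (cor r d) \<noteq> 0" using not_pr[of "cor r d" "d + 2"] by auto
  then show ?thesis using o by (simp add: XS_def)
qed

text \<open>The framed branch points on the boundary correspond to the flags on the sides. They are
  the attachment points together with the corners without weight, since at a corner the condition on
  the half-line says that its weight is not 0.\<close>

lemma att_eq: "att w r (MM s) + card free_corners = card BF"
proof -
  let ?N = "{B. branch u B \<and> (\<exists>d. ev d \<and> on d B)}"
  have inj: "inj_on fst BF"
  proof (rule inj_onI)
    fix f g assume h: "f \<in> BF" "g \<in> BF" "fst f = fst g"
    obtain B d e where fg: "f = (B, d)" "g = (B, e)" using h(3) by (metis prod.collapse)
    have "d = e \<or> d = e + 1 \<or> d = e + 2" "e = d \<or> e = d + 1 \<or> e = d + 2" using h(1,2) FF_D(3) by (auto simp: fg BF_def inn_def)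
    then have "d = e" by (elim disjE) auto
    then show "f = g" using fg by simp
  qed
  have img: "fst ` BF = ?N"
  proof (rule set_eqI, rule iffI)
    fix B assume "B \<in> ?N"
    then obtain d where d: "branch u B" "ev d" "on d B" by blast
    then have SI: "(B, d) \<in> SI" by (simp add: SI_def)
    show "B \<in> fst ` BF"
    proof (cases "B = cor r (d + 2)")
      case True
      have "(B, d + 2) \<in> SI" using d True by (simp add: SI_def)
      moreover have "B \<noteq> cor r (d + 2 + 2)" using True cor_inj[of "d + 2" "d + 2 + 2"] d(2) by auto
      ultimately show ?thesis unfolding BF_SI by force
    qed (use SI in \<open>force simp: BF_SI\<close>)
  qed (auto simp: BF_SI SI_def)
  have prev: "w (j - 1) = dir (ix j + 2 + 2)" for j
  proof -
    have "ix j = ix (j - 1) + 2" using ix_next[of "j - 1"] by simp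
    then have "ix j + 2 + 2 = ix (j - 1)" by simp
    then show ?thesis using e[of "j - 1"] by (simp only:)
  qed
  have half: "halfline (cor r d) (dir (d + 2)) \<subseteq> supp (MM s) \<longleftrightarrow> s (cor r d) \<noteq> 0" if d: "ev d" for d
  proof -
    have o: "on (d + 2 + 2) (cor r d)" "cor r d \<in> TT r" "ev (d + 2)" using on_cor(1)[OF d] cor_TT[OF r d] d by simp_all
    obtain j where j: "ix j = d + 2" using ix_ex[OF o(3)] by blast
    have out: "halfline (cor r d) (dir (d + 2)) \<inter> TT r = {}" using exit_outside[OF o(3,2,1)] by (auto simp: halfline_def simp del: dir_add)
    have fr: "cor r d \<in> frontier (TT r)" unfolding frontier_TT using o d by blast
    have "halfline (cor r d) (dir (d + 2)) \<subseteq> supp (MM s) \<longleftrightarrow> (cor r d, j) \<in> exits w w r (MM s)"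
      unfolding exits_def tri_TT[OF r] mem_Collect_eq prod.case e j using out fr by blast
    also have "\<dots> \<longleftrightarrow> s (cor r d) \<noteq> 0" unfolding exits_MM using corner_exit[OF d] j by simp
    finally show ?thesis .
  qed
  have cond: "(\<forall>k. A = corner w r k \<longrightarrow> halfline A (w (k - 1)) \<subseteq> supp (MM s)) \<longleftrightarrow> A \<notin> cor r ` free_corners" for A
  proof -
    have "(\<forall>k. A = corner w r k \<longrightarrow> halfline A (w (k - 1)) \<subseteq> supp (MM s)) \<longleftrightarrow> (\<forall>k. A = cor r (ix k + 2) \<longrightarrow> s A \<noteq> 0)"
      unfolding corner_cor prev using half[of "ix k + 2" for k] by (auto simp del: dir_add)
    also have "\<dots> \<longleftrightarrow> (\<forall>d. ev d \<and> A = cor r d \<longrightarrow> s A \<noteq> 0)"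
    proof -
      have "\<exists>k. d = ix k + 2" if "ev d" for d
      proof -
        obtain k where "ix k = d + 4" using ix_ex[of "d + 4"] \<open>ev d\<close> by auto
        then have "d = ix k + 2" by simp
        then show ?thesis ..
      qed
      then show ?thesis using ev_ix ev_add(2) by metis
    qed
    finally show ?thesis by (auto simp: free_corners_def)
  qed
  have "attachment_points w r (MM s) = ?N - cor r ` free_corners"
  proof (rule set_eqI)
    fix A
    have "A \<in> fst ` XS \<longleftrightarrow> A \<in> ?N" if nf: "A \<notin> cor r ` free_corners"
    proof
      assume "A \<in> fst ` XS"
      then obtain k where "(A, k) \<in> XS" by auto
      then show "A \<in> ?N" using XS_branch by blast
    next
      assume "A \<in> ?N"
      then obtain d where d: "branch u A" "ev d" "on d A" by blast
      show "A \<in> fst ` XS"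
      proof (cases "\<exists>e. ev e \<and> A = cor r e")
        case True
        then obtain e where e: "ev e" "A = cor r e" by blast
        then have "s A \<noteq> 0" using nf by (auto simp: free_corners_def)
        then show ?thesis using corner_exit[OF e(1)] e(2) by force
      qed (use side_exit[OF d] in force)
    qed
    then show "A \<in> attachment_points w r (MM s) \<longleftrightarrow> A \<in> ?N - cor r ` free_corners"
      unfolding attachment_points_def exit_points_XS mem_Collect_eq cond by auto
  qed
  moreover have "cor r ` free_corners \<subseteq> ?N" using cor_branch by (auto simp: free_corners_def)
  moreover have "card (cor r ` free_corners) = card free_corners" by (rule card_image) (use cor_inj in \<open>auto simp: inj_on_def free_corners_def\<close>)
  moreover have "card ?N = card BF" using card_image[OF inj] img by simp
  moreover have "finite ?N" using finite_subset[of ?N "{B. branch u B}"] U.finite_branch by auto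
  ultimately show ?thesis unfolding att_def using card_Diff_subset[of "cor r ` free_corners" ?N] card_mono[of ?N "cor r ` free_corners"] by auto
qed

lemma vertices_iff: "A \<in> vertices w r (MM s) \<longleftrightarrow> branch s A \<or> A \<in> fst ` XS"
  unfolding vertices_def exit_points_XS branch_points_MM[OF fss poss] by simp

lemma vertex_u: "A \<in> vertices w r (MM s) \<Longrightarrow> branch u A"
  using vertices_iff branch_s_u XS_branch(1) by force

text \<open>Off the sides the frame adds nothing, and on a side away from the corners the support
  leaves through the point. At a corner of weight 0 only the line of directions \<open>d + 1\<close>
  and \<open>d + 4\<close> is possible, and it leaves there.\<close>

lemma u_vertex: assumes B: "branch u B" "pr s B m" shows "B \<in> vertices w r (MM s)"
proof -
  have BT: "B \<in> TT r" by (rule branch_TT[OF B(1)])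
  consider (i) "\<And>d. ev d \<Longrightarrow> \<not> on d B" | (c) d where "ev d" "B = cor r d" | (b) d where "ev d" "on d B" "\<And>e. ev e \<Longrightarrow> B \<noteq> cor r e" by blast
  then show ?thesis
  proof cases
    case i
    have "D (fr r) B k = 0" for k
    proof -
      have "\<not> hit k (B - cor r d)" if "ev d" for d using frame_hit[OF BT that, of k] i[OF that] i[of "d + 4"] that by auto
      then show ?thesis unfolding D_fr by (intro sum.neutral) auto
    qed
    then have "branch s B" using B(1) by (simp add: branch_def pr_def D_u)
    then show ?thesis by (simp add: vertices_iff)
  next
    case c
    show ?thesis
    proof (cases "s B = 0")
      case True
      have "D s B (d + 5) = 0" by (rule extreme_line(2)[OF fss poss c(1) side_min[OF c(1)]]) (use c in auto)
      moreover have "D s B (d + 4 + 5) = 0" by (rule extreme_line(2)[OF fss poss _ side_min]) (use c on_cor(1)[OF c(1)] in auto)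
      ultimately have z: "D s B (d + 5) = 0" "D s B (d + 3) = 0" by simp_all
      have e: "D s B d = D s B (d + 3)" "D s B (d + 2) = D s B (d + 5)" "D s B (d + 1) = D s B (d + 4)"
        using jump[of B d] jump[of B "d + 2"] jump[of B "d + 1"] True by simp_all
      have "pr s B (d + 4)" using six_rel[of m d] B(2) z e by (auto simp: pr_def)
      then have "(B, d + 4) \<in> XS" using c BT by (simp add: XS_def)
      then show ?thesis by (force simp: vertices_iff)
    qed (simp add: vertices_iff nz_branch)
  next
    case b
    then show ?thesis using side_exit[OF B(1) b(1,2)] by (force simp: vertices_iff)
  qed
qed

definition EF :: "((real^2) \<times> 6) set" where "EF = {(B, k). (B, k) \<in> FF \<and> ev k \<and> D s B k > 0}"

lemma no_s_inside: assumes f: "(B, k) \<in> FF" and t: "0 < t" "t < len u B k" shows "s (B + t *\<^sub>R dir k) = 0"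
  using U.len_props(3)[OF FF_fin(1)[OF f] t] nz_branch branch_s_u by blast

lemma D_inside: assumes f: "(B, k) \<in> FF" and t: "0 < t" "t < len u B k"
  shows "D s (B + t *\<^sub>R dir k) (k + 3) = D s B k" "D s (B + t *\<^sub>R dir k) k = D s B k"
    "l \<noteq> k \<Longrightarrow> l \<noteq> k + 3 \<Longrightarrow> D s (B + t *\<^sub>R dir k) l = 0" "tau s (B + t *\<^sub>R dir k) k = sig (B, k)"
proof -
  let ?y = "B + t *\<^sub>R dir k"
  show 3: "D s ?y (k + 3) = D s B k" by (rule D_const[OF t(1)]) (use no_s_inside[OF f] t in force)
  then show "D s ?y k = D s B k" using jump[of ?y k] no_s_inside[OF f t] by simp
  have nb: "\<not> branch u ?y" by (rule U.len_props(3)[OF FF_fin(1)[OF f] t])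
  have "pr u ?y k" using U.D_edge_fwd[OF FF_fin(1)[OF f], of t] t FF_D(2)[OF f] by (simp add: pr_def)
  then show "D s ?y l = 0" if "l \<noteq> k" "l \<noteq> k + 3" using U.nonbranch(3)[OF nb, of k l] that pr_s_u[of ?y l] not_pr by blast
  show "tau s ?y k = sig (B, k)" unfolding sig_def prod.case
    by (rule tau_edge(2)[OF U.len_props(1)[OF FF_fin(1)[OF f]] _ t]) (use interior[OF f] in blast)
qed

text \<open>\<open>edges\<close> lists an edge in its even orientation, and this is a flag: an even
  direction along a side has the triangle on its left. The density condition discards the edges that
  belong to the frame alone.\<close>

lemma edges_EF: "(A, B, j) \<in> edges w r (MM s) \<longleftrightarrow> (A, ix j) \<in> EF \<and> B = nb u A (ix j)"
proof -
  have seg: "open_segment A (A + l *\<^sub>R dir k) = (\<lambda>t. A + t *\<^sub>R dir k) ` {0<..<l}" if "l > 0" for A l k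
    by (rule open_segment_arc[OF dir_nonzero that])
  show ?thesis
  proof
    assume h: "(A, B, j) \<in> edges w r (MM s)"
    let ?k = "ix j"
    obtain l where l: "l > 0" "B = A + l *\<^sub>R dir ?k" using h by (auto simp: edges_def e)
    have V: "A \<in> vertices w r (MM s)" "B \<in> vertices w r (MM s)" using h by (auto simp: edges_def)
    have ins: "A + t *\<^sub>R dir ?k \<in> supp (MM s)" "A + t *\<^sub>R dir ?k \<in> TT r" "A + t *\<^sub>R dir ?k \<notin> vertices w r (MM s)" if "0 < t" "t < l" for t
    proof -
      have "A + t *\<^sub>R dir ?k \<in> open_segment A B" unfolding l(2) seg[OF l(1)] using that by auto
      then show "A + t *\<^sub>R dir ?k \<in> supp (MM s)" "A + t *\<^sub>R dir ?k \<in> TT r" "A + t *\<^sub>R dir ?k \<notin> vertices w r (MM s)"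
        using h tri_TT[OF r] by (auto simp: edges_def)
    qed
    have nbr: "\<not> branch u (A + t *\<^sub>R dir ?k)" if "0 < t" "t < l" for t
      using ins[OF that] u_vertex supp_pr by blast
    have bA: "branch u A" "branch u (A + l *\<^sub>R dir ?k)" using V vertex_u l(2) by auto
    have fin: "fin u A ?k" "len u A ?k = l" using U.len_eqI[OF l(1) bA(2) nbr] by auto
    have "\<exists>P m t'. (P, m) \<in> {P. s P \<noteq> 0} \<times> UNIV \<and> A + t *\<^sub>R dir ?k = P + t' *\<^sub>R dir m \<and> pr s (P + t' *\<^sub>R dir m) m" if t: "0 < t" "t < l" for t
    proof -
      let ?y = "A + t *\<^sub>R dir ?k"
      obtain m where m: "pr s ?y m" using ins(1)[OF t] supp_pr by blast
      then have "D s ?y m \<noteq> 0" by (simp add: pr_def)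
      then obtain P where P: "s P \<noteq> 0" "off m P = off m ?y" using D_nz_line by blast
      have "?y - P = (- off (m + 1) (?y - P)) *\<^sub>R dir m" by (rule on_lineD) (use P(2) in simp)
      then have "?y = P + (- off (m + 1) (?y - P)) *\<^sub>R dir m" by (metis add.commute diff_add_cancel)
      then have "(P, m) \<in> {P. s P \<noteq> 0} \<times> UNIV \<and> ?y = P + (- off (m + 1) (?y - P)) *\<^sub>R dir m \<and> pr s (P + (- off (m + 1) (?y - P)) *\<^sub>R dir m) m"
        using P(1) m by (metis (mono_tags, lifting) SigmaI UNIV_I mem_Collect_eq)
      then show ?thesis by blast
    qed
    from parallel_ray[OF _ l(1) this] obtain m t where m: "0 < t" "t < l" "pr s (A + t *\<^sub>R dir ?k) m" "m = ?k \<or> m = ?k + 3"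
      using fss by (fastforce simp: fs_def)
    have s0: "s (A + t *\<^sub>R dir ?k) = 0" if "0 < t" "t < l" for t using nbr[OF that] nz_branch branch_s_u by blast
    have "D s (A + t *\<^sub>R dir ?k) (?k + 3) = D s A ?k" by (rule D_const[OF m(1)]) (use s0 m in force)
    moreover have "D s (A + t *\<^sub>R dir ?k) ?k = D s (A + t *\<^sub>R dir ?k) (?k + 3)" using jump[of "A + t *\<^sub>R dir ?k" ?k] s0[OF m(1,2)] by simp
    ultimately have DA: "pr s A ?k" using m(3,4) by (auto simp: pr_def)
    have "inn A ?k" unfolding inn_def
    proof (intro conjI allI impI branch_TT[OF bA(1)], elim conjE)
      fix e assume e: "ev e" "on e A"
      have "off e (A + t *\<^sub>R dir ?k - cor r e) \<ge> 0" using ins(2)[OF m(1,2)] e(1) by (simp add: TT_def del: off_lin)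
      then have "t * off e (dir ?k) \<ge> 0" using e(2) by simp
      then have "\<not> off e (dir ?k) < 0" using m(1) by (simp add: zero_le_mult_iff)
      then show "?k = e \<or> ?k = e + 1 \<or> ?k = e + 2" using off_dir_sign(2)[of e ?k] six_rel[of ?k e] ev_ix[of j] e(1) by (metis ev_add(3))
    qed
    then show "(A, ?k) \<in> EF \<and> B = nb u A ?k" using bA DA pr_s_u[OF DA] fin l(2) by (simp add: EF_def FF_def pr_def nb_def)
  next
    assume h: "(A, ix j) \<in> EF \<and> B = nb u A (ix j)"
    let ?k = "ix j"
    have f: "(A, ?k) \<in> FF" and D: "D s A ?k > 0" and B: "B = A + len u A ?k *\<^sub>R dir ?k" using h by (auto simp: EF_def nb_def)
    note fin = FF_fin[OF f]
    have l: "len u A ?k > 0" by (rule U.len_props(1)[OF fin(1)])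
    have "A \<in> vertices w r (MM s)" using u_vertex[OF FF_D(1)[OF f], of ?k] D by (simp add: pr_def)
    moreover have "B \<in> vertices w r (MM s)"
      using u_vertex[of B "?k + 3"] U.len_props(2)[OF fin(1)] D_s_nb[OF f] D h by (simp add: pr_def)
    moreover have "open_segment A B \<subseteq> supp (MM s) \<inter> Defs.tri w r"
    proof
      fix y assume "y \<in> open_segment A B"
      then obtain t where t: "0 < t" "t < len u A ?k" "y = A + t *\<^sub>R dir ?k" unfolding B seg[OF l] by auto
      then have "pr s y ?k" using D_inside(2)[OF f t(1,2)] D by (simp add: pr_def)
      then show "y \<in> supp (MM s) \<inter> Defs.tri w r" using fin(2)[of t] t tri_TT[OF r] supp_pr[of y] by auto
    qed
    moreover have "open_segment A B \<inter> vertices w r (MM s) = {}"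
      unfolding B seg[OF l] using U.len_props(3)[OF fin(1)] vertex_u by fastforce
    ultimately show "(A, B, j) \<in> edges w r (MM s)" using l B by (auto simp: edges_def e)
  qed
qed

end

section \<open>The dual is well defined\<close>

context hex
begin

lemma TT_add: assumes "x \<in> TT a" "y \<in> TT b" shows "x + y \<in> TT (a + b)"
proof -
  have "cor (a + b) d = cor a d + cor b d" for d by (simp add: cor_def scaleR_left_distrib)
  then have "off d (x + y - cor (a + b) d) = off d (x - cor a d) + off d (y - cor b d)" for d by simp
  moreover have "off d (x - cor a d) \<ge> 0" "off d (y - cor b d) \<ge> 0" if "ev d" for d using assms that by (auto simp: TT_def simp del: off_lin)
  ultimately show ?thesis unfolding TT_def by (simp del: off_lin)
qed

lemma ray_TT: assumes A: "A \<in> TT r" and h: "\<And>e. ev e \<Longrightarrow> off e A = off e (cor r e) \<Longrightarrow> off e (dir k) \<ge> 0"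
  shows "\<forall>\<^sub>F t in at_right 0. A + t *\<^sub>R dir k \<in> TT r"
proof -
  have "\<forall>\<^sub>F t in at_right 0. off e (A + t *\<^sub>R dir k - cor r e) \<ge> 0" if e: "ev e" for e
  proof (cases "off e A = off e (cor r e)")
    case True
    have "\<forall>\<^sub>F t :: real in at_right 0. t > 0" by (rule eventually_at_right_less)
    then show ?thesis by eventually_elim (use True h[OF e True] in simp)
  next
    case False
    then have "off e (A + 0 *\<^sub>R dir k - cor r e) > 0" using A e by (simp add: TT_def order_less_le)
    moreover have "((\<lambda>t. off e (A + t *\<^sub>R dir k - cor r e)) \<longlongrightarrow> off e (A + 0 *\<^sub>R dir k - cor r e)) (at_right 0)"
      unfolding off_def by (intro tendsto_intros)
    ultimately show ?thesis using order_tendstoD(1)[of _ _ "at_right (0::real)" 0] by (force elim: eventually_mono)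
  qed
  then have "\<forall>\<^sub>F t in at_right 0. \<forall>e\<in>{e. ev e}. off e (A + t *\<^sub>R dir k - cor r e) \<ge> 0" by (intro eventually_ball_finite) auto
  then show ?thesis by (rule eventually_mono) (simp add: TT_def)
qed

text \<open>A weight is the jump between two opposite germs, which are visible if both lie in the
  triangle. At a corner one of them leaves the triangle, but its density is 0 by
  \<open>extreme_line\<close>.\<close>

lemma MM_determined:
  assumes r: "r > 0" and s1: "fs s1" "pos s1" "\<And>A. s1 A \<noteq> 0 \<Longrightarrow> A \<in> TT r" and s2: "fs s2" "pos s2" "\<And>A. s2 A \<noteq> 0 \<Longrightarrow> A \<in> TT r"
    and eq: "\<And>E. E \<in> sets borel \<Longrightarrow> E \<subseteq> TT r \<Longrightarrow> emeasure (MM s1) E = emeasure (MM s2) E"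
  shows "s1 = s2"
proof
  fix A
  interpret S1: hext dir s1 r by unfold_locales (use r s1 in auto)
  interpret S2: hext dir s2 r by unfold_locales (use r s2 in auto)
  have ray: "D s1 A k = D s2 A k" if k: "\<forall>\<^sub>F t in at_right 0. A + t *\<^sub>R dir k \<in> TT r" for k
  proof -
    obtain b where b: "b > 0" "\<And>t. 0 < t \<Longrightarrow> t < b \<Longrightarrow> A + t *\<^sub>R dir k \<in> TT r" using k unfolding eventually_at_right_field by auto
    obtain r1 where r1: "r1 > 0" "\<And>E. E \<in> sets borel \<Longrightarrow> emeasure (MM s1) (E \<inter> ray A k r1) = ennreal (D s1 A k) * arclen A (dir k) r1 E"
      using has_density_MM[OF s1(1,2), of A k] unfolding has_density_arc[OF norm_dir] by blast
    obtain r2 where r2: "r2 > 0" "\<And>E. E \<in> sets borel \<Longrightarrow> emeasure (MM s2) (E \<inter> ray A k r2) = ennreal (D s2 A k) * arclen A (dir k) r2 E"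
      using has_density_MM[OF s2(1,2), of A k] unfolding has_density_arc[OF norm_dir] by blast
    define \<rho> where "\<rho> = min b (min r1 r2)"
    have \<rho>: "\<rho> > 0" "\<rho> \<le> r1" "\<rho> \<le> r2" "\<rho> \<le> b" using b r1 r2 by (auto simp: \<rho>_def)
    have "emeasure (MM s1) (ray A k \<rho>) = ennreal (D s1 A k) * ennreal \<rho>"
    proof -
      have "emeasure (MM s1) (UNIV \<inter> ray A k \<rho>) = ennreal (D s1 A k) * arclen A (dir k) \<rho> UNIV"
        by (rule density_restrict[OF norm_dir \<rho>(1,2)]) (use r1(2) in auto)
      then show ?thesis using arclen_UNIV[OF \<rho>(1)] by simp
    qed
    moreover have "emeasure (MM s2) (ray A k \<rho>) = ennreal (D s2 A k) * ennreal \<rho>"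
    proof -
      have "emeasure (MM s2) (UNIV \<inter> ray A k \<rho>) = ennreal (D s2 A k) * arclen A (dir k) \<rho> UNIV"
        by (rule density_restrict[OF norm_dir \<rho>(1,3)]) (use r2(2) in auto)
      then show ?thesis using arclen_UNIV[OF \<rho>(1)] by simp
    qed
    moreover have "emeasure (MM s1) (ray A k \<rho>) = emeasure (MM s2) (ray A k \<rho>)"
      by (rule eq) (use ray_borel b(2) \<rho> in auto)
    ultimately have "ennreal (D s1 A k * \<rho>) = ennreal (D s2 A k * \<rho>)" using \<rho>(1) by (simp add: ennreal_mult)
    then show ?thesis using \<rho>(1) by simp
  qed
  have nn: "s1 A = s2 A" if d: "ev d" "D s1 A d = D s2 A d" "D s1 A (d + 3) = D s2 A (d + 3)" for d
    using S1.jump[of A d] S2.jump[of A d] d by (simp add: sg_def)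
  show "s1 A = s2 A"
  proof (cases "A \<in> TT r")
    case True
    have corner: ?thesis if d: "ev d" "S1.on d A" "S1.on (d + 4) A" for d
    proof (rule nn[OF d(1)])
      have A: "A = cor r d" using S1.on_cor(2)[OF d] .
      have n: "\<not> S1.on (d + 2) A" using off_cor(3)[OF d(1), of r] r A by simp
      show "D s1 A d = D s2 A d"
      proof (rule ray, rule ray_TT[OF True])
        fix e assume e: "ev e" "S1.on e A"
        have "e = d \<or> e = d + 4" using six_rel[of e d] e d(1) n by auto
        then show "off e (dir d) \<ge> 0" by auto
      qed
      have "D s1 A (d + 4 + 5) = 0" by (rule extreme_line(2)[OF s1(1,2) _ S1.side_min]) (use d in auto)
      moreover have "D s2 A (d + 4 + 5) = 0" by (rule extreme_line(2)[OF s2(1,2) _ S2.side_min]) (use d in auto)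
      ultimately show "D s1 A (d + 3) = D s2 A (d + 3)" by simp
    qed
    show ?thesis
    proof (cases "\<exists>d. ev d \<and> S1.on d A")
      case False
      then have "\<forall>\<^sub>F t in at_right 0. A + t *\<^sub>R dir k \<in> TT r" for k by (intro ray_TT[OF True]) auto
      then show ?thesis by (intro nn[of 0] ray) (auto simp: ev_def)
    next
      case T: True
      then obtain d where d: "ev d" "S1.on d A" by blast
      consider "S1.on (d + 4) A" | "S1.on (d + 2) A" | "\<not> S1.on (d + 4) A" "\<not> S1.on (d + 2) A" by blast
      then show ?thesis
      proof cases
        case 2 then show ?thesis using corner[of "d + 2"] d by simp
      next
        case 3
        have "off e (dir k) \<ge> 0" if "ev e" "S1.on e A" "k = d \<or> k = d + 3" for e k
          using six_rel[of e d] that d 3 by auto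
        then have evn: "\<forall>\<^sub>F t in at_right 0. A + t *\<^sub>R dir k \<in> TT r" if "k = d \<or> k = d + 3" for k using that by (intro ray_TT[OF True]) blast
        show ?thesis by (rule nn[OF d(1) ray[OF evn] ray[OF evn]]) simp_all
      qed (use corner d in blast)
    qed
  qed (use s1(3) s2(3) in metis)
qed

end

context hext
begin

text \<open>A piece just outside the side \<open>d\<close> of the triangle is moved onto the corresponding side.\<close>

lemma outer_off: assumes d: "ev d" and m: "on d m" shows "off d (tau s m (d + 5)) = off d (cor wt d)"
proof -
  have "off d (tg (d + 5) (m - A)) = - of_bool (d = 2)" if A: "s A \<noteq> 0" for A
  proof -
    let ?y = "m - A"
    have "off d ?y \<le> 0" using side_min[OF d A] m by simp
    then have n: "\<not> gp d (d + 5) ?y" using mid_sign[of d "d + 5"] by (auto simp: gp_def)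
    consider "d = 0" | "d = 2" | "d = 4" using d by (auto simp: ev_def)
    then show ?thesis
    proof cases
      case 2
      have "gp 0 1 ?y \<or> gp 4 1 ?y"
      proof (rule ccontr)
        assume "\<not> ?thesis"
        then have "off 0 ?y \<le> 0" "off 4 ?y \<le> 0" "off 0 ?y \<noteq> 0" by (auto simp: gp_def mid_num not_less)
        moreover have "off 2 ?y \<le> 0" using \<open>off d ?y \<le> 0\<close> 2 by simp
        ultimately show False by (simp add: off_num)
      qed
      then show ?thesis using n 2 by (auto simp: tg_def off_num off_dir_num)
    qed (use n in \<open>auto simp: tg_def off_num off_dir_num\<close>)
  qed
  then have "off d (tau s m (d + 5)) = (\<Sum>A | s A \<noteq> 0. s A * - of_bool (d = 2))"
    unfolding tau_def off_sum by (intro sum.cong) (auto simp del: dir_add)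
  also have "\<dots> = - of_bool (d = 2) * wt" unfolding wt_def sum_distrib_left by (simp add: mult.commute)
  also have "\<dots> = off d (cor wt d)" using d by (auto simp: ev_def cor_def off_num off_dir_num)
  finally show ?thesis .
qed

end

context puzzle
begin

lemma w_next: "w (j + 1) = dir (ix j + 2)"
  using e[of "j + 1"] ix_next[of j] by simp

text \<open>Displacement to the right of the edge; for an edge on a side this belongs to a piece
  reaching outside the triangle.\<close>

definition rsig :: "(real^2) \<times> 6 \<Rightarrow> real^2" where "rsig = (\<lambda>(B, k). sig (B, k) + D s B k *\<^sub>R dir (k + 5))"

lemma edge_sides: assumes f: "(B, k) \<in> FF"
  shows "side_piece (MM s) B (nb u B k) (dir (k + 2)) = lev (sig (B, k))" "side_piece (MM s) B (nb u B k) (- dir (k + 2)) = lev (rsig (B, k))"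
    "midpoint B (nb u B k) \<in> TT r" "midpoint B (nb u B k) \<in> closure (lev (rsig (B, k)))"
    "\<exists>x. x \<in> lev (sig (B, k))" "\<exists>x. x \<in> lev (rsig (B, k))" "off k (midpoint B (nb u B k)) = off k B"
proof -
  let ?t = "len u B k / 2" and ?m = "midpoint B (nb u B k)"
  have l: "len u B k > 0" by (rule U.len_props(1)[OF FF_fin(1)[OF f]])
  then have t: "0 < ?t" "?t < len u B k" by simp_all
  have m: "?m = B + ?t *\<^sub>R dir k" unfolding nb_def midpoint_def by (simp add: scaleR_right_distrib)
  note i = D_inside[OF f t, folded m]
  show "?m \<in> TT r" unfolding m by (rule FF_fin(2)[OF f]) (use t in auto)
  show "off k ?m = off k B" unfolding m by simp
  have L: "D s ?m (k + 1) = 0" "D s ?m (k + 2) = 0" by (rule i(3); simp)+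
  have R: "D s ?m (k + 3 + 1) = 0" "D s ?m (k + 3 + 2) = 0" by (rule i(3); simp)+
  have "tau s ?m (k + 3) = tau s ?m (k + 5)" using tau_jump[of s ?m "k + 3"] tau_jump[of s ?m "k + 4"] R by simp
  also have "\<dots> = rsig (B, k)" unfolding tau_step i(2,4) rsig_def by (simp add: algebra_simps)
  finally have rt: "tau s ?m (k + 3) = rsig (B, k)" .
  have n: "dir (k + 3 + 2) = - dir (k + 2)" by simp
  show "side_piece (MM s) B (nb u B k) (dir (k + 2)) = lev (sig (B, k))" "\<exists>x. x \<in> lev (sig (B, k))"
    using side_piece_lev[OF L] i(4) by simp_all
  show "side_piece (MM s) B (nb u B k) (- dir (k + 2)) = lev (rsig (B, k))" "?m \<in> closure (lev (rsig (B, k)))" "\<exists>x. x \<in> lev (rsig (B, k))"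
    using side_piece_lev[OF R] unfolding rt n by simp_all
qed

definition Tp :: "(real^2) set \<Rightarrow> real^2" where "Tp C = tau s (SOME x. x \<in> C) 0"

lemma Tp_lev: "x \<in> lev q \<Longrightarrow> Tp (lev q) = q"
  using someI[of "\<lambda>x. x \<in> lev q" x] unfolding Tp_def by (simp add: lev_def)

lemma edge_cases: assumes "(A, B, j) \<in> edges w r (MM s)"
  shows "(A, ix j) \<in> FF" "D s A (ix j) > 0" "B = nb u A (ix j)" "side_piece (MM s) A B (w (j + 1)) = lev (sig (A, ix j))"
    "side_piece (MM s) A B (- w (j + 1)) = lev (rsig (A, ix j))"
proof -
  show f: "(A, ix j) \<in> FF" "D s A (ix j) > 0" "B = nb u A (ix j)" using assms edges_EF by (auto simp: EF_def)
  show "side_piece (MM s) A B (w (j + 1)) = lev (sig (A, ix j))" "side_piece (MM s) A B (- w (j + 1)) = lev (rsig (A, ix j))"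
    using edge_sides(1,2)[OF f(1)] f(3) unfolding w_next by simp_all
qed

lemma sig_rsig: "sig f - rsig f = D s (fst f) (snd f) *\<^sub>R dir (snd f + 2)"
  by (cases f) (simp add: rsig_def algebra_simps)

lemma inflation_Tp: "inflation w r (MM s) Tp"
  unfolding inflation_def
proof (intro conjI ballI)
  fix x assume x: "x \<in> edges w r (MM s)"
  obtain A B j where e': "x = (A, B, j)" by (cases x)
  note h = edge_cases[OF x[unfolded e']]
  have "Tp (lev (sig (A, ix j))) = sig (A, ix j)" "Tp (lev (rsig (A, ix j))) = rsig (A, ix j)" using edge_sides(5,6)[OF h(1)] Tp_lev by blast+
  then show "case x of (A, B, j) \<Rightarrow> Tp (side_piece (MM s) A B (w (j + 1))) - Tp (side_piece (MM s) A B (- w (j + 1))) = dens (MM s) A (w j) *\<^sub>R w (j + 1)"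
    unfolding e' prod.case h(4,5) unfolding dens_e w_next using sig_rsig[of "(A, ix j)"] by simp
next
  fix C assume C: "C \<in> pieces (MM s)"
  have W: "wt \<ge> 0" using TT_tau[of 0 0] TT_iff[of 0 "tau s 0 0" wt] by (simp add: cor_def ev_def off_num)
  have "x + Tp C \<in> TT (r + wt)" if "x \<in> TT r" for x using TT_add[OF that TT_tau] unfolding Tp_def .
  then show "(\<lambda>x. x + Tp C) ` (closure C \<inter> Defs.tri w r) \<subseteq> Defs.tri w (r + weight w w r (MM s))"
    unfolding weight_MM using tri_TT[OF r] tri_TT[of "r + wt"] r W by auto
qed

lemma deflation_EF:
  assumes "\<And>f. f \<in> EF \<Longrightarrow> \<tau> (lev (sig f)) = sig f" "\<And>f. f \<in> EF \<Longrightarrow> \<tau> (lev (rsig f)) = rsig f"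
  shows "deflation w r (MM s) \<tau> E = (\<Sum>f\<in>EF. ennreal (lam f) * seg_length (rsig f) (sig f) E)"
  unfolding deflation_def
proof (rule sum.reindex_bij_witness[where i = "\<lambda>(B, k). (B, nb u B k, inv_into UNIV ix k)" and j = "\<lambda>(A, B, j). (A, ix j)"])
  fix x assume x: "x \<in> edges w r (MM s)"
  obtain A B j where e': "x = (A, B, j)" by (cases x)
  note h = edge_cases[OF x[unfolded e']]
  have "inj ix" using ix by (simp add: bij_betw_def)
  then show "(case case x of (A, B, j) \<Rightarrow> (A, ix j) of (B, k) \<Rightarrow> (B, nb u B k, inv_into UNIV ix k)) = x" using e' h(3) by simp
  show "(case x of (A, B, j) \<Rightarrow> (A, ix j)) \<in> EF" using h(1,2) e' by (simp add: EF_def)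
  have f: "(A, ix j) \<in> EF" using h(1,2) by (simp add: EF_def)
  have "dist A B = lam (A, ix j)" using lam_pos[OF h(1)] unfolding h(3) nb_def by (simp add: dist_norm lam_def)
  then show "ennreal (lam (case x of (A, B, j) \<Rightarrow> (A, ix j))) * seg_length (rsig (case x of (A, B, j) \<Rightarrow> (A, ix j))) (sig (case x of (A, B, j) \<Rightarrow> (A, ix j))) E
     = (case x of (A, B, j) \<Rightarrow> ennreal (dist A B) * seg_length (\<tau> (side_piece (MM s) A B (- w (j + 1)))) (\<tau> (side_piece (MM s) A B (w (j + 1)))) E)"
    unfolding e' prod.case h(4,5) assms(1)[OF f] assms(2)[OF f] by simp
next
  fix f assume "f \<in> EF"
  obtain B k where f: "f = (B, k)" by force
  have k: "ix (inv_into UNIV ix k) = k" using ix_ex[of k] \<open>f \<in> EF\<close> f by (auto simp: EF_def intro!: f_inv_into_f)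
  then show "(case case f of (B, k) \<Rightarrow> (B, nb u B k, inv_into UNIV ix k) of (A, B, j) \<Rightarrow> (A, ix j)) = f" using f by simp
  show "(case f of (B, k) \<Rightarrow> (B, nb u B k, inv_into UNIV ix k)) \<in> edges w r (MM s)" using \<open>f \<in> EF\<close> f k edges_EF by simp
qed

definition II :: "(real^2) \<times> 6 \<Rightarrow> (real^2) set \<Rightarrow> ennreal" where
  "II f E = emeasure lborel {t \<in> {0<..<D s (fst f) (snd f)}. sig f + t *\<^sub>R dir (snd f + 5) \<in> E}"

lemma seg_II: assumes f: "f \<in> EF" and E: "E \<in> sets borel" shows "seg_length (rsig f) (sig f) E = II f E"
proof -
  obtain B k where fk: "f = (B, k)" by force
  let ?D = "D s B k" and ?S = "{t \<in> {0<..<D s B k}. sig f + t *\<^sub>R dir (k + 5) \<in> E}"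
  have D: "?D > 0" using f fk by (simp add: EF_def)
  have s: "sig f = rsig f + ?D *\<^sub>R dir (k + 2)" using sig_rsig[of f] fk by (simp add: algebra_simps)
  have "seg_length (rsig f) (sig f) E = arclen (rsig f) (dir (k + 2)) ?D E" unfolding s by (rule seg_length_arc[OF E D norm_dir])
  also have "\<dots> = emeasure lborel {t. ?D + - 1 * t \<in> ?S}" unfolding arclen_def
  proof (rule arg_cong[of _ _ "emeasure lborel"], rule Collect_cong)
    fix t
    have "rsig f + t *\<^sub>R dir (k + 2) = sig f + (?D + - 1 * t) *\<^sub>R dir (k + 5)" unfolding s by (simp add: algebra_simps)
    then show "t \<in> {0<..<?D} \<and> rsig f + t *\<^sub>R dir (k + 2) \<in> E \<longleftrightarrow> ?D + - 1 * t \<in> ?S" by (auto simp del: dir_add)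
  qed
  also have "\<dots> = emeasure lborel ?S" by (rule emeasure_lborel_reflect) (use affine_vimage_sets[OF E] in auto)
  finally show ?thesis by (simp add: II_def fk)
qed

text \<open>For a flag on a side, \<open>seg\<close> is an infinite ray. By \<open>outer_off\<close>
  it reaches the boundary of the triangle of size \<open>wt\<close> exactly at the parameter
  \<open>D s B k\<close>, so inside the triangle it is a finite segment like the others.\<close>

lemma seg_pt: assumes f: "(B, k) \<in> FF" and E: "E \<subseteq> TT wt" and p: "d.pt (2 - k) c t \<in> E"
    and ne: "t \<noteq> - d.off (3 - k) (sig (B, k))" "t \<noteq> - d.off (3 - k) (sig (B, k)) + D s B k"
  shows "(\<exists>\<theta>\<ge>0. seg (B, k) \<theta> (d.pt (2 - k) c t)) \<longleftrightarrow> c = d.off (2 - k) (sig (B, k)) \<and> t + d.off (3 - k) (sig (B, k)) \<in> {0<..<D s B k}"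
proof -
  let ?c = "d.off (2 - k) (sig (B, k))" and ?t = "- d.off (3 - k) (sig (B, k))"
  have i: "2 - k + 1 = 3 - k" by (simp add: algebra_simps)
  have "sig (B, k) = d.pt (2 - k) ?c ?t" using d.pt_off[of "2 - k" "sig (B, k)"] unfolding i by simp
  then have sp: "sig (B, k) + \<theta> *\<^sub>R dir (k + 5) = d.pt (2 - k) ?c (?t + \<theta>)" for \<theta> using d.pt_shift[of "2 - k" ?c ?t \<theta>] unfolding ddir_dual by simp
  have inj: "d.pt (2 - k) c t = d.pt (2 - k) c' t' \<longleftrightarrow> c = c' \<and> t = t'" for c' t'
  proof
    assume q: "d.pt (2 - k) c t = d.pt (2 - k) c' t'"
    show "c = c' \<and> t = t'" using arg_cong[OF q, of "d.off (2 - k)"] arg_cong[OF q, of "d.off (2 - k + 1)"] unfolding d.off_pt by simp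
  qed simp
  have eq: "d.pt (2 - k) c t = sig (B, k) + \<theta> *\<^sub>R dir (k + 5) \<longleftrightarrow> c = ?c \<and> \<theta> = t - ?t" for \<theta> unfolding sp inj by auto
  have bd: "t - ?t \<le> D s B k" if b: "(B, k) \<in> BF" and c: "c = ?c"
  proof -
    have k: "ev k" "on k B" using b by (auto simp: BF_def)
    have "sig (B, k) + (t - ?t) *\<^sub>R dir (k + 5) \<in> TT wt" using p E c eq[of "t - ?t"] by auto
    then have "off k (sig (B, k)) - (t - ?t) - off k (cor wt k) \<ge> 0" using k by (auto simp: TT_def)
    moreover have "off k (cor wt k) = off k (sig (B, k)) - D s B k" using outer_off[OF k] tau_step[of s B k] by (simp add: sig_def)
    ultimately show ?thesis by linarith
  qed
  show ?thesis
  proof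
    assume "\<exists>\<theta>\<ge>0. seg (B, k) \<theta> (d.pt (2 - k) c t)"
    then show "c = ?c \<and> t + d.off (3 - k) (sig (B, k)) \<in> {0<..<D s B k}" unfolding seg_def fst_conv snd_conv eq using ne bd by force
  next
    assume "c = ?c \<and> t + d.off (3 - k) (sig (B, k)) \<in> {0<..<D s B k}"
    then show "\<exists>\<theta>\<ge>0. seg (B, k) \<theta> (d.pt (2 - k) c t)" unfolding seg_def fst_conv snd_conv eq by (intro exI[of _ "t - ?t"]) auto
  qed
qed

lemma lint_tt: assumes \<kappa>: "ev \<kappa>" and E: "E \<in> sets borel" "E \<subseteq> TT wt"
  shows "d.lint tt \<kappa> c E = (\<Sum>f | f \<in> FF \<and> snd f = 2 - \<kappa>. ennreal (lam f) * (if c = d.off \<kappa> (sig f) then II f E else 0))"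
proof -
  define k where "k = 2 - \<kappa>"
  have kk: "\<kappa> = 2 - k" "ev k" using \<kappa> by (auto simp: k_def ev_def)
  let ?F = "{f. f \<in> FF \<and> snd f = k}"
  let ?t = "\<lambda>f. d.off (3 - k) (sig f)"
  let ?Z = "\<lambda>f. {t. c = d.off \<kappa> (sig f) \<and> t + ?t f \<in> {0<..<D s (fst f) k} \<and> d.pt \<kappa> c t \<in> E}"
  have fF: "finite ?F" using finite_FF by simp
  have Zm: "?Z f \<in> sets lborel" for f
  proof -
    have "{t. t + ?t f \<in> {0<..<D s (fst f) k}} = {- ?t f<..<D s (fst f) k - ?t f}" by auto
    then have "?Z f = (if c = d.off \<kappa> (sig f) then {- ?t f<..<D s (fst f) k - ?t f} \<inter> (d.pt \<kappa> c -` E \<inter> space borel) else {})" by auto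
    moreover have "d.pt \<kappa> c -` E \<inter> space borel \<in> sets borel" by (rule measurable_sets[OF d.pt_measurable E(1)])
    ultimately show ?thesis by auto
  qed
  have "d.lint tt \<kappa> c E = (\<integral>\<^sup>+t. (\<Sum>f\<in>?F. ennreal (lam f) * indicator (?Z f) t) \<partial>lborel)"
    unfolding d.lint_def
  proof (rule nn_integral_cong_AE)
    \<comment> \<open>The end points of the finitely many dual segments are discarded.\<close>
    have "AE t in lborel. \<forall>f\<in>?F. t \<noteq> - ?t f \<and> t \<noteq> - ?t f + D s (fst f) k"
      using fF by (intro AE_finite_allI) (auto intro: AE_conjI AE_lborel_singleton)
    then show "AE t in lborel. ennreal (d.D tt (d.pt \<kappa> c t) \<kappa>) * indicator E (d.pt \<kappa> c t) = (\<Sum>f\<in>?F. ennreal (lam f) * indicator (?Z f) t)"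
    proof eventually_elim
      case (elim t)
      show ?case
      proof (cases "d.pt \<kappa> c t \<in> E")
        case True
        have "d.D tt (d.pt \<kappa> c t) \<kappa> = (\<Sum>f\<in>?F. lam f * of_bool (\<exists>\<theta>\<ge>0. seg f \<theta> (d.pt \<kappa> c t)))" unfolding kk(1) by (rule D_tt_even[OF kk(2)])
        also have "\<dots> = (\<Sum>f\<in>?F. lam f * indicator (?Z f) t)"
        proof (rule sum.cong[OF refl])
          fix f assume f: "f \<in> ?F"
          then obtain B where B: "f = (B, k)" "(B, k) \<in> FF" by (cases f) auto
          have "(\<exists>\<theta>\<ge>0. seg f \<theta> (d.pt \<kappa> c t)) \<longleftrightarrow> t \<in> ?Z f"
            using seg_pt[OF B(2) E(2) True[unfolded kk(1)]] bspec[OF elim f] True unfolding kk(1) B(1) by auto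
          then show "lam f * of_bool (\<exists>\<theta>\<ge>0. seg f \<theta> (d.pt \<kappa> c t)) = lam f * indicator (?Z f) t" by (simp only: indicator_def)
        qed
        finally have Dq: "d.D tt (d.pt \<kappa> c t) \<kappa> = (\<Sum>f\<in>?F. lam f * indicator (?Z f) t)" .
        have "ennreal (d.D tt (d.pt \<kappa> c t) \<kappa>) = (\<Sum>f\<in>?F. ennreal (lam f * indicator (?Z f) t))"
          unfolding Dq by (rule sum_ennreal[symmetric]) (simp add: lam_pos less_imp_le)
        also have "\<dots> = (\<Sum>f\<in>?F. ennreal (lam f) * indicator (?Z f) t)" by (rule sum.cong) (auto simp: indicator_def)
        finally show ?thesis using True by simp
      next
        case False
        then have "(\<Sum>f\<in>?F. ennreal (lam f) * indicator (?Z f) t) = 0" by (intro sum.neutral) auto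
        then show ?thesis using False by simp
      qed
    qed
  qed
  also have "\<dots> = (\<Sum>f\<in>?F. ennreal (lam f) * emeasure lborel (?Z f))"
  proof -
    have "(\<integral>\<^sup>+t. (\<Sum>f\<in>?F. ennreal (lam f) * indicator (?Z f) t) \<partial>lborel) = (\<Sum>f\<in>?F. \<integral>\<^sup>+t. ennreal (lam f) * indicator (?Z f) t \<partial>lborel)"
      by (intro nn_integral_sum borel_measurable_times_ennreal borel_measurable_const borel_measurable_indicator Zm)
    then show ?thesis unfolding nn_integral_cmult_indicator[OF Zm] .
  qed
  also have "\<dots> = (\<Sum>f\<in>?F. ennreal (lam f) * (if c = d.off \<kappa> (sig f) then II f E else 0))"
  proof (rule sum.cong[OF refl])
    fix f assume f: "f \<in> ?F"
    have "emeasure lborel (?Z f) = II f E" if c: "c = d.off \<kappa> (sig f)"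
    proof -
      let ?S = "{t \<in> {0<..<D s (fst f) k}. sig f + t *\<^sub>R dir (k + 5) \<in> E}"
      have i: "2 - k + 1 = 3 - k" by (simp add: algebra_simps)
      have "d.pt \<kappa> c t = sig f + (t + ?t f) *\<^sub>R dir (k + 5)" for t
        using d.pt_shift[of "2 - k" c "- ?t f" "t + ?t f"] d.pt_off[of "2 - k" "sig f"] unfolding c kk(1) i ddir_dual by simp
      then have "?Z f = {t. ?t f + 1 * t \<in> ?S}" using c by (auto simp: add.commute simp del: dir_add)
      moreover have "emeasure lborel \<dots> = emeasure lborel ?S" by (rule emeasure_lborel_reflect) (use affine_vimage_sets[OF E(1)] in auto)
      ultimately show ?thesis using f by (simp add: II_def)
    qed
    then show "ennreal (lam f) * emeasure lborel (?Z f) = ennreal (lam f) * (if c = d.off \<kappa> (sig f) then II f E else 0)" by auto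
  qed
  finally show ?thesis by (simp add: k_def)
qed

lemma emeasure_tt: assumes E: "E \<in> sets borel" "E \<subseteq> TT wt"
  shows "emeasure (d.MM tt) E = (\<Sum>f\<in>EF. ennreal (lam f) * seg_length (rsig f) (sig f) E)"
proof -
  let ?S = "sig ` FF" and ?X = "{f. f \<in> FF \<and> ev (snd f)}"
  have fX: "finite ?X" using finite_FF by simp
  have "emeasure (d.MM tt) E = (\<Sum>\<kappa>\<in>{0, 2, 4}. \<Sum>c\<in>d.off \<kappa> ` ?S. d.lint tt \<kappa> c E)"
    by (rule d.emeasure_MM'[OF E(1)]) (use finite_FF tt_start in auto)
  also have "\<dots> = (\<Sum>\<kappa>\<in>{0, 2, 4}. \<Sum>f | f \<in> ?X \<and> 2 - snd f = \<kappa>. ennreal (lam f) * II f E)"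
  proof (rule sum.cong[OF refl])
    fix \<kappa> :: 6 assume "\<kappa> \<in> {0, 2, 4}"
    then have \<kappa>: "ev \<kappa>" by (auto simp: ev_def)
    let ?F = "{f. f \<in> FF \<and> snd f = 2 - \<kappa>}"
    have F: "?F = {f. f \<in> ?X \<and> 2 - snd f = \<kappa>}" using \<kappa> by (auto simp: ev_def)
    have "(\<Sum>c\<in>d.off \<kappa> ` ?S. d.lint tt \<kappa> c E) = (\<Sum>f\<in>?F. \<Sum>c\<in>d.off \<kappa> ` ?S. ennreal (lam f) * (if c = d.off \<kappa> (sig f) then II f E else 0))"
      unfolding lint_tt[OF \<kappa> E] by (rule sum.swap)
    also have "\<dots> = (\<Sum>f\<in>?F. ennreal (lam f) * II f E)"
      unfolding sum_distrib_left[symmetric] using finite_FF by (intro sum.cong) auto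
    finally show "(\<Sum>c\<in>d.off \<kappa> ` ?S. d.lint tt \<kappa> c E) = (\<Sum>f | f \<in> ?X \<and> 2 - snd f = \<kappa>. ennreal (lam f) * II f E)" unfolding F .
  qed
  also have "\<dots> = (\<Sum>f\<in>?X. ennreal (lam f) * II f E)" by (rule sum.group[OF fX]) (auto simp: ev_def)
  also have "\<dots> = (\<Sum>f\<in>EF. ennreal (lam f) * II f E)"
  proof (rule sum.mono_neutral_right[OF fX])
    show "EF \<subseteq> ?X" by (auto simp: EF_def)
    show "\<forall>f\<in>?X - EF. ennreal (lam f) * II f E = 0"
    proof
      fix f assume "f \<in> ?X - EF"
      then have "D s (fst f) (snd f) \<le> 0" by (cases f) (auto simp: EF_def)
      then have "II f E = 0" unfolding II_def by simp
      then show "ennreal (lam f) * II f E = 0" by simp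
    qed
  qed
  also have "\<dots> = (\<Sum>f\<in>EF. ennreal (lam f) * seg_length (rsig f) (sig f) E)" by (rule sum.cong) (simp_all add: seg_II E(1))
  finally show ?thesis .
qed

text \<open>Two inflations differ by a vector that is constant across edges. Moving from piece to piece
  towards the side \<open>d\<close> one reaches a piece touching that side, so this vector points inwards at each
  of the three sides; hence it vanishes.\<close>

lemma inflation_unique: assumes inf: "inflation w r (MM s) \<tau>"
  shows "f \<in> FF \<Longrightarrow> \<tau> (lev (sig f)) = sig f" "f \<in> EF \<Longrightarrow> \<tau> (lev (rsig f)) = rsig f"
proof -
  define \<theta> where "\<theta> q = \<tau> (lev q) - q" for q
  have edge: "\<theta> (sig f) = \<theta> (rsig f)" if f: "f \<in> EF" for f
  proof -
    obtain B k where fk: "f = (B, k)" by force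
    obtain j where j: "ix j = k" using ix_ex[of k] f fk by (auto simp: EF_def)
    have e': "(B, nb u B k, j) \<in> edges w r (MM s)" using edges_EF[of B _ j] f fk j by simp
    have "\<tau> (side_piece (MM s) B (nb u B k) (w (j + 1))) - \<tau> (side_piece (MM s) B (nb u B k) (- w (j + 1))) = dens (MM s) B (w j) *\<^sub>R w (j + 1)"
      using inf e' unfolding inflation_def by blast
    then have "\<tau> (lev (sig f)) - \<tau> (lev (rsig f)) = sig f - rsig f" using edge_cases[OF e'] unfolding sig_rsig dens_e w_next j fk by simp
    then show ?thesis by (simp add: \<theta>_def algebra_simps)
  qed
  have cross: "\<theta> (sig (opp f)) = \<theta> (sig f)" if f: "f \<in> FF - BF" for f
  proof -
    have even: "\<theta> (sig (opp f)) = \<theta> (sig f)" if f: "f \<in> FF - BF" "ev (snd f)" for f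
    proof -
      obtain B k where fk: "f = (B, k)" by force
      have "f \<in> EF" "sig (opp f) = rsig f" using f D_s_inner[of B k] sig_opp[of B k] fk by (auto simp: EF_def rsig_def)
      then show ?thesis using edge by simp
    qed
    show ?thesis
    proof (cases "ev (snd f)")
      case False
      then have "ev (snd (opp f))" by (cases f) (simp add: opp_def)
      then show ?thesis using even[of "opp f"] opp_FF[OF f] by simp
    qed (use even f in blast)
  qed
  have touch: "off d (\<theta> (sig (B, d))) \<ge> 0" if b: "(B, d) \<in> BF" for B d
  proof -
    have f: "(B, d) \<in> FF" and d: "ev d" "on d B" using b by (auto simp: BF_def)
    have eq: "\<theta> (sig (B, d)) = \<theta> (rsig (B, d))"
    proof (cases "D s B d > 0")
      case True then show ?thesis using edge[of "(B, d)"] f d by (simp add: EF_def)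
    next
      case False
      then have "D s B d = 0" using D_nonneg[of B d] by linarith
      then show ?thesis by (simp add: rsig_def)
    qed
    note es = edge_sides[OF f]
    let ?m = "midpoint B (nb u B d)"
    have P: "lev (rsig (B, d)) \<in> pieces (MM s)" using es(6) lev_pieces by blast
    have W: "wt \<ge> 0" using TT_tau[of 0 0] TT_iff[of 0 "tau s 0 0" wt] by (simp add: cor_def ev_def off_num)
    have "(\<lambda>x. x + \<tau> (lev (rsig (B, d)))) ` (closure (lev (rsig (B, d))) \<inter> Defs.tri w r) \<subseteq> Defs.tri w (r + wt)"
      using inf P unfolding inflation_def weight_MM by blast
    then have "?m + \<tau> (lev (rsig (B, d))) \<in> TT (r + wt)" using es(3,4) tri_TT[OF r] tri_TT[of "r + wt"] r W by auto
    then have "off d ?m + off d (\<tau> (lev (rsig (B, d)))) \<ge> off d (cor (r + wt) d)" using d(1) by (auto simp: TT_def)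
    moreover have "cor (r + wt) d = cor r d + cor wt d" by (simp add: cor_def scaleR_left_distrib)
    moreover have "rsig (B, d) = tau s B (d + 5)" by (simp add: rsig_def sig_def tau_step scaleR_diff_right)
    ultimately show ?thesis unfolding eq using outer_off[OF d] es(7) d(2) by (simp add: \<theta>_def)
  qed
  \<comment> \<open>The edge vectors of the piece add up to 0. Without an edge of direction
    \<open>d\<close> or \<open>d + 5\<close> they would all be parallel to
    \<open>dir (d + 4)\<close>, but \<open>phi\<close> always turns.\<close>
  have next_flag: "\<exists>g. g \<in> FF \<and> sig g = sig f \<and> (snd g = d \<or> snd g = d + 5)" if f: "f \<in> FF" for f d
  proof (rule ccontr)
    assume no: "\<not> ?thesis"
    let ?G = "{g. g \<in> FF \<and> sig g = sig f}"
    have "(\<Sum>g\<in>?G. lam g * off (d + 4) (dir (snd g))) = 0" using arg_cong[OF closing[of "sig f"], of "off (d + 4)"] by (simp add: off_sum)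
    then have "(\<Sum>g\<in>?G. - (lam g * off (d + 4) (dir (snd g)))) = 0" unfolding sum_negf by simp
    note sum0 = this
    have n: "- (lam g * off (d + 4) (dir (snd g))) \<ge> 0" if "g \<in> ?G" for g
    proof -
      have "\<not> (snd g = d \<or> snd g = d + 5)" using no that by blast
      then have "snd g \<noteq> d + 4 + 1 \<and> snd g \<noteq> d + 4 + 2" by simp
      then have "off (d + 4) (dir (snd g)) \<le> 0" using off_dir_sign(1)[of "d + 4" "snd g"] by force
      then show ?thesis using lam_pos[of g] that by (simp add: mult_le_0_iff del: off_add)
    qed
    have z: "lam g * off (d + 4) (dir (snd g)) = 0" if "g \<in> ?G" for g
    proof -
      have "- (lam g * off (d + 4) (dir (snd g))) = 0" by (rule sum_nonneg_0[OF _ n sum0 that]) (use finite_FF in auto)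
      then show ?thesis by simp
    qed
    have "snd g = d + 4 \<or> snd g = d + 4 + 3" if "g \<in> ?G" for g
      using z[OF that] lam_pos[of g] that off_dir_sign(3)[of "d + 4" "snd g"] by (auto simp del: off_add)
    then have "snd f = d + 4 \<or> snd f = d + 4 + 3" "snd (phi f) = d + 4 \<or> snd (phi f) = d + 4 + 3" using f phi_FF[OF f] sig_phi[OF f] by auto
    then show False using phi_dir[of "fst f" "snd f"] by auto
  qed
  \<comment> \<open>Crossing such an edge lowers \<open>off d\<close> of the displacement, so the
    induction ends at a flag on side \<open>d\<close>, where \<open>touch\<close> applies.\<close>
  have ge: "off d (\<theta> (sig f)) \<ge> 0" if "f \<in> FF" "ev d" for f d
    using that(1)
  proof (induction "card {h \<in> FF. off d (sig h) < off d (sig f)}" arbitrary: f rule: less_induct)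
    case less
    obtain g where g: "g \<in> FF" "sig g = sig f" "snd g = d \<or> snd g = d + 5" using next_flag[OF less.prems, of d] by blast
    obtain B k where gk: "g = (B, k)" by force
    show ?case
    proof (cases "g \<in> BF")
      case True
      then have "k = d" using g(3) gk that(2) by (auto simp: BF_def)
      then show ?thesis using touch[of B d] True gk g(2) by simp
    next
      case False
      then have o: "opp g \<in> FF" and D: "D s B k > 0" using opp_FF(1)[of g] D_s_inner[of B k] g(1) gk by auto
      have "off d (dir (k + 5)) = - 1" using g(3) gk by auto
      then have lt: "off d (sig (opp g)) < off d (sig f)" using sig_opp[of B k] g gk D by (simp del: dir_add)
      have "{h \<in> FF. off d (sig h) < off d (sig (opp g))} \<subset> {h \<in> FF. off d (sig h) < off d (sig f)}" using lt o by force
      then have "card {h \<in> FF. off d (sig h) < off d (sig (opp g))} < card {h \<in> FF. off d (sig h) < off d (sig f)}" using finite_FF by (intro psubset_card_mono) auto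
      then have "off d (\<theta> (sig (opp g))) \<ge> 0" using less.hyps o by blast
      then show ?thesis using cross[of g] g False by simp
    qed
  qed
  have z: "\<theta> (sig f) = 0" if f: "f \<in> FF" for f
  proof -
    have "off 0 (\<theta> (sig f)) \<ge> 0" "off 2 (\<theta> (sig f)) \<ge> 0" "off 4 (\<theta> (sig f)) \<ge> 0" using ge[OF f] by (auto simp: ev_def)
    then have "off 0 (\<theta> (sig f)) = 0" "off 1 (\<theta> (sig f)) = 0" by (simp_all add: off_num)
    then show ?thesis using off_eqI[of 0 "\<theta> (sig f)" 0] by simp
  qed
  show "\<tau> (lev (sig f)) = sig f" if "f \<in> FF" using z[OF that] by (simp add: \<theta>_def)
  show "\<tau> (lev (rsig f)) = rsig f" if "f \<in> EF"
  proof -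
    have "f \<in> FF" using that by (auto simp: EF_def)
    then show ?thesis using edge[OF that] z by (simp add: \<theta>_def)
  qed
qed

lemma dTT: "R > 0 \<Longrightarrow> d.TT R = TT R"
  unfolding d.TT_hull TT_hull by (simp add: ddir_def insert_commute)

sublocale dt: tri_dirs ddir w "\<lambda>j. - w j" "\<lambda>j. 4 - ix j"
proof
  have "bij_betw (\<lambda>k. 4 - k) {k. ev k} {k. ev k}" by (rule bij_betwI[where g = "\<lambda>k. 4 - k"]) (auto simp: ev_def)
  from bij_betw_trans[OF ix this] show "bij_betw (\<lambda>j. 4 - ix j) UNIV {k. ev k}" by (simp add: comp_def)
  show "- w j = ddir (4 - ix j)" for j
  proof -
    have "1 - (4 - ix j) = ix j + 3" by (simp add: algebra_simps)
    then have "ddir (4 - ix j) = dir (ix j + 3)" unfolding ddir_def by (rule arg_cong)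
    then show ?thesis using e[of j] by simp
  qed
  show "w = (\<lambda>j. - w j) \<or> w = (\<lambda>j. - (- w j))" by simp
  show "Defs.tri w R = d.TT R" if "R > 0" for R using tri_TT[OF that] dTT[OF that] by simp
qed

text \<open>All inflations have the same deflation, which is the restriction of
  \<open>d.MM tt\<close>; by \<open>MM_determined\<close> this restriction fixes the
  measure.\<close>

lemma dual_eq: assumes "wt > 0" shows "dual w r (MM s) = d.MM tt"
  unfolding dual_def
proof (rule the_equality)
  have tT: "A \<in> d.TT wt" if "tt A \<noteq> 0" for A using tt_start[OF that] TT_tau dTT[OF assms] by (auto simp: sig_def)
  interpret X: tri_meas ddir w "\<lambda>j. - w j" "\<lambda>j. 4 - ix j" tt wt by unfold_locales (use assms tT in auto)
  have defl: "deflation w r (MM s) \<tau> E = (\<Sum>f\<in>EF. ennreal (lam f) * seg_length (rsig f) (sig f) E)" if "inflation w r (MM s) \<tau>" for \<tau> E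
    using inflation_unique[OF that] by (intro deflation_EF) (auto simp: EF_def)
  show "is_dual w r (MM s) (d.MM tt)" unfolding is_dual_def weight_MM tri_TT[OF assms]
    using X.MM_cone_tri inflation_Tp defl emeasure_tt by (intro conjI exI[of _ Tp]) auto
  fix \<nu> assume "is_dual w r (MM s) \<nu>"
  then obtain \<tau> where nu: "\<nu> \<in> cone_tri w (\<lambda>j. - w j) wt" "inflation w r (MM s) \<tau>"
    "\<And>E. E \<in> sets borel \<Longrightarrow> E \<subseteq> TT wt \<Longrightarrow> emeasure \<nu> E = deflation w r (MM s) \<tau> E"
    unfolding is_dual_def weight_MM tri_TT[OF assms] by blast
  obtain t where t: "fs t" "d.pos t" "\<And>A. t A \<noteq> 0 \<Longrightarrow> A \<in> d.TT wt" "\<nu> = d.MM t" using dt.cone_tri_rep[OF assms nu(1)] by blast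
  have "t = tt"
  proof (rule d.MM_determined[OF assms t(1-3) fs_tt pos_tt tT])
    fix E :: "(real^2) set" assume E: "E \<in> sets borel" "E \<subseteq> d.TT wt"
    then have "E \<subseteq> TT wt" using dTT[OF assms] by simp
    then show "emeasure (d.MM t) E = emeasure (d.MM tt) E" using nu(3) defl[OF nu(2)] emeasure_tt E(1) t(4) by simp
  qed
  then show "\<nu> = d.MM tt" using t(4) by simp
qed

lemma ext_dual: assumes "wt > 0" shows "ext w (MM s) + ext w (dual w r (MM s)) = att w r (MM s) + 1"
proof -
  have "ext w (MM s) = card free" by (rule ext_decomposition(2)[OF cone_M_eq])
  moreover have "ext w (d.MM tt) = card T.free" by (rule T.ext_decomposition(2)[OF dt.cone_M_eq])
  ultimately show ?thesis using frame_count card_free_U att_eq unfolding dual_eq[OF assms] by linarith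
qed

end

text \<open>Interleaving the vectors with their negatives in steps of 60 degrees puts
  \<open>w 1\<close>, \<open>w 2\<close>, \<open>w 3\<close> at the even indices in cyclic
  order.\<close>

definition dirs :: "(3 \<Rightarrow> real^2) \<Rightarrow> 6 \<Rightarrow> real^2" where
  "dirs w k = (if k = 0 then w 1 else if k = 1 then - w 3 else if k = 2 then w 2 else if k = 3 then - w 1 else if k = 4 then w 3 else - w 2)"

definition dix :: "3 \<Rightarrow> 6" where "dix j = (if j = 1 then 0 else if j = 2 then 2 else 4)"

lemma tri_dirs_dirs:
  assumes n: "\<And>j. norm (w j) = 1" and s: "w 1 + w 2 + w 3 = 0" shows "tri_dirs (dirs w) w w dix"
proof -
  have w3: "w 3 = - w 1 - w 2" using s by (simp add: algebra_simps eq_neg_iff_add_eq_0)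
  interpret hex "dirs w"
  proof
    show "norm (dirs w k) = 1" for k using n by (simp add: dirs_def)
    show "dirs w (k + 1) = dirs w k + dirs w (k + 2)" for k using six_cases[of k] by (elim disjE) (simp_all add: dirs_def w3)
  qed
  show ?thesis
  proof
    have "range dix = {k. ev k}" unfolding Collect_ev UNIV_3 by (auto simp: dix_def)
    moreover have "inj dix" by (rule injI) (use exhaust_3 in \<open>auto simp: dix_def split: if_splits\<close>)
    ultimately show "bij_betw dix UNIV {k. ev k}" by (simp add: bij_betw_def)
    show "w j = dirs w (dix j)" for j using exhaust_3[of j] by (auto simp: dix_def dirs_def)
    show "Defs.tri w r = TT r" if "r > 0" for r
      unfolding TT_hull[OF that] Defs.tri_def corner_def by (simp add: dirs_def w3 insert_commute add.commute)
  qed simp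
qed

theorem theorem1p1:
  fixes w :: "3 \<Rightarrow> real^2" and r :: real and \<mu> :: "(real^2) measure"
  assumes "\<And>j. norm (w j) = 1"
    and "w 1 + w 2 + w 3 = 0"
    and "r > 0"
    and "\<mu> \<in> cone_Mr w r"
    and "rigid w w r \<mu>"
    and "\<mu> \<noteq> null_measure borel"
  shows "ext w \<mu> + ext w (dual w r \<mu>) = att w r \<mu> + 1"
proof -
  interpret D: tri_dirs "dirs w" w w dix by (rule tri_dirs_dirs) (use assms in auto)
  obtain s where s: "fs s" "D.pos s" "\<And>A. s A \<noteq> 0 \<Longrightarrow> A \<in> D.TT r" "\<mu> = D.MM s"
    using D.cone_tri_rep[OF assms(3,4)] by blast
  interpret M: tri_meas "dirs w" w w dix s r by unfold_locales (use s assms in auto)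
  have w3: "w 3 = - w 1 - w 2" using assms(2) by (simp add: algebra_simps eq_neg_iff_add_eq_0)
  interpret P: puzzle "dirs w" s r w dix
  proof
    show "D.rig s" using M.rigid_rig assms(5) s(4) by simp
    show "dix (j + 1) = dix j + 2" for j using exhaust_3[of j] by (elim disjE) (simp_all add: dix_def)
    show "corner w r j = D.cor r (dix j + 2)" for j using exhaust_3[of j] by (elim disjE) (simp_all add: dix_def corner_def D.cor_def dirs_def w3)
  qed
  have "\<exists>A. s A \<noteq> 0"
  proof (rule ccontr)
    assume "\<nexists>A. s A \<noteq> 0"
    then have "s = (\<lambda>A. 0)" by auto
    then show False using assms(6) s(4) D.MM_zero by simp
  qed
  then show ?thesis using M.wt_pos P.ext_dual unfolding s(4) by blast
qed

end
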